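(* Let $\tau>0$, $\alpha\in\mathbb C$, integers $0\le m\le q$, $0\le n\le p$, ${\bf a}\in\mathbb C^p$, ${\bf b}\in\mathbb C^q$ be admissible parameters (i.e. $\Lambda^+\cap\Lambda^-=\emptyset$ and one of the cases (i)-(vii) described in the context holds), and let $K_{p,q}^{m,n}\Big(\begin{matrix}{\bf a}\\{\bf b}\end{matrix}\Big\vert z;\tau,\alpha\Big)$ be the corresponding Meijer-Barnes $K$-function. Consider the function $$w\mapsto K_{p,q}^{m,n}\Big(\begin{matrix}{\bf a}\\{\bf b}\end{matrix}\Big\vert e^{2\pi w};\tau,\alpha\Big),$$ initially defined for $w\in\mathbb R$ in cases (i)-(vi) and for $w\in\mathbb R\setminus\{0\}$ in case (vii). 1. In cases (i)-(v) this function can be continued analytically to an entire function of $w$. 2. In case (vi) (where $p=q$ and $\alpha=0$) it can be continued analytically to the horizontal strip $|\mathrm{Im}(w)|<-\mathrm{Re}(\nu)/(4\tau)$. 3. In case (vii) (where $p=q$ and $\alpha=0$) its restrictions to $(-\infty,0)$ and $(0,\infty)$ can be continued analytically to the half-planes $\mathrm{Re}(w)<0$ and $\mathrm{Re}(w)>0$, respectively; and if $\mathrm{Re}(\xi)<-2\tau$, then the function (extended to $w=0$) is continuous on $\mathbb R$.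
   Context: Barnes double gamma function. For $\tau\in\mathbb C\setminus(-\infty,0]$ let $\psi=\Gamma'/\Gamma$, let $\gamma_E=-\psi(1)$, $$C(\tau)=\lim_{k\to\infty}\Big[\sum_{j=1}^{k-1}\psi(j\tau)+\tfrac12\psi(k\tau)-\tfrac1\tau\ln\frac{\Gamma(k\tau)}{\sqrt{2\pi}}\Big],\quad D(\tau)=\lim_{k\to\infty}\Big[\sum_{j=1}^{k-1}\psi'(j\tau)+\tfrac12\psi'(k\tau)-\tfrac1\tau\psi(k\tau)\Big],$$ $a(\tau)=\gamma_E\tau+\frac{\tau}{2}\ln(2\pi\tau)+\frac12\ln\tau-\tau C(\tau)$, $b(\tau)=-\frac{\pi^2\tau^2}{6}-\tau\ln\tau-\tau^2D(\tau)$, and $$G(z;\tau)=\frac z\tau e^{a(\tau)\frac z\tau+b(\tau)\frac{z^2}{2\tau^2}}\prod_{k,l\ge0,\,(k,l)\ne(0,0)}\Big(1+\frac z{k\tau+l}\Big)e^{-\frac z{k\tau+l}+\frac{z^2}{2(k\tau+l)^2}} .$$ It is entire in $z$, and satisfies $G(1;\tau)=1$, $G(z+1;\tau)=\Gamma(z/\tau)G(z;\tau)$, $G(z+\tau;\tau)=(2\pi)^{\frac{\tau-1}2}\tau^{-z+\frac12}\Gamma(z)G(z;\tau)$. Parameters. For $\tau>0$, $\alpha\in\mathbb C$, integers $0\le m\le q$, $0\le n\le p$, ${\bf a}=(a_1,\dots,a_p)\in\mathbb C^p$, ${\bf b}=(b_1,\dots,b_q)\in\mathbb C^q$ put $$\mathcal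 G(s)=\mathcal G_{p,q}^{m,n}\Big(\begin{matrix}{\bf a}\\{\bf b}\end{matrix}\Big\vert s;\tau\Big)=\frac{\prod_{j=1}^mG(b_j-s;\tau)\prod_{j=1}^nG(1+\tau-a_j+s;\tau)}{\prod_{j=m+1}^qG(1+\tau-b_j+s;\tau)\prod_{j=n+1}^pG(a_j-s;\tau)},$$ $\Lambda^+=\{a_j+l\tau+k: n+1\le j\le p,\ l,k\ge0\}$, $\Lambda^-=\{b_j-l\tau-k: m+1\le j\le q,\ l,k\ge1\}$ ($l,k$ integers), $N=2(m+n)-p-q$, $\nu=\sum_{j=1}^pa_j-\sum_{j=1}^qb_j$, $\mu=\sum_{j=1}^na_j-\sum_{j=n+1}^pa_j+\sum_{j=1}^mb_j-\sum_{j=m+1}^qb_j$, $\xi=\sum_{j=1}^na_j^2-\sum_{j=n+1}^pa_j^2+\sum_{j=1}^mb_j^2-\sum_{j=m+1}^qb_j^2$. Contours. Assume $\Lambda^+\cap\Lambda^-=\emptyset$. For $\theta^+\in(0,\pi)$, $\theta^-\in(-\pi,0)$, $\mathcal L_{\theta^-,\theta^+}$ denotes a simple contour dividing the plane into two domains, one containing $\Lambda^+$ and all large positive numbers and the other containing $\Lambda^-$, oriented so that $\Lambda^-$ is on the left, and which for large $|s|$ coincides with a ray $c_++re^{i\theta^+}$ in the upper half-plane and a ray $c_-+re^{i\theta^-}$ in the lower half-plane. Write $\mathcal L_{i\infty}=\mathcal L_{-\pi/2,\pi/2}$. $K$-function. For $z>0$, $$K_{p,q}^{m,n}\Big(\begin{matrix}{\bf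 a}\\{\bf b}\end{matrix}\Big\vert z;\tau,\alpha\Big)=\frac1{2\pi i}\int_{\mathcal L_{\theta^-,\theta^+}}\mathcal G(s)e^{\frac{\pi\alpha}\tau s^2}z^{-s}\,ds,$$ with $\theta^\pm$ chosen as follows (the value does not depend on the choice within these rules): (i) $N>0$: any $\theta^+\in(\pi/4,3\pi/4)$, $\theta^-\in(-3\pi/4,-\pi/4)$. (ii) $N=0$, $\mathrm{Re}(\alpha)\ge0$, $4\alpha\ne\pm(p-q)i$: any $\theta^+\in(0,\pi)$ with $\mathrm{Re}((\alpha+(p-q)i/4)s^2)<0$ on $\arg s=\theta^+$, any $\theta^-\in(-\pi,0)$ with $\mathrm{Re}((\alpha-(p-q)i/4)s^2)<0$ on $\arg s=\theta^-$. (iii) $N=0$, $4\alpha=(q-p)i\ne0$, $\mu\neq 0$, $\arg\mu\ne\pi/2$: any $\theta^+\in(0,\pi)$ with $\mathrm{Re}(\mu s)>0$ on $\arg s=\theta^+$, any $\theta^-\in(-\pi,0)$ with $\mathrm{Re}(i(q-p)s^2)<0$ on $\arg s=\theta^-$. (iv) $N=0$, $4\alpha=(p-q)i\ne0$, $\mu\ne0$, $\arg\mu\ne-\pi/2$: any $\theta^+\in(0,\pi)$ with $\mathrm{Re}(i(p-q)s^2)<0$ on $\arg s=\theta^+$, any $\theta^-\in(-\pi,0)$ with $\mathrm{Re}(\mu s)>0$ on $\arg s=\theta^-$. (v) $N=\alpha=p-q=0$, $\mathrm{Re}(\mu)\ne0$: any $\theta^+\in(0,\pi)$, $\theta^-\in(-\pi,0)$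 with $\mathrm{Re}(\mu s)>0$ on $\arg s=\theta^\pm$. (vi) $N=\alpha=p-q=\mu=0$, $\mathrm{Re}(\nu)<0$: $\theta^\pm=\pm\pi/2$. (vii) $N=\alpha=p-q=\mu=\nu=0$, with $z\in(0,1)\cup(1,\infty)$: $\theta^\pm=\pm\epsilon$ if $z>1$ and $\theta^\pm=\pm(\pi-\epsilon)$ if $0<z<1$, for any $\epsilon\in(0,\pi/2)$. Parameters satisfying $\Lambda^+\cap\Lambda^-=\emptyset$ and one of (i)-(vii) are called admissible. *)

theory Defs
  imports "HOL-Analysis.Analysis"
begin

section \<open>Barnes double gamma function\<close>

text \<open>
  The term \<open>ln (\<Gamma>(k\<tau>) / sqrt (2\<pi>))\<close> is written with \<open>ln_Gamma\<close>, the branch of the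
  logarithm of \<open>\<Gamma>\<close> that is analytic on the plane cut along the nonpositive reals and real on
  the positive axis. The principal logarithm of \<open>\<Gamma>(k\<tau>)\<close> is the same for \<open>\<tau> > 0\<close>, but may
  jump for non-real \<open>\<tau>\<close>.
\<close>

definition Barnes_C :: "complex \<Rightarrow> complex" where
  "Barnes_C \<tau> = lim (\<lambda>k. (\<Sum>j=1..<k. Digamma (of_nat j * \<tau>)) + Digamma (of_nat k * \<tau>) / 2
      - (ln_Gamma (of_nat k * \<tau>) - of_real (ln (sqrt (2 * pi)))) / \<tau>)"

definition Barnes_D :: "complex \<Rightarrow> complex" where
  "Barnes_D \<tau> = lim (\<lambda>k. (\<Sum>j=1..<k. Polygamma 1 (of_nat j * \<tau>)) + Polygamma 1 (of_nat k * \<tau>) / 2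
      - Digamma (of_nat k * \<tau>) / \<tau>)"

definition Barnes_a :: "complex \<Rightarrow> complex" where
  "Barnes_a \<tau> = euler_mascheroni * \<tau> + \<tau> / 2 * ln (2 * of_real pi * \<tau>) + ln \<tau> / 2 - \<tau> * Barnes_C \<tau>"

definition Barnes_b :: "complex \<Rightarrow> complex" where
  "Barnes_b \<tau> = - (of_real pi)\<^sup>2 * \<tau>\<^sup>2 / 6 - \<tau> * ln \<tau> - \<tau>\<^sup>2 * Barnes_D \<tau>"

text \<open>
  The infinite product is the limit over the net of finite subsets of the index set, as in
  the definition of \<open>infsum\<close> for sums.
\<close>

definition Barnes_G :: "complex \<Rightarrow> complex \<Rightarrow> complex" where
  "Barnes_G \<tau> z = z / \<tau> * exp (Barnes_a \<tau> * (z / \<tau>) + Barnes_b \<tau> * (z\<^sup>2 / (2 * \<tau>\<^sup>2))) *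
     Lim (finite_subsets_at_top (UNIV - {(0, 0)}))
       (\<lambda>F. \<Prod>(k, l)\<in>F. let \<omega> = of_nat k * \<tau> + of_nat l
              in (1 + z / \<omega>) * exp (- (z / \<omega>) + z\<^sup>2 / (2 * \<omega>\<^sup>2)))"


section \<open>Parameters\<close>

text \<open>The vectors \<open>(a\<^sub>1, \<dots>, a\<^sub>p)\<close> and \<open>(b\<^sub>1, \<dots>, b\<^sub>q)\<close> are functions on \<open>nat\<close>, of which only the
  values on \<open>{1..p}\<close> and \<open>{1..q}\<close> are used.\<close>

definition K_Gquot :: "nat \<Rightarrow> nat \<Rightarrow> nat \<Rightarrow> nat \<Rightarrow> (nat \<Rightarrow> complex) \<Rightarrow> (nat \<Rightarrow> complex) \<Rightarrow>
    real \<Rightarrow> complex \<Rightarrow> complex" where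
  "K_Gquot p q m n a b \<tau> s =
     ((\<Prod>j=1..m. Barnes_G (of_real \<tau>) (b j - s)) *
      (\<Prod>j=1..n. Barnes_G (of_real \<tau>) (1 + of_real \<tau> - a j + s))) /
     ((\<Prod>j=m+1..q. Barnes_G (of_real \<tau>) (1 + of_real \<tau> - b j + s)) *
      (\<Prod>j=n+1..p. Barnes_G (of_real \<tau>) (a j - s)))"

definition Lambda_plus :: "nat \<Rightarrow> nat \<Rightarrow> (nat \<Rightarrow> complex) \<Rightarrow> real \<Rightarrow> complex set" where
  "Lambda_plus p n a \<tau> =
     {a j + of_nat l * of_real \<tau> + of_nat k | (j::nat) (l::nat) (k::nat). j \<in> {n+1..p}}"

definition Lambda_minus :: "nat \<Rightarrow> nat \<Rightarrow> (nat \<Rightarrow> complex) \<Rightarrow> real \<Rightarrow> complex set" where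
  "Lambda_minus q m b \<tau> =
     {b j - of_nat l * of_real \<tau> - of_nat k | (j::nat) (l::nat) (k::nat).
        j \<in> {m+1..q} \<and> l \<ge> 1 \<and> k \<ge> 1}"

definition K_N :: "nat \<Rightarrow> nat \<Rightarrow> nat \<Rightarrow> nat \<Rightarrow> int" where
  "K_N p q m n = 2 * (int m + int n) - int p - int q"

definition K_nu :: "nat \<Rightarrow> nat \<Rightarrow> (nat \<Rightarrow> complex) \<Rightarrow> (nat \<Rightarrow> complex) \<Rightarrow> complex" where
  "K_nu p q a b = (\<Sum>j=1..p. a j) - (\<Sum>j=1..q. b j)"

definition K_mu :: "nat \<Rightarrow> nat \<Rightarrow> nat \<Rightarrow> nat \<Rightarrow> (nat \<Rightarrow> complex) \<Rightarrow> (nat \<Rightarrow> complex) \<Rightarrow> complex" where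
  "K_mu p q m n a b =
     (\<Sum>j=1..n. a j) - (\<Sum>j=n+1..p. a j) + (\<Sum>j=1..m. b j) - (\<Sum>j=m+1..q. b j)"

definition K_xi :: "nat \<Rightarrow> nat \<Rightarrow> nat \<Rightarrow> nat \<Rightarrow> (nat \<Rightarrow> complex) \<Rightarrow> (nat \<Rightarrow> complex) \<Rightarrow> complex" where
  "K_xi p q m n a b =
     (\<Sum>j=1..n. (a j)\<^sup>2) - (\<Sum>j=n+1..p. (a j)\<^sup>2) + (\<Sum>j=1..m. (b j)\<^sup>2) - (\<Sum>j=m+1..q. (b j)\<^sup>2)"

definition K_case_i :: "nat \<Rightarrow> nat \<Rightarrow> nat \<Rightarrow> nat \<Rightarrow> bool" where
  "K_case_i p q m n \<longleftrightarrow> K_N p q m n > 0"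

definition K_case_ii :: "nat \<Rightarrow> nat \<Rightarrow> nat \<Rightarrow> nat \<Rightarrow> complex \<Rightarrow> bool" where
  "K_case_ii p q m n \<alpha> \<longleftrightarrow> K_N p q m n = 0 \<and> Re \<alpha> \<ge> 0 \<and>
     4 * \<alpha> \<noteq> (of_nat p - of_nat q) * \<i> \<and> 4 * \<alpha> \<noteq> - (of_nat p - of_nat q) * \<i>"

definition K_case_iii :: "nat \<Rightarrow> nat \<Rightarrow> nat \<Rightarrow> nat \<Rightarrow> (nat \<Rightarrow> complex) \<Rightarrow> (nat \<Rightarrow> complex) \<Rightarrow>
    complex \<Rightarrow> bool" where
  "K_case_iii p q m n a b \<alpha> \<longleftrightarrow> K_N p q m n = 0 \<and>
     4 * \<alpha> = (of_nat q - of_nat p) * \<i> \<and> \<alpha> \<noteq> 0 \<and>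
     K_mu p q m n a b \<noteq> 0 \<and> Arg (K_mu p q m n a b) \<noteq> pi / 2"

definition K_case_iv :: "nat \<Rightarrow> nat \<Rightarrow> nat \<Rightarrow> nat \<Rightarrow> (nat \<Rightarrow> complex) \<Rightarrow> (nat \<Rightarrow> complex) \<Rightarrow>
    complex \<Rightarrow> bool" where
  "K_case_iv p q m n a b \<alpha> \<longleftrightarrow> K_N p q m n = 0 \<and>
     4 * \<alpha> = (of_nat p - of_nat q) * \<i> \<and> \<alpha> \<noteq> 0 \<and>
     K_mu p q m n a b \<noteq> 0 \<and> Arg (K_mu p q m n a b) \<noteq> - (pi / 2)"

definition K_case_v :: "nat \<Rightarrow> nat \<Rightarrow> nat \<Rightarrow> nat \<Rightarrow> (nat \<Rightarrow> complex) \<Rightarrow> (nat \<Rightarrow> complex) \<Rightarrow>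
    complex \<Rightarrow> bool" where
  "K_case_v p q m n a b \<alpha> \<longleftrightarrow> K_N p q m n = 0 \<and> \<alpha> = 0 \<and> p = q \<and> Re (K_mu p q m n a b) \<noteq> 0"

definition K_case_vi :: "nat \<Rightarrow> nat \<Rightarrow> nat \<Rightarrow> nat \<Rightarrow> (nat \<Rightarrow> complex) \<Rightarrow> (nat \<Rightarrow> complex) \<Rightarrow>
    complex \<Rightarrow> bool" where
  "K_case_vi p q m n a b \<alpha> \<longleftrightarrow> K_N p q m n = 0 \<and> \<alpha> = 0 \<and> p = q \<and> K_mu p q m n a b = 0 \<and>
     Re (K_nu p q a b) < 0"

definition K_case_vii :: "nat \<Rightarrow> nat \<Rightarrow> nat \<Rightarrow> nat \<Rightarrow> (nat \<Rightarrow> complex) \<Rightarrow> (nat \<Rightarrow> complex) \<Rightarrow>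
    complex \<Rightarrow> bool" where
  "K_case_vii p q m n a b \<alpha> \<longleftrightarrow> K_N p q m n = 0 \<and> \<alpha> = 0 \<and> p = q \<and> K_mu p q m n a b = 0 \<and>
     K_nu p q a b = 0"

definition K_admissible :: "nat \<Rightarrow> nat \<Rightarrow> nat \<Rightarrow> nat \<Rightarrow> (nat \<Rightarrow> complex) \<Rightarrow> (nat \<Rightarrow> complex) \<Rightarrow>
    real \<Rightarrow> complex \<Rightarrow> bool" where
  "K_admissible p q m n a b \<tau> \<alpha> \<longleftrightarrow> Lambda_plus p n a \<tau> \<inter> Lambda_minus q m b \<tau> = {} \<and>
     (K_case_i p q m n \<or> K_case_ii p q m n \<alpha> \<or> K_case_iii p q m n a b \<alpha> \<or>
      K_case_iv p q m n a b \<alpha> \<or> K_case_v p q m n a b \<alpha> \<or> K_case_vi p q m n a b \<alpha> \<or>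
      K_case_vii p q m n a b \<alpha>)"


section \<open>Contours\<close>

text \<open>
  \<open>separating_contour L\<^sub>+ L\<^sub>- \<theta>\<^sub>- \<theta>\<^sub>+ \<gamma>\<close>: the curve \<open>\<gamma>\<close> is a simple contour \<open>\<L>\<^bsub>\<theta>\<^sub>-,\<theta>\<^sub>+\<^esub>\<close> separating
  \<open>L\<^sub>+\<close> from \<open>L\<^sub>-\<close>. It runs from the lower ray to the upper ray, so the domain \<open>D\<^sub>+\<close>, which
  contains all large positive numbers, is on its right and \<open>D\<^sub>-\<close> is on its left.
\<close>

definition separating_contour :: "complex set \<Rightarrow> complex set \<Rightarrow> real \<Rightarrow> real \<Rightarrow>
    (real \<Rightarrow> complex) \<Rightarrow> bool" where
  "separating_contour Lp Lm \<theta>m \<theta>p \<gamma> \<longleftrightarrow>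
     \<gamma> piecewise_C1_differentiable_on UNIV \<and> inj \<gamma> \<and>
     (\<exists>cp. eventually (\<lambda>t. \<gamma> t = cp + of_real t * cis \<theta>p) at_top) \<and>
     (\<exists>cm. eventually (\<lambda>t. \<gamma> t = cm + of_real (- t) * cis \<theta>m) at_bot) \<and>
     (\<exists>Dp Dm. Dp \<noteq> Dm \<and> components (- range \<gamma>) = {Dp, Dm} \<and>
        Lp \<subseteq> Dp \<and> eventually (\<lambda>x. of_real x \<in> Dp) at_top \<and> Lm \<subseteq> Dm)"

text \<open>The analogue of \<open>contour_integral\<close> for curves parametrised by the whole real line.\<close>

definition line_contour_integral :: "(real \<Rightarrow> complex) \<Rightarrow> (complex \<Rightarrow> complex) \<Rightarrow> complex" where
  "line_contour_integral \<gamma> f = integral UNIV (\<lambda>t. f (\<gamma> t) * vector_derivative \<gamma> (at t))"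

definition K_angles :: "nat \<Rightarrow> nat \<Rightarrow> nat \<Rightarrow> nat \<Rightarrow> (nat \<Rightarrow> complex) \<Rightarrow> (nat \<Rightarrow> complex) \<Rightarrow>
    complex \<Rightarrow> real \<Rightarrow> real \<Rightarrow> real \<Rightarrow> bool" where
  "K_angles p q m n a b \<alpha> z \<theta>m \<theta>p \<longleftrightarrow>
     \<theta>p \<in> {0<..<pi} \<and> \<theta>m \<in> {-pi<..<0} \<and>
     (K_case_i p q m n \<and> \<theta>p \<in> {pi/4<..<3*pi/4} \<and> \<theta>m \<in> {-3*pi/4<..<-pi/4} \<or>
      K_case_ii p q m n \<alpha> \<and>
        (\<forall>s. s \<noteq> 0 \<and> Arg s = \<theta>p \<longrightarrow> Re ((\<alpha> + (of_nat p - of_nat q) * \<i> / 4) * s\<^sup>2) < 0) \<and>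
        (\<forall>s. s \<noteq> 0 \<and> Arg s = \<theta>m \<longrightarrow> Re ((\<alpha> - (of_nat p - of_nat q) * \<i> / 4) * s\<^sup>2) < 0) \<or>
      K_case_iii p q m n a b \<alpha> \<and>
        (\<forall>s. s \<noteq> 0 \<and> Arg s = \<theta>p \<longrightarrow> Re (K_mu p q m n a b * s) > 0) \<and>
        (\<forall>s. s \<noteq> 0 \<and> Arg s = \<theta>m \<longrightarrow> Re (\<i> * (of_nat q - of_nat p) * s\<^sup>2) < 0) \<or>
      K_case_iv p q m n a b \<alpha> \<and>
        (\<forall>s. s \<noteq> 0 \<and> Arg s = \<theta>p \<longrightarrow> Re (\<i> * (of_nat p - of_nat q) * s\<^sup>2) < 0) \<and>
        (\<forall>s. s \<noteq> 0 \<and> Arg s = \<theta>m \<longrightarrow> Re (K_mu p q m n a b * s) > 0) \<or>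
      K_case_v p q m n a b \<alpha> \<and>
        (\<forall>s. s \<noteq> 0 \<and> Arg s = \<theta>p \<longrightarrow> Re (K_mu p q m n a b * s) > 0) \<and>
        (\<forall>s. s \<noteq> 0 \<and> Arg s = \<theta>m \<longrightarrow> Re (K_mu p q m n a b * s) > 0) \<or>
      K_case_vi p q m n a b \<alpha> \<and> \<theta>p = pi / 2 \<and> \<theta>m = - (pi / 2) \<or>
      K_case_vii p q m n a b \<alpha> \<and>
        (\<exists>\<epsilon>\<in>{0<..<pi/2}. z > 1 \<and> \<theta>p = \<epsilon> \<and> \<theta>m = - \<epsilon> \<or>
                       z < 1 \<and> \<theta>p = pi - \<epsilon> \<and> \<theta>m = - (pi - \<epsilon>)))"

definition K_contour :: "nat \<Rightarrow> nat \<Rightarrow> nat \<Rightarrow> nat \<Rightarrow> (nat \<Rightarrow> complex) \<Rightarrow> (nat \<Rightarrow> complex) \<Rightarrow>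
    real \<Rightarrow> complex \<Rightarrow> real \<Rightarrow> (real \<Rightarrow> complex) \<Rightarrow> bool" where
  "K_contour p q m n a b \<tau> \<alpha> z \<gamma> \<longleftrightarrow>
     (\<exists>\<theta>m \<theta>p. K_angles p q m n a b \<alpha> z \<theta>m \<theta>p \<and>
        separating_contour (Lambda_plus p n a \<tau>) (Lambda_minus q m b \<tau>) \<theta>m \<theta>p \<gamma>)"


section \<open>The Meijer-Barnes K-function\<close>

text \<open>
  The integral is the same for all contours satisfying \<open>K_contour\<close>, so any one may be chosen.
  The function is meaningful for admissible parameters and \<open>z > 0\<close>, with \<open>z \<noteq> 1\<close> in case (vii).
\<close>

definition Meijer_Barnes_K :: "nat \<Rightarrow> nat \<Rightarrow> nat \<Rightarrow> nat \<Rightarrow> (nat \<Rightarrow> complex) \<Rightarrow>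
    (nat \<Rightarrow> complex) \<Rightarrow> real \<Rightarrow> complex \<Rightarrow> real \<Rightarrow> complex" where
  "Meijer_Barnes_K p q m n a b \<tau> \<alpha> z =
     1 / (2 * of_real pi * \<i>) *
     line_contour_integral (SOME \<gamma>. K_contour p q m n a b \<tau> \<alpha> z \<gamma>)
       (\<lambda>s. K_Gquot p q m n a b \<tau> s * exp (of_real pi * \<alpha> / of_real \<tau> * s\<^sup>2) *
            of_real z powr (- s))"

end

theory Submission
  imports Defs "HOL-Complex_Analysis.Complex_Analysis" "HOL-Real_Asymp.Real_Asymp"
begin

text \<open>
  Let \<open>\<Phi>\<close> be an elementary function whose mixed second difference with steps \<open>1\<close> and \<open>\<tau>\<close> is \<open>Ln\<close>
  up to a summable error. The double sum of logarithms in the product for \<open>G(z;\<tau>)\<close> then telescopes,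
  which gives \<open>ln G\<close> up to a bounded error in every sector around a half of the imaginary axis. Hence the
  integrand without the factor \<open>z powr (- s)\<close> is
  \<open>exp (A s\<^sup>2 Ln s + B s\<^sup>2 + C s Ln s + L s + P Ln s + O(1))\<close> there, with coefficients given
  by \<open>N\<close>, \<open>\<alpha>\<close>, \<open>p - q\<close>, \<open>\<mu>\<close>, \<open>\<nu>\<close>, \<open>\<xi>\<close>.

  In cases (i)-(v) the first nonzero term among the first three makes the integrand decay faster than any
  exponential on both ends of the contour, and the integral converges for all complex \<open>w\<close>. In case (vi)
  the term \<open>L s\<close> gives the exponential rate that determines the strip. In case (vii) only the power
  \<open>\<bar>s\<bar> powr (Re \<xi> / (2 \<tau>))\<close> is left; then the factor \<open>exp (- 2 \<pi> w s)\<close> has to provide the decay, and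
  rotating the two ends of the contour with \<open>w\<close> covers a half-plane. If this power is less than \<open>- 1\<close>, the
  ends can be made vertical for real \<open>w\<close>, the integral is continuous in \<open>w\<close>, and since all contours with
  vertical ends give the same value, it agrees with both branches.
\<close>

section \<open>The double gamma function as a lattice product\<close>

text \<open>The constants in the asymptotics of \<open>Barnes_G\<close> are kept as unknowns
  \<open>b1\<close>, \<open>b2\<close>, \<open>b3\<close>. Only their multipliers matter:
  \<open>b2\<close> comes with the factor \<open>K_N\<close>, while \<open>b1\<close> and
  \<open>b3\<close> come with differences that vanish when \<open>K_N = 0\<close>,
  \<open>p = q\<close> and \<open>K_mu = 0\<close>. Thus every coefficient that decides convergence
  is explicit in the case in which it is the leading one. The other obstacle is the contour inside
  \<open>Meijer_Barnes_K\<close>. It is an unspecified curve, chosen for each z separately, so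
  nothing is known about it before a contour has been constructed. Outside case (vii) the condition
  on the contour does not involve z and the same curve is chosen for all z. In case (vii) two curves
  occur, one for z > 1 and one for z < 1. Continuity at w = 0 compares them, and this needs Cauchy's
  theorem for unbounded curves that separate two infinite sets of poles.\<close>

lemma norm_Ln_one_plus_remainder:
  fixes z :: complex
  assumes z: "norm z \<le> 1/2" and n: "n \<ge> 1"
  shows "norm (Ln (1 + z) + (\<Sum>k<n. (- z) ^ k / of_nat k)) \<le> 2 * norm z ^ n"
proof -
  \<comment> \<open>The term with k = 0 of each sum is a quotient by \<open>of_nat 0\<close>, hence
    0. The factor 2 of the bound is the geometric series with ratio at most 1/2.\<close>
  have s: "(\<lambda>i. - ((- z) ^ (i + n)) / of_nat (i + n)) sums
             (Ln (1 + z) - (\<Sum>k<n. - ((- z) ^ k) / of_nat k))"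
    using Ln_series'[of z] z by (intro sums_split_initial_segment) auto
  have g: "(\<lambda>i. norm z ^ n * norm z ^ i) sums (norm z ^ n * (1 / (1 - norm z)))"
    using z by (intro sums_mult geometric_sums) auto
  have "norm (\<Sum>i. - ((- z) ^ (i + n)) / of_nat (i + n)) \<le> (\<Sum>i. norm z ^ n * norm z ^ i)"
  proof (rule norm_suminf_le)
    fix i
    have "norm (- ((- z) ^ (i + n)) / of_nat (i + n)) = norm z ^ (i + n) / real (i + n)"
      by (simp add: norm_divide norm_power del: of_nat_add)
    also have "\<dots> \<le> norm z ^ (i + n)"
      using n by (simp add: divide_le_eq mult_le_cancel_left1 del: of_nat_add)
    finally show "norm (- ((- z) ^ (i + n)) / of_nat (i + n)) \<le> norm z ^ n * norm z ^ i"
      by (simp add: power_add mult.commute)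
  qed (use g in \<open>auto simp: sums_iff\<close>)
  also have "\<dots> = norm z ^ n * (1 / (1 - norm z))"
    using g by (simp add: sums_iff)
  also have "\<dots> \<le> norm z ^ n * 2"
    using z by (intro mult_left_mono) (auto simp: divide_simps)
  finally show ?thesis
    using s by (simp add: sums_iff sum_negf)
qed

section \<open>Summation over the lattice of the numbers k \<tau> + l\<close>

definition lat :: "real \<Rightarrow> nat \<times> nat \<Rightarrow> real" where
  "lat \<tau> kl = real (fst kl) * \<tau> + real (snd kl)"

lemma lat_nonneg: "\<tau> > 0 \<Longrightarrow> lat \<tau> kl \<ge> 0"
  by (simp add: lat_def)

lemma lat_pos: "\<tau> > 0 \<Longrightarrow> kl \<noteq> (0, 0) \<Longrightarrow> lat \<tau> kl > 0"
  by (cases kl) (auto simp: lat_def add_nonneg_pos add_pos_nonneg)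

lemma finite_lat_le:
  assumes "\<tau> > 0"
  shows "finite {kl. lat \<tau> kl \<le> R}"
proof -
  have "{kl. lat \<tau> kl \<le> R} \<subseteq> {..nat \<lceil>R / \<tau>\<rceil>} \<times> {..nat \<lceil>R\<rceil>}"
  proof
    fix kl assume "kl \<in> {kl. lat \<tau> kl \<le> R}"
    then have h: "real (fst kl) * \<tau> + real (snd kl) \<le> R" by (simp add: lat_def)
    have p: "real (fst kl) * \<tau> \<ge> 0" using assms by simp
    then have "real (snd kl) \<le> R" using h by linarith
    moreover have "real (fst kl) * \<tau> \<le> R" using h by linarith
    then have "real (fst kl) \<le> R / \<tau>" using assms by (simp add: pos_le_divide_eq)
    ultimately have "fst kl \<le> nat \<lceil>R / \<tau>\<rceil>" "snd kl \<le> nat \<lceil>R\<rceil>" by linarith+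
    then show "kl \<in> {..nat \<lceil>R / \<tau>\<rceil>} \<times> {..nat \<lceil>R\<rceil>}" by (cases kl) auto
  qed
  then show ?thesis by (rule finite_subset) auto
qed

text \<open>With c = min 1 \<tau>, the number 1 + k \<tau> + l is at least c (k + 1) and at least c
  (l + 1). Giving each of the two bounds half of the exponent 3 separates the variables, and the
  double sum is at most the square of a convergent series with exponent 3/2.\<close>

lemma summable_lat_cube:
  assumes "\<tau> > 0"
  shows "(\<lambda>kl. 1 / (1 + lat \<tau> kl) ^ 3) summable_on UNIV"
proof (rule nonneg_bdd_above_summable_on)
  show "1 / (1 + lat \<tau> kl) ^ 3 \<ge> 0" for kl
    using lat_nonneg[OF assms, of kl] by simp
next
  define c where "c = min 1 \<tau>"
  have c: "c > 0" "c \<le> 1" "c \<le> \<tau>" using assms by (auto simp: c_def)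
  define g where "g = (\<lambda>k. c powr (-3/2) * real (Suc k) powr (-3/2))"
  have "summable (\<lambda>k. real k powr (-3/2))" by (simp add: summable_real_powr_iff)
  then have "summable (\<lambda>k. real (Suc k) powr (-3/2))" by (subst summable_Suc_iff)
  then have sg: "summable g" unfolding g_def by (rule summable_mult)
  have g0: "g k \<ge> 0" for k by (simp add: g_def)
  have bnd: "1 / (1 + lat \<tau> (k, l)) ^ 3 \<le> g k * g l" for k l
  proof -
    let ?s = "1 + lat \<tau> (k, l)"
    have "real k * c \<le> real k * \<tau>" "real l * c \<le> real l"
      using c by (auto intro!: mult_left_mono mult_left_le)
    moreover have "real k * \<tau> \<ge> 0" using c by auto
    ultimately have "c * real (Suc k) \<le> ?s" "c * real (Suc l) \<le> ?s"
      using c unfolding lat_def fst_conv snd_conv of_nat_Suc distrib_left mult.commute[of c] by linarith+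
    then have *: "?s powr (-3/2) \<le> (c * real (Suc k)) powr (-3/2)"
        "?s powr (-3/2) \<le> (c * real (Suc l)) powr (-3/2)"
      using c by (auto intro!: powr_mono2')
    have "?s > 0" using lat_nonneg[OF assms, of "(k,l)"] by linarith
    then have "1 / ?s ^ 3 = ?s powr (-3/2) * ?s powr (-3/2)"
      by (simp add: powr_add [symmetric] powr_minus powr_numeral field_simps)
    also have "\<dots> \<le> (c * real (Suc k)) powr (-3/2) * (c * real (Suc l)) powr (-3/2)"
      using * by (intro mult_mono) auto
    also have "\<dots> = g k * g l" using c by (simp add: g_def powr_mult)
    finally show ?thesis .
  qed
  show "bdd_above (sum (\<lambda>kl. 1 / (1 + lat \<tau> kl) ^ 3) ` {F. F \<subseteq> UNIV \<and> finite F})"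
  proof (rule bdd_aboveI2)
    fix F :: "(nat \<times> nat) set" assume "F \<in> {F. F \<subseteq> UNIV \<and> finite F}"
    then have F: "finite F" by simp
    have "sum (\<lambda>kl. 1 / (1 + lat \<tau> kl) ^ 3) F \<le> sum (\<lambda>(k, l). g k * g l) F"
      using bnd by (intro sum_mono) auto
    also have "\<dots> \<le> sum (\<lambda>(k, l). g k * g l) (fst ` F \<times> snd ` F)"
      using F g0 by (intro sum_mono2) (auto simp: split: prod.splits intro: rev_image_eqI)
    also have "\<dots> = sum g (fst ` F) * sum g (snd ` F)"
      by (simp add: sum_product sum.cartesian_product)
    also have "\<dots> \<le> suminf g * suminf g"
      using F g0 sg by (intro mult_mono sum_le_suminf sum_nonneg suminf_nonneg) auto
    finally show "sum (\<lambda>kl. 1 / (1 + lat \<tau> kl) ^ 3) F \<le> suminf g * suminf g" .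
  qed
qed

section \<open>Weierstrass factors and their product\<close>

definition weierstrass_log :: "real \<Rightarrow> complex \<Rightarrow> complex" where
  "weierstrass_log \<omega> z = Ln (1 + z / of_real \<omega>) - z / of_real \<omega> + z\<^sup>2 / (2 * (of_real \<omega>)\<^sup>2)"

definition weierstrass_fac :: "real \<Rightarrow> complex \<Rightarrow> complex" where
  "weierstrass_fac \<omega> z = (1 + z / of_real \<omega>) * exp (- (z / of_real \<omega>) + z\<^sup>2 / (2 * (of_real \<omega>)\<^sup>2))"

lemma exp_weierstrass_log: "1 + z / of_real \<omega> \<noteq> 0 \<Longrightarrow> exp (weierstrass_log \<omega> z) = weierstrass_fac \<omega> z"
  by (simp add: weierstrass_log_def weierstrass_fac_def exp_add exp_diff exp_minus field_simps)

lemma norm_weierstrass_log_le: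
  assumes "\<omega> > 0" "2 * norm z \<le> \<omega>"
  shows "norm (weierstrass_log \<omega> z) \<le> 2 * norm z ^ 3 / \<omega> ^ 3"
proof -
  have n: "norm (z / of_real \<omega>) \<le> 1/2" using assms by (simp add: norm_divide divide_simps)
  have "weierstrass_log \<omega> z = Ln (1 + z / of_real \<omega>) + (\<Sum>k<3. (- (z / of_real \<omega>)) ^ k / of_nat k)"
    by (simp add: weierstrass_log_def eval_nat_numeral field_simps)
  also have "norm \<dots> \<le> 2 * norm (z / of_real \<omega>) ^ 3"
    using n by (intro norm_Ln_one_plus_remainder) auto
  finally show ?thesis using assms by (simp add: norm_divide power_divide)
qed

abbreviation latI :: "(nat \<times> nat) set" where "latI \<equiv> UNIV - {(0, 0)}"

definition lat_product :: "real \<Rightarrow> complex \<Rightarrow> complex" where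
  "lat_product \<tau> z = Lim (finite_subsets_at_top latI) (\<lambda>F. \<Prod>kl\<in>F. weierstrass_fac (lat \<tau> kl) z)"

lemma Barnes_G_lat_product:
  "Barnes_G (of_real \<tau>) z = z / of_real \<tau> * exp (Barnes_a (of_real \<tau>) * (z / of_real \<tau>)
     + Barnes_b (of_real \<tau>) * (z\<^sup>2 / (2 * (of_real \<tau>)\<^sup>2))) * lat_product \<tau> z"
proof -
  have "(\<lambda>(k, l). let \<omega> = of_nat k * of_real \<tau> + of_nat l
              in (1 + z / \<omega>) * exp (- (z / \<omega>) + z\<^sup>2 / (2 * \<omega>\<^sup>2))) = (\<lambda>kl. weierstrass_fac (lat \<tau> kl) z)"
    by (auto simp: fun_eq_iff weierstrass_fac_def lat_def Let_def)
  then show ?thesis unfolding Barnes_G_def lat_product_def by simp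
qed

lemma summable_weierstrass_log_bound:
  assumes "\<tau> > 0" "c \<ge> 0"
  shows "(\<lambda>kl. c / lat \<tau> kl ^ 3) summable_on latI"
proof -
  define m where "m = min 1 \<tau>"
  have m: "m > 0" "m \<le> 1" "m \<le> \<tau>" using assms by (auto simp: m_def)
  have "(\<lambda>kl. (c * ((1 + m) / m) ^ 3) * (1 / (1 + lat \<tau> kl) ^ 3)) summable_on latI"
    by (intro summable_on_cmult_right summable_on_subset[OF summable_lat_cube[OF assms(1)]]) auto
  then show ?thesis
  proof (rule summable_on_comparison_test)
    fix kl :: "nat \<times> nat" assume kl: "kl \<in> latI"
    have p: "lat \<tau> kl > 0" using lat_pos[OF assms(1)] kl by auto
    have "lat \<tau> kl \<ge> m"
    proof (cases "fst kl = 0")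
      case True
      then have "real (snd kl) \<ge> 1" using kl by (cases kl) auto
      then show ?thesis using m True by (simp add: lat_def)
    next
      case False
      then have "real (fst kl) \<ge> 1" by auto
      then have "real (fst kl) * \<tau> \<ge> \<tau>" using assms(1) by simp
      moreover have "real (snd kl) \<ge> 0" by simp
      ultimately show ?thesis using m unfolding lat_def by linarith
    qed
    then have "m * (1 + lat \<tau> kl) \<le> (1 + m) * lat \<tau> kl" by (simp add: algebra_simps)
    then have "1 / lat \<tau> kl \<le> ((1 + m) / m) * (1 / (1 + lat \<tau> kl))"
      using m p by (simp add: divide_simps mult.commute)
    then have "(1 / lat \<tau> kl) ^ 3 \<le> (((1 + m) / m) * (1 / (1 + lat \<tau> kl))) ^ 3"
      using p by (intro power_mono) auto
    then have "c * (1 / lat \<tau> kl) ^ 3 \<le> c * (((1 + m) / m) * (1 / (1 + lat \<tau> kl))) ^ 3"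
      using assms(2) by (rule mult_left_mono)
    then show "c / lat \<tau> kl ^ 3 \<le> (c * ((1 + m) / m) ^ 3) * (1 / (1 + lat \<tau> kl) ^ 3)"
      by (simp add: power_mult_distrib power_divide)
    show "0 \<le> c / lat \<tau> kl ^ 3" using assms p by simp
  qed
qed

lemma summable_weierstrass_log:
  assumes "\<tau> > 0"
  shows "(\<lambda>kl. weierstrass_log (lat \<tau> kl) z) summable_on latI"
proof -
  let ?F = "{kl. lat \<tau> kl \<le> 2 * norm z}"
  have "(\<lambda>kl. norm (weierstrass_log (lat \<tau> kl) z)) summable_on (latI - ?F)"
  proof (rule Infinite_Sum.abs_summable_on_comparison_test'[of "\<lambda>kl. 2 * norm z ^ 3 / lat \<tau> kl ^ 3"])
    show "(\<lambda>kl. 2 * cmod z ^ 3 / lat \<tau> kl ^ 3) summable_on latI - ?F"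
      by (rule summable_on_subset[OF summable_weierstrass_log_bound[OF assms]]) auto
    show "norm (weierstrass_log (lat \<tau> kl) z) \<le> 2 * cmod z ^ 3 / lat \<tau> kl ^ 3" if "kl \<in> latI - ?F" for kl
      using that lat_pos[OF assms] by (intro norm_weierstrass_log_le) auto
  qed
  then have "(\<lambda>kl. weierstrass_log (lat \<tau> kl) z) summable_on (latI - ?F)"
    by (rule abs_summable_summable)
  moreover have "(\<lambda>kl. weierstrass_log (lat \<tau> kl) z) summable_on (latI \<inter> ?F)"
    using finite_lat_le[OF assms] by (intro summable_on_finite) auto
  ultimately have "(\<lambda>kl. weierstrass_log (lat \<tau> kl) z) summable_on ((latI - ?F) \<union> (latI \<inter> ?F))"
    by (intro summable_on_union)
  moreover have "(latI - ?F) \<union> (latI \<inter> ?F) = latI" by blast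
  ultimately show ?thesis by simp
qed

text \<open>The finitely many factors in \<open>F0\<close>, which may vanish at z, stay outside the
  logarithm. Every set far out in the net contains \<open>F0\<close>, so splitting them off does not
  disturb the limit. With \<open>F0\<close> a ball of the lattice this gives holomorphy and the
  zeros; with \<open>F0\<close> empty it gives a logarithm off the nonpositive real axis.\<close>

lemma lat_product_factor:
  assumes t: "\<tau> > 0" and F0: "finite F0" "F0 \<subseteq> latI"
    and nz: "\<And>kl. kl \<in> latI - F0 \<Longrightarrow> 1 + z / of_real (lat \<tau> kl) \<noteq> 0"
  shows "lat_product \<tau> z = (\<Prod>kl\<in>F0. weierstrass_fac (lat \<tau> kl) z) * exp (\<Sum>\<^sub>\<infinity>kl\<in>latI - F0. weierstrass_log (lat \<tau> kl) z)"
proof -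
  \<comment> \<open>Extending the logarithms by 0 on \<open>F0\<close> puts the sum on the same net,
    the finite subsets of \<open>latI\<close>, as the product.\<close>
  define h where "h = (\<lambda>kl. if kl \<in> F0 then 0 else weierstrass_log (lat \<tau> kl) z)"
  have "(\<lambda>kl. weierstrass_log (lat \<tau> kl) z) summable_on (latI - F0)"
    by (rule summable_on_subset[OF summable_weierstrass_log[OF t]]) auto
  then have "((\<lambda>kl. weierstrass_log (lat \<tau> kl) z) has_sum (\<Sum>\<^sub>\<infinity>kl\<in>latI - F0. weierstrass_log (lat \<tau> kl) z)) (latI - F0)"
    by (rule has_sum_infsum)
  also have "?this \<longleftrightarrow> (h has_sum (\<Sum>\<^sub>\<infinity>kl\<in>latI - F0. weierstrass_log (lat \<tau> kl) z)) latI"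
    by (rule has_sum_cong_neutral) (auto simp: h_def)
  finally have "(h has_sum (\<Sum>\<^sub>\<infinity>kl\<in>latI - F0. weierstrass_log (lat \<tau> kl) z)) latI" .
  then have "(sum h \<longlongrightarrow> (\<Sum>\<^sub>\<infinity>kl\<in>latI - F0. weierstrass_log (lat \<tau> kl) z)) (finite_subsets_at_top latI)"
    by (simp add: has_sum_def)
  then have lim: "((\<lambda>F. (\<Prod>kl\<in>F0. weierstrass_fac (lat \<tau> kl) z) * exp (sum h F)) \<longlongrightarrow>
      (\<Prod>kl\<in>F0. weierstrass_fac (lat \<tau> kl) z) * exp (\<Sum>\<^sub>\<infinity>kl\<in>latI - F0. weierstrass_log (lat \<tau> kl) z)) (finite_subsets_at_top latI)"
    by (intro tendsto_intros)
  have ev: "eventually (\<lambda>F. (\<Prod>kl\<in>F0. weierstrass_fac (lat \<tau> kl) z) * exp (sum h F) = (\<Prod>kl\<in>F. weierstrass_fac (lat \<tau> kl) z))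
      (finite_subsets_at_top latI)"
    unfolding eventually_finite_subsets_at_top
  proof (intro exI[of _ F0] conjI allI impI)
    fix F assume F: "finite F \<and> F0 \<subseteq> F \<and> F \<subseteq> latI"
    have "(\<Prod>kl\<in>F. weierstrass_fac (lat \<tau> kl) z) = (\<Prod>kl\<in>F0. weierstrass_fac (lat \<tau> kl) z) * (\<Prod>kl\<in>F - F0. weierstrass_fac (lat \<tau> kl) z)"
      using F by (metis prod.subset_diff mult.commute)
    also have "(\<Prod>kl\<in>F - F0. weierstrass_fac (lat \<tau> kl) z) = (\<Prod>kl\<in>F - F0. exp (h kl))"
    proof (rule prod.cong[OF refl])
      fix kl assume kl: "kl \<in> F - F0"
      then have "1 + z / of_real (lat \<tau> kl) \<noteq> 0" using F by (intro nz) auto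
      then show "weierstrass_fac (lat \<tau> kl) z = exp (h kl)" using kl by (simp add: h_def exp_weierstrass_log)
    qed
    also have "\<dots> = exp (sum h (F - F0))" using F by (simp add: exp_sum)
    also have "sum h (F - F0) = sum h F"
      using F by (intro sum.mono_neutral_left) (auto simp: h_def)
    finally show "(\<Prod>kl\<in>F0. weierstrass_fac (lat \<tau> kl) z) * exp (sum h F) = (\<Prod>kl\<in>F. weierstrass_fac (lat \<tau> kl) z)" by simp
  qed (use F0 in auto)
  show ?thesis unfolding lat_product_def
    by (rule tendsto_Lim[OF _ Lim_transform_eventually[OF lim ev]]) auto
qed

text \<open>The set of separated factors depends on R only, not on z. Beyond 2 R the quotient of z
  by the lattice point is at most 1/2 in modulus, so these factors have no zeros and the cubic bound
  for their logarithms applies.\<close>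

lemma lat_product_ball:
  assumes t: "\<tau> > 0" and R: "R > 0" and z: "norm z \<le> R"
  shows "lat_product \<tau> z = (\<Prod>kl\<in>{kl \<in> latI. lat \<tau> kl \<le> 2 * R}. weierstrass_fac (lat \<tau> kl) z)
     * exp (\<Sum>\<^sub>\<infinity>kl\<in>latI - {kl \<in> latI. lat \<tau> kl \<le> 2 * R}. weierstrass_log (lat \<tau> kl) z)"
proof (rule lat_product_factor[OF t])
  show "finite {kl \<in> latI. lat \<tau> kl \<le> 2 * R}"
    by (rule finite_subset[OF _ finite_lat_le[OF t, of "2 * R"]]) auto
  fix kl assume "kl \<in> latI - {kl \<in> latI. lat \<tau> kl \<le> 2 * R}"
  then have l: "lat \<tau> kl > 2 * R" by auto
  show "1 + z / of_real (lat \<tau> kl) \<noteq> 0"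
  proof
    assume "1 + z / of_real (lat \<tau> kl) = 0"
    then have "z = - of_real (lat \<tau> kl)" using l R by (auto simp: field_simps add_eq_0_iff)
    then have "norm z = lat \<tau> kl" using l R by auto
    then show False using l z R by linarith
  qed
qed auto

text \<open>On a ball the logarithms of the factors that are not separated have a summable majorant
  that does not depend on z, so their sum is a uniform limit of holomorphic functions. Balls of all
  radii exhaust the plane.\<close>

lemma holomorphic_lat_product:
  assumes t: "\<tau> > 0"
  shows "lat_product \<tau> holomorphic_on UNIV"
proof -
  have "lat_product \<tau> holomorphic_on ball 0 R" if R: "R > 0" for R
  proof -
    let ?F0 = "{kl \<in> latI. lat \<tau> kl \<le> 2 * R}"
    have nz: "1 + z / of_real (lat \<tau> kl) \<notin> \<real>\<^sub>\<le>\<^sub>0" if "z \<in> cball 0 R" "kl \<in> latI - ?F0" for z :: complex and kl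
    proof -
      have l: "lat \<tau> kl > 2 * R" "lat \<tau> kl > 0" using that R by auto
      have "norm (z / of_real (lat \<tau> kl)) < 1" using l that R by (simp add: norm_divide)
      then have "Re (z / of_real (lat \<tau> kl)) > -1"
        using abs_Re_le_cmod[of "z / of_real (lat \<tau> kl)"] by linarith
      then show ?thesis by (auto simp: complex_nonpos_Reals_iff)
    qed
    have hol: "(\<lambda>z. weierstrass_log (lat \<tau> kl) z) holomorphic_on cball 0 R" if "kl \<in> latI - ?F0" for kl
    proof -
      have l: "lat \<tau> kl \<noteq> 0" using that lat_pos[OF t, of kl] by auto
      have *: "1 + z / of_real (lat \<tau> kl) \<notin> \<real>\<^sub>\<le>\<^sub>0" if "z \<in> cball 0 R" for z :: complex
        using nz[OF that \<open>kl \<in> latI - ?F0\<close>] .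
      show ?thesis unfolding weierstrass_log_def by (intro holomorphic_intros *) (use l in auto)
    qed
    have ul: "uniform_limit (cball 0 R) (\<lambda>F z. \<Sum>kl\<in>F. weierstrass_log (lat \<tau> kl) z)
        (\<lambda>z. \<Sum>\<^sub>\<infinity>kl\<in>latI - ?F0. weierstrass_log (lat \<tau> kl) z) (finite_subsets_at_top (latI - ?F0))"
    proof (rule Weierstrass_m_test_general[where M = "\<lambda>kl. 2 * R ^ 3 / lat \<tau> kl ^ 3"])
      fix kl z assume *: "kl \<in> latI - ?F0" "z \<in> cball (0::complex) R"
      then have p: "lat \<tau> kl > 0" using lat_pos[OF t] by auto
      have "norm (weierstrass_log (lat \<tau> kl) z) \<le> 2 * norm z ^ 3 / lat \<tau> kl ^ 3"
        using * p by (intro norm_weierstrass_log_le) auto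
      also have "\<dots> \<le> 2 * R ^ 3 / lat \<tau> kl ^ 3"
        using * p by (intro divide_right_mono mult_left_mono power_mono) auto
      finally show "norm (weierstrass_log (lat \<tau> kl) z) \<le> 2 * R ^ 3 / lat \<tau> kl ^ 3" .
    next
      show "(\<lambda>kl. 2 * R ^ 3 / lat \<tau> kl ^ 3) summable_on latI - ?F0"
        by (rule summable_on_subset[OF summable_weierstrass_log_bound[OF t]]) (use R in auto)
    qed
    have "(\<lambda>z. \<Sum>\<^sub>\<infinity>kl\<in>latI - ?F0. weierstrass_log (lat \<tau> kl) z) holomorphic_on ball 0 R"
    proof (rule holomorphic_uniform_limit[OF _ ul])
      show "\<forall>\<^sub>F F in finite_subsets_at_top (latI - ?F0).
          continuous_on (cball 0 R) (\<lambda>z. \<Sum>kl\<in>F. weierstrass_log (lat \<tau> kl) z) \<and>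
          (\<lambda>z. \<Sum>kl\<in>F. weierstrass_log (lat \<tau> kl) z) holomorphic_on ball 0 R"
      proof (rule eventually_finite_subsets_at_top_weakI)
        fix F assume F: "finite F" "F \<subseteq> latI - ?F0"
        have "(\<lambda>z. \<Sum>kl\<in>F. weierstrass_log (lat \<tau> kl) z) holomorphic_on cball 0 R"
          using F hol by (intro holomorphic_intros) auto
        then show "continuous_on (cball 0 R) (\<lambda>z. \<Sum>kl\<in>F. weierstrass_log (lat \<tau> kl) z) \<and>
          (\<lambda>z. \<Sum>kl\<in>F. weierstrass_log (lat \<tau> kl) z) holomorphic_on ball 0 R"
          using holomorphic_on_imp_continuous_on holomorphic_on_subset[OF _ ball_subset_cball] by blast
      qed
    qed auto
    moreover have "(\<lambda>z. weierstrass_fac (lat \<tau> kl) z) holomorphic_on ball 0 R" if "kl \<in> ?F0" for kl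
    proof -
      have l: "lat \<tau> kl \<noteq> 0" using that lat_pos[OF t, of kl] by auto
      show ?thesis unfolding weierstrass_fac_def by (intro holomorphic_intros) (use l in auto)
    qed
    ultimately have "(\<lambda>z. (\<Prod>kl\<in>?F0. weierstrass_fac (lat \<tau> kl) z) * exp (\<Sum>\<^sub>\<infinity>kl\<in>latI - ?F0. weierstrass_log (lat \<tau> kl) z))
        holomorphic_on ball 0 R"
      by (intro holomorphic_intros) auto
    then show ?thesis
    proof (rule holomorphic_transform)
      fix z :: complex assume "z \<in> ball 0 R"
      then have "norm z \<le> R" by simp
      from lat_product_ball[OF t R this]
      show "(\<Prod>kl\<in>?F0. weierstrass_fac (lat \<tau> kl) z) * exp (\<Sum>\<^sub>\<infinity>kl\<in>latI - ?F0. weierstrass_log (lat \<tau> kl) z) = lat_product \<tau> z" ..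
    qed
  qed
  then have "lat_product \<tau> holomorphic_on (\<Union>R\<in>{0<..}. ball 0 R)"
    by (subst holomorphic_on_UN_open) auto
  moreover have "(\<Union>R\<in>{0<..}. ball 0 R) = (UNIV :: complex set)"
  proof (intro set_eqI iffI UNIV_I)
    fix z :: complex
    have "norm z + 1 \<in> {0<..}" by (simp add: add_nonneg_pos)
    then show "z \<in> (\<Union>R\<in>{0<..}. ball 0 R)" by (intro UN_I) auto
  qed
  ultimately show ?thesis by simp
qed

lemma holomorphic_Barnes_G:
  assumes "\<tau> > 0" "f holomorphic_on A"
  shows "(\<lambda>z. Barnes_G (of_real \<tau>) (f z)) holomorphic_on A"
proof -
  have "(\<lambda>z. lat_product \<tau> (f z)) holomorphic_on A"
    using holomorphic_on_compose_gen[OF assms(2) holomorphic_lat_product[OF assms(1)]] by (simp add: o_def)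
  then show ?thesis using assms unfolding Barnes_G_lat_product by (intro holomorphic_intros) auto
qed

lemma Barnes_G_eq_0:
  assumes t: "\<tau> > 0" and z: "Barnes_G (of_real \<tau>) z = 0"
  obtains kl where "z = - of_real (lat \<tau> kl)"
proof (cases "z = 0")
  case True
  then have "z = - of_real (lat \<tau> (0, 0))" by (simp add: lat_def)
  then show ?thesis by (rule that)
next
  case False
  then have "lat_product \<tau> z = 0" using z t by (simp add: Barnes_G_lat_product)
  moreover have "norm z > 0" using False by simp
  ultimately have "(\<Prod>kl\<in>{kl \<in> latI. lat \<tau> kl \<le> 2 * norm z}. weierstrass_fac (lat \<tau> kl) z) = 0"
    using lat_product_ball[OF t _ order_refl, of z] by simp
  moreover have "finite {kl \<in> latI. lat \<tau> kl \<le> 2 * norm z}"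
    by (rule finite_subset[OF _ finite_lat_le[OF t, of "2 * norm z"]]) auto
  ultimately obtain kl where kl: "kl \<in> latI" "weierstrass_fac (lat \<tau> kl) z = 0"
    using prod_zero_iff by fastforce
  then have "lat \<tau> kl > 0" using lat_pos[OF t] by auto
  moreover have "1 + z / of_real (lat \<tau> kl) = 0" using kl by (simp add: weierstrass_fac_def)
  ultimately have "z = - of_real (lat \<tau> kl)" by (auto simp: field_simps add_eq_0_iff)
  then show ?thesis by (rule that)
qed

section \<open>Asymptotics of the double gamma function\<close>

text \<open>Within one open half-plane, or on the positive axis, the arguments of z and z + c differ
  by less than \<pi>, and that of 1 + c / z is at most \<pi> in modulus. Hence the imaginary parts
  of the two sides differ by less than 2 \<pi>, while their exponentials agree.\<close>

lemma Ln_add_same_half_plane: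
  assumes "Im z > 0 \<and> Im (z + c) > 0 \<or> Im z < 0 \<and> Im (z + c) < 0 \<or>
           Im z = 0 \<and> Re z > 0 \<and> Im (z + c) = 0 \<and> Re (z + c) > 0"
  shows "Ln (z + c) = Ln z + Ln (1 + c / z)"
proof -
  have "z + c \<noteq> 0"
  proof
    assume "z + c = 0"
    then have "Im (z + c) = 0" "Re (z + c) = 0" by simp_all
    then show False using assms by linarith
  qed
  moreover have "z \<noteq> 0" using assms by auto
  ultimately have nz: "z \<noteq> 0" "z + c \<noteq> 0" by auto
  have nz': "1 + c / z \<noteq> 0" using nz by (simp add: field_simps add_eq_0_iff)
  have d: "\<bar>Im (Ln (z + c)) - Im (Ln z)\<bar> < pi"
    using assms
  proof (elim disjE)
    assume "Im z > 0 \<and> Im (z + c) > 0"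
    then show ?thesis using Im_Ln_pos_lt_imp[of z] Im_Ln_pos_lt_imp[of "z + c"] by linarith
  next
    assume *: "Im z < 0 \<and> Im (z + c) < 0"
    then have "Im (Ln z) < 0" "Im (Ln (z + c)) < 0"
      using Im_Ln_pos_le[of z] Im_Ln_pos_le[of "z + c"] nz mpi_less_Im_Ln[of z] Im_Ln_le_pi[of z]
        mpi_less_Im_Ln[of "z + c"] Im_Ln_le_pi[of "z + c"] by linarith+
    then show ?thesis using mpi_less_Im_Ln[of z] mpi_less_Im_Ln[of "z + c"] nz by linarith
  next
    assume "Im z = 0 \<and> Re z > 0 \<and> Im (z + c) = 0 \<and> Re (z + c) > 0"
    then have "Im (Ln z) = 0" "Im (Ln (z + c)) = 0"
      using Im_Ln_eq_0[of z] Im_Ln_eq_0[of "z + c"] nz by auto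
    then show ?thesis by simp
  qed
  show ?thesis
  proof (rule exp_complex_eqI)
    show "\<bar>Im (Ln (z + c)) - Im (Ln z + Ln (1 + c / z))\<bar> < 2 * pi"
      using d mpi_less_Im_Ln[OF nz'] Im_Ln_le_pi[OF nz'] unfolding plus_complex.sel by linarith
    show "exp (Ln (z + c)) = exp (Ln z + Ln (1 + c / z))"
      using nz nz' by (simp add: exp_add field_simps)
  qed
qed

lemma Ln_add_of_real:
  assumes "z \<notin> \<real>\<^sub>\<le>\<^sub>0" "x \<ge> 0"
  shows "Ln (z + of_real x) = Ln z + Ln (1 + of_real x / z)"
proof (rule Ln_add_same_half_plane)
  show "Im z > 0 \<and> Im (z + of_real x) > 0 \<or> Im z < 0 \<and> Im (z + of_real x) < 0 \<or>
        Im z = 0 \<and> Re z > 0 \<and> Im (z + of_real x) = 0 \<and> Re (z + of_real x) > 0"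
    using assms by (auto simp: complex_nonpos_Reals_iff)
qed

lemma add_notin_nonpos_Reals:
  fixes z :: complex
  assumes "z \<notin> \<real>\<^sub>\<le>\<^sub>0" "x \<ge> 0"
  shows "z + of_real x \<notin> \<real>\<^sub>\<le>\<^sub>0"
  using assms by (auto simp: complex_nonpos_Reals_iff)

text \<open>Interpolation at 1, 2, 3 expresses the three coefficients as fixed linear combinations
  of three values, so they converge with the values. This identifies the limit of quadratics that
  are assembled from divergent sums.\<close>

lemma quadratic_pointwise_limit:
  fixes A B C :: "nat \<Rightarrow> complex"
  assumes lim: "\<And>z. z \<notin> \<real>\<^sub>\<le>\<^sub>0 \<Longrightarrow> (\<lambda>n. A n + B n * z + C n * z\<^sup>2) \<longlonglongrightarrow> g z"
  shows "\<exists>a b c. \<forall>z. z \<notin> \<real>\<^sub>\<le>\<^sub>0 \<longrightarrow> g z = a + b * z + c * z\<^sup>2"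
proof -
  have p: "(1::complex) \<notin> \<real>\<^sub>\<le>\<^sub>0" "(2::complex) \<notin> \<real>\<^sub>\<le>\<^sub>0" "(3::complex) \<notin> \<real>\<^sub>\<le>\<^sub>0"
    by (auto simp: complex_nonpos_Reals_iff)
  note l = lim[OF p(1)] lim[OF p(2)] lim[OF p(3)]
  have "(\<lambda>n. 3 * (A n + B n * 1 + C n * 1\<^sup>2) - 3 * (A n + B n * 2 + C n * 2\<^sup>2) + (A n + B n * 3 + C n * 3\<^sup>2))
      \<longlonglongrightarrow> 3 * g 1 - 3 * g 2 + g 3"
    by (intro tendsto_intros l)
  then have a: "A \<longlonglongrightarrow> 3 * g 1 - 3 * g 2 + g 3" by (simp add: algebra_simps)
  have "(\<lambda>n. (- 5 * (A n + B n * 1 + C n * 1\<^sup>2) + 8 * (A n + B n * 2 + C n * 2\<^sup>2) - 3 * (A n + B n * 3 + C n * 3\<^sup>2)) / 2)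
      \<longlonglongrightarrow> (- 5 * g 1 + 8 * g 2 - 3 * g 3) / 2"
    by (intro tendsto_intros l) auto
  then have b: "B \<longlonglongrightarrow> (- 5 * g 1 + 8 * g 2 - 3 * g 3) / 2" by (simp add: algebra_simps)
  have "(\<lambda>n. ((A n + B n * 1 + C n * 1\<^sup>2) - 2 * (A n + B n * 2 + C n * 2\<^sup>2) + (A n + B n * 3 + C n * 3\<^sup>2)) / 2)
      \<longlonglongrightarrow> (g 1 - 2 * g 2 + g 3) / 2"
    by (intro tendsto_intros l) auto
  then have c: "C \<longlonglongrightarrow> (g 1 - 2 * g 2 + g 3) / 2" by (simp add: algebra_simps)
  have "g z = (3 * g 1 - 3 * g 2 + g 3) + (- 5 * g 1 + 8 * g 2 - 3 * g 3) / 2 * z + (g 1 - 2 * g 2 + g 3) / 2 * z\<^sup>2"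
    if "z \<notin> \<real>\<^sub>\<le>\<^sub>0" for z
    by (rule LIMSEQ_unique[OF lim[OF that]]) (intro tendsto_intros a b c)
  then show ?thesis by blast
qed

section \<open>The elementary function with mixed second difference close to the logarithm\<close>

definition Phi_coeff1 :: "real \<Rightarrow> complex" where "Phi_coeff1 \<tau> = - (1 + of_real \<tau>) / (2 * of_real \<tau>)"
text \<open>Together with the leading coefficient 1 / (2 \<tau>) and
  \<open>Phi_coeff1 \<tau>\<close>, this makes \<open>Phi0 \<tau>\<close> one half of the double
  Bernoulli polynomial \<open>B_{2,2}(z | 1, \<tau>)\<close>.\<close>

definition Phi_coeff0 :: "real \<Rightarrow> complex" where "Phi_coeff0 \<tau> = of_real \<tau> / 12 + 1 / 4 + 1 / (12 * of_real \<tau>)"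

text \<open>\<open>Phi\<close> is the truncation of the Euler--Maclaurin expansion of the double sum of logarithms; the
  coefficients are those for which \<open>Phi_err\<close> is of order \<open>\<bar>z\<bar> powr (- 3)\<close>.\<close>

definition Phi0 :: "real \<Rightarrow> complex \<Rightarrow> complex" where
  "Phi0 \<tau> z = z\<^sup>2 / (2 * of_real \<tau>) + Phi_coeff1 \<tau> * z + Phi_coeff0 \<tau>"

definition Phi :: "real \<Rightarrow> complex \<Rightarrow> complex" where
  "Phi \<tau> z = Phi0 \<tau> z * Ln z - 3 / (4 * of_real \<tau>) * z\<^sup>2 - Phi_coeff1 \<tau> * z"

definition Phi_err :: "real \<Rightarrow> complex \<Rightarrow> complex" where
  "Phi_err \<tau> z = Phi \<tau> z - Phi \<tau> (z + 1) - Phi \<tau> (z + of_real \<tau>) + Phi \<tau> (z + of_real (1 + \<tau>)) - Ln z"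

text \<open>The Taylor polynomial of Ln (1 + x) of degree 4. The remainder has order 5 in 1 / z;
  multiplied by the quadratic \<open>Phi0\<close> it has order 3, which is summable over the
  lattice.\<close>

abbreviation Lpoly :: "complex \<Rightarrow> complex" where
  "Lpoly x \<equiv> x - x\<^sup>2 / 2 + x ^ 3 / 3 - x ^ 4 / 4"

text \<open>In the expansion in powers of z the terms of order 1 are linear in c and cancel, those
  of order 0 leave 3/2, and those of orders -1 and -2 vanish by the choice of \<open>a1\<close> and
  \<open>a0\<close>. Only orders -3 and -4 remain.\<close>

lemma Phi_polynomial_part:
  fixes z t a1 a0 :: complex
  assumes "z \<noteq> 0" "t \<noteq> 0"
  defines "a1 \<equiv> - (1 + t) / (2 * t)" and "a0 \<equiv> t / 12 + 1 / 4 + 1 / (12 * t)"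
  defines "P \<equiv> \<lambda>w. w\<^sup>2 / (2 * t) + a1 * w + a0"
  defines "q0 \<equiv> \<lambda>c. P c * c ^ 3 / 3 - (c / t + a1) * c ^ 4 / 4" and "q1 \<equiv> \<lambda>c. - P c * c ^ 4 / 4"
  shows "- P (z + 1) * Lpoly (1 / z) - P (z + t) * Lpoly (t / z) + P (z + (1 + t)) * Lpoly ((1 + t) / z) - 3 / 2
     = (q0 (1 + t) - q0 1 - q0 t) / z ^ 3 + (q1 (1 + t) - q1 1 - q1 t) / z ^ 4"
proof -
  \<comment> \<open>With \<open>T\<close> for 1 / t, and below \<open>y\<close> for 1 / z, the
    claims become polynomial identities modulo T t = 1 and z y = 1.\<close>
  define T where "T = inverse t"
  have tT: "T * t = 1" "T * (t * w) = w" for w using assms(2) by (simp_all add: T_def)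
  have dt: "w / t = w * T" "w / (2 * t) = w * T / 2" "w / (4 * t) = w * T / 4" "w / (6 * t) = w * T / 6"
      "w / (8 * t) = w * T / 8" "w / (12 * t) = w * T / 12" for w
    by (simp_all only: T_def divide_inverse inverse_mult_distrib mult_ac)
  note expand = eval_nat_numeral algebra_simps add_divide_distrib diff_divide_distrib tT
  have exp1: "P (z + c) * Lpoly (c / z) = c * z / (2 * t) + (c * (c / t + a1) - c\<^sup>2 / (4 * t))
     + (c * P c - c\<^sup>2 * (c / t + a1) / 2 + c ^ 3 / (6 * t)) / z
     + (c ^ 3 * (c / t + a1) / 3 - c\<^sup>2 * P c / 2 - c ^ 4 / (8 * t)) / z\<^sup>2
     + q0 c / z ^ 3 + q1 c / z ^ 4" for c
  proof -
    have P: "P (z + c) = z\<^sup>2 / (2 * t) + (c / t + a1) * z + P c"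
      using assms(2) by (simp add: P_def field_simps power2_eq_square)
    define y where "y = inverse z"
    have zy: "z * y = 1" using assms(1) by (simp add: y_def)
    have gen: "(A * z\<^sup>2 + B * z + p) * (c * y - (c * y)\<^sup>2 / 2 + (c * y) ^ 3 / 3 - (c * y) ^ 4 / 4)
       = A * c * z + (c * B - A * c\<^sup>2 / 2) + (c * p - c\<^sup>2 * B / 2 + A * c ^ 3 / 3) * y
         + (c ^ 3 * B / 3 - c\<^sup>2 * p / 2 - A * c ^ 4 / 4) * y ^ 2
         + (p * c ^ 3 / 3 - B * c ^ 4 / 4) * y ^ 3 + (- p * c ^ 4 / 4) * y ^ 4" for A B p
    proof -
      have *: "y * z = 1" "y * (z * w) = w" for w using zy by (simp_all add: algebra_simps)
      show ?thesis by (simp add: eval_nat_numeral algebra_simps add_divide_distrib *)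
    qed
    have "P (z + c) * Lpoly (c / z) = (T / 2 * z\<^sup>2 + (c * T + a1) * z + P c)
        * (c * y - (c * y)\<^sup>2 / 2 + (c * y) ^ 3 / 3 - (c * y) ^ 4 / 4)"
      unfolding P y_def T_def by (simp add: field_simps)
    moreover have dz: "w / z = w * y" "w / z ^ k = w * y ^ k" for w k
      by (simp_all only: y_def divide_inverse power_inverse)
    ultimately show ?thesis unfolding gen q0_def q1_def dt dz
      by (simp add: algebra_simps add_divide_distrib diff_divide_distrib)
  qed
  have i0: "(1 + t) * ((1 + t) / t + a1) - (1 + t)\<^sup>2 / (4 * t) - (1 * (1 / t + a1) - 1\<^sup>2 / (4 * t))
      - (t * (t / t + a1) - t\<^sup>2 / (4 * t)) = 3 / 2"
    unfolding a1_def dt by (simp add: expand)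
  \<comment> \<open>This coefficient is the value of c^3 / (6 t) + a1 c^2 / 2 + a0 c at 1 + t minus
    its values at 1 and t, that is (1 + t) / 2 + a1 t. Its vanishing determines
    \<open>a1\<close>.\<close>
  have i1: "(1 + t) * P (1 + t) - (1 + t)\<^sup>2 * ((1 + t) / t + a1) / 2 + (1 + t) ^ 3 / (6 * t)
     - (1 * P 1 - 1\<^sup>2 * (1 / t + a1) / 2 + 1 ^ 3 / (6 * t)) - (t * P t - t\<^sup>2 * (t / t + a1) / 2 + t ^ 3 / (6 * t)) = 0"
    unfolding a1_def a0_def P_def dt by (simp add: expand)
  \<comment> \<open>The same combination of values, now of - c^4 / (24 t) - a1 c^3 / 6 - a0 c^2 / 2.
    Its vanishing determines \<open>a0\<close>.\<close>
  have i2: "(1 + t) ^ 3 * ((1 + t) / t + a1) / 3 - (1 + t)\<^sup>2 * P (1 + t) / 2 - (1 + t) ^ 4 / (8 * t)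
     - (1 ^ 3 * (1 / t + a1) / 3 - 1\<^sup>2 * P 1 / 2 - 1 ^ 4 / (8 * t))
     - (t ^ 3 * (t / t + a1) / 3 - t\<^sup>2 * P t / 2 - t ^ 4 / (8 * t)) = 0"
    unfolding a1_def a0_def P_def dt by (simp add: expand)
  have alg: "- (u1 + v1 + w1 + x1 + y1 + z1) - (u2 + v2 + w2 + x2 + y2 + z2) + (u3 + v3 + w3 + x3 + y3 + z3) - k
     = (u3 - u1 - u2) + (v3 - v1 - v2 - k) + (w3 - w1 - w2) + (x3 - x1 - x2) + (y3 - y1 - y2) + (z3 - z1 - z2)"
    for u1 v1 w1 x1 y1 z1 u2 v2 w2 x2 y2 z2 u3 v3 w3 x3 y3 z3 k :: complex
    by simp
  have "- P (z + 1) * Lpoly (1 / z) - P (z + t) * Lpoly (t / z) + P (z + (1 + t)) * Lpoly ((1 + t) / z) - 3 / 2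
     = ((1 + t) * z / (2 * t) - 1 * z / (2 * t) - t * z / (2 * t))
     + ((1 + t) * ((1 + t) / t + a1) - (1 + t)\<^sup>2 / (4 * t) - (1 * (1 / t + a1) - 1\<^sup>2 / (4 * t))
      - (t * (t / t + a1) - t\<^sup>2 / (4 * t)) - 3 / 2)
     + ((1 + t) * P (1 + t) - (1 + t)\<^sup>2 * ((1 + t) / t + a1) / 2 + (1 + t) ^ 3 / (6 * t)
     - (1 * P 1 - 1\<^sup>2 * (1 / t + a1) / 2 + 1 ^ 3 / (6 * t)) - (t * P t - t\<^sup>2 * (t / t + a1) / 2 + t ^ 3 / (6 * t))) / z
     + ((1 + t) ^ 3 * ((1 + t) / t + a1) / 3 - (1 + t)\<^sup>2 * P (1 + t) / 2 - (1 + t) ^ 4 / (8 * t)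
     - (1 ^ 3 * (1 / t + a1) / 3 - 1\<^sup>2 * P 1 / 2 - 1 ^ 4 / (8 * t))
     - (t ^ 3 * (t / t + a1) / 3 - t\<^sup>2 * P t / 2 - t ^ 4 / (8 * t))) / z\<^sup>2
     + (q0 (1 + t) - q0 1 - q0 t) / z ^ 3 + (q1 (1 + t) - q1 1 - q1 t) / z ^ 4"
    unfolding mult_minus_left exp1 alg diff_divide_distrib[symmetric] ..
  then show ?thesis unfolding i0 i1 i2 by (simp flip: diff_divide_distrib) (simp add: algebra_simps)
qed

text \<open>Each shifted logarithm is \<open>Ln z\<close> plus a Taylor polynomial plus a remainder
  \<open>E\<close> of order -5. The Taylor polynomials are settled by
  \<open>Phi_polynomial_part\<close>, and each remainder is multiplied by a quadratic, which leaves
  order -3.\<close>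

lemma Phi_err_bound:
  assumes t: "\<tau> > 0"
  obtains R C where "R > 0" "C \<ge> 0"
    "\<And>z::complex. z \<notin> \<real>\<^sub>\<le>\<^sub>0 \<Longrightarrow> norm z \<ge> R \<Longrightarrow> norm (Phi_err \<tau> z) \<le> C / norm z ^ 3"
proof -
  define P where "P = Phi0 \<tau>"
  define q0 where "q0 = (\<lambda>c. P c * c ^ 3 / 3 - (c / of_real \<tau> + Phi_coeff1 \<tau>) * c ^ 4 / 4)"
  define q1 where "q1 = (\<lambda>c. - P c * c ^ 4 / 4)"
  define t where "t = complex_of_real \<tau>"
  have tn: "t \<noteq> 0" using assms by (simp add: t_def)
  define Q0 where "Q0 = q0 (1 + t) - q0 1 - q0 t"
  define Q1 where "Q1 = q1 (1 + t) - q1 1 - q1 t"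
  \<comment> \<open>For |z| at least \<open>M\<close> the quotients of 1, \<tau> and 1 + \<tau> by z
    are all at most 1/2 in modulus.\<close>
  define M where "M = 2 * (1 + \<tau>)"
  define E where "E = (\<lambda>(c::real) (z::complex). Ln (1 + of_real c / z) - Lpoly (of_real c / z))"
  define D where "D = 1 / \<tau> + norm (Phi_coeff1 \<tau>) + norm (Phi_coeff0 \<tau>)"
  define C where "C = norm Q0 + norm Q1 + 3 * (D * 4 * (2 * M ^ 5))"
  have M: "M \<ge> 2" using assms by (simp add: M_def)
  have D: "D \<ge> 0" using assms by (simp add: D_def)
  show ?thesis
  proof (rule that[of M C])
    show "M > 0" using M by simp
    show "C \<ge> 0" unfolding C_def using D M by (intro add_nonneg_nonneg mult_nonneg_nonneg) auto
    fix z :: complex assume z: "z \<notin> \<real>\<^sub>\<le>\<^sub>0" "norm z \<ge> M"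
    have nz: "z \<noteq> 0" using z by auto
    have n1: "norm z \<ge> 1" using z M by linarith
    have Eb: "norm (P (z + of_real c) * E c z) \<le> D * 4 * (2 * M ^ 5) / norm z ^ 3"
      if c: "0 \<le> c" "c \<le> 1 + \<tau>" for c
    proof -
      let ?u = "of_real c / z"
      have "norm ?u \<le> 1/2" using c z(2) nz by (simp add: norm_divide divide_simps M_def)
      then have "norm (Ln (1 + ?u) + (\<Sum>k<5. (- ?u) ^ k / of_nat k)) \<le> 2 * norm ?u ^ 5"
        by (intro norm_Ln_one_plus_remainder) auto
      also have "Ln (1 + ?u) + (\<Sum>k<5. (- ?u) ^ k / of_nat k) = E c z"
        by (simp add: E_def eval_nat_numeral)
      also have "2 * norm ?u ^ 5 \<le> 2 * (M / norm z) ^ 5"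
        using c nz assms by (intro mult_left_mono power_mono) (auto simp: norm_divide M_def divide_right_mono)
      finally have e: "norm (E c z) \<le> 2 * M ^ 5 / norm z ^ 5" by (simp add: power_divide)
      have w: "norm (z + of_real c) \<le> 2 * norm z"
        using norm_triangle_ineq[of z "of_real c"] c z(2) M unfolding M_def by simp
      let ?w = "z + of_real c"
      have "norm (P ?w) \<le> norm (?w\<^sup>2 / (2 * of_real \<tau>)) + norm (Phi_coeff1 \<tau> * ?w) + norm (Phi_coeff0 \<tau>)"
        unfolding P_def Phi0_def by (intro order_trans[OF norm_triangle_ineq] add_mono order_refl norm_triangle_ineq)
      also have "\<dots> = norm ?w ^ 2 / (2 * \<tau>) + norm (Phi_coeff1 \<tau>) * norm ?w + norm (Phi_coeff0 \<tau>)"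
        using assms by (simp add: norm_divide norm_mult norm_power)
      also have "\<dots> \<le> (2 * norm z)\<^sup>2 / (2 * \<tau>) + norm (Phi_coeff1 \<tau>) * (2 * norm z) + norm (Phi_coeff0 \<tau>) * 1"
        using w assms by (intro add_mono divide_right_mono power_mono mult_left_mono) auto
      also have "\<dots> \<le> (1 / \<tau>) * (4 * norm z ^ 2) + norm (Phi_coeff1 \<tau>) * (4 * norm z ^ 2) + norm (Phi_coeff0 \<tau>) * (4 * norm z ^ 2)"
      proof (intro add_mono mult_left_mono)
        show "(2 * norm z)\<^sup>2 / (2 * \<tau>) \<le> 1 / \<tau> * (4 * (norm z)\<^sup>2)"
          using assms by (simp add: power_mult_distrib divide_simps)
        have "norm z * 1 \<le> norm z * norm z" using n1 by (intro mult_left_mono) auto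
        then show "2 * norm z \<le> 4 * (norm z)\<^sup>2" using n1 by (simp add: power2_eq_square)
        show "1 \<le> 4 * (norm z)\<^sup>2" using one_le_power[OF n1, of 2] by linarith
      qed auto
      also have "\<dots> = D * 4 * norm z ^ 2" by (simp add: D_def algebra_simps)
      finally have p: "norm (P ?w) \<le> D * 4 * norm z ^ 2" .
      have "norm (P ?w * E c z) \<le> (D * 4 * norm z ^ 2) * (2 * M ^ 5 / norm z ^ 5)"
        unfolding norm_mult using p e by (intro mult_mono) (use D in auto)
      also have "\<dots> = D * 4 * (2 * M ^ 5) / norm z ^ 3"
        using nz by (simp add: field_simps eval_nat_numeral)
      finally show ?thesis .
    qed
    have L: "Ln (z + of_real c) = Ln z + Lpoly (of_real c / z) + E c z" if "c \<ge> 0" for c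
      using Ln_add_of_real[OF z(1) that] by (simp add: E_def)
    \<comment> \<open>The leading coefficient 1 / (2 \<tau>) is chosen for this: exactly one
      \<open>Ln z\<close> survives and is cancelled by the last term of
      \<open>Phi_err\<close>.\<close>
    have dd: "P z - P (z + 1) - P (z + t) + P (z + (1 + t)) = 1"
      using assms by (simp add: P_def Phi0_def t_def field_simps power2_eq_square)
    \<comment> \<open>The coefficient 3 / (4 \<tau>) of z^2 in \<open>Phi\<close> turns this into
      3/2, the constant that \<open>Phi_polynomial_part\<close> leaves over.\<close>
    have quad: "(z\<^sup>2 - (z + 1)\<^sup>2 - (z + t)\<^sup>2 + (z + (1 + t))\<^sup>2) = 2 * t"
      by (simp add: algebra_simps power2_eq_square)
    have L1: "Ln (z + 1) = Ln z + Lpoly (1 / z) + E 1 z"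
      and L2: "Ln (z + t) = Ln z + Lpoly (t / z) + E \<tau> z"
      and L3: "Ln (z + (1 + t)) = Ln z + Lpoly ((1 + t) / z) + E (1 + \<tau>) z"
      using L[of 1] L[of \<tau>] L[of "1 + \<tau>"] assms by (simp_all add: t_def)
    have alg: "p * l - k * z2 - a * z - (p1 * (l + l1 + e1) - k * z21 - a * (z + 1)) - (p2 * (l + l2 + e2) - k * z22 - a * (z + t))
          + (p3 * (l + l3 + e3) - k * z23 - a * (z + (1 + t))) - l
        = (p - p1 - p2 + p3) * l - l - k * (z2 - z21 - z22 + z23) + (- p1 * l1 - p2 * l2 + p3 * l3)
          + (- p1 * e1 - p2 * e2 + p3 * e3)" for p p1 p2 p3 l l1 l2 l3 e1 e2 e3 k a z2 z21 z22 z23 z t :: complex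
      by (simp add: algebra_simps)
    have "Phi_err \<tau> z = (P z - P (z + 1) - P (z + t) + P (z + (1 + t))) * Ln z - Ln z
        - 3 / (4 * t) * (z\<^sup>2 - (z + 1)\<^sup>2 - (z + t)\<^sup>2 + (z + (1 + t))\<^sup>2)
        + (- P (z + 1) * Lpoly (1 / z) - P (z + t) * Lpoly (t / z) + P (z + (1 + t)) * Lpoly ((1 + t) / z))
        + (- P (z + 1) * E 1 z - P (z + t) * E \<tau> z + P (z + (1 + t)) * E (1 + \<tau>) z)"
      unfolding Phi_err_def Phi_def P_def[symmetric] of_real_add of_real_1 t_def[symmetric] L1 L2 L3 by (rule alg)
    also have "\<dots> = (- P (z + 1) * Lpoly (1 / z) - P (z + t) * Lpoly (t / z) + P (z + (1 + t)) * Lpoly ((1 + t) / z) - 3 / 2)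
        + (- P (z + 1) * E 1 z - P (z + t) * E \<tau> z + P (z + (1 + t)) * E (1 + \<tau>) z)"
      unfolding dd quad using tn by simp
    also have "(- P (z + 1) * Lpoly (1 / z) - P (z + t) * Lpoly (t / z) + P (z + (1 + t)) * Lpoly ((1 + t) / z) - 3 / 2)
        = Q0 / z ^ 3 + Q1 / z ^ 4"
      using Phi_polynomial_part[OF nz tn]
      unfolding Q0_def Q1_def q0_def q1_def P_def Phi0_def Phi_coeff1_def Phi_coeff0_def t_def .
    finally have "norm (Phi_err \<tau> z) \<le> norm (Q0 / z ^ 3) + norm (Q1 / z ^ 4) +
        (norm (P (z + 1) * E 1 z) + norm (P (z + t) * E \<tau> z) + norm (P (z + (1 + t)) * E (1 + \<tau>) z))"
      by (smt (verit, best) norm_triangle_ineq norm_triangle_ineq4 norm_minus_cancel mult_minus_left)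
    also have "\<dots> \<le> norm Q0 / norm z ^ 3 + norm Q1 / norm z ^ 3 +
        (D * 4 * (2 * M ^ 5) / norm z ^ 3 + D * 4 * (2 * M ^ 5) / norm z ^ 3 + D * 4 * (2 * M ^ 5) / norm z ^ 3)"
    proof (intro add_mono)
      show "norm (Q1 / z ^ 4) \<le> norm Q1 / norm z ^ 3"
        using n1 nz by (auto simp: norm_divide norm_power intro!: divide_left_mono power_increasing)
      show "norm (P (z + 1) * E 1 z) \<le> D * 4 * (2 * M ^ 5) / norm z ^ 3"
        using Eb[of 1] assms by simp
      show "norm (P (z + t) * E \<tau> z) \<le> D * 4 * (2 * M ^ 5) / norm z ^ 3"
        using Eb[of \<tau>] assms by (simp add: t_def)
      show "norm (P (z + (1 + t)) * E (1 + \<tau>) z) \<le> D * 4 * (2 * M ^ 5) / norm z ^ 3"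
        using Eb[of "1 + \<tau>"] assms by (simp add: t_def)
    qed (simp add: norm_divide norm_power)
    also have "\<dots> = C / norm z ^ 3" by (simp add: C_def add_divide_distrib)
    finally show "norm (Phi_err \<tau> z) \<le> C / norm z ^ 3" .
  qed
qed

section \<open>Telescoping over square boxes and the limit of the far corners\<close>

lemma sum_Phi_box:
  fixes z :: complex
  shows "(\<Sum>kl\<in>{..<K} \<times> {..<K}. Phi \<tau> (z + of_real (lat \<tau> kl)) - Phi \<tau> (z + of_real (lat \<tau> kl) + 1)
      - Phi \<tau> (z + of_real (lat \<tau> kl) + of_real \<tau>) + Phi \<tau> (z + of_real (lat \<tau> kl) + of_real (1 + \<tau>)))
    = Phi \<tau> z - Phi \<tau> (of_real (real K) + z) - Phi \<tau> (of_real (real K * \<tau>) + z)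
      + Phi \<tau> (of_real (real K * \<tau> + real K) + z)"
proof -
  define f where "f = (\<lambda>k l. Phi \<tau> (z + of_real (lat \<tau> (k, l))))"
  have shift: "Phi \<tau> (z + of_real (lat \<tau> (k, l)) + 1) = f k (Suc l)"
     "Phi \<tau> (z + of_real (lat \<tau> (k, l)) + of_real \<tau>) = f (Suc k) l"
     "Phi \<tau> (z + of_real (lat \<tau> (k, l)) + of_real (1 + \<tau>)) = f (Suc k) (Suc l)"
     "Phi \<tau> (z + of_real (lat \<tau> (k, l))) = f k l" for k l
    unfolding f_def lat_def by (simp_all add: algebra_simps)
  have "(\<Sum>kl\<in>{..<K} \<times> {..<K}. Phi \<tau> (z + of_real (lat \<tau> kl)) - Phi \<tau> (z + of_real (lat \<tau> kl) + 1)
      - Phi \<tau> (z + of_real (lat \<tau> kl) + of_real \<tau>) + Phi \<tau> (z + of_real (lat \<tau> kl) + of_real (1 + \<tau>)))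
      = (\<Sum>(k, l)\<in>{..<K} \<times> {..<K}. f k l - f k (Suc l) - f (Suc k) l + f (Suc k) (Suc l))"
    by (intro sum.cong refl) (auto simp only: shift split: prod.splits)
  also have "\<dots> = (\<Sum>k<K. \<Sum>l<K. (f k l - f (Suc k) l) - (f k (Suc l) - f (Suc k) (Suc l)))"
    by (simp add: sum.cartesian_product [symmetric] algebra_simps)
  also have "\<dots> = (\<Sum>k<K. (f k 0 - f k K) - (f (Suc k) 0 - f (Suc k) K))"
    by (intro sum.cong refl, subst sum_lessThan_telescope') (simp add: algebra_simps)
  also have "\<dots> = (f 0 0 - f 0 K) - (f K 0 - f K K)"
    by (subst sum_lessThan_telescope') simp
  finally show ?thesis by (simp add: f_def lat_def algebra_simps)
qed

text \<open>The coefficients of the quadratic polynomial in z that approximates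
  \<open>Phi \<tau> (x + z)\<close> up to o(1) for large x. They come from Ln (x + z) = ln x + z / x
  - z^2 / (2 x^2) + ... by dropping all that tends to 0.\<close>

definition Phi_quad :: "real \<Rightarrow> real \<Rightarrow> complex \<times> complex \<times> complex" where
  "Phi_quad \<tau> x =
     (Phi0 \<tau> (of_real x) * of_real (ln x) - 3 / (4 * of_real \<tau>) * (of_real x)\<^sup>2 - Phi_coeff1 \<tau> * of_real x,
      (of_real x / of_real \<tau> + Phi_coeff1 \<tau>) * of_real (ln x) - of_real x / of_real \<tau>,
      of_real (ln x) / (2 * of_real \<tau>))"

text \<open>Three terms of the logarithm suffice: the remainder \<open>E\<close> has order -3 in x
  against the quadratic growth of \<open>Phi0\<close>, and the other terms outside the quadratic,
  collected in \<open>rest\<close>, carry a negative power of x.\<close>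

lemma Phi_shift_real_limit:
  fixes z :: complex
  assumes t: "\<tau> > 0" and X: "filterlim X at_top sequentially"
  shows "(\<lambda>n. Phi \<tau> (of_real (X n) + z) -
     (case Phi_quad \<tau> (X n) of (A, B, C) \<Rightarrow> A + B * z + C * z\<^sup>2)) \<longlonglongrightarrow> 0"
proof -
  define t where "t = complex_of_real \<tau>"
  have tn: "t \<noteq> 0" using assms by (simp add: t_def)
  define E where "E = (\<lambda>n. Ln (1 + z / of_real (X n)) - z / of_real (X n) + (z / of_real (X n))\<^sup>2 / 2)"
  define rest where "rest = (\<lambda>n. z ^ 3 / (2 * t) / of_real (X n) + Phi_coeff1 \<tau> * z\<^sup>2 / of_real (X n) + Phi_coeff0 \<tau> * z / of_real (X n)
     - z\<^sup>2 / 2 * (z / t / of_real (X n) + z\<^sup>2 / (2 * t) / (of_real (X n))\<^sup>2 + Phi_coeff1 \<tau> / of_real (X n)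
        + (Phi_coeff1 \<tau> * z + Phi_coeff0 \<tau>) / (of_real (X n))\<^sup>2))"
  have inv: "(\<lambda>n. c / complex_of_real (X n)) \<longlonglongrightarrow> 0" for c
  proof -
    have "(\<lambda>n. inverse (X n)) \<longlonglongrightarrow> 0" by (rule tendsto_inverse_0_at_top[OF X])
    then have "(\<lambda>n. c * complex_of_real (inverse (X n))) \<longlonglongrightarrow> c * of_real 0" by (intro tendsto_intros)
    then show ?thesis by (simp add: divide_inverse)
  qed
  have inv2: "(\<lambda>n. c / (complex_of_real (X n))\<^sup>2) \<longlonglongrightarrow> 0" for c
    using tendsto_mult[OF inv[of c] inv[of 1]] by (simp add: power2_eq_square)
  have "rest \<longlonglongrightarrow> 0 + 0 + 0 - z\<^sup>2 / 2 * (0 + 0 + 0 + 0)"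
    unfolding rest_def by (intro tendsto_intros inv inv2)
  then have l1: "rest \<longlonglongrightarrow> 0" by simp
  have ev: "eventually (\<lambda>n. X n > 2 * norm z + 1) sequentially"
    using X by (simp add: filterlim_at_top_dense)
  have l2: "(\<lambda>n. Phi0 \<tau> (of_real (X n) + z) * E n) \<longlonglongrightarrow> 0"
  proof (rule Lim_null_comparison)
    show "eventually (\<lambda>n. norm (Phi0 \<tau> (of_real (X n) + z) * E n) \<le>
        norm (Phi0 \<tau> (of_real (X n) + z) / (of_real (X n))\<^sup>2 * (2 * z ^ 3 / of_real (X n)))) sequentially"
      using ev
    proof eventually_elim
      case (elim n)
      have p: "X n > 0" using elim norm_ge_zero[of z] by linarith
      have "norm (z / of_real (X n)) \<le> 1/2" using elim p by (simp add: norm_divide)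
      then have "norm (Ln (1 + z / of_real (X n)) + (\<Sum>k<3. (- (z / of_real (X n))) ^ k / of_nat k)) \<le> 2 * norm (z / of_real (X n)) ^ 3"
        by (intro norm_Ln_one_plus_remainder) auto
      then have "norm (E n) \<le> 2 * norm (z / of_real (X n)) ^ 3"
        unfolding E_def by (simp add: eval_nat_numeral algebra_simps)
      then have "norm (E n) \<le> norm (2 * z ^ 3 / of_real (X n) / (of_real (X n))\<^sup>2)"
        using p by (simp add: norm_divide norm_mult norm_power power_divide eval_nat_numeral)
      then have "norm (Phi0 \<tau> (of_real (X n) + z)) * norm (E n) \<le>
          norm (Phi0 \<tau> (of_real (X n) + z)) * norm (2 * z ^ 3 / of_real (X n) / (of_real (X n))\<^sup>2)"
        by (rule mult_left_mono) simp
      then show ?case by (simp add: norm_mult norm_divide mult_ac)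
    qed
    have "(\<lambda>n. (1 / (2 * t) + (2 * z / (2 * t)) / of_real (X n) + (z\<^sup>2 / (2 * t)) / (of_real (X n))\<^sup>2 + Phi_coeff1 \<tau> / of_real (X n)
       + (Phi_coeff1 \<tau> * z + Phi_coeff0 \<tau>) / (of_real (X n))\<^sup>2) * (2 * z ^ 3 / of_real (X n))) \<longlonglongrightarrow>
       (1 / (2 * t) + 0 + 0 + 0 + 0) * 0"
      by (intro tendsto_mult tendsto_add tendsto_const inv inv2)
    also have "?this \<longleftrightarrow> (\<lambda>n. Phi0 \<tau> (of_real (X n) + z) / (of_real (X n))\<^sup>2 * (2 * z ^ 3 / of_real (X n))) \<longlonglongrightarrow> (1 / (2 * t) + 0 + 0 + 0 + 0) * 0"
    proof (intro filterlim_cong refl eventually_mono[OF ev])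
      fix n assume n: "X n > 2 * norm z + 1"
      have "X n \<noteq> 0" using n norm_ge_zero[of z] by linarith
      then have "Phi0 \<tau> (of_real (X n) + z) / (of_real (X n))\<^sup>2 = 1 / (2 * t) + (2 * z / (2 * t)) / of_real (X n) + (z\<^sup>2 / (2 * t)) / (of_real (X n))\<^sup>2 + Phi_coeff1 \<tau> / of_real (X n)
       + (Phi_coeff1 \<tau> * z + Phi_coeff0 \<tau>) / (of_real (X n))\<^sup>2"
        using tn unfolding Phi0_def t_def[symmetric] by (simp add: field_simps power2_eq_square)
      then show "(1 / (2 * t) + 2 * z / (2 * t) / of_real (X n) + z\<^sup>2 / (2 * t) / (of_real (X n))\<^sup>2 + Phi_coeff1 \<tau> / of_real (X n)
       + (Phi_coeff1 \<tau> * z + Phi_coeff0 \<tau>) / (of_real (X n))\<^sup>2) * (2 * z ^ 3 / of_real (X n)) = Phi0 \<tau> (of_real (X n) + z) / (of_real (X n))\<^sup>2 * (2 * z ^ 3 / of_real (X n))"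
        by simp
    qed
    finally have "(\<lambda>n. Phi0 \<tau> (of_real (X n) + z) / (of_real (X n))\<^sup>2 * (2 * z ^ 3 / of_real (X n))) \<longlonglongrightarrow> 0" by simp
    then show "(\<lambda>n. norm (Phi0 \<tau> (of_real (X n) + z) / (of_real (X n))\<^sup>2 * (2 * z ^ 3 / of_real (X n)))) \<longlonglongrightarrow> 0"
      by (rule tendsto_norm_zero)
  qed
  have "(\<lambda>n. Phi0 \<tau> (of_real (X n) + z) * E n + rest n) \<longlonglongrightarrow> 0"
    using tendsto_add[OF l2 l1] by simp
  moreover have "eventually (\<lambda>n. Phi0 \<tau> (of_real (X n) + z) * E n + rest n = Phi \<tau> (of_real (X n) + z) -
     (case Phi_quad \<tau> (X n) of (A, B, C) \<Rightarrow> A + B * z + C * z\<^sup>2)) sequentially"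
    using ev
  proof eventually_elim
    case (elim n)
    define x where "x = complex_of_real (X n)"
    have p: "X n > 0" using elim norm_ge_zero[of z] by linarith
    then have xn: "x \<noteq> 0" by (simp add: x_def)
    have "x + z = x * (1 + z / x)" using xn by (simp add: distrib_left)
    then have "Ln (x + z) = Ln (x * (1 + z / x))" by simp
    also have "\<dots> = of_real (ln (X n)) + Ln (1 + z / x)"
    proof -
      have "norm z < X n" using elim norm_ge_zero[of z] by linarith
      then have "norm (z / x) < 1" using p by (simp add: x_def norm_divide divide_less_eq)
      then have "1 + z / x \<noteq> 0" by (metis add.commute add_eq_0_iff norm_minus_cancel norm_one order_less_irrefl)
      then show ?thesis unfolding x_def using p by (simp add: Ln_times_of_real Ln_of_real)
    qed
    finally have L: "Ln (x + z) = of_real (ln (X n)) + (E n + z / x - (z / x)\<^sup>2 / 2)"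
      by (simp add: E_def x_def)
    have main: "(P2 * (x + z)\<^sup>2 + a1 * (x + z) + a0) * (l + (e + z / x - (z / x)\<^sup>2 / 2)) - 3 * P2 / 2 * (x + z)\<^sup>2 - a1 * (x + z)
       - ((P2 * x\<^sup>2 + a1 * x + a0) * l - 3 * P2 / 2 * x\<^sup>2 - a1 * x + ((2 * P2 * x + a1) * l - 2 * P2 * x) * z + P2 * l * z\<^sup>2)
       = (P2 * (x + z)\<^sup>2 + a1 * (x + z) + a0) * e
        + (P2 * z ^ 3 / x + a1 * z\<^sup>2 / x + a0 * z / x
           - z\<^sup>2 / 2 * (2 * P2 * z / x + P2 * z\<^sup>2 / x\<^sup>2 + a1 / x + (a1 * z + a0) / x\<^sup>2))"
      for P2 a1 a0 l e
    proof -
      define y where "y = inverse x"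
      have xy: "x * y = 1" "x * (y * w) = w" for w using xn by (simp_all add: y_def)
      have dz: "w / x = w * y" "w / x ^ k = w * y ^ k" for w k
        by (simp_all only: y_def divide_inverse power_inverse)
      show ?thesis unfolding dz
        by (simp add: eval_nat_numeral algebra_simps add_divide_distrib diff_divide_distrib xy)
    qed
    have "Phi \<tau> (x + z) - (case Phi_quad \<tau> (X n) of (A, B, C) \<Rightarrow> A + B * z + C * z\<^sup>2)
       = (1 / (2 * t) * (x + z)\<^sup>2 + Phi_coeff1 \<tau> * (x + z) + Phi_coeff0 \<tau>) * (of_real (ln (X n)) + (E n + z / x - (z / x)\<^sup>2 / 2)) - 3 * (1 / (2 * t)) / 2 * (x + z)\<^sup>2 - Phi_coeff1 \<tau> * (x + z)
       - ((1 / (2 * t) * x\<^sup>2 + Phi_coeff1 \<tau> * x + Phi_coeff0 \<tau>) * of_real (ln (X n)) - 3 * (1 / (2 * t)) / 2 * x\<^sup>2 - Phi_coeff1 \<tau> * x + ((2 * (1 / (2 * t)) * x + Phi_coeff1 \<tau>) * of_real (ln (X n)) - 2 * (1 / (2 * t)) * x) * z + 1 / (2 * t) * of_real (ln (X n)) * z\<^sup>2)"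
      unfolding Phi_def Phi_quad_def Phi0_def L x_def[symmetric] t_def[symmetric] by simp
    also have "\<dots> = Phi0 \<tau> (x + z) * E n + rest n"
      unfolding main unfolding Phi0_def rest_def x_def[symmetric] t_def[symmetric] by simp
    finally show ?case unfolding x_def by simp
  qed
  ultimately show ?thesis by (rule Lim_transform_eventually)
qed

lemma summable_Phi_err:
  fixes z :: complex
  assumes t: "\<tau> > 0" and z: "z \<notin> \<real>\<^sub>\<le>\<^sub>0"
  shows "(\<lambda>kl. Phi_err \<tau> (z + of_real (lat \<tau> kl))) summable_on UNIV"
proof -
  obtain R C where R: "R > 0" "C \<ge> 0"
    "\<And>z::complex. z \<notin> \<real>\<^sub>\<le>\<^sub>0 \<Longrightarrow> norm z \<ge> R \<Longrightarrow> norm (Phi_err \<tau> z) \<le> C / norm z ^ 3"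
    using Phi_err_bound[OF t] by metis
  \<comment> \<open>Off this finite set |z + lat| is at least R, so that the cubic bound applies,
    and at least (1 + lat) / 4, which produces the factor 64 = 4^3 in the majorant.\<close>
  let ?F = "{kl. lat \<tau> kl \<le> 2 * norm z + 2 * R + 1}"
  have "(\<lambda>kl. norm (Phi_err \<tau> (z + of_real (lat \<tau> kl)))) summable_on (UNIV - ?F)"
  proof (rule Infinite_Sum.abs_summable_on_comparison_test'[of "\<lambda>kl. C * 64 * (1 / (1 + lat \<tau> kl) ^ 3)"])
    show "(\<lambda>kl. C * 64 * (1 / (1 + lat \<tau> kl) ^ 3)) summable_on UNIV - ?F"
      by (intro summable_on_cmult_right summable_on_subset[OF summable_lat_cube[OF t]]) auto
    fix kl assume "kl \<in> UNIV - ?F"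
    then have l: "lat \<tau> kl > 2 * norm z + 2 * R + 1" by auto
    have l1: "lat \<tau> kl \<ge> 1" using l R norm_ge_zero[of z] by linarith
    have "norm (z + of_real (lat \<tau> kl)) \<ge> norm (of_real (lat \<tau> kl) :: complex) - norm z"
      using norm_diff_ineq[of "of_real (lat \<tau> kl)" z] by (simp add: add.commute)
    also have "norm (of_real (lat \<tau> kl) :: complex) = lat \<tau> kl" using l1 by simp
    finally have g0: "norm (z + of_real (lat \<tau> kl)) \<ge> lat \<tau> kl - norm z" .
    have g: "norm (z + of_real (lat \<tau> kl)) \<ge> R"
      using g0 l R(1) norm_ge_zero[of z] by linarith
    have h: "norm z \<le> lat \<tau> kl / 2" using l R(1) by linarith
    have "(1 + lat \<tau> kl) / 4 \<le> lat \<tau> kl / 2" using l1 by simp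
    also have "\<dots> \<le> lat \<tau> kl - norm z" using h by simp
    finally have g2: "norm (z + of_real (lat \<tau> kl)) \<ge> (1 + lat \<tau> kl) / 4"
      using g0 by (rule order_trans)
    have "norm (Phi_err \<tau> (z + of_real (lat \<tau> kl))) \<le> C / norm (z + of_real (lat \<tau> kl)) ^ 3"
      using R(3)[OF add_notin_nonpos_Reals[OF z lat_nonneg[OF t]] g] .
    also have "\<dots> \<le> C / ((1 + lat \<tau> kl) / 4) ^ 3"
    proof (rule divide_left_mono[OF _ R(2)])
      show "((1 + lat \<tau> kl) / 4) ^ 3 \<le> norm (z + of_real (lat \<tau> kl)) ^ 3"
        using g2 l1 by (intro power_mono) auto
      have "norm (z + of_real (lat \<tau> kl)) > 0" using g R(1) by linarith
      then show "0 < norm (z + of_real (lat \<tau> kl)) ^ 3 * ((1 + lat \<tau> kl) / 4) ^ 3" using l1 by auto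
    qed
    also have "\<dots> = C * 64 * (1 / (1 + lat \<tau> kl) ^ 3)" by (simp add: power_divide)
    finally show "norm (Phi_err \<tau> (z + of_real (lat \<tau> kl))) \<le> C * 64 * (1 / (1 + lat \<tau> kl) ^ 3)" .
  qed
  then have "(\<lambda>kl. Phi_err \<tau> (z + of_real (lat \<tau> kl))) summable_on (UNIV - ?F)"
    by (rule abs_summable_summable)
  moreover have "(\<lambda>kl. Phi_err \<tau> (z + of_real (lat \<tau> kl))) summable_on ?F"
    using finite_lat_le[OF t] by (intro summable_on_finite) auto
  ultimately have "(\<lambda>kl. Phi_err \<tau> (z + of_real (lat \<tau> kl))) summable_on ((UNIV - ?F) \<union> ?F)"
    by (intro summable_on_union)
  then show ?thesis by simp
qed

text \<open>The product and the sums are limits over all finite sets, whereas the telescoping needs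
  boxes. The boxes are cofinal, so the limits may be computed along them.\<close>

lemma box_at_top: "filterlim (\<lambda>K. {..<K} \<times> {..<K}) (finite_subsets_at_top (UNIV :: (nat \<times> nat) set)) sequentially"
  unfolding filterlim_finite_subsets_at_top
proof (intro allI impI)
  fix X :: "(nat \<times> nat) set" assume "finite X \<and> X \<subseteq> UNIV"
  then have f: "finite (fst ` X)" "finite (snd ` X)" by auto
  obtain N where N: "\<And>x. x \<in> X \<Longrightarrow> fst x < N \<and> snd x < N"
  proof (rule that[of "Suc (Max (insert 0 (fst ` X)) + Max (insert 0 (snd ` X)))"])
    fix x assume "x \<in> X"
    then have "fst x \<le> Max (insert 0 (fst ` X))" "snd x \<le> Max (insert 0 (snd ` X))"
      using f by (auto intro: Max_ge)
    then show "fst x < Suc (Max (insert 0 (fst ` X)) + Max (insert 0 (snd ` X))) \<and>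
      snd x < Suc (Max (insert 0 (fst ` X)) + Max (insert 0 (snd ` X)))" by linarith
  qed
  show "\<forall>\<^sub>F y in sequentially. finite ({..<y} \<times> {..<y}) \<and> X \<subseteq> {..<y} \<times> {..<y} \<and> {..<y} \<times> {..<y} \<subseteq> UNIV"
    using eventually_ge_at_top[of N]
  proof eventually_elim
    case (elim y)
    have "X \<subseteq> {..<y} \<times> {..<y}"
    proof
      fix x assume "x \<in> X"
      from N[OF this] elim show "x \<in> {..<y} \<times> {..<y}" by (cases x) auto
    qed
    then show ?case by auto
  qed
qed

lemma box_latI_at_top: "filterlim (\<lambda>K. {..<K} \<times> {..<K} - {(0, 0)}) (finite_subsets_at_top latI) sequentially"
  unfolding filterlim_finite_subsets_at_top
proof (intro allI impI)
  fix X :: "(nat \<times> nat) set" assume X: "finite X \<and> X \<subseteq> latI"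
  then have "eventually (\<lambda>K. finite ({..<K} \<times> {..<K}) \<and> X \<subseteq> {..<K} \<times> {..<K} \<and> {..<K} \<times> {..<K} \<subseteq> (UNIV :: (nat \<times> nat) set)) sequentially"
    using box_at_top unfolding filterlim_finite_subsets_at_top by blast
  then show "\<forall>\<^sub>F y in sequentially. finite ({..<y} \<times> {..<y} - {(0, 0)}) \<and> X \<subseteq> {..<y} \<times> {..<y} - {(0, 0)} \<and>
      {..<y} \<times> {..<y} - {(0, 0)} \<subseteq> latI"
    by eventually_elim (use X in auto)
qed

text \<open>On a box the Weierstrass logarithms are the numbers Ln (z + lat) up to a quadratic in z.
  Adding the sum of \<open>Phi_err\<close> makes the sum telescope to four corners, of which the
  three far ones are quadratic in z up to o(1). So the difference between the logarithm of the
  product and \<open>Phi\<close> minus the error sum is a pointwise limit of quadratics.\<close>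

lemma Barnes_G_exp_form:
  assumes t: "\<tau> > 0"
  obtains b0 b1 b2 where "\<And>z. z \<notin> \<real>\<^sub>\<le>\<^sub>0 \<Longrightarrow> Barnes_G (of_real \<tau>) z =
     exp (Phi0 \<tau> z * Ln z + b2 * z\<^sup>2 + b1 * z + b0 - (\<Sum>\<^sub>\<infinity>kl. Phi_err \<tau> (z + of_real (lat \<tau> kl))))"
proof -
  define S where "S = (\<lambda>z. \<Sum>\<^sub>\<infinity>kl\<in>latI. weierstrass_log (lat \<tau> kl) z)"
  define E where "E = (\<lambda>z. \<Sum>\<^sub>\<infinity>kl. Phi_err \<tau> (z + of_real (lat \<tau> kl)))"
  define box where "box = (\<lambda>K::nat. {..<K} \<times> {..<K})"
  define qA where "qA = (\<lambda>x. fst (Phi_quad \<tau> x))"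
  define qB where "qB = (\<lambda>x. fst (snd (Phi_quad \<tau> x)))"
  define qC where "qC = (\<lambda>x. snd (snd (Phi_quad \<tau> x)))"
  define q where "q = (\<lambda>x z. qA x + qB x * z + qC x * z\<^sup>2)"
  define wA where "wA = (\<lambda>K. \<Sum>kl\<in>box K - {(0,0)}. - complex_of_real (ln (lat \<tau> kl)))"
  define wB where "wB = (\<lambda>K. \<Sum>kl\<in>box K - {(0,0)}. - (1 / complex_of_real (lat \<tau> kl)))"
  define wC where "wC = (\<lambda>K. \<Sum>kl\<in>box K - {(0,0)}. 1 / (2 * (complex_of_real (lat \<tau> kl))\<^sup>2))"
  \<comment> \<open>Only the whole expression is shown to converge, for each z;
    \<open>quadratic_pointwise_limit\<close> then gives the shape of the limit.\<close>
  have lim: "(\<lambda>K. (wA K - qA (real K) - qA (real K * \<tau>) + qA (real K * \<tau> + real K))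
        + (wB K - qB (real K) - qB (real K * \<tau>) + qB (real K * \<tau> + real K)) * z
        + (wC K - qC (real K) - qC (real K * \<tau>) + qC (real K * \<tau> + real K)) * z\<^sup>2)
      \<longlonglongrightarrow> Ln z + S z + E z - Phi \<tau> z" if z: "z \<notin> \<real>\<^sub>\<le>\<^sub>0" for z
  proof -
    have X1: "filterlim (\<lambda>K::nat. real K) at_top sequentially" by (rule filterlim_real_sequentially)
    have X2: "filterlim (\<lambda>K. real K * \<tau>) at_top sequentially"
      using t X1 by (intro filterlim_at_top_mult_tendsto_pos[OF tendsto_const]) auto
    have X3: "filterlim (\<lambda>K. real K * \<tau> + real K) at_top sequentially"
      by (rule filterlim_at_top_add_at_top[OF X2 X1])
    have P: "(\<lambda>n. Phi \<tau> (of_real (X n) + z) - q (X n) z) \<longlonglongrightarrow> 0"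
      if "filterlim X at_top sequentially" for X
      using Phi_shift_real_limit[OF t that, of z] by (simp add: q_def qA_def qB_def qC_def case_prod_unfold add.assoc)
    have "((\<lambda>kl. weierstrass_log (lat \<tau> kl) z) has_sum S z) latI"
      unfolding S_def by (rule has_sum_infsum[OF summable_weierstrass_log[OF t]])
    then have l1: "(\<lambda>K. \<Sum>kl\<in>box K - {(0,0)}. weierstrass_log (lat \<tau> kl) z) \<longlonglongrightarrow> S z"
      unfolding has_sum_def box_def by (rule filterlim_compose[OF _ box_latI_at_top])
    have "((\<lambda>kl. Phi_err \<tau> (z + of_real (lat \<tau> kl))) has_sum E z) UNIV"
      unfolding E_def by (rule has_sum_infsum[OF summable_Phi_err[OF t z]])
    then have l2: "(\<lambda>K. \<Sum>kl\<in>box K. Phi_err \<tau> (z + of_real (lat \<tau> kl))) \<longlonglongrightarrow> E z"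
      unfolding has_sum_def box_def by (rule filterlim_compose[OF _ box_at_top])
    have l3: "(\<lambda>K. Ln z + (\<Sum>kl\<in>box K - {(0,0)}. weierstrass_log (lat \<tau> kl) z)
          + (\<Sum>kl\<in>box K. Phi_err \<tau> (z + of_real (lat \<tau> kl))) - Phi \<tau> z
          + (Phi \<tau> (of_real (real K) + z) - q (real K) z) + (Phi \<tau> (of_real (real K * \<tau>) + z) - q (real K * \<tau>) z)
          - (Phi \<tau> (of_real (real K * \<tau> + real K) + z) - q (real K * \<tau> + real K) z))
        \<longlonglongrightarrow> Ln z + S z + E z - Phi \<tau> z + 0 + 0 - 0"
      by (intro tendsto_intros l1 l2 P X1 X2 X3)
    have "eventually (\<lambda>K. Ln z + (\<Sum>kl\<in>box K - {(0,0)}. weierstrass_log (lat \<tau> kl) z)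
          + (\<Sum>kl\<in>box K. Phi_err \<tau> (z + of_real (lat \<tau> kl))) - Phi \<tau> z
          + (Phi \<tau> (of_real (real K) + z) - q (real K) z) + (Phi \<tau> (of_real (real K * \<tau>) + z) - q (real K * \<tau>) z)
          - (Phi \<tau> (of_real (real K * \<tau> + real K) + z) - q (real K * \<tau> + real K) z)
        = (wA K - qA (real K) - qA (real K * \<tau>) + qA (real K * \<tau> + real K))
        + (wB K - qB (real K) - qB (real K * \<tau>) + qB (real K * \<tau> + real K)) * z
        + (wC K - qC (real K) - qC (real K * \<tau>) + qC (real K * \<tau> + real K)) * z\<^sup>2) sequentially"
      using eventually_gt_at_top[of 0]
    proof eventually_elim
      case (elim K)
      have fin: "finite (box K)" "(0, 0) \<in> box K" using elim by (auto simp: box_def)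
      have "(\<Sum>kl\<in>box K - {(0,0)}. weierstrass_log (lat \<tau> kl) z) =
          (\<Sum>kl\<in>box K - {(0,0)}. Ln (z + of_real (lat \<tau> kl)) - of_real (ln (lat \<tau> kl)) - 1 / of_real (lat \<tau> kl) * z
             + 1 / (2 * (of_real (lat \<tau> kl))\<^sup>2) * z\<^sup>2)"
      proof (rule sum.cong[OF refl])
        fix kl assume "kl \<in> box K - {(0,0)}"
        then have p: "lat \<tau> kl > 0" using lat_pos[OF t] by auto
        have nz: "z + of_real (lat \<tau> kl) \<noteq> 0" using add_notin_nonpos_Reals[OF z, of "lat \<tau> kl"] p by auto
        have "1 + z / of_real (lat \<tau> kl) = (z + of_real (lat \<tau> kl)) / of_real (lat \<tau> kl)"
          using p by (simp add: field_simps)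
        then show "weierstrass_log (lat \<tau> kl) z = Ln (z + of_real (lat \<tau> kl)) - of_real (ln (lat \<tau> kl)) - 1 / of_real (lat \<tau> kl) * z
             + 1 / (2 * (of_real (lat \<tau> kl))\<^sup>2) * z\<^sup>2"
          unfolding weierstrass_log_def using Ln_divide_of_real[OF p nz] by simp
      qed
      also have "\<dots> = (\<Sum>kl\<in>box K - {(0,0)}. Ln (z + of_real (lat \<tau> kl))) + (wA K + wB K * z + wC K * z\<^sup>2)"
        by (simp add: wA_def wB_def wC_def sum.distrib sum_subtractf sum_negf sum_distrib_right)
      \<comment> \<open>\<open>Ln z\<close> is the term of the origin, which the product over
        \<open>latI\<close> omits and the prefactor z of \<open>Barnes_G\<close> restores.\<close>
      finally have W: "Ln z + (\<Sum>kl\<in>box K - {(0,0)}. weierstrass_log (lat \<tau> kl) z)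
          = (\<Sum>kl\<in>box K. Ln (z + of_real (lat \<tau> kl))) + (wA K + wB K * z + wC K * z\<^sup>2)"
        using fin by (simp add: sum.remove[of "box K" "(0,0)"] lat_def)
      have "(\<Sum>kl\<in>box K. Ln (z + of_real (lat \<tau> kl))) + (\<Sum>kl\<in>box K. Phi_err \<tau> (z + of_real (lat \<tau> kl)))
         = (\<Sum>kl\<in>box K. Phi \<tau> (z + of_real (lat \<tau> kl)) - Phi \<tau> (z + of_real (lat \<tau> kl) + 1)
          - Phi \<tau> (z + of_real (lat \<tau> kl) + of_real \<tau>) + Phi \<tau> (z + of_real (lat \<tau> kl) + of_real (1 + \<tau>)))"
        unfolding sum.distrib [symmetric] Phi_err_def by (intro sum.cong refl) simp
      also have "\<dots> = Phi \<tau> z - Phi \<tau> (of_real (real K) + z) - Phi \<tau> (of_real (real K * \<tau>) + z)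
          + Phi \<tau> (of_real (real K * \<tau> + real K) + z)"
        unfolding box_def by (rule sum_Phi_box)
      finally have T: "(\<Sum>kl\<in>box K. Phi_err \<tau> (z + of_real (lat \<tau> kl))) = Phi \<tau> z - Phi \<tau> (of_real (real K) + z) - Phi \<tau> (of_real (real K * \<tau>) + z)
          + Phi \<tau> (of_real (real K * \<tau> + real K) + z) - (\<Sum>kl\<in>box K. Ln (z + of_real (lat \<tau> kl)))"
        by (simp add: algebra_simps)
      show ?case unfolding W T q_def by (simp add: algebra_simps)
    qed
    from Lim_transform_eventually[OF l3 this] show ?thesis by simp
  qed
  obtain a b c where abc: "\<And>z. z \<notin> \<real>\<^sub>\<le>\<^sub>0 \<Longrightarrow> Ln z + S z + E z - Phi \<tau> z = a + b * z + c * z\<^sup>2"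
    using quadratic_pointwise_limit[OF lim] by blast
  define t where "t = complex_of_real \<tau>"
  have tn: "t \<noteq> 0" using assms by (simp add: t_def)
  show ?thesis
  \<comment> \<open>The witnesses collect the limiting quadratic, the polynomial terms subtracted in
    \<open>Phi\<close>, and the exponent of the prefactor with \<open>Barnes_a\<close> and
    \<open>Barnes_b\<close>; \<open>Ln t\<close> stems from the division by \<tau>.\<close>
  proof (rule that[of "c - 3 / (4 * t) + Barnes_b t / (2 * t\<^sup>2)" "b - Phi_coeff1 \<tau> + Barnes_a t / t" "a - Ln t"])
    fix z :: complex assume z: "z \<notin> \<real>\<^sub>\<le>\<^sub>0"
    have zn: "z \<noteq> 0" using z by auto
    have "lat_product \<tau> z = (\<Prod>kl\<in>{}. weierstrass_fac (lat \<tau> kl) z) * exp (\<Sum>\<^sub>\<infinity>kl\<in>latI - {}. weierstrass_log (lat \<tau> kl) z)"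
    proof (rule lat_product_factor[OF assms])
      fix kl assume "kl \<in> latI - {}"
      then have p: "lat \<tau> kl > 0" using lat_pos[OF assms] by auto
      then have "z + of_real (lat \<tau> kl) \<noteq> 0" using add_notin_nonpos_Reals[OF z, of "lat \<tau> kl"] by auto
      then show "1 + z / of_real (lat \<tau> kl) \<noteq> 0" using p by (simp add: field_simps add_eq_0_iff)
    qed auto
    then have "lat_product \<tau> z = exp (S z)" by (simp add: S_def)
    then have "Barnes_G t z = exp (Ln z - Ln t) * exp (Barnes_a t * (z / t) + Barnes_b t * (z\<^sup>2 / (2 * t\<^sup>2))) * exp (S z)"
      unfolding t_def Barnes_G_lat_product using zn tn by (simp add: exp_diff t_def)
    also have "\<dots> = exp ((Ln z + S z) - Ln t + (Barnes_a t * (z / t) + Barnes_b t * (z\<^sup>2 / (2 * t\<^sup>2))))"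
      by (simp add: exp_add [symmetric] algebra_simps)
    also have "Ln z + S z = Phi \<tau> z - E z + (a + b * z + c * z\<^sup>2)" using abc[OF z] by (simp add: algebra_simps)
    finally show "Barnes_G (of_real \<tau>) z = exp (Phi0 \<tau> z * Ln z + (c - 3 / (4 * t) + Barnes_b t / (2 * t\<^sup>2)) * z\<^sup>2
        + (b - Phi_coeff1 \<tau> + Barnes_a t / t) * z + (a - Ln t) - (\<Sum>\<^sub>\<infinity>kl. Phi_err \<tau> (z + of_real (lat \<tau> kl))))"
      unfolding Phi_def E_def t_def [symmetric] by (simp add: algebra_simps)
  qed
qed

text \<open>Adding a nonnegative lattice point does not change the imaginary part, so in the sector
  |z + lat| is at least \<kappa> |z|. Once |z| is at least 1, this gives 1 + lat <= (1 + 2 /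
  \<kappa>) |z + lat|. The cubic bound is therefore dominated by one summable family for all such
  z.\<close>

lemma Phi_err_sum_bound:
  assumes t: "\<tau> > 0" and k: "\<kappa> > 0"
  obtains R B where "R > 0" "B \<ge> 0" "\<And>z. norm z \<ge> R \<Longrightarrow> \<bar>Im z\<bar> \<ge> \<kappa> * norm z \<Longrightarrow>
     norm (\<Sum>\<^sub>\<infinity>kl. Phi_err \<tau> (z + of_real (lat \<tau> kl))) \<le> B"
proof -
  obtain R C where R: "R > 0" "C \<ge> 0"
    "\<And>z::complex. z \<notin> \<real>\<^sub>\<le>\<^sub>0 \<Longrightarrow> norm z \<ge> R \<Longrightarrow> norm (Phi_err \<tau> z) \<le> C / norm z ^ 3"
    using Phi_err_bound[OF t] by metis
  define c where "c = 1 + 2 / \<kappa>"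
  have c: "c > 0" using k by (simp add: c_def add_pos_pos)
  define B where "B = (\<Sum>\<^sub>\<infinity>kl. C * c ^ 3 * (1 / (1 + lat \<tau> kl) ^ 3))"
  have sB: "(\<lambda>kl. C * c ^ 3 * (1 / (1 + lat \<tau> kl) ^ 3)) summable_on UNIV"
    by (intro summable_on_cmult_right summable_lat_cube[OF t])
  show ?thesis
  proof (rule that[of "R / \<kappa> + 1" B])
    show "R / \<kappa> + 1 > 0" using R k by (simp add: add_pos_pos)
    show "B \<ge> 0" unfolding B_def using R(2) c lat_nonneg[OF t] by (intro infsum_nonneg) auto
    fix z assume z: "norm z \<ge> R / \<kappa> + 1" "\<bar>Im z\<bar> \<ge> \<kappa> * norm z"
    have "R / \<kappa> > 0" using R k by simp
    then have z1: "norm z \<ge> 1" "norm z \<ge> R / \<kappa>" using z by linarith+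
    then have zR: "\<kappa> * norm z \<ge> R" using k by (simp add: field_simps)
    have "Im z \<noteq> 0" using z(2) zR R(1) by linarith
    then have zn: "z \<notin> \<real>\<^sub>\<le>\<^sub>0" by (auto simp: complex_nonpos_Reals_iff)
    have b: "norm (Phi_err \<tau> (z + of_real (lat \<tau> kl))) \<le> C * c ^ 3 * (1 / (1 + lat \<tau> kl) ^ 3)" for kl
    proof -
      let ?w = "z + of_real (lat \<tau> kl)"
      have l0: "lat \<tau> kl \<ge> 0" by (rule lat_nonneg[OF t])
      have "\<kappa> * norm z \<le> \<bar>Im ?w\<bar>" using z by simp
      also have "\<dots> \<le> norm ?w" by (rule abs_Im_le_cmod)
      finally have w: "\<kappa> * norm z \<le> norm ?w" .
      then have wz: "norm z \<le> norm ?w / \<kappa>" using k by (simp add: field_simps)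
      have "lat \<tau> kl = norm (?w - z)" using l0 by simp
      also have "\<dots> \<le> norm ?w + norm z" by (rule norm_triangle_ineq4)
      finally have "1 + lat \<tau> kl \<le> norm ?w + 2 * (norm ?w / \<kappa>)" using wz z1 by linarith
      then have g: "1 + lat \<tau> kl \<le> c * norm ?w" by (simp add: c_def algebra_simps)
      have "norm (Phi_err \<tau> ?w) \<le> C / norm ?w ^ 3"
        using R(3)[OF add_notin_nonpos_Reals[OF zn l0]] w zR by linarith
      also have "\<dots> \<le> C / ((1 + lat \<tau> kl) / c) ^ 3"
      proof (rule divide_left_mono[OF _ R(2)])
        show "((1 + lat \<tau> kl) / c) ^ 3 \<le> norm ?w ^ 3"
          using g l0 c by (intro power_mono) (auto simp: field_simps)
        have "norm ?w > 0" using w zR R by linarith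
        then show "0 < norm ?w ^ 3 * ((1 + lat \<tau> kl) / c) ^ 3" using l0 c by (auto intro!: mult_pos_pos zero_less_power divide_pos_pos)
      qed
      also have "\<dots> = C * c ^ 3 * (1 / (1 + lat \<tau> kl) ^ 3)" by (simp add: power_divide)
      finally show ?thesis .
    qed
    have ab: "(\<lambda>kl. norm (Phi_err \<tau> (z + of_real (lat \<tau> kl)))) summable_on UNIV"
      by (rule Infinite_Sum.abs_summable_on_comparison_test'[OF sB]) (rule b)
    have "norm (\<Sum>\<^sub>\<infinity>kl. Phi_err \<tau> (z + of_real (lat \<tau> kl))) \<le> (\<Sum>\<^sub>\<infinity>kl. norm (Phi_err \<tau> (z + of_real (lat \<tau> kl))))"
      by (rule norm_infsum_bound[OF ab])
    also have "\<dots> \<le> B" unfolding B_def by (rule infsum_mono[OF ab sB b])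
    finally show "norm (\<Sum>\<^sub>\<infinity>kl. Phi_err \<tau> (z + of_real (lat \<tau> kl))) \<le> B" .
  qed
qed

text \<open>The coefficient of \<open>Ln z\<close> is \<open>Phi0 \<tau> (c + z)\<close>, expanded
  in powers of z. In this form the exponent is linear in 1, c and c^2, so that products of shifted
  factors see their shifts only through sums and sums of squares.\<close>

definition Barnes_expo :: "real \<Rightarrow> complex \<Rightarrow> complex \<Rightarrow> complex \<Rightarrow> complex \<Rightarrow> complex \<Rightarrow> complex" where
  "Barnes_expo \<tau> b2 b1 b3 c z = (z\<^sup>2 / (2 * of_real \<tau>) + (Phi_coeff1 \<tau> + c / of_real \<tau>) * z
      + (Phi_coeff0 \<tau> + Phi_coeff1 \<tau> * c + c\<^sup>2 / (2 * of_real \<tau>))) * Ln z + b2 * z\<^sup>2 + (b1 + c * b3) * z"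

text \<open>Ln (z + c) is Ln z + c / z up to order -2. Against the quadratic \<open>Phi0\<close> the
  term c / z leaves c z / (2 \<tau>) and a bounded part, and the remainder leaves a bounded part
  only.\<close>

lemma Barnes_G_shift_asymp:
  assumes t: "\<tau> > 0"
  obtains b1 b2 b3 where "\<And>c \<kappa>. \<kappa> > 0 \<Longrightarrow> \<exists>R B. \<forall>z. norm z \<ge> R \<longrightarrow> \<bar>Im z\<bar> \<ge> \<kappa> * norm z \<longrightarrow>
     (\<exists>e. norm e \<le> B \<and> Barnes_G (of_real \<tau>) (c + z) = exp (Barnes_expo \<tau> b2 b1 b3 c z + e))"
proof -
  obtain b0 b1 b2 where G: "\<And>z. z \<notin> \<real>\<^sub>\<le>\<^sub>0 \<Longrightarrow> Barnes_G (of_real \<tau>) z =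
     exp (Phi0 \<tau> z * Ln z + b2 * z\<^sup>2 + b1 * z + b0 - (\<Sum>\<^sub>\<infinity>kl. Phi_err \<tau> (z + of_real (lat \<tau> kl))))"
    using Barnes_G_exp_form[OF t] by metis
  define t where "t = complex_of_real \<tau>"
  have tn: "t \<noteq> 0" using assms by (simp add: t_def)
  \<comment> \<open>The first summand comes from \<open>Phi0\<close> times c / z, the second from
    the mixed term of b2 (z + c)^2.\<close>
  define b3 where "b3 = 1 / (2 * t) + 2 * b2"
  show ?thesis
  proof (rule that[of b2 b1 b3])
    fix c :: complex and \<kappa> :: real assume k: "\<kappa> > 0"
    \<comment> \<open>Passing from z to z + c may halve the imaginary part and double the modulus,
      hence the sector with \<kappa> / 4.\<close>
    obtain R B where RB: "R > 0" "B \<ge> 0" "\<And>z. norm z \<ge> R \<Longrightarrow> \<bar>Im z\<bar> \<ge> (\<kappa> / 4) * norm z \<Longrightarrow>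
       norm (\<Sum>\<^sub>\<infinity>kl. Phi_err \<tau> (z + of_real (lat \<tau> kl))) \<le> B"
      using Phi_err_sum_bound[OF assms, of "\<kappa> / 4"] k by auto
    define k0 where "k0 = c * (c / t + Phi_coeff1 \<tau>) + b2 * c\<^sup>2 + b1 * c + b0"
    define k1 where "k1 = c * Phi0 \<tau> c"
    define M where "M = 1 / (2 * \<tau>) + norm (c / t + Phi_coeff1 \<tau>) + norm (Phi0 \<tau> c)"
    define B' where "B' = B + norm k0 + norm k1 + M * (2 * norm c ^ 2)"
    \<comment> \<open>Among other bounds this makes |c| at most |z| / 2 and at most \<kappa> |z| /
      2, so that z and z + c lie in the same half-plane.\<close>
    define R' where "R' = 1 + R + 2 * norm c + 2 * (norm c / \<kappa>) + norm c"
    have M0: "M \<ge> 0" using assms by (simp add: M_def)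
    show "\<exists>R B. \<forall>z. norm z \<ge> R \<longrightarrow> \<bar>Im z\<bar> \<ge> \<kappa> * norm z \<longrightarrow>
     (\<exists>e. norm e \<le> B \<and> Barnes_G (of_real \<tau>) (c + z) = exp (Barnes_expo \<tau> b2 b1 b3 c z + e))"
    proof (rule exI[of _ R'], rule exI[of _ B'], intro allI impI)
      fix z assume z: "norm z \<ge> R'" "\<bar>Im z\<bar> \<ge> \<kappa> * norm z"
      have ck: "norm c / \<kappa> \<ge> 0" using k by simp
      have z1: "norm z \<ge> 1" "norm z \<ge> 2 * norm c" "norm z \<ge> 2 * (norm c / \<kappa>)" "norm z \<ge> R + norm c"
        using z(1) ck RB(1) norm_ge_zero[of c] unfolding R'_def by linarith+
      have zn: "z \<noteq> 0" using z1 by auto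
      have kz: "\<kappa> * norm z \<ge> 2 * norm c" using z1(3) k by (simp add: field_simps)
      have kz0: "\<kappa> * norm z > 0" using k z1 by (intro mult_pos_pos) auto
      let ?w = "z + c"
      have Imc: "\<bar>Im c\<bar> \<le> norm c" by (rule abs_Im_le_cmod)
      have same: "Im z > 0 \<and> Im ?w > 0 \<or> Im z < 0 \<and> Im ?w < 0"
        using z(2) kz kz0 Imc by auto
      have wn: "?w \<notin> \<real>\<^sub>\<le>\<^sub>0" using same by (auto simp: complex_nonpos_Reals_iff)
      have nw: "norm ?w \<le> 2 * norm z" "norm ?w \<ge> R"
        using norm_triangle_ineq[of z c] z1 norm_triangle_ineq2[of z "-c"] RB(1) norm_ge_zero[of c] by simp_all
      have "\<bar>Im ?w\<bar> \<ge> \<kappa> * norm z / 2" using z(2) kz Imc unfolding plus_complex.sel by linarith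
      moreover have "\<kappa> * norm ?w \<le> \<kappa> * (2 * norm z)" using nw k by (intro mult_left_mono) auto
      ultimately have "\<bar>Im ?w\<bar> \<ge> \<kappa> / 4 * norm ?w" by simp
      then have Eb: "norm (\<Sum>\<^sub>\<infinity>kl. Phi_err \<tau> (?w + of_real (lat \<tau> kl))) \<le> B" (is "norm ?E \<le> B")
        using RB(3) nw by blast
      define L where "L = Ln (1 + c / z) - c / z"
      have Ln: "Ln ?w = Ln z + (c / z + L)"
        by (subst Ln_add_same_half_plane) (use same in \<open>simp_all only: L_def, auto\<close>)
      have nu: "norm (c / z) \<le> 1/2" using z1 zn by (simp add: norm_divide divide_simps)
      have "norm (Ln (1 + c / z) + (\<Sum>k<2. (- (c / z)) ^ k / of_nat k)) \<le> 2 * norm (c / z) ^ 2"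
        using nu by (intro norm_Ln_one_plus_remainder) auto
      then have Lb: "norm L \<le> 2 * norm c ^ 2 / norm z ^ 2"
        by (simp add: L_def eval_nat_numeral norm_divide power_divide)
      define e where "e = k0 + k1 / z + Phi0 \<tau> ?w * L - ?E"
      have P: "Phi0 \<tau> ?w = z\<^sup>2 / (2 * t) + (c / t + Phi_coeff1 \<tau>) * z + Phi0 \<tau> c"
        using tn by (simp add: Phi0_def t_def[symmetric] field_simps power2_eq_square)
      have "norm (Phi0 \<tau> ?w) \<le> norm (z\<^sup>2 / (2 * t)) + norm ((c / t + Phi_coeff1 \<tau>) * z) + norm (Phi0 \<tau> c)"
        unfolding P by (intro order_trans[OF norm_triangle_ineq] add_mono order_refl norm_triangle_ineq)
      also have "\<dots> \<le> 1 / (2 * \<tau>) * norm z ^ 2 + norm (c / t + Phi_coeff1 \<tau>) * norm z ^ 2 + norm (Phi0 \<tau> c) * norm z ^ 2"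
      proof (intro add_mono)
        show "norm (z\<^sup>2 / (2 * t)) \<le> 1 / (2 * \<tau>) * norm z ^ 2" using assms by (simp add: t_def norm_divide norm_power norm_mult)
        show "norm ((c / t + Phi_coeff1 \<tau>) * z) \<le> norm (c / t + Phi_coeff1 \<tau>) * norm z ^ 2"
          unfolding norm_mult using mult_left_mono[OF z1(1), of "norm z"] by (intro mult_left_mono) (simp_all add: power2_eq_square)
        show "norm (Phi0 \<tau> c) \<le> norm (Phi0 \<tau> c) * norm z ^ 2" using one_le_power[OF z1(1), of 2] by (simp add: mult_le_cancel_left1)
      qed
      also have "\<dots> = M * norm z ^ 2" by (simp add: M_def algebra_simps)
      finally have "norm (Phi0 \<tau> ?w * L) \<le> (M * norm z ^ 2) * (2 * norm c ^ 2 / norm z ^ 2)"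
        unfolding norm_mult using Lb M0 by (intro mult_mono) auto
      also have "\<dots> = M * (2 * norm c ^ 2)" using zn by simp
      finally have PL: "norm (Phi0 \<tau> ?w * L) \<le> M * (2 * norm c ^ 2)" .
      have k1: "norm (k1 / z) \<le> norm k1" using z1 by (simp add: norm_divide divide_le_eq mult_le_cancel_left1)
      have "norm e \<le> norm k0 + norm (k1 / z) + norm (Phi0 \<tau> ?w * L) + norm ?E"
        unfolding e_def by (intro order_trans[OF norm_triangle_ineq4] add_mono order_refl order_trans[OF norm_triangle_ineq] norm_triangle_ineq)
      then have eb: "norm e \<le> B'" using Eb PL k1 unfolding B'_def by linarith
      have "Phi0 \<tau> ?w * Ln ?w = Phi0 \<tau> ?w * Ln z + Phi0 \<tau> ?w * (c / z) + Phi0 \<tau> ?w * L"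
        unfolding Ln by (simp add: algebra_simps)
      moreover have "Phi0 \<tau> ?w * (c / z) = c * z / (2 * t) + c * (c / t + Phi_coeff1 \<tau>) + k1 / z"
        unfolding P k1_def using zn tn by (simp add: field_simps power2_eq_square)
      moreover have "Phi0 \<tau> ?w * Ln z = (z\<^sup>2 / (2 * t) + (Phi_coeff1 \<tau> + c / t) * z
          + (Phi_coeff0 \<tau> + Phi_coeff1 \<tau> * c + c\<^sup>2 / (2 * t))) * Ln z"
        unfolding P by (simp add: Phi0_def t_def[symmetric] algebra_simps)
      ultimately have "Phi0 \<tau> ?w * Ln ?w + b2 * ?w\<^sup>2 + b1 * ?w + b0 - ?E = Barnes_expo \<tau> b2 b1 b3 c z + e"
        unfolding Barnes_expo_def e_def k0_def b3_def t_def[symmetric]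
        by (simp add: power2_eq_square algebra_simps)
      then have "Barnes_G (of_real \<tau>) (c + z) = exp (Barnes_expo \<tau> b2 b1 b3 c z + e)"
        using G[OF wn] by (simp add: add.commute)
      then show "\<exists>e. norm e \<le> B' \<and> Barnes_G (of_real \<tau>) (c + z) = exp (Barnes_expo \<tau> b2 b1 b3 c z + e)"
        using eb by blast
    qed
  qed
qed

section \<open>Existence of separating contours\<close>

text \<open>Squaring removes the kink of \<open>max 0\<close>: the derivative 2 max 0 x is
  continuous. \<open>ramp\<close> and \<open>bump\<close> are built from such squares.\<close>

lemma C1_differentiable_on_max0_square:
  fixes g :: "real \<Rightarrow> real"
  assumes "g C1_differentiable_on S"
  shows "(\<lambda>x. (max 0 (g x))\<^sup>2) C1_differentiable_on S"
proof -
  have d: "((\<lambda>x::real. (max 0 x)\<^sup>2) has_real_derivative 2 * max 0 x) (at x)" for x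
  proof (cases x "0::real" rule: linorder_cases)
    case greater
    have "((\<lambda>x. x\<^sup>2) has_real_derivative 2 * x) (at x)" by (auto intro!: derivative_eq_intros)
    then have "((\<lambda>x. (max 0 x)\<^sup>2) has_real_derivative 2 * x) (at x)"
      by (rule has_field_derivative_transform_within_open[of _ _ _ "{0<..}"]) (use greater in auto)
    then show ?thesis using greater by simp
  next
    case less
    have "((\<lambda>x::real. 0::real) has_real_derivative 0) (at x)" by simp
    then have "((\<lambda>x. (max 0 x)\<^sup>2) has_real_derivative 0) (at x)"
      by (rule has_field_derivative_transform_within_open[of _ _ _ "{..<0}"]) (use less in auto)
    then show ?thesis using less by simp
  next
    case equal
    have "((\<lambda>h::real. max 0 h) \<longlongrightarrow> max 0 0) (at 0)" by (intro tendsto_intros)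
    then have "((\<lambda>h::real. max 0 h) \<longlongrightarrow> 0) (at 0)" by simp
    then have "((\<lambda>h::real. ((max 0 (0 + h))\<^sup>2 - (max 0 0)\<^sup>2) / h) \<longlongrightarrow> 0) (at 0)"
      by (rule Lim_transform_eventually)
         (auto simp: eventually_at_filter max_def power2_eq_square)
    then show ?thesis using equal by (simp add: DERIV_def)
  qed
  obtain D where D: "\<And>x. x \<in> S \<Longrightarrow> (g has_vector_derivative D x) (at x)" "continuous_on S D"
    using assms unfolding C1_differentiable_on_def by blast
  have cg: "continuous_on S g"
    by (rule continuous_at_imp_continuous_on) (use D(1) has_vector_derivative_continuous in blast)
  show ?thesis unfolding C1_differentiable_on_def
  proof (intro exI[of _ "\<lambda>x. 2 * max 0 (g x) * D x"] conjI ballI)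
    fix x assume "x \<in> S"
    then have "(g has_real_derivative D x) (at x)"
      using D(1) by (simp add: has_real_derivative_iff_has_vector_derivative)
    from DERIV_chain2[OF d this]
    show "((\<lambda>x. (max 0 (g x))\<^sup>2) has_vector_derivative 2 * max 0 (g x) * D x) (at x)"
      by (simp add: has_real_derivative_iff_has_vector_derivative)
  next
    show "continuous_on S (\<lambda>x. 2 * max 0 (g x) * D x)"
      using D(2) cg by (intro continuous_intros)
  qed
qed

lemma C1_differentiable_on_sum:
  assumes "\<And>i. i \<in> I \<Longrightarrow> f i C1_differentiable_on S"
  shows "(\<lambda>x. \<Sum>i\<in>I. f i x) C1_differentiable_on S"
  using assms by (induction I rule: infinite_finite_induct) auto

text \<open>Here the kink stays. It becomes the one exceptional parameter of the contour, at which
  the two ends with unrelated slopes are joined.\<close>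

lemma C1_differentiable_on_max0:
  "(\<lambda>s::real. max 0 s) C1_differentiable_on (UNIV - {0})"
  "(\<lambda>s::real. min 0 s) C1_differentiable_on (UNIV - {0})"
proof -
  have d: "((\<lambda>s::real. max 0 s) has_real_derivative (if s > 0 then 1 else 0)) (at s)"
    "((\<lambda>s::real. min 0 s) has_real_derivative (if s > 0 then 0 else 1)) (at s)" if "s \<noteq> 0" for s
  proof -
    have i: "((\<lambda>s::real. s) has_real_derivative 1) (at s)" "((\<lambda>s::real. 0::real) has_real_derivative 0) (at s)"
      by (auto intro!: derivative_eq_intros)
    show "((\<lambda>s::real. max 0 s) has_real_derivative (if s > 0 then 1 else 0)) (at s)"
    proof (cases "s > 0")
      case True
      then show ?thesis using has_field_derivative_transform_within_open[OF i(1), of "{0<..}"] by auto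
    next
      case False
      then show ?thesis using that has_field_derivative_transform_within_open[OF i(2), of "{..<0}"] by auto
    qed
    show "((\<lambda>s::real. min 0 s) has_real_derivative (if s > 0 then 0 else 1)) (at s)"
    proof (cases "s > 0")
      case True
      then show ?thesis using has_field_derivative_transform_within_open[OF i(2), of "{0<..}"] by auto
    next
      case False
      then show ?thesis using that has_field_derivative_transform_within_open[OF i(1), of "{..<0}"] by auto
    qed
  qed
  have c: "continuous_on (UNIV - {0::real}) (\<lambda>s. if s > 0 then a else b)" for a b :: real
  proof -
    have "continuous_on ({0<..} \<union> {..<0::real}) (\<lambda>s. if s > 0 then a else b)"
    proof (rule continuous_on_open_Un)
      show "continuous_on {0::real<..} (\<lambda>s. if s > 0 then a else b)"
        by (rule continuous_on_eq[of _ "\<lambda>_. a"]) auto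
      show "continuous_on {..<0::real} (\<lambda>s. if s > 0 then a else b)"
      proof (rule continuous_on_eq[of _ "\<lambda>_. b"])
        fix x :: real assume "x \<in> {..<0}"
        then have "\<not> x > 0" by simp
        then show "b = (if 0 < x then a else b)" by simp
      qed simp
    qed auto
    moreover have "{0<..} \<union> {..<0::real} = UNIV - {0}" by auto
    ultimately show ?thesis by simp
  qed
  show "(\<lambda>s::real. max 0 s) C1_differentiable_on (UNIV - {0})"
    unfolding C1_differentiable_on_def using d(1) c[of 1 0]
    by (intro exI[of _ "\<lambda>s. if s > 0 then 1 else 0"]) (auto simp: has_real_derivative_iff_has_vector_derivative)
  show "(\<lambda>s::real. min 0 s) C1_differentiable_on (UNIV - {0})"
    unfolding C1_differentiable_on_def using d(2) c[of 0 1]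
    by (intro exI[of _ "\<lambda>s. if s > 0 then 0 else 1"]) (auto simp: has_real_derivative_iff_has_vector_derivative)
qed

text \<open>A continuous function that is strictly increasing on \<open>[-X, X]\<close>, of class \<open>C\<^sup>1\<close>, and constant
  to the left and to the right of this interval.\<close>

definition ramp :: "real \<Rightarrow> real \<Rightarrow> real" where
  "ramp X x = (max 0 (x + X))\<^sup>2 - 2 * (max 0 x)\<^sup>2 + (max 0 (x - X))\<^sup>2"

lemma ramp_right: "X > 0 \<Longrightarrow> x \<ge> X \<Longrightarrow> ramp X x = 2 * X\<^sup>2"
  by (simp add: ramp_def power2_eq_square algebra_simps)

lemma ramp_left: "X > 0 \<Longrightarrow> x \<le> - X \<Longrightarrow> ramp X x = 0"
  by (simp add: ramp_def)

lemma ramp_strict_mono: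
  assumes "X > 0" "- X \<le> x" "x < y" "y \<le> X"
  shows "ramp X x < ramp X y"
proof -
  have neg: "ramp X u < ramp X v" if "- X \<le> u" "u < v" "v \<le> 0" for u v
  proof -
    have "(u + X)\<^sup>2 < (v + X)\<^sup>2" using that by (intro power_strict_mono) auto
    then show ?thesis using that assms(1) by (simp add: ramp_def)
  qed
  have pos: "ramp X u < ramp X v" if "0 \<le> u" "u < v" "v \<le> X" for u v
  proof -
    have e: "ramp X w = 2 * X\<^sup>2 - (X - w)\<^sup>2" if "0 \<le> w" "w \<le> X" for w
      using that assms(1) by (simp add: ramp_def power2_eq_square algebra_simps)
    have "(X - v)\<^sup>2 < (X - u)\<^sup>2" using that by (intro power_strict_mono) auto
    then show ?thesis using that e[of u] e[of v] by simp
  qed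
  show ?thesis
  proof (cases "y \<le> 0 \<or> 0 \<le> x")
    case True
    then show ?thesis using neg[of x y] pos[of x y] assms by auto
  next
    case False
    then show ?thesis using neg[of x 0] pos[of 0 y] assms by auto
  qed
qed

lemma ramp_inj:
  assumes "X > 0" "\<bar>x\<bar> \<le> X" "\<bar>y\<bar> \<le> X" "ramp X x = ramp X y"
  shows "x = y"
  using ramp_strict_mono[of X x y] ramp_strict_mono[of X y x] assms
  by (cases x y rule: linorder_cases) (auto simp: abs_le_iff)

lemma continuous_on_ramp [continuous_intros]:
  "continuous_on A f \<Longrightarrow> continuous_on A (\<lambda>x. ramp X (f x))"
  unfolding ramp_def by (intro continuous_intros)

text \<open>Along a straight ray the shear is finally a constant shift, so the sheared curve still
  ends in straight rays of the prescribed directions.\<close>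

lemma ramp_eventually_const:
  assumes "X > 0"
  shows "\<exists>\<kappa>. eventually (\<lambda>t. ramp X (t * a) = \<kappa>) at_top"
proof (cases a "0::real" rule: linorder_cases)
  case greater
  have "eventually (\<lambda>t. t \<ge> X / a) at_top" by (rule eventually_ge_at_top)
  then have "eventually (\<lambda>t. ramp X (t * a) = 2 * X\<^sup>2) at_top"
    by eventually_elim (use assms greater in \<open>auto intro!: ramp_right simp: field_simps\<close>)
  then show ?thesis by blast
next
  case less
  have "eventually (\<lambda>t. t \<ge> X / (- a)) at_top" by (rule eventually_ge_at_top)
  then have "eventually (\<lambda>t. ramp X (t * a) = 0) at_top"
    by eventually_elim (use assms less in \<open>auto intro!: ramp_left simp: field_simps\<close>)
  then show ?thesis by blast
qed auto

text \<open>A function of class C^1 with value 1 at 0 that vanishes at distance \<eta> and beyond: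
  multiples of its translates correct a function at finitely many separated points independently of
  each other.\<close>

definition bump :: "real \<Rightarrow> real \<Rightarrow> real" where
  "bump \<eta> d = (max 0 (\<eta>\<^sup>2 - d\<^sup>2))\<^sup>2 / \<eta> ^ 4"

lemma bump_0: "\<eta> > 0 \<Longrightarrow> bump \<eta> 0 = 1"
  by (simp add: bump_def power_mult[symmetric])

lemma bump_far:
  assumes "\<eta> > 0" "\<bar>d\<bar> \<ge> \<eta>"
  shows "bump \<eta> d = 0"
proof -
  have "\<eta>\<^sup>2 \<le> \<bar>d\<bar>\<^sup>2" using assms by (intro power_mono) auto
  then show ?thesis by (simp add: bump_def)
qed

lemma finite_separated:
  fixes Y :: "real set"
  assumes "finite Y"
  obtains \<eta> where "\<eta> > 0" "\<And>x y. x \<in> Y \<Longrightarrow> y \<in> Y \<Longrightarrow> x \<noteq> y \<Longrightarrow> \<bar>x - y\<bar> \<ge> \<eta>"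
proof -
  define D where "D = insert 1 ((\<lambda>(x, y). \<bar>x - y\<bar>) ` {(x, y) \<in> Y \<times> Y. x \<noteq> y})"
  have "{(x, y) \<in> Y \<times> Y. x \<noteq> y} \<subseteq> Y \<times> Y" by auto
  then have fin: "finite D" unfolding D_def using assms by (meson finite_SigmaI finite_imageI finite_insert finite_subset)
  show ?thesis
  proof (rule that[of "Min D"])
    have "Min D \<in> D" using fin by (intro Min_in) (auto simp: D_def)
    then show "Min D > 0" by (auto simp: D_def)
    show "Min D \<le> \<bar>x - y\<bar>" if "x \<in> Y" "y \<in> Y" "x \<noteq> y" for x y
      using fin that by (intro Min_le) (force simp: D_def)+
  qed
qed

text \<open>The contour is a graph \<open>x = f y\<close> composed with a shear \<open>(x, y) \<mapsto> (x, y - c k(x))\<close>: the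
  shear separates the heights of points that lie on one horizontal line in the wrong order, after which
  prescribing \<open>f\<close> at finitely many heights suffices.\<close>

lemma separating_contour_exists:
  assumes tp: "\<theta>p \<in> {0<..<pi}" and tm: "\<theta>m \<in> {-pi<..<0}"
    and disj: "Lp \<inter> Lm = {}"
    and finp: "\<And>x. finite {s \<in> Lp. Re s \<le> x}" and finm: "\<And>x. finite {s \<in> Lm. Re s \<ge> x}"
    and imp: "finite (Im ` Lp)" and imm: "finite (Im ` Lm)"
  shows "\<exists>\<gamma>. separating_contour Lp Lm \<theta>m \<theta>p \<gamma>"
proof -
  \<comment> \<open>A point of \<open>Lp\<close> to the right of X, or of \<open>Lm\<close> to the
    left of - X, is on its correct side whenever the graph takes one of the values X and - X at its
    height. Only the finitely many other points constrain the curve.\<close>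
  obtain X where X: "X > 0" "\<And>s. s \<in> Lp \<Longrightarrow> Re s > - X" "\<And>s. s \<in> Lm \<Longrightarrow> Re s < X"
  proof -
    let ?S = "insert 0 ((\<lambda>s. \<bar>Re s\<bar>) ` ({s \<in> Lp. Re s \<le> 0} \<union> {s \<in> Lm. Re s \<ge> 0}))"
    have f: "finite ?S" using finp finm by auto
    have le: "x \<le> Max ?S" if "x \<in> ?S" for x using f that by (rule Max_ge)
    have M0: "Max ?S \<ge> 0" by (rule le) simp
    show ?thesis
    proof (rule that[of "Max ?S + 1"])
      show "Max ?S + 1 > 0" using M0 by linarith
      fix s
      show "Re s > - (Max ?S + 1)" if "s \<in> Lp"
      proof (cases "Re s \<le> 0")
        case True
        then have "\<bar>Re s\<bar> \<le> Max ?S" by (intro le insertI2 imageI) (use that True in auto)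
        then show ?thesis by linarith
      qed (use M0 in linarith)
      show "Re s < Max ?S + 1" if "s \<in> Lm"
      proof (cases "Re s \<ge> 0")
        case True
        then have "\<bar>Re s\<bar> \<le> Max ?S" by (intro le insertI2 imageI) (use that True in auto)
        then show ?thesis by linarith
      qed (use M0 in linarith)
    qed
  qed
  define Fp where "Fp = {s \<in> Lp. Re s \<le> X}"
  define Fm where "Fm = {s \<in> Lm. Re s \<ge> - X}"
  have fF: "finite Fp" "finite Fm" using finp finm by (auto simp: Fp_def Fm_def)
  let ?k = "ramp X"
  \<comment> \<open>The finitely many excluded slopes are those for which a point of
    \<open>Fp\<close> and a point of \<open>Fm\<close> get the same sheared height. If the two ramp
    values agree, the quotient is 0 by convention and excludes nothing essential: the points then
    have equal real parts and, being distinct, different heights.\<close>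
  have "\<exists>c. c \<notin> (\<lambda>(s, s'). (Im s' - Im s) / (?k (Re s) - ?k (Re s'))) ` (Fp \<times> Fm)"
    by (rule ex_new_if_finite[OF infinite_UNIV_char_0]) (use fF in auto)
  then obtain c where c: "c \<notin> (\<lambda>(s, s'). (Im s' - Im s) / (?k (Re s) - ?k (Re s'))) ` (Fp \<times> Fm)" by blast
  define h where "h = (\<lambda>s. Im s + c * ?k (Re s))"
  have hne: "h s \<noteq> h s'" if s: "s \<in> Fp" "s' \<in> Fm" for s s'
  proof
    assume eq: "h s = h s'"
    show False
    proof (cases "?k (Re s) = ?k (Re s')")
      case True
      have "Re s = Re s'"
        by (rule ramp_inj[OF X(1) _ _ True]) (use s X(2)[of s] X(3)[of s'] in \<open>auto simp: Fp_def Fm_def abs_le_iff\<close>)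
      moreover have "Im s = Im s'" using eq True by (simp add: h_def)
      ultimately have "s = s'" by (simp add: complex_eq_iff)
      then show False using s disj by (auto simp: Fp_def Fm_def)
    next
      case False
      have "c * (?k (Re s) - ?k (Re s')) = Im s' - Im s" using eq by (simp add: h_def algebra_simps)
      then have "c = (Im s' - Im s) / (?k (Re s) - ?k (Re s'))" using False by (simp add: field_simps)
      then have "c \<in> (\<lambda>(s, s'). (Im s' - Im s) / (?k (Re s) - ?k (Re s'))) ` (Fp \<times> Fm)"
        using s by (intro image_eqI[of _ _ "(s, s')"]) auto
      then show False using c by blast
    qed
  qed
  \<comment> \<open>All sheared heights occurring in \<open>Lp\<close> and \<open>Lm\<close>. The
    set is finite although the families are not: beyond X and - X the ramp is constant, and only
    finitely many imaginary parts occur.\<close>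
  define Y where "Y = h ` Fp \<union> h ` Fm \<union> (\<lambda>y. y + c * (2 * X\<^sup>2)) ` Im ` Lp \<union> Im ` Lm"
  have fY: "finite Y" using fF imp imm by (simp add: Y_def)
  have hY: "h s \<in> Y" if hs: "s \<in> Lp \<union> Lm" for s
  proof -
    consider "s \<in> Fp \<union> Fm" | "s \<in> Lp" "Re s > X" | "s \<in> Lm" "Re s < - X"
      using hs unfolding Fp_def Fm_def Un_iff mem_Collect_eq by (metis not_less)
    then show ?thesis
    proof cases
      case 2
      then have "h s = Im s + c * (2 * X\<^sup>2)" using X(1) by (simp add: h_def ramp_right)
      then show ?thesis using 2 by (auto simp: Y_def)
    next
      case 3
      then have "h s = Im s" using X(1) by (simp add: h_def ramp_left)
      then show ?thesis using 3 by (auto simp: Y_def)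
    qed (auto simp: Y_def)
  qed
  obtain \<eta> where \<eta>: "\<eta> > 0" "\<And>x y. x \<in> Y \<Longrightarrow> y \<in> Y \<Longrightarrow> x \<noteq> y \<Longrightarrow> \<bar>x - y\<bar> \<ge> \<eta>"
    using finite_separated[OF fY] by metis
  have sp: "sin \<theta>p > 0" using tp by (simp add: sin_gt_zero)
  have sm: "sin \<theta>m < 0" using tm sin_gt_zero[of "- \<theta>m"] by simp
  define A A' B' where "A = cos \<theta>p / sin \<theta>p" and "A' = cos \<theta>m / sin \<theta>m" and "B' = - sin \<theta>m"
  have B': "B' > 0" using sm by (simp add: B'_def)
  \<comment> \<open>The piecewise linear graph of two rays from the origin: \<open>A\<close> and
    \<open>A'\<close> are the cotangents of the two angles.\<close>
  define base where "base = (\<lambda>u. A * max 0 u + A' * min 0 u)"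
  \<comment> \<open>At a height used by \<open>Fm\<close> the curve has to pass to the right of that
    point; at all other heights in \<open>Y\<close> it passes to the left, where it leaves the
    points of \<open>Lp\<close> on its right.\<close>
  define val where "val = (\<lambda>y. if y \<in> h ` Fm then X else - X)"
  define f where "f = (\<lambda>u. base u + (\<Sum>y\<in>Y. (val y - base y) * bump \<eta> (u - y)))"
  \<comment> \<open>Rescales the height so that both rays are traversed with unit speed, as
    \<open>separating_contour\<close> prescribes.\<close>
  define \<rho> where "\<rho> = (\<lambda>s. sin \<theta>p * max 0 s + B' * min 0 s)"
  define \<gamma> where "\<gamma> = (\<lambda>s. f (\<rho> s) *\<^sub>R (1::complex) + (\<rho> s - c * ?k (f (\<rho> s))) *\<^sub>R \<i>)"
  have f_Y: "f y = val y" if "y \<in> Y" for y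
  proof -
    have "(\<Sum>x\<in>Y. (val x - base x) * bump \<eta> (y - x)) = (\<Sum>x\<in>Y. if x = y then val y - base y else 0)"
    proof (rule sum.cong[OF refl])
      fix x assume "x \<in> Y"
      then show "(val x - base x) * bump \<eta> (y - x) = (if x = y then val y - base y else 0)"
        using \<eta>(2)[of y x] that bump_far[OF \<eta>(1), of "y - x"] bump_0[OF \<eta>(1)] by auto
    qed
    also have "\<dots> = val y - base y" using fY that by simp
    finally show ?thesis by (simp add: f_def)
  qed
  have cont_f: "continuous_on UNIV f"
    unfolding f_def base_def bump_def using \<eta>(1) by (intro continuous_intros) auto
  have re_g: "Re (\<gamma> s) = f (\<rho> s)" and im_g: "Im (\<gamma> s) = \<rho> s - c * ?k (f (\<rho> s))" for s
    by (simp_all add: \<gamma>_def)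
  have base_rho: "base (\<rho> s) = cos \<theta>p * max 0 s + (- cos \<theta>m) * min 0 s" for s
  proof (cases "s \<ge> 0")
    case True
    then have "\<rho> s = sin \<theta>p * s" "\<rho> s \<ge> 0" using sp by (simp_all add: \<rho>_def)
    then show ?thesis using True sp by (simp add: base_def A_def)
  next
    case False
    then have "\<rho> s = B' * s" "\<rho> s < 0" using B' by (simp_all add: \<rho>_def mult_pos_neg)
    then show ?thesis using False sm by (simp add: base_def A'_def B'_def)
  qed
  have strict: "\<rho> s < \<rho> t" if st: "s < t" for s t
  proof -
    consider "0 \<le> s" | "s < 0" "t \<le> 0" | "s < 0" "t > 0" using st by linarith
    then show ?thesis
    proof cases
      case 3
      then have "B' * s < 0" "sin \<theta>p * t > 0" using sp B' by (simp_all add: mult_pos_neg)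
      then show ?thesis using 3 by (simp add: \<rho>_def)
    qed (use sp B' st in \<open>auto simp: \<rho>_def\<close>)
  qed
  have surj: "\<exists>s. \<rho> s = u" for u
  proof (cases "u \<ge> 0")
    case True
    then show ?thesis using sp by (intro exI[of _ "u / sin \<theta>p"]) (simp add: \<rho>_def)
  next
    case False
    then have "u / B' < 0" using B' by (simp add: divide_neg_pos)
    then show ?thesis using False B' by (intro exI[of _ "u / B'"]) (simp add: \<rho>_def)
  qed
  have range: "range \<gamma> = {s. Re s = f (h s)}"
  proof (intro set_eqI iffI)
    fix w assume "w \<in> range \<gamma>"
    then show "w \<in> {s. Re s = f (h s)}" by (auto simp: h_def re_g im_g)
  next
    fix w assume "w \<in> {s. Re s = f (h s)}"
    then have w: "Re w = f (h w)" by simp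
    obtain s where s: "\<rho> s = h w" using surj by blast
    have "\<gamma> s = w" using w unfolding complex_eq_iff re_g im_g s by (simp add: h_def)
    then show "w \<in> range \<gamma>" by blast
  qed
  have inj: "inj \<gamma>"
  proof (rule injI)
    fix s t assume eq: "\<gamma> s = \<gamma> t"
    then have "f (\<rho> s) = f (\<rho> t)" "\<rho> s - c * ?k (f (\<rho> s)) = \<rho> t - c * ?k (f (\<rho> t))"
      by (metis re_g, metis im_g)
    then have "\<rho> s = \<rho> t" by simp
    then show "s = t" using strict[of s t] strict[of t s] by (cases s t rule: linorder_cases) auto
  qed
  have C1: "\<gamma> C1_differentiable_on (UNIV - {0})"
  proof -
    have r: "\<rho> C1_differentiable_on (UNIV - {0})"
      unfolding \<rho>_def by (intro C1_differentiable_on_add C1_differentiable_on_mult C1_differentiable_on_const C1_differentiable_on_max0)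
    have b: "(\<lambda>s. base (\<rho> s)) C1_differentiable_on (UNIV - {0})"
      unfolding base_rho by (intro C1_differentiable_on_add C1_differentiable_on_mult C1_differentiable_on_const C1_differentiable_on_max0)
    have bu: "(\<lambda>s. bump \<eta> (\<rho> s - y)) C1_differentiable_on (UNIV - {0})" for y
      unfolding bump_def power2_eq_square[of "\<rho> _ - y"] divide_inverse
      by (intro C1_differentiable_on_mult C1_differentiable_on_const C1_differentiable_on_max0_square C1_differentiable_on_diff r)
    have fr: "(\<lambda>s. f (\<rho> s)) C1_differentiable_on (UNIV - {0})"
      unfolding f_def
      by (intro C1_differentiable_on_add C1_differentiable_on_sum C1_differentiable_on_mult C1_differentiable_on_const b bu)
    show ?thesis unfolding \<gamma>_def ramp_def
      by (intro C1_differentiable_on_add C1_differentiable_on_diff C1_differentiable_on_mult C1_differentiable_on_scaleR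
           C1_differentiable_on_const C1_differentiable_on_max0_square fr r)
  qed
  have cont_g: "continuous_on UNIV \<gamma>"
    unfolding \<gamma>_def \<rho>_def
    by (intro continuous_intros continuous_on_compose2[OF cont_f]) auto
  have pC1: "\<gamma> piecewise_C1_differentiable_on UNIV"
    unfolding piecewise_C1_differentiable_on_def using cont_g C1 by (intro conjI exI[of _ "{0}"]) auto
  have far: "f u = base u" if "\<And>y. y \<in> Y \<Longrightarrow> \<bar>u - y\<bar> \<ge> \<eta>" for u
    unfolding f_def using that bump_far[OF \<eta>(1)] by simp
  obtain M where M: "\<And>y. y \<in> Y \<Longrightarrow> \<bar>y\<bar> \<le> M"
    using fY by (metis bounded_iff finite_imp_bounded real_norm_def)
  have ray_p: "\<exists>cp. eventually (\<lambda>t. \<gamma> t = cp + of_real t * cis \<theta>p) at_top"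
  proof -
    obtain \<kappa> where \<kappa>: "eventually (\<lambda>t. ?k (t * cos \<theta>p) = \<kappa>) at_top"
      using ramp_eventually_const[OF X(1)] by blast
    have "eventually (\<lambda>t. \<gamma> t = Complex 0 (- c * \<kappa>) + of_real t * cis \<theta>p) at_top"
      using \<kappa> eventually_ge_at_top[of 0] eventually_ge_at_top[of "(M + \<eta>) / sin \<theta>p"]
    proof eventually_elim
      case (elim t)
      have r: "\<rho> t = t * sin \<theta>p" using elim by (simp add: \<rho>_def)
      have "t * sin \<theta>p \<ge> M + \<eta>" using elim(3) sp by (simp add: field_simps)
      then have "f (\<rho> t) = base (\<rho> t)" unfolding r by (intro far) (use M in force)
      then have "f (\<rho> t) = t * cos \<theta>p" unfolding base_rho using elim by simp
      then show ?case unfolding complex_eq_iff re_g im_g r using elim(1) by simp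
    qed
    then show ?thesis by blast
  qed
  have ray_m: "\<exists>cm. eventually (\<lambda>t. \<gamma> t = cm + of_real (- t) * cis \<theta>m) at_bot"
  proof -
    obtain \<kappa> where \<kappa>: "eventually (\<lambda>t. ?k (t * cos \<theta>m) = \<kappa>) at_top"
      using ramp_eventually_const[OF X(1)] by blast
    have "eventually (\<lambda>t. \<gamma> (- t) = Complex 0 (- c * \<kappa>) + of_real t * cis \<theta>m) at_top"
      using \<kappa> eventually_gt_at_top[of 0] eventually_ge_at_top[of "(M + \<eta>) / B'"]
    proof eventually_elim
      case (elim t)
      have r: "\<rho> (- t) = - (t * B')" using elim by (simp add: \<rho>_def)
      have "t * B' \<ge> M + \<eta>" using elim(3) B' by (simp add: field_simps)
      then have "f (\<rho> (- t)) = base (\<rho> (- t))" unfolding r by (intro far) (use M in force)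
      then have "f (\<rho> (- t)) = t * cos \<theta>m" unfolding base_rho using elim by simp
      then show ?case unfolding complex_eq_iff re_g im_g r using elim(1) by (simp add: B'_def)
    qed
    then have "eventually (\<lambda>t. \<gamma> t = Complex 0 (- c * \<kappa>) + of_real (- t) * cis \<theta>m) at_bot"
      unfolding at_bot_mirror eventually_filtermap by simp
    then show ?thesis by blast
  qed
  define Dp where "Dp = {s. Re s > f (h s)}"
  define Dm where "Dm = {s. Re s < f (h s)}"
  have cont_fh: "continuous_on UNIV (\<lambda>s. f (h s))"
    unfolding h_def by (intro continuous_intros continuous_on_compose2[OF cont_f]) auto
  have "open Dp" "open Dm" unfolding Dp_def Dm_def
    by (intro open_Collect_less cont_fh continuous_intros)+
  \<comment> \<open>A map that carries the vertical line through 0 onto the contour and the two open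
    half-planes onto its two sides, which are therefore connected.\<close>
  define \<Psi> where "\<Psi> = (\<lambda>w. Complex (Re w + f (Im w)) (Im w - c * ?k (Re w + f (Im w))))"
  have cont_Psi: "continuous_on UNIV \<Psi>"
    unfolding \<Psi>_def Complex_eq by (intro continuous_intros continuous_on_compose2[OF cont_f]) auto
  have hPsi: "h (\<Psi> w) = Im w" "Re (\<Psi> w) = Re w + f (Im w)" for w
    by (simp_all add: \<Psi>_def h_def)
  have inv: "\<Psi> (Complex (Re s - f (h s)) (h s)) = s" for s
    by (simp add: \<Psi>_def complex_eq_iff) (simp add: h_def)
  have im_p: "\<Psi> ` {w. Re w > 0} = Dp"
  proof
    show "\<Psi> ` {w. Re w > 0} \<subseteq> Dp" by (auto simp: Dp_def hPsi)
    show "Dp \<subseteq> \<Psi> ` {w. Re w > 0}"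
    proof
      fix s assume s: "s \<in> Dp"
      show "s \<in> \<Psi> ` {w. Re w > 0}"
        by (rule image_eqI[where x = "Complex (Re s - f (h s)) (h s)"]) (use s in \<open>simp_all add: inv Dp_def\<close>)
    qed
  qed
  have im_m: "\<Psi> ` {w. Re w < 0} = Dm"
  proof
    show "\<Psi> ` {w. Re w < 0} \<subseteq> Dm" by (auto simp: Dm_def hPsi)
    show "Dm \<subseteq> \<Psi> ` {w. Re w < 0}"
    proof
      fix s assume s: "s \<in> Dm"
      show "s \<in> \<Psi> ` {w. Re w < 0}"
        by (rule image_eqI[where x = "Complex (Re s - f (h s)) (h s)"]) (use s in \<open>simp_all add: inv Dm_def\<close>)
    qed
  qed
  have "connected Dp" "connected Dm"
    unfolding im_p[symmetric] im_m[symmetric]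
    by (intro connected_continuous_image continuous_on_subset[OF cont_Psi] convex_connected
         convex_halfspace_Re_gt convex_halfspace_Re_lt; simp)+
  moreover have psi: "\<Psi> 1 \<in> Dp" "\<Psi> (- 1) \<in> Dm" by (auto simp: Dp_def Dm_def hPsi)
  ultimately have comp: "components (- range \<gamma>) = {Dp, Dm}"
    using \<open>open Dp\<close> \<open>open Dm\<close>
    by (intro components_open_unique; auto simp: range Dp_def Dm_def pairwise_def disjnt_def)
  have "Dp \<noteq> Dm" using psi by (auto simp: Dp_def Dm_def)
  have "Lp \<subseteq> Dp"
  proof
    fix s assume s: "s \<in> Lp"
    have v: "f (h s) = val (h s)" using s by (intro f_Y hY) auto
    show "s \<in> Dp"
    proof (cases "Re s \<le> X")
      case True
      then have "s \<in> Fp" using s by (simp add: Fp_def)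
      then have "h s \<notin> h ` Fm" using hne by blast
      then show ?thesis using X(2)[OF s] v by (simp add: Dp_def val_def)
    next
      case False
      then show ?thesis using X(1) v by (simp add: Dp_def val_def)
    qed
  qed
  moreover have "Lm \<subseteq> Dm"
  proof
    fix s assume s: "s \<in> Lm"
    have v: "f (h s) = val (h s)" using s by (intro f_Y hY) auto
    show "s \<in> Dm"
    proof (cases "Re s \<ge> - X")
      case True
      then have "s \<in> Fm" using s by (simp add: Fm_def)
      then show ?thesis using X(3)[OF s] v by (simp add: Dm_def val_def)
    next
      case False
      then show ?thesis using X(1) v by (simp add: Dm_def val_def)
    qed
  qed
  moreover have "eventually (\<lambda>x. complex_of_real x \<in> Dp) at_top"
    using eventually_ge_at_top[of X] eventually_gt_at_top[of "f (c * (2 * X\<^sup>2))"]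
    by eventually_elim (use X(1) in \<open>simp add: Dp_def h_def ramp_right\<close>)
  ultimately show ?thesis unfolding separating_contour_def
    using pC1 inj ray_p ray_m comp \<open>Dp \<noteq> Dm\<close> by blast
qed

section \<open>Integrals along rays and contours\<close>

text \<open>Integrability for each single w already provides a local majorant, because on a small
  square |exp (w \<phi>)| is dominated by the sum of its values at the four corners. The majorant
  also dominates the exponential series around the centre, which can then be integrated termwise
  into a power series in w.\<close>

lemma holomorphic_parametric_integral:
  fixes g \<phi> :: "real \<Rightarrow> complex"
  assumes U: "open U" and int: "\<And>w. w \<in> U \<Longrightarrow> integrable M (\<lambda>t. g t * exp (w * \<phi> t))"
    and meas: "\<phi> \<in> borel_measurable M"
  shows "(\<lambda>w. LINT t|M. g t * exp (w * \<phi> t)) holomorphic_on U"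
proof -
  have "\<exists>r>0. (\<lambda>w. LINT t|M. g t * exp (w * \<phi> t)) holomorphic_on ball w0 r" if w0: "w0 \<in> U" for w0
  proof -
    obtain e where e: "e > 0" "ball w0 e \<subseteq> U" using U w0 by (auto simp: open_contains_ball)
    define r where "r = e / 2"
    have r: "r > 0" using e by (simp add: r_def)
    \<comment> \<open>The corners of a square around 0: the corner matching the signs of the real
      and imaginary part of \<phi> yields the factor exp (r (|Re \<phi>| + |Im \<phi>|)).\<close>
    define V where "V = {Complex r r, Complex r (-r), Complex (-r) r, Complex (-r) (-r)}"
    have V: "w0 + v \<in> U" if "v \<in> V" for v
    proof -
      have "norm v < 2 * r" using that r unfolding V_def
        by (auto simp: cmod_def real_sqrt_mult[symmetric] intro!: real_less_lsqrt simp: power2_eq_square)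
      then have "w0 + v \<in> ball w0 e" by (simp add: dist_norm r_def)
      then show ?thesis using e by blast
    qed
    define D where "D = (\<lambda>t. \<Sum>v\<in>V. norm (g t * exp ((w0 + v) * \<phi> t)))"
    have intD: "integrable M D" unfolding D_def using int V by (intro Bochner_Integration.integrable_sum integrable_norm) auto
    define G where "G = (\<lambda>t. g t * exp (w0 * \<phi> t))"
    have measG: "G \<in> borel_measurable M" unfolding G_def using int[OF w0] by (rule borel_measurable_integrable)
    have dom: "norm (G t) * exp (r * norm (\<phi> t)) \<le> D t" for t
    proof -
      define x where "x = \<bar>Re (\<phi> t)\<bar>" define y where "y = \<bar>Im (\<phi> t)\<bar>"
      have "norm (\<phi> t) \<le> x + y" unfolding x_def y_def by (rule cmod_le)
      then have "exp (r * norm (\<phi> t)) \<le> exp (r * (x + y))" using r by simp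
      obtain v where v: "v \<in> V" "Re (v * \<phi> t) = r * (x + y)"
      proof (rule that[of "Complex (if Re (\<phi> t) \<ge> 0 then r else - r) (if Im (\<phi> t) \<ge> 0 then - r else r)"])
      qed (auto simp: V_def x_def y_def algebra_simps)
      have "norm (G t) * exp (r * norm (\<phi> t)) \<le> norm (G t) * exp (r * (x + y))"
        by (rule mult_left_mono) (fact, rule norm_ge_zero)
      also have "\<dots> = norm (g t * exp ((w0 + v) * \<phi> t))"
      proof -
        have "exp (r * (x + y)) = norm (exp (v * \<phi> t))" by (simp only: norm_exp_eq_Re v(2))
        then show ?thesis by (simp add: G_def norm_mult exp_add distrib_right)
      qed
      also have "\<dots> \<le> D t" unfolding D_def using v(1) by (intro member_le_sum) (auto simp: V_def)
      finally show ?thesis .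
    qed
    define a where "a = (\<lambda>n. LINT t|M. G t * (\<phi> t ^ n / fact n))"
    have "(\<lambda>n. a n * (w - w0) ^ n) sums (LINT t|M. g t * exp (w * \<phi> t))" if w: "w \<in> ball w0 r" for w
    proof -
      define h where "h = w - w0"
      have h: "norm h \<le> r" using w by (simp add: h_def dist_norm norm_minus_commute)
      define f where "f = (\<lambda>n t. G t * ((h * \<phi> t) ^ n / fact n))"
      have measf: "f n \<in> borel_measurable M" for n
        unfolding f_def using measG meas by measurable
      have nf: "norm (f n t) = norm (G t) * (norm (h * \<phi> t) ^ n / fact n)" for n t
        by (simp add: f_def norm_mult norm_divide norm_power)
      have se: "(\<lambda>n. norm (f n t)) sums (norm (G t) * exp (norm (h * \<phi> t)))" for t
        unfolding nf using sums_mult[where c = "norm (G t)", OF exp_converges[of "norm (h * \<phi> t)"]]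
        by (simp add: scaleR_conv_of_real divide_inverse mult_ac)
      have le: "norm (G t) * exp (norm (h * \<phi> t)) \<le> D t" for t
      proof (rule order_trans[OF mult_left_mono dom])
        show "exp (norm (h * \<phi> t)) \<le> exp (r * norm (\<phi> t))" using h by (simp add: norm_mult mult_right_mono)
      qed auto
      have partial: "(\<Sum>n<k. norm (f n t)) \<le> D t" for k t
        using sum_le_suminf[OF sums_summable[OF se[of t]], of "{..<k}"] se[of t] le[of t] by (auto simp: sums_iff)
      have intf: "integrable M (f n)" for n
      proof (rule Bochner_Integration.integrable_bound[OF intD measf])
        have "norm (f n t) \<le> (\<Sum>i<Suc n. norm (f i t))" for t by (intro member_le_sum) auto
        then have "norm (f n t) \<le> D t" for t using partial[where k = "Suc n"] by (rule order_trans)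
        then show "AE x in M. norm (f n x) \<le> norm (D x)" by (intro always_eventually) (auto intro: order_trans[OF _ abs_ge_self])
      qed
      have "(\<lambda>n. integral\<^sup>L M (f n)) sums (LINT t|M. (\<Sum>n. f n t))"
      proof (rule sums_integral[OF intf])
        show "AE x in M. summable (\<lambda>i. norm (f i x))" using se by (auto intro: sums_summable)
        show "summable (\<lambda>i. LINT x|M. norm (f i x))"
        proof (rule summableI_nonneg_bounded)
          fix k
          have "(\<Sum>i<k. LINT x|M. norm (f i x)) = (LINT x|M. (\<Sum>i<k. norm (f i x)))"
            using intf by (subst Bochner_Integration.integral_sum) auto
          also have "\<dots> \<le> integral\<^sup>L M D" using intf intD partial by (intro integral_mono) auto
          finally show "(\<Sum>i<k. LINT x|M. norm (f i x)) \<le> integral\<^sup>L M D" .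
        qed auto
      qed
      moreover have "(\<Sum>n. f n t) = g t * exp (w * \<phi> t)" for t
      proof -
        have "(\<lambda>n. f n t) sums (G t * exp (h * \<phi> t))"
          unfolding f_def using sums_mult[where c = "G t", OF exp_converges[of "h * \<phi> t"]]
          by (simp add: scaleR_conv_of_real divide_inverse mult_ac)
        then show ?thesis by (simp add: sums_iff G_def h_def exp_add[symmetric] algebra_simps)
      qed
      moreover have "integral\<^sup>L M (f n) = a n * (w - w0) ^ n" for n
      proof -
        have "f n = (\<lambda>t. G t * (\<phi> t ^ n / fact n) * h ^ n)"
          by (simp add: f_def power_mult_distrib fun_eq_iff mult_ac)
        then show ?thesis unfolding a_def h_def[symmetric] by (simp only: integral_mult_left_zero)
      qed
      ultimately show ?thesis by simp
    qed
    then have "(\<lambda>w. LINT t|M. g t * exp (w * \<phi> t)) holomorphic_on ball w0 r"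
      by (rule power_series_holomorphic)
    then show ?thesis using r by blast
  qed
  then have "(\<lambda>w. LINT t|M. g t * exp (w * \<phi> t)) analytic_on U"
    unfolding analytic_on_def by simp
  then show ?thesis by (rule analytic_imp_holomorphic)
qed

section \<open>Integrals along rays\<close>

definition ray_integral :: "(complex \<Rightarrow> complex) \<Rightarrow> complex \<Rightarrow> complex \<Rightarrow> complex" where
  "ray_integral f v d = (LINT t:{0..}|lborel. f (v + of_real t * d) * d)"

definition ray_integrable :: "(complex \<Rightarrow> complex) \<Rightarrow> complex \<Rightarrow> complex \<Rightarrow> bool" where
  "ray_integrable f v d \<longleftrightarrow> set_integrable lborel {0..} (\<lambda>t. f (v + of_real t * d) * d)"

lemma ray_integrable_powr:
  assumes cont: "continuous_on {0..} (\<lambda>t. f (v + of_real t * d))"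
    and e: "e < -1" and bd: "eventually (\<lambda>t. norm (f (v + of_real t * d)) \<le> C * t powr e) at_top"
  shows "ray_integrable f v d"
proof -
  let ?f = "\<lambda>t. f (v + of_real t * d) * d"
  obtain T0 where T0: "\<And>t. t \<ge> T0 \<Longrightarrow> norm (f (v + of_real t * d)) \<le> C * t powr e"
    using bd by (auto simp: eventually_at_top_linorder)
  define T where "T = max 1 T0"
  have T: "T \<ge> 1" "\<And>t. t \<ge> T \<Longrightarrow> norm (f (v + of_real t * d)) \<le> C * t powr e"
    using T0 by (auto simp: T_def)
  have contf: "continuous_on {0..} ?f" using cont by (intro continuous_intros)
  have i1: "set_integrable lborel {0..T} ?f"
    by (intro borel_integrable_atLeastAtMost' continuous_on_subset[OF contf]) auto
  have ip: "set_integrable lborel {T..} (\<lambda>t. C * t powr e * norm d)"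
  proof -
    have "((\<lambda>t. t powr e) has_integral - (T powr (e + 1)) / (e + 1)) {T..}"
      using has_integral_powr_to_inf[OF e, of T] T(1) by simp
    then have "(\<lambda>t. t powr e) absolutely_integrable_on {T..}"
      by (intro nonnegative_absolutely_integrable_1) (auto simp: integrable_on_def)
    then have "set_integrable lborel {T..} (\<lambda>t. t powr e)"
      by (simp add: set_integrable_def integrable_completion)
    then show ?thesis by (intro set_integrable_mult_left set_integrable_mult_right)
  qed
  have i2: "set_integrable lborel {T..} ?f"
  proof (rule set_integrable_bound[OF ip])
    show "set_borel_measurable lborel {T..} ?f"
      unfolding set_borel_measurable_def
      using borel_measurable_continuous_on_indicator[of "{T..}" ?f] continuous_on_subset[OF contf, of "{T..}"] T(1) by auto
    show "AE x in lborel. x \<in> {T..} \<longrightarrow> norm (?f x) \<le> norm (C * x powr e * norm d)"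
    proof (intro always_eventually allI impI)
      fix x assume "x \<in> {T..}"
      then have "norm (?f x) \<le> C * x powr e * norm d"
        unfolding norm_mult using T(2) by (intro mult_right_mono) auto
      then show "norm (?f x) \<le> norm (C * x powr e * norm d)" unfolding real_norm_def by linarith
    qed
  qed
  have "{0..T} \<union> {T..} = {0..}" using T(1) by auto
  then show ?thesis unfolding ray_integrable_def using set_integrable_Un[OF i1 i2] by simp
qed

lemma ray_integrable_exp_decay:
  assumes cont: "continuous_on {0..} (\<lambda>t. f (v + of_real t * d))"
    and e: "\<eta> > 0" and bd: "eventually (\<lambda>t. norm (f (v + of_real t * d)) \<le> C * exp (- \<eta> * t)) at_top"
  shows "ray_integrable f v d"
proof (rule ray_integrable_powr[OF cont, of "-2" "\<bar>C\<bar>"])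
  have "((\<lambda>t. t powr 2 * exp (- \<eta> * t)) \<longlongrightarrow> 0) at_top" using e by real_asymp
  then have "eventually (\<lambda>t. t powr 2 * exp (- \<eta> * t) < 1) at_top" by (rule order_tendstoD) simp
  then show "eventually (\<lambda>t. norm (f (v + of_real t * d)) \<le> \<bar>C\<bar> * t powr (-2)) at_top"
    using bd eventually_gt_at_top[of 0]
  proof eventually_elim
    case (elim t)
    have "exp (- \<eta> * t) \<le> t powr (-2)" using elim by (simp add: powr_minus field_simps)
    then have "C * exp (- \<eta> * t) \<le> \<bar>C\<bar> * t powr (-2)"
      by (intro mult_mono) auto
    then show ?case using elim by linarith
  qed
qed simp

text \<open>Makes the Lebesgue integral along a ray a limit of contour integrals over segments, to
  which Cauchy's theorem and primitives apply.\<close>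

lemma ray_integral_truncated:
  assumes "ray_integrable f v d"
    and cont: "continuous_on {0..} (\<lambda>t. f (v + of_real t * d))"
  shows "(\<lambda>n. contour_integral (linepath v (v + of_real (real n) * d)) f) \<longlonglongrightarrow> ray_integral f v d"
proof -
  have "((\<lambda>b. LINT t:{0..b}|lborel. f (v + of_real t * d) * d) \<longlongrightarrow> ray_integral f v d) at_top"
    unfolding ray_integral_def using assms(1)
    by (intro tendsto_set_lebesgue_integral_at_top) (auto simp: ray_integrable_def)
  then have l: "(\<lambda>n. LINT t:{0..real n}|lborel. f (v + of_real t * d) * d) \<longlonglongrightarrow> ray_integral f v d"
    by (rule filterlim_compose[OF _ filterlim_real_sequentially])
  have "contour_integral (linepath v (v + of_real (real n) * d)) f = (LINT t:{0..real n}|lborel. f (v + of_real t * d) * d)"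
    if n: "n > 0" for n :: nat
  proof -
    let ?F = "\<lambda>t. f (v + of_real t * d) * d"
    have si: "set_integrable lborel {0..real n} ?F"
      using cont by (intro borel_integrable_atLeastAtMost' continuous_intros continuous_on_subset[OF cont]) auto
    have "(?F has_integral (LINT t:{0..real n}|lborel. ?F t)) {0..real n}"
      unfolding set_borel_integral_eq_integral(2)[OF si]
      by (rule integrable_integral[OF set_borel_integral_eq_integral(1)[OF si]])
    then have "((\<lambda>x. ?F (real n * x)) has_integral (1 / real n) *\<^sub>R (LINT t:{0..real n}|lborel. ?F t)) ((\<lambda>x. x / real n) ` {0..real n})"
      using n by (subst abs_of_nat[symmetric], intro has_integral_stretch_real) auto
    also have "(\<lambda>x. x / real n) ` {0..real n} = {0..1}"
      using n image_divide_atLeastAtMost[of "real n" 0 "real n"] by simp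
    finally have "((\<lambda>x. of_real (real n) * ?F (real n * x)) has_integral of_real (real n) * ((1 / real n) *\<^sub>R (LINT t:{0..real n}|lborel. ?F t))) {0..1}"
      by (intro has_integral_mult_right)
    then have "((\<lambda>x. of_real (real n) * ?F (real n * x)) has_integral (LINT t:{0..real n}|lborel. ?F t)) {0..1}"
      using n by (simp add: scaleR_conv_of_real)
    moreover have lp: "f (linepath v (v + of_real (real n) * d) x) * (v + of_real (real n) * d - v) = of_real (real n) * ?F (real n * x)" for x
      by (simp add: linepath_def scaleR_conv_of_real algebra_simps)
    ultimately have "(f has_contour_integral (LINT t:{0..real n}|lborel. ?F t)) (linepath v (v + of_real (real n) * d))"
      unfolding has_contour_integral_linepath lp by simp
    then show ?thesis by (rule contour_integral_unique)
  qed
  then have "eventually (\<lambda>n. (LINT t:{0..real n}|lborel. f (v + of_real t * d) * d) = contour_integral (linepath v (v + of_real (real n) * d)) f) sequentially"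
    by (intro eventually_mono[OF eventually_gt_at_top[of 0]]) auto
  from Lim_transform_eventually[OF l this] show ?thesis .
qed

text \<open>Cauchy's theorem for a truncated sector or strip, whose far side is a chord.\<close>

lemma ray_integral_move:
  assumes C: "convex C" and hol: "f holomorphic_on C"
    and in1: "\<And>t. t \<ge> 0 \<Longrightarrow> v1 + of_real t * d1 \<in> C" and in2: "\<And>t. t \<ge> 0 \<Longrightarrow> v2 + of_real t * d2 \<in> C"
    and i1: "ray_integrable f v1 d1" and i2: "ray_integrable f v2 d2"
    and e: "e < - 1"
    and dec: "eventually (\<lambda>R. \<forall>s\<in>closed_segment (v1 + of_real R * d1) (v2 + of_real R * d2). norm (f s) \<le> B * R powr e) at_top"
  shows "ray_integral f v1 d1 = contour_integral (linepath v1 v2) f + ray_integral f v2 d2"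
proof -
  have contC: "continuous_on C f" using hol by (rule holomorphic_on_imp_continuous_on)
  have cont: "continuous_on {0..} (\<lambda>t. f (v1 + of_real t * d1))" "continuous_on {0..} (\<lambda>t. f (v2 + of_real t * d2))"
    using in1 in2 by (auto intro!: continuous_on_compose2[OF contC] continuous_intros)
  define chord where "chord = (\<lambda>n::nat. contour_integral (linepath (v1 + of_real (real n) * d1) (v2 + of_real (real n) * d2)) f)"
  have v: "v1 \<in> C" "v2 \<in> C" using in1[of 0] in2[of 0] by auto
  have ci: "f contour_integrable_on linepath a b" if "a \<in> C" "b \<in> C" for a b
    using that C by (intro contour_integrable_continuous_linepath continuous_on_subset[OF contC] closed_segment_subset)
  have eq: "contour_integral (linepath v1 (v1 + of_real (real n) * d1)) f
      = contour_integral (linepath v1 v2) f + contour_integral (linepath v2 (v2 + of_real (real n) * d2)) f - chord n" for n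
  proof -
    define p where "p = v1 + of_real (real n) * d1"
    define q where "q = v2 + of_real (real n) * d2"
    have pq: "p \<in> C" "q \<in> C" using in1[of "real n"] in2[of "real n"] by (auto simp: p_def q_def)
    have "(f has_contour_integral 0) (linepath v1 v2 +++ linepath v2 q +++ linepath q p +++ linepath p v1)"
    proof (rule Cauchy_theorem_convex_simple[OF hol C])
      show "path_image (linepath v1 v2 +++ linepath v2 q +++ linepath q p +++ linepath p v1) \<subseteq> C"
        using v pq by (intro subset_path_image_join) (simp_all add: closed_segment_subset[OF _ _ C])
    qed (auto intro!: valid_path_join)
    then have "contour_integral (linepath v1 v2) f + (contour_integral (linepath v2 q) f + (contour_integral (linepath q p) f + contour_integral (linepath p v1) f)) = 0"
      using v pq ci by (auto dest!: contour_integral_unique)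
    moreover have "contour_integral (linepath q p) f = - contour_integral (linepath p q) f"
      "contour_integral (linepath p v1) f = - contour_integral (linepath v1 p) f"
      using pq v by (intro contour_integral_reverse_linepath continuous_on_subset[OF contC] closed_segment_subset C; simp)+
    ultimately show ?thesis unfolding chord_def p_def[symmetric] q_def[symmetric]
      by (simp add: add_eq_0_iff algebra_simps)
  qed
  \<comment> \<open>The chord has length at most K n and the integrand on it is at most |B| n^e, so
    its contribution is of order n^(e + 1), which tends to 0 for e < -1.\<close>
  have "chord \<longlonglongrightarrow> 0"
  proof (rule Lim_null_comparison)
    define K where "K = norm (v2 - v1) + norm (d2 - d1)"
    have "eventually (\<lambda>n. \<forall>s\<in>closed_segment (v1 + of_real (real n) * d1) (v2 + of_real (real n) * d2). norm (f s) \<le> B * real n powr e) sequentially"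
      using dec by (rule eventually_compose_filterlim[OF _ filterlim_real_sequentially])
    then show "eventually (\<lambda>n. norm (chord n) \<le> (\<bar>B\<bar> * K) * (real n powr (e + 1))) sequentially"
      using eventually_gt_at_top[of 0]
    proof eventually_elim
      case (elim n)
      define p where "p = v1 + of_real (real n) * d1"
      define q where "q = v2 + of_real (real n) * d2"
      have pq: "p \<in> C" "q \<in> C" using in1[of "real n"] in2[of "real n"] by (auto simp: p_def q_def)
      have "norm (chord n) \<le> (\<bar>B\<bar> * real n powr e) * norm (q - p)"
        unfolding chord_def p_def[symmetric] q_def[symmetric]
      proof (rule contour_integral_bound_linepath[OF ci[OF pq]])
        fix s assume "s \<in> closed_segment p q"
        then have "norm (f s) \<le> B * real n powr e" using elim(1) by (simp add: p_def q_def)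
        also have "\<dots> \<le> \<bar>B\<bar> * real n powr e" by (intro mult_right_mono) auto
        finally show "norm (f s) \<le> \<bar>B\<bar> * real n powr e" .
      qed auto
      also have "norm (q - p) \<le> K * real n"
      proof -
        have "q - p = (v2 - v1) + of_real (real n) * (d2 - d1)" by (simp add: p_def q_def algebra_simps)
        then have "norm (q - p) \<le> norm (v2 - v1) + real n * norm (d2 - d1)"
          using norm_triangle_ineq[of "v2 - v1" "of_real (real n) * (d2 - d1)"] by (simp add: norm_mult)
        also have "\<dots> \<le> real n * norm (v2 - v1) + real n * norm (d2 - d1)"
          using elim(2) by (intro add_right_mono) (auto simp: mult_le_cancel_right1)
        finally show ?thesis by (simp add: K_def algebra_simps)
      qed
      also have "(\<bar>B\<bar> * real n powr e) * (K * real n) = (\<bar>B\<bar> * K) * (real n powr (e + 1))"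
        using elim(2) by (simp add: powr_add)
      finally show ?case by (simp add: mult_left_mono)
    qed
    have "((\<lambda>x. x powr (e + 1)) \<longlongrightarrow> 0) at_top" using e by (intro tendsto_neg_powr filterlim_ident) auto
    then have "(\<lambda>n. real n powr (e + 1)) \<longlonglongrightarrow> 0" by (rule filterlim_compose[OF _ filterlim_real_sequentially])
    then show "(\<lambda>n. (\<bar>B\<bar> * K) * (real n powr (e + 1))) \<longlonglongrightarrow> 0" by (rule tendsto_mult_right_zero)
  qed
  then have "(\<lambda>n. contour_integral (linepath v1 v2) f + contour_integral (linepath v2 (v2 + of_real (real n) * d2)) f - chord n)
      \<longlonglongrightarrow> contour_integral (linepath v1 v2) f + ray_integral f v2 d2 - 0"
    by (intro tendsto_intros ray_integral_truncated i2 cont)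
  then have "(\<lambda>n. contour_integral (linepath v1 (v1 + of_real (real n) * d1)) f) \<longlonglongrightarrow> contour_integral (linepath v1 v2) f + ray_integral f v2 d2"
    unfolding eq[symmetric] by simp
  with ray_integral_truncated[OF i1 cont(1)] show ?thesis by (rule LIMSEQ_unique)
qed

section \<open>Decomposition of a contour into a middle part and two rays\<close>

definition mid_path :: "(real \<Rightarrow> complex) \<Rightarrow> real \<Rightarrow> real \<Rightarrow> complex" where
  "mid_path \<gamma> T = (\<lambda>u. \<gamma> (- T + 2 * T * u))"

definition contour_tails :: "(real \<Rightarrow> complex) \<Rightarrow> real \<Rightarrow> complex \<Rightarrow> complex \<Rightarrow> bool" where
  "contour_tails \<gamma> T dp dm \<longleftrightarrow> \<gamma> piecewise_C1_differentiable_on UNIV \<and> T > 0 \<and> dp \<noteq> 0 \<and> dm \<noteq> 0 \<and>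
     (\<forall>t\<ge>0. \<gamma> (T + t) = \<gamma> T + of_real t * dp) \<and> (\<forall>t\<ge>0. \<gamma> (- T - t) = \<gamma> (- T) + of_real t * dm)"

text \<open>The directions are arguments of their own, so the middle part of a contour can be
  combined with ends other than its own; this is what turning the ends means below. Both rays are
  parametrised outward, hence the minus sign at the lower one.\<close>

definition contour_sum :: "(real \<Rightarrow> complex) \<Rightarrow> real \<Rightarrow> complex \<Rightarrow> complex \<Rightarrow> (complex \<Rightarrow> complex) \<Rightarrow> complex" where
  "contour_sum \<gamma> T dp dm f = contour_integral (mid_path \<gamma> T) f
     + ray_integral f (\<gamma> T) dp - ray_integral f (\<gamma> (- T)) dm"

lemma contour_tails_mono:
  assumes "contour_tails \<gamma> T dp dm" "T \<le> T'"
  shows "contour_tails \<gamma> T' dp dm"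
proof -
  have p: "\<gamma> (T + t) = \<gamma> T + of_real t * dp" "\<gamma> (- T - t) = \<gamma> (- T) + of_real t * dm" if "t \<ge> 0" for t
    using assms(1) that unfolding contour_tails_def by auto
  have "\<gamma> (T' + t) = \<gamma> T' + of_real t * dp" "\<gamma> (- T' - t) = \<gamma> (- T') + of_real t * dm" if "t \<ge> 0" for t
  proof -
    have e1: "\<gamma> (T' + t) = \<gamma> T + of_real (T' - T + t) * dp" "\<gamma> T' = \<gamma> T + of_real (T' - T) * dp"
      using p(1)[of "T' - T + t"] p(1)[of "T' - T"] assms(2) that by simp_all
    show "\<gamma> (T' + t) = \<gamma> T' + of_real t * dp" unfolding e1 by (simp add: algebra_simps)
    have e2: "\<gamma> (- T' - t) = \<gamma> (- T) + of_real (T' - T + t) * dm" "\<gamma> (- T') = \<gamma> (- T) + of_real (T' - T) * dm"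
      using p(2)[of "T' - T + t"] p(2)[of "T' - T"] assms(2) that by simp_all
    show "\<gamma> (- T' - t) = \<gamma> (- T') + of_real t * dm" unfolding e2 by (simp add: algebra_simps)
  qed
  then show ?thesis using assms unfolding contour_tails_def by auto
qed

lemma separating_contour_tails:
  assumes "separating_contour Lp Lm \<theta>m \<theta>p \<gamma>"
  obtains T where "contour_tails \<gamma> T (cis \<theta>p) (cis \<theta>m)"
proof -
  obtain cp cm where c: "eventually (\<lambda>t. \<gamma> t = cp + of_real t * cis \<theta>p) at_top"
    "eventually (\<lambda>t. \<gamma> t = cm + of_real (- t) * cis \<theta>m) at_bot" and pc: "\<gamma> piecewise_C1_differentiable_on UNIV"
    using assms unfolding separating_contour_def by blast
  obtain T1 where T1: "\<And>t. t \<ge> T1 \<Longrightarrow> \<gamma> t = cp + of_real t * cis \<theta>p"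
    using c(1) by (auto simp: eventually_at_top_linorder)
  obtain T2 where T2: "\<And>t. t \<le> T2 \<Longrightarrow> \<gamma> t = cm + of_real (- t) * cis \<theta>m"
    using c(2) by (auto simp: eventually_at_bot_linorder)
  define T where "T = max 1 (max T1 (- T2))"
  have T: "T \<ge> T1" "- T \<le> T2" "T > 0" by (auto simp: T_def)
  show ?thesis
  proof (rule that[of T])
    show "contour_tails \<gamma> T (cis \<theta>p) (cis \<theta>m)"
      unfolding contour_tails_def using pc T T1[of T] T2[of "- T"]
      by (auto simp: T1 T2 algebra_simps)
  qed
qed

lemma contour_tails_range:
  assumes "contour_tails \<gamma> T dp dm" "t \<ge> 0"
  shows "\<gamma> T + of_real t * dp \<in> range \<gamma>" "\<gamma> (- T) + of_real t * dm \<in> range \<gamma>"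
  using assms unfolding contour_tails_def by (metis rangeI)+

lemma mid_path_simps:
  assumes "contour_tails \<gamma> T dp dm"
  shows "valid_path (mid_path \<gamma> T)" "path_image (mid_path \<gamma> T) \<subseteq> range \<gamma>"
    "pathstart (mid_path \<gamma> T) = \<gamma> (- T)" "pathfinish (mid_path \<gamma> T) = \<gamma> T"
proof -
  have T: "T > 0" and pc: "\<gamma> piecewise_C1_differentiable_on UNIV" using assms by (auto simp: contour_tails_def)
  have aff: "(\<lambda>u. - T + 2 * T * u) piecewise_C1_differentiable_on {0..1}"
    by (intro C1_differentiable_imp_piecewise derivative_intros)
  have fin: "finite ({0..1} \<inter> (\<lambda>u. - T + 2 * T * u) -` {x})" for x
  proof (rule finite_subset)
    show "{0..1} \<inter> (\<lambda>u. - T + 2 * T * u) -` {x} \<subseteq> {(x + T) / (2 * T)}"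
      using T by (auto simp: field_simps)
  qed auto
  have "(\<gamma> \<circ> (\<lambda>u. - T + 2 * T * u)) piecewise_C1_differentiable_on {0..1}"
    by (rule piecewise_C1_differentiable_compose[OF aff piecewise_C1_differentiable_on_subset[OF pc] fin]) auto
  then show "valid_path (mid_path \<gamma> T)" by (simp add: valid_path_def mid_path_def o_def)
  show "path_image (mid_path \<gamma> T) \<subseteq> range \<gamma>" by (auto simp: path_image_def mid_path_def)
  show "pathstart (mid_path \<gamma> T) = \<gamma> (- T)" "pathfinish (mid_path \<gamma> T) = \<gamma> T"
    by (auto simp: pathstart_def pathfinish_def mid_path_def)
qed

lemma mid_path_has_integral:
  assumes ct: "contour_tails \<gamma> T dp dm" and S: "open S" "range \<gamma> \<subseteq> S" and f: "f holomorphic_on S"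
  shows "((\<lambda>t. f (\<gamma> t) * vector_derivative \<gamma> (at t)) has_integral contour_integral (mid_path \<gamma> T) f) {- T..T}"
proof -
  have T: "T > 0" and pc: "\<gamma> piecewise_C1_differentiable_on UNIV" using ct by (auto simp: contour_tails_def)
  let ?\<eta> = "mid_path \<gamma> T"
  have "f contour_integrable_on ?\<eta>"
    by (rule contour_integrable_holomorphic_simple[OF f S(1)]) (use mid_path_simps[OF ct] S in auto)
  then have "((\<lambda>u. f (?\<eta> u) * vector_derivative ?\<eta> (at u)) has_integral contour_integral ?\<eta> f) (cbox 0 1)"
    using has_contour_integral_integral has_contour_integral by fastforce
  from has_integral_affinity'[OF this, of "1 / (2 * T)" "1/2"] T
  have "((\<lambda>x. f (?\<eta> (x / (2 * T) + 1/2)) * vector_derivative ?\<eta> (at (x / (2 * T) + 1/2)))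
      has_integral (2 * T) *\<^sub>R contour_integral ?\<eta> f) {- T..T}"
    by (simp add: field_simps)
  from has_integral_cmul[OF this, of "1 / (2 * T)"] T
  have hi: "((\<lambda>x. (1 / (2 * T)) *\<^sub>R (f (?\<eta> (x / (2 * T) + 1/2)) * vector_derivative ?\<eta> (at (x / (2 * T) + 1/2))))
      has_integral contour_integral ?\<eta> f) {- T..T}"
    by simp
  obtain K where K: "finite K" "\<gamma> C1_differentiable_on (UNIV - K)"
    using pc unfolding piecewise_C1_differentiable_on_def by blast
  show ?thesis
  proof (rule has_integral_spike_finite[OF K(1) _ hi])
    fix x assume x: "x \<in> {- T..T} - K"
    then obtain D where D: "(\<gamma> has_vector_derivative D) (at x)"
      using K(2) unfolding C1_differentiable_on_def by blast
    define u where "u = x / (2 * T) + 1/2"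
    have xu: "- T + 2 * T * u = x" using T by (simp add: u_def field_simps)
    have "((\<lambda>u. - T + 2 * T * u) has_vector_derivative 2 * T) (at u)"
      by (auto intro!: derivative_eq_intros simp flip: has_real_derivative_iff_has_vector_derivative)
    from vector_diff_chain_at[OF this, of \<gamma> D] D xu
    have "(?\<eta> has_vector_derivative (2 * T) *\<^sub>R D) (at u)"
      by (simp add: mid_path_def o_def)
    then have "vector_derivative ?\<eta> (at u) = (2 * T) *\<^sub>R D" by (rule vector_derivative_at)
    moreover have "vector_derivative \<gamma> (at x) = D" using D by (rule vector_derivative_at)
    moreover have "?\<eta> u = \<gamma> x" by (simp only: mid_path_def xu)
    ultimately show "f (\<gamma> x) * vector_derivative \<gamma> (at x) = (1 / (2 * T)) *\<^sub>R (f (?\<eta> (x / (2 * T) + 1/2)) * vector_derivative ?\<eta> (at (x / (2 * T) + 1/2)))"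
      using T unfolding u_def[symmetric] by simp
  qed
qed

lemma upper_tail_has_integral:
  assumes ct: "contour_tails \<gamma> T dp dm" and r: "ray_integrable f (\<gamma> T) dp"
  shows "((\<lambda>t. f (\<gamma> t) * vector_derivative \<gamma> (at t)) has_integral ray_integral f (\<gamma> T) dp) {T..}"
proof -
  have ray: "\<gamma> (T + t) = \<gamma> T + of_real t * dp" if "t \<ge> 0" for t
    using ct that unfolding contour_tails_def by auto
  define G where "G = (\<lambda>t. indicator {0..} t *\<^sub>R (f (\<gamma> T + of_real t * dp) * dp))"
  have iG: "integrable lborel G" using r by (simp add: ray_integrable_def set_integrable_def G_def)
  have rG: "(LINT t|lborel. G t) = ray_integral f (\<gamma> T) dp"
    by (simp only: ray_integral_def set_lebesgue_integral_def G_def)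
  have "integrable lborel (\<lambda>t. G (- T + 1 * t))" by (rule lborel_integrable_real_affine[OF iG]) simp
  moreover have "(LINT t|lborel. G (- T + 1 * t)) = ray_integral f (\<gamma> T) dp"
    using lborel_integral_real_affine[of "1" G "- T"] rG by simp
  ultimately have "((\<lambda>t. G (- T + 1 * t)) has_integral ray_integral f (\<gamma> T) dp) UNIV"
    using has_integral_integral_lborel by fastforce
  moreover have Gt: "G (- T + 1 * t) = (if t \<in> {T..} then f (\<gamma> t) * dp else 0)" for t
    using ray[of "t - T"] by (auto simp: G_def indicator_def)
  ultimately have h: "((\<lambda>t. f (\<gamma> t) * dp) has_integral ray_integral f (\<gamma> T) dp) {T..}"
    unfolding Gt has_integral_restrict_UNIV by simp
  show ?thesis
  proof (rule has_integral_spike_finite[of "{T}", OF _ _ h])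
    fix t assume t: "t \<in> {T..} - {T}"
    have "((\<lambda>t. \<gamma> T + of_real (t - T) * dp) has_vector_derivative dp) (at t)"
      by (auto intro!: derivative_eq_intros simp: has_vector_derivative_def scaleR_conv_of_real)
    then have "(\<gamma> has_vector_derivative dp) (at t)"
    proof (rule has_vector_derivative_transform_within_open)
      show "\<gamma> T + of_real (s - T) * dp = \<gamma> s" if "s \<in> {T<..}" for s
        using ray[of "s - T"] that by simp
    qed (use t in auto)
    then show "f (\<gamma> t) * vector_derivative \<gamma> (at t) = f (\<gamma> t) * dp" by (simp add: vector_derivative_at)
  qed auto
qed

lemma lower_tail_has_integral:
  assumes ct: "contour_tails \<gamma> T dp dm" and r: "ray_integrable f (\<gamma> (- T)) dm"
  shows "((\<lambda>t. f (\<gamma> t) * vector_derivative \<gamma> (at t)) has_integral - ray_integral f (\<gamma> (- T)) dm) {..- T}"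
proof -
  have ray: "\<gamma> (- T - t) = \<gamma> (- T) + of_real t * dm" if "t \<ge> 0" for t
    using ct that unfolding contour_tails_def by auto
  define G where "G = (\<lambda>t. indicator {0..} t *\<^sub>R (f (\<gamma> (- T) + of_real t * dm) * dm))"
  have iG: "integrable lborel G" using r by (simp add: ray_integrable_def set_integrable_def G_def)
  have rG: "(LINT t|lborel. G t) = ray_integral f (\<gamma> (- T)) dm"
    by (simp only: ray_integral_def set_lebesgue_integral_def G_def)
  have "integrable lborel (\<lambda>t. G (- T + (- 1) * t))" by (rule lborel_integrable_real_affine[OF iG]) simp
  moreover have "(LINT t|lborel. G (- T + (- 1) * t)) = ray_integral f (\<gamma> (- T)) dm"
    using lborel_integral_real_affine[of "- 1" G "- T"] rG by simp
  ultimately have "((\<lambda>t. G (- T + (- 1) * t)) has_integral ray_integral f (\<gamma> (- T)) dm) UNIV"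
    using has_integral_integral_lborel by fastforce
  moreover have Gt: "G (- T + (- 1) * t) = (if t \<in> {..- T} then f (\<gamma> t) * dm else 0)" for t
    using ray[of "- T - t"] by (auto simp: G_def indicator_def)
  ultimately have "((\<lambda>t. f (\<gamma> t) * dm) has_integral ray_integral f (\<gamma> (- T)) dm) {..- T}"
    unfolding Gt has_integral_restrict_UNIV by simp
  then have h: "((\<lambda>t. - (f (\<gamma> t) * dm)) has_integral - ray_integral f (\<gamma> (- T)) dm) {..- T}"
    by (rule has_integral_neg)
  show ?thesis
  proof (rule has_integral_spike_finite[of "{- T}", OF _ _ h])
    fix t assume t: "t \<in> {..- T} - {- T}"
    have "((\<lambda>t. \<gamma> (- T) + of_real (- T - t) * dm) has_vector_derivative - dm) (at t)"
      by (auto intro!: derivative_eq_intros simp: has_vector_derivative_def scaleR_conv_of_real)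
    then have "(\<gamma> has_vector_derivative - dm) (at t)"
    proof (rule has_vector_derivative_transform_within_open)
      show "\<gamma> (- T) + of_real (- T - s) * dm = \<gamma> s" if "s \<in> {..<- T}" for s
        using ray[of "- T - s"] that by simp
    qed (use t in auto)
    then show "f (\<gamma> t) * vector_derivative \<gamma> (at t) = - (f (\<gamma> t) * dm)" by (simp add: vector_derivative_at)
  qed auto
qed

text \<open>Cutting at - T and T splits the gauge integral over the real line into a contour
  integral and two absolutely convergent ray integrals. The lower piece runs inward and changes
  sign.\<close>

lemma line_contour_integral_eq_contour_sum:
  assumes ct: "contour_tails \<gamma> T dp dm" and S: "open S" "range \<gamma> \<subseteq> S" and f: "f holomorphic_on S"
    and r: "ray_integrable f (\<gamma> T) dp" "ray_integrable f (\<gamma> (- T)) dm"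
  shows "line_contour_integral \<gamma> f = contour_sum \<gamma> T dp dm f"
proof -
  have T: "T > 0" using ct by (auto simp: contour_tails_def)
  let ?F = "\<lambda>t. f (\<gamma> t) * vector_derivative \<gamma> (at t)"
  have "(?F has_integral (- ray_integral f (\<gamma> (- T)) dm + contour_integral (mid_path \<gamma> T) f)) ({..- T} \<union> {- T..T})"
  proof (rule has_integral_Un[OF lower_tail_has_integral[OF ct r(2)] mid_path_has_integral[OF ct S f]])
    have "{..- T} \<inter> {- T..T} \<subseteq> {- T}" by auto
    then show "negligible ({..- T} \<inter> {- T..T})" by (meson negligible_sing negligible_subset)
  qed
  moreover have "{..- T} \<union> {- T..T} = {..T}" using T by auto
  ultimately have "(?F has_integral (- ray_integral f (\<gamma> (- T)) dm + contour_integral (mid_path \<gamma> T) f)) {..T}" by simp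
  then have "(?F has_integral (- ray_integral f (\<gamma> (- T)) dm + contour_integral (mid_path \<gamma> T) f) + ray_integral f (\<gamma> T) dp) ({..T} \<union> {T..})"
  proof (rule has_integral_Un[OF _ upper_tail_has_integral[OF ct r(1)]])
    have "{..T} \<inter> {T..} \<subseteq> {T}" by auto
    then show "negligible ({..T} \<inter> {T..})" by (meson negligible_sing negligible_subset)
  qed
  moreover have "{..T} \<union> {T..} = UNIV" by auto
  ultimately show ?thesis unfolding line_contour_integral_def contour_sum_def
    by (simp add: integral_unique algebra_simps)
qed

text \<open>The derivative of the contour need not be bounded. Replacing the middle part by a
  polynomial path makes the dependence on parameters of the integrand accessible.\<close>

lemma mid_path_polynomial:
  assumes ct: "contour_tails \<gamma> T dp dm" and S: "open S" "range \<gamma> \<subseteq> S"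
  obtains h where "polynomial_function h" "path_image h \<subseteq> S"
    "\<And>f. f holomorphic_on S \<Longrightarrow> contour_integral (mid_path \<gamma> T) f = contour_integral h f"
proof -
  note m = mid_path_simps[OF ct]
  have p: "path (mid_path \<gamma> T)" using m(1) by (rule valid_path_imp_path)
  have ps: "path_image (mid_path \<gamma> T) \<subseteq> S" using m(2) S(2) by blast
  from contour_integral_nearby_ends[OF S(1) p ps]
  obtain d where d0: "d > 0" "\<forall>g h. valid_path g \<and> valid_path h \<and>
      (\<forall>t\<in>{0..1}. norm (g t - mid_path \<gamma> T t) < d \<and> norm (h t - mid_path \<gamma> T t) < d) \<and>
      pathstart h = pathstart g \<and> pathfinish h = pathfinish g \<longrightarrow>
      path_image g \<subseteq> S \<and> path_image h \<subseteq> S \<and>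
      (\<forall>f. f holomorphic_on S \<longrightarrow> contour_integral h f = contour_integral g f)" by (elim exE conjE) (rule that)
  have d: "d > 0" "\<And>g h. valid_path g \<Longrightarrow> valid_path h \<Longrightarrow>
      (\<forall>t\<in>{0..1}. norm (g t - mid_path \<gamma> T t) < d \<and> norm (h t - mid_path \<gamma> T t) < d) \<Longrightarrow>
      pathstart h = pathstart g \<Longrightarrow> pathfinish h = pathfinish g \<Longrightarrow>
      path_image g \<subseteq> S \<and> path_image h \<subseteq> S \<and>
      (\<forall>f. f holomorphic_on S \<longrightarrow> contour_integral h f = contour_integral g f)"
    using d0 by blast+
  obtain h where h: "polynomial_function h" "pathstart h = pathstart (mid_path \<gamma> T)" "pathfinish h = pathfinish (mid_path \<gamma> T)"
      "\<And>t. t \<in> {0..1} \<Longrightarrow> norm (h t - mid_path \<gamma> T t) < d"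
    using path_approx_polynomial_function[OF p d(1)] by metis
  have "path_image h \<subseteq> S \<and> (\<forall>f. f holomorphic_on S \<longrightarrow> contour_integral h f = contour_integral (mid_path \<gamma> T) f)"
    using d(2)[OF m(1) valid_path_polynomial_function[OF h(1)]] h d(1) by simp
  then show ?thesis using that[OF h(1)] by auto
qed

text \<open>A polynomial path has a continuous derivative, so for every w the integrand is
  continuous on [0, 1] and \<open>holomorphic_parametric_integral\<close> applies on the whole
  plane.\<close>

lemma holomorphic_contour_integral_polynomial:
  assumes h: "polynomial_function h" "path_image h \<subseteq> S" and f: "continuous_on S f"
  shows "(\<lambda>w. contour_integral h (\<lambda>s. f s * exp (w * s))) holomorphic_on UNIV"
proof -
  obtain h' where h': "polynomial_function h'" "\<And>x. (h has_vector_derivative h' x) (at x)"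
    using has_vector_derivative_polynomial_function[OF h(1)] by metis
  have ch: "continuous_on A h" "continuous_on A h'" for A
    using h(1) h'(1) by (auto intro: continuous_on_polymonial_function)
  have cfh: "continuous_on {0..1} (\<lambda>t. f (h t))"
    by (rule continuous_on_compose2[OF f ch(1)]) (use h(2) in \<open>auto simp: path_image_def\<close>)
  define g where "g = (\<lambda>t. indicator {0..1} t *\<^sub>R (f (h t) * h' t))"
  have si: "set_integrable lborel {0..1} (\<lambda>t. f (h t) * h' t * exp (w * h t))" for w
    by (intro borel_integrable_atLeastAtMost' continuous_intros cfh ch)
  have "(\<lambda>w. LINT t|lborel. g t * exp (w * h t)) holomorphic_on UNIV"
  proof (rule holomorphic_parametric_integral)
    fix w
    show "integrable lborel (\<lambda>t. g t * exp (w * h t))"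
      using si[of w] by (simp add: set_integrable_def g_def)
    show "h \<in> borel_measurable lborel" using borel_measurable_continuous_onI[OF ch(1)] by simp
  qed auto
  moreover have "contour_integral h (\<lambda>s. f s * exp (w * s)) = (LINT t|lborel. g t * exp (w * h t))" for w
  proof -
    have "((\<lambda>t. f (h t) * h' t * exp (w * h t)) has_integral (LINT t:{0..1}|lborel. f (h t) * h' t * exp (w * h t))) {0..1}"
      unfolding set_borel_integral_eq_integral(2)[OF si]
      by (rule integrable_integral[OF set_borel_integral_eq_integral(1)[OF si]])
    then have "((\<lambda>s. f s * exp (w * s)) has_contour_integral (LINT t:{0..1}|lborel. f (h t) * h' t * exp (w * h t))) h"
      unfolding has_contour_integral vector_derivative_at[OF h'(2)] by (simp add: mult_ac)
    then show ?thesis by (simp add: contour_integral_unique set_lebesgue_integral_def g_def)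
  qed
  ultimately show ?thesis by simp
qed

lemma holomorphic_ray_integral:
  assumes U: "open U" and int: "\<And>w. w \<in> U \<Longrightarrow> ray_integrable (\<lambda>s. f s * exp (w * s)) v d"
  shows "(\<lambda>w. ray_integral (\<lambda>s. f s * exp (w * s)) v d) holomorphic_on U"
proof -
  define g where "g = (\<lambda>t. indicator {0..} t *\<^sub>R (f (v + of_real t * d) * d))"
  have "(\<lambda>w. LINT t|lborel. g t * exp (w * (v + of_real t * d))) holomorphic_on U"
  proof (rule holomorphic_parametric_integral[OF U])
    fix w assume "w \<in> U"
    from int[OF this] show "integrable lborel (\<lambda>t. g t * exp (w * (v + of_real t * d)))"
      by (simp add: ray_integrable_def set_integrable_def g_def mult_ac)
  qed measurable
  moreover have "ray_integral (\<lambda>s. f s * exp (w * s)) v d = (LINT t|lborel. g t * exp (w * (v + of_real t * d)))" for w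
    unfolding ray_integral_def set_lebesgue_integral_def g_def
    by (intro Bochner_Integration.integral_cong) (simp_all add: mult_ac)
  ultimately show ?thesis by simp
qed

section \<open>Change of contour\<close>

lemma closed_ray:
  fixes v d :: complex
  assumes "d \<noteq> 0"
  shows "closed ((\<lambda>t. v + of_real t * d) ` {0..})"
proof -
  have "closed ((\<lambda>t. of_real t * d) ` {0..})"
    using assms by (intro closed_injective_linear_image) (auto simp: linear_iff inj_def distrib_right scaleR_conv_of_real)
  then have "closed ((+) v ` ((\<lambda>t. of_real t * d) ` {0..}))" by (rule closed_translation)
  then show ?thesis by (simp add: image_image)
qed

text \<open>The range is a compact arc and two closed rays. Being closed, it has a complement with
  open components, on which connectedness arguments can be run.\<close>

lemma closed_range_contour:
  assumes ct: "contour_tails \<gamma> T dp dm"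
  shows "closed (range \<gamma>)"
proof -
  have T: "T > 0" "dp \<noteq> 0" "dm \<noteq> 0" and pc: "\<gamma> piecewise_C1_differentiable_on UNIV"
    and ray: "\<And>t. t \<ge> 0 \<Longrightarrow> \<gamma> (T + t) = \<gamma> T + of_real t * dp" "\<And>t. t \<ge> 0 \<Longrightarrow> \<gamma> (- T - t) = \<gamma> (- T) + of_real t * dm"
    using ct by (auto simp: contour_tails_def)
  have "continuous_on {- T..T} \<gamma>"
    using pc by (meson piecewise_C1_differentiable_on_def continuous_on_subset subset_UNIV)
  then have "closed (\<gamma> ` {- T..T})" by (intro compact_imp_closed compact_continuous_image) auto
  moreover have "range \<gamma> = \<gamma> ` {- T..T} \<union> (\<lambda>t. \<gamma> T + of_real t * dp) ` {0..} \<union> (\<lambda>t. \<gamma> (- T) + of_real t * dm) ` {0..}"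
  proof (intro subset_antisym subsetI)
    fix z assume "z \<in> range \<gamma>"
    then obtain t where t: "z = \<gamma> t" by blast
    consider "t \<in> {- T..T}" | "t > T" | "t < - T" by fastforce
    then show "z \<in> \<gamma> ` {- T..T} \<union> (\<lambda>t. \<gamma> T + of_real t * dp) ` {0..} \<union> (\<lambda>t. \<gamma> (- T) + of_real t * dm) ` {0..}"
    proof cases
      case 2
      then have "z = \<gamma> T + of_real (t - T) * dp" using ray(1)[of "t - T"] t by simp
      then show ?thesis using 2 by (intro UnI1 UnI2 image_eqI[of _ _ "t - T"]) auto
    next
      case 3
      then have "z = \<gamma> (- T) + of_real (- T - t) * dm" using ray(2)[of "- T - t"] t by simp
      then show ?thesis using 3 by (intro UnI2 image_eqI[of _ _ "- T - t"]) auto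
    qed (use t in auto)
  qed (use contour_tails_range[OF ct] in auto)
  ultimately show ?thesis using T by (auto intro!: closed_ray)
qed

text \<open>A single Cauchy kernel decays like 1 / |s|, too slowly for an unbounded contour; the
  difference of two decays like 1 / |s|^2. Its integral plays the role of a difference of winding
  numbers.\<close>

definition cauchy_diff :: "complex \<Rightarrow> complex \<Rightarrow> complex \<Rightarrow> complex" where
  "cauchy_diff x y s = 1 / (s - x) - 1 / (s - y)"

lemma holomorphic_cauchy_diff: "x \<notin> S \<Longrightarrow> y \<notin> S \<Longrightarrow> cauchy_diff x y holomorphic_on S"
  unfolding cauchy_diff_def by (intro holomorphic_intros) auto

lemma norm_cauchy_diff_le:
  assumes "norm (s - x) \<ge> r" "norm (s - y) \<ge> r" "r > 0"
  shows "norm (cauchy_diff x y s) \<le> norm (x - y) / r\<^sup>2"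
proof -
  have nz: "s - x \<noteq> 0" "s - y \<noteq> 0" using assms by auto
  then have "cauchy_diff x y s = (x - y) / ((s - x) * (s - y))"
    by (simp add: cauchy_diff_def field_simps)
  then have "norm (cauchy_diff x y s) = norm (x - y) / (norm (s - x) * norm (s - y))"
    by (simp add: norm_divide norm_mult)
  also have "\<dots> \<le> norm (x - y) / (r * r)"
    using assms nz by (intro divide_left_mono mult_mono mult_pos_pos) auto
  finally show ?thesis by (simp add: power2_eq_square)
qed

lemma ray_integrable_cauchy_diff:
  assumes d: "d \<noteq> 0" and av: "\<And>t. t \<ge> 0 \<Longrightarrow> v + of_real t * d \<noteq> x" "\<And>t. t \<ge> 0 \<Longrightarrow> v + of_real t * d \<noteq> y"
  shows "ray_integrable (cauchy_diff x y) v d"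
proof (rule ray_integrable_powr[of _ _ _ "-2" "4 * norm (x - y) / (norm d)\<^sup>2"])
  show "continuous_on {0..} (\<lambda>t. cauchy_diff x y (v + of_real t * d))"
    unfolding cauchy_diff_def using av by (intro continuous_intros) auto
  show "eventually (\<lambda>t. norm (cauchy_diff x y (v + of_real t * d)) \<le> 4 * norm (x - y) / (norm d)\<^sup>2 * t powr - 2) at_top"
    using eventually_gt_at_top[of 0] eventually_ge_at_top[of "2 * norm (v - x) / norm d"]
      eventually_ge_at_top[of "2 * norm (v - y) / norm d"]
  proof eventually_elim
    case (elim t)
    have far: "norm (v + of_real t * d - z) \<ge> t * norm d / 2" if "t \<ge> 2 * norm (v - z) / norm d" for z
    proof -
      have "2 * norm (v - z) \<le> t * norm d" using that d by (simp add: field_simps)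
      moreover have "norm (of_real t * d) - norm (v - z) \<le> norm (of_real t * d + (v - z))"
        by (rule norm_diff_ineq)
      moreover have "norm (of_real t * d) = t * norm d" using elim by (simp add: norm_mult)
      moreover have "of_real t * d + (v - z) = v + of_real t * d - z" by simp
      ultimately show ?thesis by simp
    qed
    have "norm (cauchy_diff x y (v + of_real t * d)) \<le> norm (x - y) / (t * norm d / 2)\<^sup>2"
      using far elim d by (intro norm_cauchy_diff_le) auto
    also have "\<dots> = 4 * norm (x - y) / (norm d)\<^sup>2 * t powr - 2"
      using elim by (simp add: powr_minus powr_numeral field_simps)
    finally show ?case .
  qed
qed auto

text \<open>Outside the large ball the kernel has a single-valued primitive that vanishes at
  infinity. The values at the two joints cancel between the middle part and the rays.\<close>

lemma contour_sum_cauchy_diff_local: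
  assumes ct: "contour_tails \<gamma> T dp dm" and \<rho>: "\<rho> > 0" and disj: "ball a (4 * \<rho>) \<inter> range \<gamma> = {}"
    and xy: "x \<in> ball a \<rho>" "y \<in> ball a \<rho>"
  shows "contour_sum \<gamma> T dp dm (cauchy_diff x y) = 0"
proof -
  define S where "S = - ball a (4 * \<rho>)"
  have T: "dp \<noteq> 0" "dm \<noteq> 0" using ct by (auto simp: contour_tails_def)
  have rS: "range \<gamma> \<subseteq> S" using disj by (auto simp: S_def)
  have far: "norm (s - y) \<ge> 3 * \<rho>" "s \<noteq> x" "s \<noteq> y" "norm ((y - x) / (s - y)) < 1" if "s \<in> S" for s
  proof -
    have s: "dist a s \<ge> 4 * \<rho>" using that by (simp add: S_def)
    have d: "dist a x < \<rho>" "dist a y < \<rho>" using xy by auto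
    show n: "norm (s - y) \<ge> 3 * \<rho>" using s d dist_triangle[of a s y] by (simp add: dist_norm norm_minus_commute)
    show "s \<noteq> x" "s \<noteq> y" using s d \<rho> by auto
    have "norm (y - x) < 2 * \<rho>" using d dist_triangle2[of y x a] by (simp add: dist_norm norm_minus_commute)
    then have "norm (y - x) < norm (s - y)" using n \<rho> by linarith
    then show "norm ((y - x) / (s - y)) < 1" using n \<rho> by (simp add: norm_divide divide_less_eq)
  qed
  \<comment> \<open>A logarithm of (s - x) / (s - y). For s off the ball of radius 4 \<rho> the
    fraction here is less than 1 in modulus, which keeps the argument of \<open>Ln\<close> off its
    cut.\<close>
  define Q where "Q = (\<lambda>s. Ln (1 + (y - x) / (s - y)))"
  have nn: "1 + (y - x) / (s - y) \<notin> \<real>\<^sub>\<le>\<^sub>0" if "s \<in> S" for s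
  proof -
    have "\<bar>Re ((y - x) / (s - y))\<bar> < 1" using far(4)[OF that] abs_Re_le_cmod by (rule le_less_trans[rotated])
    then show ?thesis by (auto simp: complex_nonpos_Reals_iff)
  qed
  have der: "(Q has_field_derivative cauchy_diff x y s) (at s within S)" if "s \<in> S" for s
  proof -
    have nz: "s - x \<noteq> 0" "s - y \<noteq> 0" using far[OF that] by auto
    have e: "1 + (y - x) / (s - y) = (s - x) / (s - y)" using nz by (simp add: field_simps)
    have gen: "inverse (A / B) * (c / (B * B)) = c / (A * B)" if "A \<noteq> 0" "B \<noteq> 0" for A B c :: complex
      using that by (simp add: field_simps)
    have "(Q has_field_derivative inverse (1 + (y - x) / (s - y)) * ((x - y) / ((s - y) * (s - y)))) (at s)"
      unfolding Q_def using nn[OF that] nz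
      by (auto intro!: derivative_eq_intros)
    also have "inverse (1 + (y - x) / (s - y)) * ((x - y) / ((s - y) * (s - y))) = (x - y) / ((s - x) * (s - y))"
      unfolding e by (rule gen) (rule nz)+
    also have "\<dots> = cauchy_diff x y s" using nz by (simp add: cauchy_diff_def field_simps)
    finally show ?thesis by (rule has_field_derivative_at_within)
  qed
  have mid: "contour_integral (mid_path \<gamma> T) (cauchy_diff x y) = Q (\<gamma> T) - Q (\<gamma> (- T))"
    using contour_integral_primitive[OF der mid_path_simps(1)[OF ct]] mid_path_simps[OF ct] rS
    by (auto intro: contour_integral_unique)
  \<comment> \<open>Along the ray \<open>Q\<close> tends to Ln 1 = 0, so only its value at the
    starting point is left.\<close>
  have ray: "ray_integral (cauchy_diff x y) v d = - Q v" if d: "d \<noteq> 0" and r: "\<And>t. t \<ge> 0 \<Longrightarrow> v + of_real t * d \<in> S" for v d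
  proof -
    have ri: "ray_integrable (cauchy_diff x y) v d"
      using d far(2,3) r by (intro ray_integrable_cauchy_diff) metis+
    have "continuous_on {0..} (\<lambda>t. cauchy_diff x y (v + of_real t * d))"
      unfolding cauchy_diff_def using far(2,3)[OF r] by (intro continuous_intros) auto
    then have l: "(\<lambda>n. contour_integral (linepath v (v + of_real (real n) * d)) (cauchy_diff x y)) \<longlonglongrightarrow> ray_integral (cauchy_diff x y) v d"
      by (rule ray_integral_truncated[OF ri])
    have "contour_integral (linepath v (v + of_real (real n) * d)) (cauchy_diff x y) = Q (v + of_real (real n) * d) - Q v" for n
    proof -
      have "path_image (linepath v (v + of_real (real n) * d)) \<subseteq> S"
      proof
        fix s assume "s \<in> path_image (linepath v (v + of_real (real n) * d))"
        then obtain u where u: "0 \<le> u" "u \<le> 1" "s = (1 - u) *\<^sub>R v + u *\<^sub>R (v + of_real (real n) * d)"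
          by (auto simp: closed_segment_def)
        then have "s = v + of_real (u * real n) * d" by (simp add: scaleR_conv_of_real algebra_simps)
        then show "s \<in> S" using r[of "u * real n"] u by simp
      qed
      from contour_integral_primitive[OF der valid_path_linepath this] show ?thesis
        by (simp add: contour_integral_unique)
    qed
    moreover have "(\<lambda>n. Q (v + of_real (real n) * d) - Q v) \<longlonglongrightarrow> Ln 1 - Q v"
    proof -
      have c: "norm d > 0" using d by simp
      have "filterlim (\<lambda>n. norm d * real n + - norm (v - y)) at_top sequentially"
        using c by real_asymp
      then have "filterlim (\<lambda>n. norm (v + of_real (real n) * d - y)) at_top sequentially"
      proof (rule filterlim_at_top_mono, intro always_eventually allI)
        fix n
        show "norm d * real n + - norm (v - y) \<le> norm (v + of_real (real n) * d - y)"
          using norm_diff_ineq[of "of_real (real n) * d" "v - y"] by (simp add: norm_mult algebra_simps)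
      qed
      then have "filterlim (\<lambda>n. v + of_real (real n) * d - y) at_infinity sequentially"
        by (rule filterlim_norm_at_top_imp_at_infinity)
      then have "(\<lambda>n. (y - x) / (v + of_real (real n) * d - y)) \<longlonglongrightarrow> 0"
        by (intro tendsto_divide_0[OF tendsto_const])
      then have "(\<lambda>n. Ln (1 + (y - x) / (v + of_real (real n) * d - y))) \<longlonglongrightarrow> Ln (1 + 0)"
        by (intro tendsto_intros) (auto simp: complex_nonpos_Reals_iff)
      from tendsto_diff[OF this tendsto_const[of "Q v"]] show ?thesis unfolding Q_def by simp
    qed
    ultimately show ?thesis using LIMSEQ_unique[OF l] by simp
  qed
  have "\<gamma> T + of_real t * dp \<in> S" "\<gamma> (- T) + of_real t * dm \<in> S" if "t \<ge> 0" for t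
    using contour_tails_range[OF ct that] rS by auto
  then show ?thesis unfolding contour_sum_def mid using ray T by simp
qed

lemma ray_integral_add:
  assumes "ray_integrable f v d" "ray_integrable g v d"
  shows "ray_integral (\<lambda>s. f s + g s) v d = ray_integral f v d + ray_integral g v d"
  using assms set_integral_add(2)[of lborel "{0..}" "\<lambda>t. f (v + of_real t * d) * d" "\<lambda>t. g (v + of_real t * d) * d"]
  unfolding ray_integrable_def ray_integral_def distrib_right by simp

text \<open>The analogue of the constancy of winding numbers on components. For fixed y the
  vanishing of the integral is passed between any two points of a small ball by the local lemma,
  since \<open>cauchy_diff w y\<close> is the sum of \<open>cauchy_diff w z\<close> and
  \<open>cauchy_diff z y\<close>, and the component is connected.\<close>

lemma contour_sum_cauchy_diff:
  assumes ct: "contour_tails \<gamma> T dp dm" and D: "D \<in> components (- range \<gamma>)" and xy: "x \<in> D" "y \<in> D"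
  shows "contour_sum \<gamma> T dp dm (cauchy_diff x y) = 0"
proof -
  have T: "dp \<noteq> 0" "dm \<noteq> 0" using ct by (auto simp: contour_tails_def)
  have oD: "open D" using open_components[OF _ D] closed_range_contour[OF ct] by auto
  have Dr: "D \<subseteq> - range \<gamma>" using D by (rule in_components_subset)
  show ?thesis
  proof (rule connected_induction_simple[of D y x "\<lambda>z. contour_sum \<gamma> T dp dm (cauchy_diff z y) = 0"])
    show "connected D" using D by (rule in_components_connected)
    show "contour_sum \<gamma> T dp dm (cauchy_diff y y) = 0"
    proof -
      have "cauchy_diff y y = (\<lambda>_. 0)" by (simp add: cauchy_diff_def fun_eq_iff)
      then show ?thesis by (simp add: contour_sum_def ray_integral_def set_lebesgue_integral_def)
    qed
    fix a assume "a \<in> D"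
    then obtain e where e: "e > 0" "ball a e \<subseteq> D" using oD by (auto simp: open_contains_ball)
    have sub: "ball a (e / 4) \<subseteq> D" using subset_ball[of "e / 4" e a] e by auto
    have step: "contour_sum \<gamma> T dp dm (cauchy_diff w y) = 0"
      if z: "z \<in> ball a (e / 4)" and w: "w \<in> ball a (e / 4)" and 0: "contour_sum \<gamma> T dp dm (cauchy_diff z y) = 0" for z w
    proof -
      have "z \<in> D" "w \<in> D" using z w sub by blast+
      then have av: "s \<noteq> z" "s \<noteq> w" "s \<noteq> y" if "s \<in> range \<gamma>" for s
        using that xy Dr by blast+
      have "cauchy_diff w y = (\<lambda>s. cauchy_diff w z s + cauchy_diff z y s)" by (simp add: cauchy_diff_def fun_eq_iff)
      moreover have ci: "cauchy_diff p q contour_integrable_on mid_path \<gamma> T" if "p \<in> {z, w, y}" "q \<in> {z, w, y}" for p q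
      proof (rule contour_integrable_holomorphic_simple[of _ "- {p, q}"])
        show "path_image (mid_path \<gamma> T) \<subseteq> - {p, q}"
          using mid_path_simps(2)[OF ct] av that by auto
      qed (auto intro!: holomorphic_cauchy_diff mid_path_simps[OF ct] finite_imp_closed)
      moreover have "ray_integrable (cauchy_diff p q) (\<gamma> T) dp \<and> ray_integrable (cauchy_diff p q) (\<gamma> (- T)) dm"
        if "p \<in> {z, w, y}" "q \<in> {z, w, y}" for p q
      proof -
        have nr: "p \<notin> range \<gamma>" "q \<notin> range \<gamma>" using that av by blast+
        have "\<gamma> T + of_real t * dp \<noteq> p" "\<gamma> T + of_real t * dp \<noteq> q"
          "\<gamma> (- T) + of_real t * dm \<noteq> p" "\<gamma> (- T) + of_real t * dm \<noteq> q" if "t \<ge> 0" for t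
          using contour_tails_range[OF ct that] nr by metis+
        then show ?thesis using T by (intro conjI ray_integrable_cauchy_diff)
      qed
      ultimately have "contour_sum \<gamma> T dp dm (cauchy_diff w y) = contour_sum \<gamma> T dp dm (cauchy_diff w z) + contour_sum \<gamma> T dp dm (cauchy_diff z y)"
        by (simp add: contour_sum_def contour_integral_add ray_integral_add)
      also have "contour_sum \<gamma> T dp dm (cauchy_diff w z) = 0"
        using e z w Dr by (intro contour_sum_cauchy_diff_local[OF ct, of "e / 4" a]) auto
      finally show ?thesis using 0 by simp
    qed
    show "\<exists>T'. openin (top_of_set D) T' \<and> a \<in> T' \<and> (\<forall>x\<in>T'. \<forall>ya\<in>T'.
        contour_sum \<gamma> T dp dm (cauchy_diff x y) = 0 \<longrightarrow> contour_sum \<gamma> T dp dm (cauchy_diff ya y) = 0)"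
    proof (rule exI[of _ "ball a (e / 4)"], intro conjI ballI impI)
      show "openin (top_of_set D) (ball a (e / 4))" using openin_open_eq[OF oD] sub by simp
      show "a \<in> ball a (e / 4)" using e by simp
    qed (rule step)
  qed (use xy in auto)
qed

section \<open>Turning the ends of a contour\<close>

lemma closed_segment_Im_ge:
  assumes "s \<in> closed_segment a b"
  shows "\<sigma> * Im s \<ge> min (\<sigma> * Im a) (\<sigma> * Im b)"
proof -
  obtain u where u: "0 \<le> u" "u \<le> 1" "s = (1 - u) *\<^sub>R a + u *\<^sub>R b"
    using assms by (auto simp: closed_segment_def)
  have "\<sigma> * Im s = (1 - u) * (\<sigma> * Im a) + u * (\<sigma> * Im b)" by (simp add: u(3) algebra_simps)
  also have "\<dots> \<ge> (1 - u) * min (\<sigma> * Im a) (\<sigma> * Im b) + u * min (\<sigma> * Im a) (\<sigma> * Im b)"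
    using u by (intro add_mono mult_left_mono) auto
  finally show ?thesis by (simp add: algebra_simps)
qed

text \<open>The factor \<sigma> is 1 for upper ends and -1 for lower ends, so that one argument
  serves both half-planes.\<close>

lemma convex_Im_halfplane: "convex {s. \<sigma> * Im s > Y}"
proof -
  have "{s. \<sigma> * Im s > Y} = {s. inner (\<sigma> *\<^sub>R \<i>) s > Y}" by (simp add: inner_complex_def)
  then show ?thesis using convex_halfspace_gt[of Y "\<sigma> *\<^sub>R \<i>"] by simp
qed

lemma chord_Im_ge:
  assumes "s \<in> closed_segment (v1 + of_real R * d1) (v2 + of_real R * d2)" "\<sigma> * Im v1 \<ge> Y" "\<sigma> * Im v2 \<ge> Y"
    "\<sigma> * Im d1 \<ge> \<delta>" "\<sigma> * Im d2 \<ge> \<delta>" "R \<ge> 0"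
  shows "\<sigma> * Im s \<ge> Y + R * \<delta>"
proof -
  have "\<sigma> * Im (v1 + of_real R * d1) \<ge> Y + R * \<delta>" "\<sigma> * Im (v2 + of_real R * d2) \<ge> Y + R * \<delta>"
    using assms(2,3) mult_left_mono[OF assms(4,6)] mult_left_mono[OF assms(5,6)] by (simp_all add: algebra_simps)
  then show ?thesis using closed_segment_Im_ge[OF assms(1), of \<sigma>] by linarith
qed

lemma ray_integral_move_halfplane:
  assumes hol: "f holomorphic_on {s. \<sigma> * Im s > Y}" and v: "\<sigma> * Im v1 > Y" "\<sigma> * Im v2 > Y"
    and d: "\<sigma> * Im d1 > 0" "\<sigma> * Im d2 > 0"
    and r: "ray_integrable f v1 d1" "ray_integrable f v2 d2" and e: "e < -1"
    and dec: "eventually (\<lambda>R. \<forall>s\<in>closed_segment (v1 + of_real R * d1) (v2 + of_real R * d2). norm (f s) \<le> B * R powr e) at_top"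
  shows "ray_integral f v1 d1 = contour_integral (linepath v1 v2) f + ray_integral f v2 d2"
proof (rule ray_integral_move[OF convex_Im_halfplane hol _ _ r e dec])
  fix t :: real assume t: "t \<ge> 0"
  have "t * (\<sigma> * Im d1) \<ge> 0" "t * (\<sigma> * Im d2) \<ge> 0" using t d by auto
  then show "v1 + of_real t * d1 \<in> {s. \<sigma> * Im s > Y}" "v2 + of_real t * d2 \<in> {s. \<sigma> * Im s > Y}"
    using v by (auto simp: algebra_simps)
qed

text \<open>The chord at R lies at least R \<delta> above the level Y that bounds the heights of x
  and y, so the kernel is of order R^(-2) on it.\<close>

lemma ray_integral_cauchy_diff_move:
  assumes \<sigma>: "\<bar>\<sigma>\<bar> = 1" and xy: "\<bar>Im x\<bar> \<le> Y" "\<bar>Im y\<bar> \<le> Y" and v: "\<sigma> * Im v1 > Y" "\<sigma> * Im v2 > Y"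
    and d: "\<sigma> * Im d1 > 0" "\<sigma> * Im d2 > 0"
  shows "ray_integral (cauchy_diff x y) v1 d1 = contour_integral (linepath v1 v2) (cauchy_diff x y) + ray_integral (cauchy_diff x y) v2 d2"
proof -
  have sI: "\<sigma> * Im z \<le> Y" if "\<bar>Im z\<bar> \<le> Y" for z :: complex
  proof -
    have "\<sigma> * Im z \<le> \<bar>\<sigma> * Im z\<bar>" by simp
    also have "\<dots> = \<bar>Im z\<bar>" using \<sigma> by (simp add: abs_mult)
    finally show ?thesis using that by linarith
  qed
  have ri: "ray_integrable (cauchy_diff x y) v d" if "\<sigma> * Im v > Y" "\<sigma> * Im d > 0" for v d
  proof (rule ray_integrable_cauchy_diff)
    show "d \<noteq> 0" using that by auto
    have "\<sigma> * Im (v + of_real t * d) > Y" if "t \<ge> 0" for t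
    proof -
      have "t * (\<sigma> * Im d) \<ge> 0" using that \<open>\<sigma> * Im d > 0\<close> by auto
      then show ?thesis using \<open>\<sigma> * Im v > Y\<close> by (simp add: algebra_simps)
    qed
    then show "v + of_real t * d \<noteq> x" "v + of_real t * d \<noteq> y" if "t \<ge> 0" for t
      using that sI[OF xy(1)] sI[OF xy(2)] by (metis not_le)+
  qed
  define \<delta> where "\<delta> = min (\<sigma> * Im d1) (\<sigma> * Im d2)"
  have \<delta>: "\<delta> > 0" "\<sigma> * Im d1 \<ge> \<delta>" "\<sigma> * Im d2 \<ge> \<delta>" using d by (auto simp: \<delta>_def)
  show ?thesis
  proof (rule ray_integral_move_halfplane[OF _ v d ri[OF v(1) d(1)] ri[OF v(2) d(2)], of "-2"])
    show "cauchy_diff x y holomorphic_on {s. Y < \<sigma> * Im s}"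
      using sI xy by (intro holomorphic_cauchy_diff) (auto simp: not_less)
    show "eventually (\<lambda>R. \<forall>s\<in>closed_segment (v1 + of_real R * d1) (v2 + of_real R * d2).
        norm (cauchy_diff x y s) \<le> (norm (x - y) / \<delta>\<^sup>2) * R powr - 2) at_top"
      using eventually_gt_at_top[of 0]
    proof (eventually_elim, intro ballI)
      fix R s assume R: "R > 0" and s: "s \<in> closed_segment (v1 + of_real R * d1) (v2 + of_real R * d2)"
      have g: "\<sigma> * Im s \<ge> Y + R * \<delta>"
        using chord_Im_ge[OF s, of Y \<sigma> \<delta>] v \<delta> R by auto
      have far: "norm (s - z) \<ge> R * \<delta>" if "\<bar>Im z\<bar> \<le> Y" for z
      proof -
        have "R * \<delta> \<le> \<sigma> * Im (s - z)" using g sI[OF that] by (simp add: algebra_simps)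
        also have "\<dots> \<le> \<bar>\<sigma> * Im (s - z)\<bar>" by simp
        also have "\<dots> = \<bar>Im (s - z)\<bar>" using \<sigma> by (simp add: abs_mult)
        finally show ?thesis using abs_Im_le_cmod order_trans by blast
      qed
      have "norm (cauchy_diff x y s) \<le> norm (x - y) / (R * \<delta>)\<^sup>2"
        using far[OF xy(1)] far[OF xy(2)] R \<delta> by (intro norm_cauchy_diff_le) auto
      also have "\<dots> = (norm (x - y) / \<delta>\<^sup>2) * R powr - 2"
        using R by (simp add: powr_minus powr_numeral field_simps)
      finally show "norm (cauchy_diff x y s) \<le> (norm (x - y) / \<delta>\<^sup>2) * R powr - 2" .
    qed
  qed auto
qed

text \<open>Both contours are turned into contours with vertical ends. The closed curve formed by their
  middle parts has winding number \<open>0\<close> around every point outside \<open>S\<close>: by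
  \<open>contour_sum_cauchy_diff\<close> the point can be exchanged for one outside a large disc.\<close>

lemma contour_sum_vertical_eq:
  assumes ct1: "contour_tails \<gamma>1 T1 dp1 dm1" and ct2: "contour_tails \<gamma>2 T2 dp2 dm2"
    and S: "open S" "range \<gamma>1 \<subseteq> S" "range \<gamma>2 \<subseteq> S" and f: "f holomorphic_on S"
    and Y: "Y \<ge> 0" "\<And>s. \<bar>Im s\<bar> > Y \<Longrightarrow> s \<in> S"
    and up: "Im (\<gamma>1 T1) > Y" "Im (\<gamma>2 T2) > Y" "Im dp1 > 0" "Im dp2 > 0"
    and lo: "Im (\<gamma>1 (- T1)) < - Y" "Im (\<gamma>2 (- T2)) < - Y" "Im dm1 < 0" "Im dm2 < 0"
    and mp: "ray_integral f (\<gamma>1 T1) \<i> = contour_integral (linepath (\<gamma>1 T1) (\<gamma>2 T2)) f + ray_integral f (\<gamma>2 T2) \<i>"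
    and mm: "ray_integral f (\<gamma>1 (- T1)) (- \<i>) = contour_integral (linepath (\<gamma>1 (- T1)) (\<gamma>2 (- T2))) f + ray_integral f (\<gamma>2 (- T2)) (- \<i>)"
    and cover: "\<And>\<zeta>. \<zeta> \<notin> S \<Longrightarrow> \<exists>A D1 D2. \<zeta> \<in> A \<and> A \<inter> S = {} \<and> \<not> bounded A \<and> A \<subseteq> D1 \<and> A \<subseteq> D2 \<and>
       D1 \<in> components (- range \<gamma>1) \<and> D2 \<in> components (- range \<gamma>2)"
  shows "contour_sum \<gamma>1 T1 \<i> (- \<i>) f = contour_sum \<gamma>2 T2 \<i> (- \<i>) f"
proof -
  note m1 = mid_path_simps[OF ct1] and m2 = mid_path_simps[OF ct2]
  let ?p1 = "mid_path \<gamma>1 T1" and ?p2 = "mid_path \<gamma>2 T2"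
  let ?up = "linepath (\<gamma>1 T1) (\<gamma>2 T2)" and ?lo = "linepath (\<gamma>1 (- T1)) (\<gamma>2 (- T2))"
    and ?lo' = "linepath (\<gamma>2 (- T2)) (\<gamma>1 (- T1))"
  define \<Gamma> where "\<Gamma> = ?p1 +++ ?up +++ reversepath ?p2 +++ ?lo'"
  have vp: "valid_path \<Gamma>" unfolding \<Gamma>_def
    using m1 m2 by (auto intro!: valid_path_join simp: valid_path_imp_reverse)
  have loop: "pathfinish \<Gamma> = pathstart \<Gamma>" unfolding \<Gamma>_def using m1 by simp
  have seg: "closed_segment (\<gamma>1 T1) (\<gamma>2 T2) \<subseteq> S" "closed_segment (\<gamma>1 (- T1)) (\<gamma>2 (- T2)) \<subseteq> S"
  proof -
    show "closed_segment (\<gamma>1 T1) (\<gamma>2 T2) \<subseteq> S"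
    proof
      fix s assume "s \<in> closed_segment (\<gamma>1 T1) (\<gamma>2 T2)"
      from closed_segment_Im_ge[OF this, of 1] up show "s \<in> S" by (intro Y(2)) auto
    qed
    show "closed_segment (\<gamma>1 (- T1)) (\<gamma>2 (- T2)) \<subseteq> S"
    proof
      fix s assume "s \<in> closed_segment (\<gamma>1 (- T1)) (\<gamma>2 (- T2))"
      from closed_segment_Im_ge[OF this, of "- 1"] lo show "s \<in> S" by (intro Y(2)) auto
    qed
  qed
  have pS: "path_image ?p1 \<subseteq> S" "path_image ?p2 \<subseteq> S" using m1 m2 S by auto
  have pas: "path_image \<Gamma> \<subseteq> S" unfolding \<Gamma>_def
    using pS seg by (intro subset_path_image_join) (simp_all add: closed_segment_commute)
  have ciG: "contour_integral \<Gamma> g = contour_integral ?p1 g + contour_integral ?up g - contour_integral ?p2 g - contour_integral ?lo g"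
    if g: "g holomorphic_on S" for g
  proof -
    have i: "g contour_integrable_on p" if "valid_path p" "path_image p \<subseteq> S" for p
      by (rule contour_integrable_holomorphic_simple[OF g S(1) that])
    have iu: "g contour_integrable_on ?up" using i[of ?up] seg(1) by simp
    have il: "g contour_integrable_on ?lo" using i[of ?lo] seg(2) by simp
    have h1: "(g has_contour_integral contour_integral ?p1 g) ?p1"
      by (rule has_contour_integral_integral[OF i[OF m1(1) pS(1)]])
    have h2: "(g has_contour_integral contour_integral ?up g) ?up"
      by (rule has_contour_integral_integral[OF iu])
    have h3: "(g has_contour_integral - contour_integral ?p2 g) (reversepath ?p2)"
      by (rule has_contour_integral_reversepath[OF m2(1) has_contour_integral_integral[OF i[OF m2(1) pS(2)]]])
    have h4: "(g has_contour_integral - contour_integral ?lo g) ?lo'"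
      using has_contour_integral_reversepath[OF valid_path_linepath has_contour_integral_integral[OF il]]
      unfolding reversepath_linepath .
    have vr: "valid_path (reversepath ?p2)" using m2(1) by (rule valid_path_imp_reverse)
    have v34: "valid_path (reversepath ?p2 +++ ?lo')"
      using m2 by (intro valid_path_join vr valid_path_linepath) simp
    have v234: "valid_path (?up +++ reversepath ?p2 +++ ?lo')"
      using m2 by (intro valid_path_join v34 valid_path_linepath) simp
    have "(g has_contour_integral (contour_integral ?p1 g + (contour_integral ?up g
        + (- contour_integral ?p2 g + - contour_integral ?lo g)))) \<Gamma>"
      unfolding \<Gamma>_def
      by (intro has_contour_integral_join h1 h2 h3 h4 m1(1) valid_path_linepath vr v34 v234)
    moreover have alg: "x = a + (b + (- c + - d)) \<Longrightarrow> x = a + b - c - d" for x a b c d :: complex by simp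
    ultimately show ?thesis by (intro alg contour_integral_unique)
  qed
  \<comment> \<open>With \<open>u\<close> and \<open>l\<close> the integrals over the two links,
    \<open>r1\<close> to \<open>r4\<close> those over the vertical rays: the first implication shows
    that kernels integrate to 0 over the loop, the second turns the vanishing for f into the
    equality of the two sums.\<close>
  have alg: "r1 = u + r2 \<Longrightarrow> r3 = l + r4 \<Longrightarrow> p1 + r1 - r3 = 0 \<Longrightarrow> p2 + r2 - r4 = 0 \<Longrightarrow> p1 + u - p2 - l = 0"
    "p1 + u - p2 - l = 0 \<Longrightarrow> p1 + (u + r2) - (l + r4) = p2 + r2 - r4" for p1 p2 r1 r2 r3 r4 u l :: complex
  proof -
    have e: "p1 + u - p2 - l = (p1 + (u + r2) - (l + r4)) - (p2 + r2 - r4)" by simp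
    show "r1 = u + r2 \<Longrightarrow> r3 = l + r4 \<Longrightarrow> p1 + r1 - r3 = 0 \<Longrightarrow> p2 + r2 - r4 = 0 \<Longrightarrow> p1 + u - p2 - l = 0"
      unfolding e by simp
    show "p1 + u - p2 - l = 0 \<Longrightarrow> p1 + (u + r2) - (l + r4) = p2 + r2 - r4"
      unfolding e by (simp only: right_minus_eq)
  qed
  have "(f has_contour_integral 0) \<Gamma>"
  proof (rule Cauchy_theorem_global[OF S(1) f vp loop pas])
    fix \<zeta> assume \<zeta>: "\<zeta> \<notin> S"
    obtain A D1 D2 where A: "\<zeta> \<in> A" "A \<inter> S = {}" "\<not> bounded A" "A \<subseteq> D1" "A \<subseteq> D2"
      "D1 \<in> components (- range \<gamma>1)" "D2 \<in> components (- range \<gamma>2)"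
      using cover[OF \<zeta>] by (elim exE conjE) (rule that)
    obtain B where "\<forall>x\<in>path_image \<Gamma>. norm x \<le> B"
      using compact_imp_bounded[OF compact_path_image[OF valid_path_imp_path[OF vp]]] unfolding bounded_iff by blast
    then have B: "path_image \<Gamma> \<subseteq> cball 0 B" by auto
    \<comment> \<open>The unbounded set \<open>A\<close> reaches beyond the disc that contains the
      loop, and it joins \<zeta> and \<mu> within one component of the complement of each
      contour.\<close>
    obtain \<mu> where \<mu>: "\<mu> \<in> A" "norm \<mu> > B" using A(3) unfolding bounded_iff by (meson not_le)
    have \<mu>S: "\<mu> \<notin> S" using \<mu> A by blast
    have im: "\<bar>Im \<zeta>\<bar> \<le> Y" "\<bar>Im \<mu>\<bar> \<le> Y" using Y(2) \<zeta> \<mu>S by (meson not_le)+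
    let ?q = "cauchy_diff \<zeta> \<mu>"
    have hq: "?q holomorphic_on S" using \<zeta> \<mu>S by (rule holomorphic_cauchy_diff)
    have vert: "contour_sum \<gamma> T \<i> (- \<i>) ?q = 0"
      if ct: "contour_tails \<gamma> T dp dm" and "Im (\<gamma> T) > Y" "Im (\<gamma> (- T)) < - Y" "Im dp > 0" "Im dm < 0"
        "D \<in> components (- range \<gamma>)" "A \<subseteq> D" for \<gamma> T dp dm D
    proof -
      \<comment> \<open>The rays are turned about their common starting point, so the connecting
        segment is degenerate.\<close>
      have "ray_integral ?q (\<gamma> T) dp = contour_integral (linepath (\<gamma> T) (\<gamma> T)) ?q + ray_integral ?q (\<gamma> T) \<i>"
        using that im by (intro ray_integral_cauchy_diff_move[of 1 _ Y]) auto
      moreover have "ray_integral ?q (\<gamma> (- T)) dm = contour_integral (linepath (\<gamma> (- T)) (\<gamma> (- T))) ?q + ray_integral ?q (\<gamma> (- T)) (- \<i>)"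
        using that im by (intro ray_integral_cauchy_diff_move[of "- 1" _ Y]) auto
      ultimately have "contour_sum \<gamma> T \<i> (- \<i>) ?q = contour_sum \<gamma> T dp dm ?q" by (simp add: contour_sum_def)
      also have "\<dots> = 0" by (rule contour_sum_cauchy_diff[OF ct that(6)]) (use that(7) A(1) \<mu>(1) in blast)+
      finally show ?thesis .
    qed
    have z1: "contour_sum \<gamma>1 T1 \<i> (- \<i>) ?q = 0" using vert[OF ct1 up(1) lo(1) up(3) lo(3) A(6,4)] .
    have z2: "contour_sum \<gamma>2 T2 \<i> (- \<i>) ?q = 0" using vert[OF ct2 up(2) lo(2) up(4) lo(4) A(7,5)] .
    have "ray_integral ?q (\<gamma>1 T1) \<i> = contour_integral ?up ?q + ray_integral ?q (\<gamma>2 T2) \<i>"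
      using up im by (intro ray_integral_cauchy_diff_move[of 1 _ Y]) auto
    moreover have "ray_integral ?q (\<gamma>1 (- T1)) (- \<i>) = contour_integral ?lo ?q + ray_integral ?q (\<gamma>2 (- T2)) (- \<i>)"
      using lo im by (intro ray_integral_cauchy_diff_move[of "- 1" _ Y]) auto
    ultimately have "contour_integral \<Gamma> ?q = 0"
      unfolding ciG[OF hq] using z1 z2 alg(1) unfolding contour_sum_def by metis
    moreover have "contour_integral \<Gamma> ?q = contour_integral \<Gamma> (\<lambda>w. 1 / (w - \<zeta>)) - contour_integral \<Gamma> (\<lambda>w. 1 / (w - \<mu>))"
      unfolding cauchy_diff_def using \<zeta> \<mu>S
      by (intro contour_integral_diff contour_integrable_holomorphic_simple[OF _ S(1) vp pas] holomorphic_intros) auto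
    moreover have "winding_number \<Gamma> z = 1 / (2 * pi * \<i>) * contour_integral \<Gamma> (\<lambda>w. 1 / (w - z))" if "z \<notin> S" for z
      using that pas by (intro winding_number_valid_path[OF vp]) auto
    ultimately have "winding_number \<Gamma> \<zeta> = winding_number \<Gamma> \<mu>" using \<zeta> \<mu>S by simp
    \<comment> \<open>Here \<mu> lies outside a convex set that contains the loop.\<close>
    also have "\<dots> = 0"
      using B \<mu>(2) by (intro winding_number_zero_outside[OF valid_path_imp_path[OF vp] convex_cball loop]) auto
    finally show "winding_number \<Gamma> \<zeta> = 0" .
  qed
  then have "contour_integral \<Gamma> f = 0" by (rule contour_integral_unique)
  then show ?thesis unfolding ciG[OF f] contour_sum_def mp mm by (rule alg(2))
qed

section \<open>Asymptotics of the integrand\<close>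

text \<open>The sum of the exponents \<open>Barnes_expo\<close> of k factors whose shifts have sum
  \<open>c1\<close> and sum of squares \<open>c2\<close>. Since it is linear in these three numbers,
  quotients of products amount to subtracting them.\<close>

definition Barnes_expo_sum :: "real \<Rightarrow> complex \<Rightarrow> complex \<Rightarrow> complex \<Rightarrow> complex \<Rightarrow> complex \<Rightarrow> complex \<Rightarrow> complex \<Rightarrow> complex" where
  "Barnes_expo_sum \<tau> b2 b1 b3 k c1 c2 z = (k * z\<^sup>2 / (2 * of_real \<tau>) + (Phi_coeff1 \<tau> * k + c1 / of_real \<tau>) * z
      + (Phi_coeff0 \<tau> * k + Phi_coeff1 \<tau> * c1 + c2 / (2 * of_real \<tau>))) * Ln z + b2 * k * z\<^sup>2 + (b1 * k + c1 * b3) * z"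

lemma Barnes_expo_sum_add:
  "Barnes_expo_sum \<tau> b2 b1 b3 k c1 c2 z + Barnes_expo_sum \<tau> b2 b1 b3 k' c1' c2' z = Barnes_expo_sum \<tau> b2 b1 b3 (k + k') (c1 + c1') (c2 + c2') z"
  unfolding Barnes_expo_sum_def by (simp add: algebra_simps add_divide_distrib)

lemma Barnes_expo_sum_diff:
  "Barnes_expo_sum \<tau> b2 b1 b3 k c1 c2 z - Barnes_expo_sum \<tau> b2 b1 b3 k' c1' c2' z = Barnes_expo_sum \<tau> b2 b1 b3 (k - k') (c1 - c1') (c2 - c2') z"
  unfolding Barnes_expo_sum_def by (simp add: algebra_simps add_divide_distrib diff_divide_distrib)

lemma Barnes_expo_eq_Barnes_expo_sum: "Barnes_expo \<tau> b2 b1 b3 c z = Barnes_expo_sum \<tau> b2 b1 b3 1 c (c\<^sup>2) z"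
  unfolding Barnes_expo_def Barnes_expo_sum_def by simp

lemma prod_Barnes_G_asymp:
  assumes fin: "finite J" and k: "\<kappa> > 0"
    and G: "\<And>c \<kappa>. \<kappa> > 0 \<Longrightarrow> \<exists>R B. \<forall>z. norm z \<ge> R \<longrightarrow> \<bar>Im z\<bar> \<ge> \<kappa> * norm z \<longrightarrow>
     (\<exists>e. norm e \<le> B \<and> Barnes_G (of_real \<tau>) (c + z) = exp (Barnes_expo \<tau> b2 b1 b3 c z + e))"
  shows "\<exists>R B. \<forall>z. norm z \<ge> R \<longrightarrow> \<bar>Im z\<bar> \<ge> \<kappa> * norm z \<longrightarrow>
     (\<exists>e. norm e \<le> B \<and> (\<Prod>j\<in>J. Barnes_G (of_real \<tau>) (c j + z)) =
        exp (Barnes_expo_sum \<tau> b2 b1 b3 (of_nat (card J)) (\<Sum>j\<in>J. c j) (\<Sum>j\<in>J. (c j)\<^sup>2) z + e))"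
  using fin
proof (induction J rule: finite_induct)
  case empty
  show ?case by (intro exI[of _ 0] allI impI) (simp add: Barnes_expo_sum_def)
next
  case (insert x F)
  obtain R1 B1 where 1: "\<And>z. norm z \<ge> R1 \<Longrightarrow> \<bar>Im z\<bar> \<ge> \<kappa> * norm z \<Longrightarrow>
     \<exists>e. norm e \<le> B1 \<and> (\<Prod>j\<in>F. Barnes_G (of_real \<tau>) (c j + z)) =
        exp (Barnes_expo_sum \<tau> b2 b1 b3 (of_nat (card F)) (\<Sum>j\<in>F. c j) (\<Sum>j\<in>F. (c j)\<^sup>2) z + e)"
    using insert.IH by metis
  obtain R2 B2 where 2: "\<And>z. norm z \<ge> R2 \<Longrightarrow> \<bar>Im z\<bar> \<ge> \<kappa> * norm z \<Longrightarrow>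
     \<exists>e. norm e \<le> B2 \<and> Barnes_G (of_real \<tau>) (c x + z) = exp (Barnes_expo \<tau> b2 b1 b3 (c x) z + e)"
    using G[OF k, of "c x"] by metis
  show ?case
  proof (rule exI[of _ "max R1 R2"], rule exI[of _ "B2 + B1"], intro allI impI)
    fix z :: complex assume z: "norm z \<ge> max R1 R2" "\<bar>Im z\<bar> \<ge> \<kappa> * norm z"
    obtain e1 where e1: "norm e1 \<le> B1" "(\<Prod>j\<in>F. Barnes_G (of_real \<tau>) (c j + z)) =
        exp (Barnes_expo_sum \<tau> b2 b1 b3 (of_nat (card F)) (\<Sum>j\<in>F. c j) (\<Sum>j\<in>F. (c j)\<^sup>2) z + e1)"
      using 1[of z] z by auto
    obtain e2 where e2: "norm e2 \<le> B2" "Barnes_G (of_real \<tau>) (c x + z) = exp (Barnes_expo \<tau> b2 b1 b3 (c x) z + e2)"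
      using 2[of z] z by auto
    have "(\<Prod>j\<in>insert x F. Barnes_G (of_real \<tau>) (c j + z))
       = exp (Barnes_expo \<tau> b2 b1 b3 (c x) z + e2) * exp (Barnes_expo_sum \<tau> b2 b1 b3 (of_nat (card F)) (\<Sum>j\<in>F. c j) (\<Sum>j\<in>F. (c j)\<^sup>2) z + e1)"
      using insert.hyps e1(2) e2(2) by simp
    also have "\<dots> = exp ((Barnes_expo_sum \<tau> b2 b1 b3 1 (c x) ((c x)\<^sup>2) z + Barnes_expo_sum \<tau> b2 b1 b3 (of_nat (card F)) (\<Sum>j\<in>F. c j) (\<Sum>j\<in>F. (c j)\<^sup>2) z) + (e2 + e1))"
      unfolding Barnes_expo_eq_Barnes_expo_sum exp_add[symmetric] by (simp add: algebra_simps)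
    also have "\<dots> = exp (Barnes_expo_sum \<tau> b2 b1 b3 (of_nat (card (insert x F))) (\<Sum>j\<in>insert x F. c j) (\<Sum>j\<in>insert x F. (c j)\<^sup>2) z + (e2 + e1))"
      unfolding Barnes_expo_sum_add using insert.hyps by simp
    finally have "(\<Prod>j\<in>insert x F. Barnes_G (of_real \<tau>) (c j + z)) =
        exp (Barnes_expo_sum \<tau> b2 b1 b3 (of_nat (card (insert x F))) (\<Sum>j\<in>insert x F. c j) (\<Sum>j\<in>insert x F. (c j)\<^sup>2) z + (e2 + e1))" .
    moreover have "norm (e2 + e1) \<le> B2 + B1" using e1(1) e2(1) norm_triangle_mono by blast
    ultimately show "\<exists>e. norm e \<le> B2 + B1 \<and> (\<Prod>j\<in>insert x F. Barnes_G (of_real \<tau>) (c j + z)) =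
        exp (Barnes_expo_sum \<tau> b2 b1 b3 (of_nat (card (insert x F))) (\<Sum>j\<in>insert x F. c j) (\<Sum>j\<in>insert x F. (c j)\<^sup>2) z + e)"
      by blast
  qed
qed

definition K_expo :: "complex \<Rightarrow> complex \<Rightarrow> complex \<Rightarrow> complex \<Rightarrow> complex \<Rightarrow> complex \<Rightarrow> complex" where
  "K_expo A B C L P s = A * s\<^sup>2 * Ln s + B * s\<^sup>2 + C * s * Ln s + L * s + P * Ln s"

text \<open>Half of the factors of \<open>K_Gquot\<close> have the argument - s. Rewriting their
  logarithm in terms of Ln s brings in the sign of Im s, which is why some coefficients differ
  between the two half-planes.\<close>

lemma Ln_minus_sgn:
  assumes "Im s \<noteq> 0"
  shows "Ln (- s) = Ln s - \<i> * of_real pi * of_real (sgn (Im s))"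
  using assms by (subst Ln_minus) (auto simp: sgn_if)

text \<open>The factors in - s and those in s each contribute one \<open>Barnes_expo_sum\<close>;
  after Ln (- s) is expressed by Ln s, coefficients are compared. The unknowns remain in
  \<open>b2\<close> times \<open>K_N\<close> and inside \<open>L\<close>, from which they disappear
  exactly under the assumptions of the second claim.\<close>

lemma K_Gquot_asymp:
  assumes t: "\<tau> > 0" and mq: "m \<le> q" and np: "n \<le> p"
  obtains b2 L P where
    "\<And>\<kappa>. \<kappa> > 0 \<Longrightarrow> \<exists>R B. \<forall>s. norm s \<ge> R \<longrightarrow> \<bar>Im s\<bar> \<ge> \<kappa> * norm s \<longrightarrow>
       (\<exists>e. norm e \<le> B \<and> K_Gquot p q m n a b \<tau> s =
         exp (K_expo (of_int (K_N p q m n) / (2 * of_real \<tau>))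
           (b2 * of_int (K_N p q m n) - \<i> * of_real pi * of_real (sgn (Im s)) * (of_nat m + of_nat n - of_nat p) / (2 * of_real \<tau>))
           (- Phi_coeff1 \<tau> * of_int (K_N p q m n) - K_mu p q m n a b / of_real \<tau>)
           (L (sgn (Im s))) P s + e))"
    "\<And>\<sigma>. K_N p q m n = 0 \<Longrightarrow> p = q \<Longrightarrow> K_mu p q m n a b = 0 \<Longrightarrow>
       L \<sigma> = - (\<i> * of_real pi * of_real \<sigma> * K_nu p q a b / (2 * of_real \<tau>))"
    "K_N p q m n = 0 \<Longrightarrow> p = q \<Longrightarrow> K_mu p q m n a b = 0 \<Longrightarrow> K_nu p q a b = 0 \<Longrightarrow>
       P = K_xi p q m n a b / (2 * of_real \<tau>)"
proof -
  obtain b1 b2 b3 where G: "\<And>c \<kappa>. \<kappa> > 0 \<Longrightarrow> \<exists>R B. \<forall>z. norm z \<ge> R \<longrightarrow> \<bar>Im z\<bar> \<ge> \<kappa> * norm z \<longrightarrow>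
     (\<exists>e. norm e \<le> B \<and> Barnes_G (of_real \<tau>) (c + z) = exp (Barnes_expo \<tau> b2 b1 b3 c z + e))"
    using Barnes_G_shift_asymp[OF t] by metis
  define T where "T = complex_of_real \<tau>"
  have Tn: "T \<noteq> 0" using t by (simp add: T_def)
  \<comment> \<open>The number of factors in - s, counted negatively in the denominator;
    \<open>n2\<close> counts those in s, and their sum is \<open>K_N\<close>. \<open>B1\<close>,
    \<open>Q1\<close> and \<open>C1\<close>, \<open>C2\<close> are the corresponding sums of shifts
    and of their squares.\<close>
  define n1 where "n1 = (of_nat m + of_nat n - of_nat p :: complex)"
  define n2 where "n2 = (of_nat n + of_nat m - of_nat q :: complex)"
  define aL where "aL = (\<Sum>j=1..n. a j)" define aH where "aH = (\<Sum>j=n+1..p. a j)"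
  define bL where "bL = (\<Sum>j=1..m. b j)" define bH where "bH = (\<Sum>j=m+1..q. b j)"
  define aL2 where "aL2 = (\<Sum>j=1..n. (a j)\<^sup>2)" define aH2 where "aH2 = (\<Sum>j=n+1..p. (a j)\<^sup>2)"
  define bL2 where "bL2 = (\<Sum>j=1..m. (b j)\<^sup>2)" define bH2 where "bH2 = (\<Sum>j=m+1..q. (b j)\<^sup>2)"
  define B1 where "B1 = bL - aH" define Q1 where "Q1 = bL2 - aH2"
  define C1 where "C1 = (\<Sum>j=1..n. 1 + T - a j) - (\<Sum>j=m+1..q. 1 + T - b j)"
  define C2 where "C2 = (\<Sum>j=1..n. (1 + T - a j)\<^sup>2) - (\<Sum>j=m+1..q. (1 + T - b j)\<^sup>2)"
  have C1: "C1 = (1 + T) * n2 - aL + bH"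
    using mq by (simp add: C1_def n2_def aL_def bH_def sum_subtractf algebra_simps of_nat_diff)
  have sq: "(\<Sum>j\<in>J. (1 + T - x j)\<^sup>2) = of_nat (card J) * (1 + T)\<^sup>2 - 2 * (1 + T) * (\<Sum>j\<in>J. x j) + (\<Sum>j\<in>J. (x j)\<^sup>2)"
    for x :: "nat \<Rightarrow> complex" and J
  proof -
    have "(1 + T - y)\<^sup>2 = (1 + T)\<^sup>2 - 2 * (1 + T) * y + y\<^sup>2" for y by (simp add: power2_eq_square algebra_simps)
    then show ?thesis by (simp only: sum.distrib sum_subtractf sum_distrib_left sum_constant)
  qed
  have C2: "C2 = (1 + T)\<^sup>2 * n2 - 2 * (1 + T) * (aL - bH) + aL2 - bH2"
    unfolding C2_def sq n2_def aL_def bH_def aL2_def bH2_def using mq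
    by (simp add: algebra_simps of_nat_diff)
  define L where "L = (\<lambda>\<sigma>. \<i> * of_real pi * of_real \<sigma> * (Phi_coeff1 \<tau> * n1 + B1 / T) + b1 * (n2 - n1) + b3 * (C1 - B1))"
  define P where "P = Phi_coeff0 \<tau> * (n1 + n2) + Phi_coeff1 \<tau> * (B1 + C1) + (Q1 + C2) / (2 * T)"
  \<comment> \<open>The coefficient of order 0 of the factors in - s. Multiplied by the jump of the
    logarithm it gives a bounded term, accounted for by \<pi> |E0| in \<open>D\<close>.\<close>
  define E0 where "E0 = Phi_coeff0 \<tau> * n1 + Phi_coeff1 \<tau> * B1 + Q1 / (2 * T)"
  have N: "complex_of_int (K_N p q m n) = n1 + n2" by (simp add: K_N_def n1_def n2_def)
  have mu: "K_mu p q m n a b = aL - aH + bL - bH" by (simp add: K_mu_def aL_def aH_def bL_def bH_def)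
  have nu: "K_nu p q a b = aL + aH - bL - bH"
  proof -
    have "{1..p} = {1..n} \<union> {n+1..p}" "{1..q} = {1..m} \<union> {m+1..q}" using mq np by auto
    then have "(\<Sum>j=1..p. a j) = aL + aH" "(\<Sum>j=1..q. b j) = bL + bH"
      unfolding aL_def aH_def bL_def bH_def by (simp_all add: sum.union_disjoint)
    then show ?thesis by (simp add: K_nu_def)
  qed
  have xi: "K_xi p q m n a b = aL2 - aH2 + bL2 - bH2" by (simp add: K_xi_def aL2_def aH2_def bL2_def bH2_def)
  show ?thesis
  proof (rule that[of b2 L P])
    fix \<kappa> :: real assume k: "\<kappa> > 0"
    note PR = prod_Barnes_G_asymp[OF _ k G]
    obtain R1 D1 where 1: "\<And>z. norm z \<ge> R1 \<Longrightarrow> \<bar>Im z\<bar> \<ge> \<kappa> * norm z \<Longrightarrow>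
       \<exists>e. norm e \<le> D1 \<and> (\<Prod>j\<in>{1..m}. Barnes_G (of_real \<tau>) (b j + z)) =
        exp (Barnes_expo_sum \<tau> b2 b1 b3 (of_nat (card {1..m})) bL bL2 z + e)"
      unfolding bL_def bL2_def using PR[of "{1..m}" b] by (metis finite_atLeastAtMost)
    obtain R2 D2 where 2: "\<And>z. norm z \<ge> R2 \<Longrightarrow> \<bar>Im z\<bar> \<ge> \<kappa> * norm z \<Longrightarrow>
       \<exists>e. norm e \<le> D2 \<and> (\<Prod>j\<in>{1..n}. Barnes_G (of_real \<tau>) (1 + T - a j + z)) =
        exp (Barnes_expo_sum \<tau> b2 b1 b3 (of_nat (card {1..n})) (\<Sum>j=1..n. 1 + T - a j) (\<Sum>j=1..n. (1 + T - a j)\<^sup>2) z + e)"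
      using PR[of "{1..n}" "\<lambda>j. 1 + T - a j"] by (metis finite_atLeastAtMost)
    obtain R3 D3 where 3: "\<And>z. norm z \<ge> R3 \<Longrightarrow> \<bar>Im z\<bar> \<ge> \<kappa> * norm z \<Longrightarrow>
       \<exists>e. norm e \<le> D3 \<and> (\<Prod>j\<in>{m+1..q}. Barnes_G (of_real \<tau>) (1 + T - b j + z)) =
        exp (Barnes_expo_sum \<tau> b2 b1 b3 (of_nat (card {m+1..q})) (\<Sum>j=m+1..q. 1 + T - b j) (\<Sum>j=m+1..q. (1 + T - b j)\<^sup>2) z + e)"
      using PR[of "{m+1..q}" "\<lambda>j. 1 + T - b j"] by (metis finite_atLeastAtMost)
    obtain R4 D4 where 4: "\<And>z. norm z \<ge> R4 \<Longrightarrow> \<bar>Im z\<bar> \<ge> \<kappa> * norm z \<Longrightarrow>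
       \<exists>e. norm e \<le> D4 \<and> (\<Prod>j\<in>{n+1..p}. Barnes_G (of_real \<tau>) (a j + z)) =
        exp (Barnes_expo_sum \<tau> b2 b1 b3 (of_nat (card {n+1..p})) aH aH2 z + e)"
      unfolding aH_def aH2_def using PR[of "{n+1..p}" a] by (metis finite_atLeastAtMost)
    define R where "R = Max {1, R1, R2, R3, R4}"
    have R: "R \<ge> 1" "R \<ge> R1" "R \<ge> R2" "R \<ge> R3" "R \<ge> R4" by (simp_all add: R_def)
    define D where "D = D1 + D2 + D3 + D4 + pi * norm E0"
    show "\<exists>R B. \<forall>s. norm s \<ge> R \<longrightarrow> \<bar>Im s\<bar> \<ge> \<kappa> * norm s \<longrightarrow>
       (\<exists>e. norm e \<le> B \<and> K_Gquot p q m n a b \<tau> s =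
         exp (K_expo (of_int (K_N p q m n) / (2 * of_real \<tau>))
           (b2 * of_int (K_N p q m n) - \<i> * of_real pi * of_real (sgn (Im s)) * (of_nat m + of_nat n - of_nat p) / (2 * of_real \<tau>))
           (- Phi_coeff1 \<tau> * of_int (K_N p q m n) - K_mu p q m n a b / of_real \<tau>)
           (L (sgn (Im s))) P s + e))"
    proof (rule exI[of _ R], rule exI[of _ D], intro allI impI)
      fix s :: complex assume s: "norm s \<ge> R" "\<bar>Im s\<bar> \<ge> \<kappa> * norm s"
      have "\<kappa> * norm s > 0" using k s R by (intro mult_pos_pos) auto
      then have Is: "Im s \<noteq> 0" using s(2) by auto
      define \<sigma> where "\<sigma> = sgn (Im s)"
      have ms: "norm (- s) \<ge> R" "\<bar>Im (- s)\<bar> \<ge> \<kappa> * norm (- s)" using s by auto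
      obtain e1 where e1: "norm e1 \<le> D1" "(\<Prod>j\<in>{1..m}. Barnes_G (of_real \<tau>) (b j + - s)) =
        exp (Barnes_expo_sum \<tau> b2 b1 b3 (of_nat (card {1..m})) bL bL2 (- s) + e1)"
        using 1[of "- s"] ms R by auto
      obtain e2 where e2: "norm e2 \<le> D2" "(\<Prod>j\<in>{1..n}. Barnes_G (of_real \<tau>) (1 + T - a j + s)) =
        exp (Barnes_expo_sum \<tau> b2 b1 b3 (of_nat (card {1..n})) (\<Sum>j=1..n. 1 + T - a j) (\<Sum>j=1..n. (1 + T - a j)\<^sup>2) s + e2)"
        using 2[of s] s R by auto
      obtain e3 where e3: "norm e3 \<le> D3" "(\<Prod>j\<in>{m+1..q}. Barnes_G (of_real \<tau>) (1 + T - b j + s)) =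
        exp (Barnes_expo_sum \<tau> b2 b1 b3 (of_nat (card {m+1..q})) (\<Sum>j=m+1..q. 1 + T - b j) (\<Sum>j=m+1..q. (1 + T - b j)\<^sup>2) s + e3)"
        using 3[of s] s R by auto
      obtain e4 where e4: "norm e4 \<le> D4" "(\<Prod>j\<in>{n+1..p}. Barnes_G (of_real \<tau>) (a j + - s)) =
        exp (Barnes_expo_sum \<tau> b2 b1 b3 (of_nat (card {n+1..p})) aH aH2 (- s) + e4)"
        using 4[of "- s"] ms R by auto
      have alg: "exp (x1 + e1) * exp (x2 + e2) / (exp (x3 + e3) * exp (x4 + e4)) =
          exp ((x1 - x4) + (x2 - x3) + (e1 + e2 - e3 - e4))" for x1 x2 x3 x4
        by (simp add: exp_add exp_diff mult_ac)
      have cards: "of_nat (card {1..m}) - of_nat (card {n+1..p}) = n1" "of_nat (card {1..n}) - of_nat (card {m+1..q}) = n2"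
        using mq np by (simp_all add: n1_def n2_def of_nat_diff)
      have "K_Gquot p q m n a b \<tau> s = exp (Barnes_expo_sum \<tau> b2 b1 b3 n1 B1 Q1 (- s) + Barnes_expo_sum \<tau> b2 b1 b3 n2 C1 C2 s + (e1 + e2 - e3 - e4))"
        using e1(2) e2(2) e3(2) e4(2)
        unfolding K_Gquot_def T_def[symmetric] diff_conv_add_uminus[of "b _" s] diff_conv_add_uminus[of "a _" s]
        by (simp only: alg Barnes_expo_sum_diff cards B1_def Q1_def C1_def C2_def)
      also have "Barnes_expo_sum \<tau> b2 b1 b3 n1 B1 Q1 (- s) + Barnes_expo_sum \<tau> b2 b1 b3 n2 C1 C2 s =
         K_expo ((n1 + n2) / (2 * T)) (b2 * (n1 + n2) - \<i> * of_real pi * of_real \<sigma> * n1 / (2 * T))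
           (- Phi_coeff1 \<tau> * (n1 + n2) - K_mu p q m n a b / T) (L \<sigma>) P s - \<i> * of_real pi * of_real \<sigma> * E0"
      proof -
        \<comment> \<open>The shift 1 + \<tau> of the arguments in s contributes (1 + \<tau>) n2 /
          \<tau>, which is - 2 n2 times \<open>Phi_coeff1\<close>; this turns n2 - n1 into - (n1 +
          n2).\<close>
        have c: "- (Phi_coeff1 \<tau> * n1 + B1 / T) + (Phi_coeff1 \<tau> * n2 + C1 / T) = - Phi_coeff1 \<tau> * (n1 + n2) - K_mu p q m n a b / T"
          unfolding C1 B1_def mu Phi_coeff1_def T_def[symmetric] using Tn by (simp add: field_simps)
        define w where "w = \<i> * of_real pi * of_real \<sigma>"
        define l where "l = Ln s"
        have ln: "Ln (- s) = l - w" using Ln_minus_sgn[OF Is] by (simp add: w_def \<sigma>_def l_def)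
        have "Barnes_expo_sum \<tau> b2 b1 b3 n1 B1 Q1 (- s) + Barnes_expo_sum \<tau> b2 b1 b3 n2 C1 C2 s =
          K_expo ((n1 + n2) / (2 * T)) (b2 * (n1 + n2) - w * n1 / (2 * T))
           (- (Phi_coeff1 \<tau> * n1 + B1 / T) + (Phi_coeff1 \<tau> * n2 + C1 / T)) (w * (Phi_coeff1 \<tau> * n1 + B1 / T) + b1 * (n2 - n1) + b3 * (C1 - B1)) P s - w * E0"
          unfolding Barnes_expo_sum_def K_expo_def P_def E0_def ln l_def[symmetric] T_def[symmetric]
          by (simp add: algebra_simps add_divide_distrib diff_divide_distrib)
        then show ?thesis unfolding c L_def w_def .
      qed
      finally have "K_Gquot p q m n a b \<tau> s = exp (K_expo ((n1 + n2) / (2 * T)) (b2 * (n1 + n2) - \<i> * of_real pi * of_real \<sigma> * n1 / (2 * T))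
           (- Phi_coeff1 \<tau> * (n1 + n2) - K_mu p q m n a b / T) (L \<sigma>) P s + (e1 + e2 - e3 - e4 - \<i> * of_real pi * of_real \<sigma> * E0))"
        by (simp add: algebra_simps)
      moreover have "norm (e1 + e2 - e3 - e4 - \<i> * of_real pi * of_real \<sigma> * E0) \<le> D"
      proof -
        have "norm (e1 + e2 - e3 - e4 - \<i> * of_real pi * of_real \<sigma> * E0) \<le> norm e1 + norm e2 + norm e3 + norm e4 + norm (\<i> * of_real pi * of_real \<sigma> * E0)"
          by (intro order_trans[OF norm_triangle_ineq4] add_mono order_refl order_trans[OF norm_triangle_ineq] norm_triangle_ineq)
        also have "norm (\<i> * of_real pi * of_real \<sigma> * E0) = pi * norm E0"
          using Is by (simp add: norm_mult \<sigma>_def abs_sgn_eq)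
        finally show ?thesis unfolding D_def using e1(1) e2(1) e3(1) e4(1) by linarith
      qed
      ultimately show "\<exists>e. norm e \<le> D \<and> K_Gquot p q m n a b \<tau> s =
         exp (K_expo (of_int (K_N p q m n) / (2 * of_real \<tau>))
           (b2 * of_int (K_N p q m n) - \<i> * of_real pi * of_real (sgn (Im s)) * (of_nat m + of_nat n - of_nat p) / (2 * of_real \<tau>))
           (- Phi_coeff1 \<tau> * of_int (K_N p q m n) - K_mu p q m n a b / of_real \<tau>)
           (L (sgn (Im s))) P s + e)"
        unfolding N T_def[symmetric] \<sigma>_def[symmetric] n1_def[symmetric] by blast
    qed
  next
    assume h: "K_N p q m n = 0" "p = q" "K_mu p q m n a b = 0"
    \<comment> \<open>Equal numbers with sum \<open>K_N = 0\<close> are 0, which removes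
      \<open>b1\<close>. Then \<open>K_mu = 0\<close> says \<open>C1 = B1\<close>, which removes
      \<open>b3\<close> and leaves \<open>K_nu\<close> as the only parameter in
      \<open>L\<close>.\<close>
    have "n1 = n2" using h(2) by (simp add: n1_def n2_def)
    moreover have "n1 + n2 = 0" using N h(1) by simp
    ultimately have z: "n1 = 0" "n2 = 0" by auto
    have BC: "C1 = B1" using h(3) unfolding C1 z mu B1_def by (simp add: algebra_simps)
    have B1: "K_nu p q a b = - 2 * B1" using h(3) unfolding nu mu B1_def by (simp add: algebra_simps)
    show "L \<sigma> = - (\<i> * of_real pi * of_real \<sigma> * K_nu p q a b / (2 * of_real \<tau>))" for \<sigma>
      unfolding L_def z BC B1 T_def by simp
    assume h4: "K_nu p q a b = 0"
    have B0: "B1 = 0" using B1 h4 by simp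
    have "aL - bH = 0" using BC B0 unfolding C1 z by (simp add: algebra_simps)
    then have "C2 = aL2 - bH2" unfolding C2 z by simp
    then show "P = K_xi p q m n a b / (2 * of_real \<tau>)"
      unfolding P_def z BC B0 xi T_def Q1_def by (simp add: algebra_simps)
  qed
qed

lemma Ln_ray:
  assumes "t > 0" "s \<noteq> 0"
  shows "Ln s = of_real (ln t) + Ln (s / of_real t)"
proof -
  show ?thesis using Ln_divide_of_real[OF assms] by simp
qed

text \<open>On the ray s = t x(t) and Ln s = y(t) ln t, where x tends to d and y to 1. After
  division by the leading growth, t^2 ln t, t^2 or t ln t, the exponent tends to a number with
  negative real part. Each of these growths exceeds every multiple of t, so \<open>M\<close> is
  arbitrary.\<close>

lemma K_expo_ray_decay:
  assumes d: "Im d \<noteq> 0"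
    and decay_direction: "Re (A * d\<^sup>2) < 0 \<or> A = 0 \<and> Re (B * d\<^sup>2) < 0 \<or> A = 0 \<and> B = 0 \<and> Re (C * d) < 0"
  shows "eventually (\<lambda>t. Re (K_expo A B C L P (v + of_real t * d)) \<le> - M * t) at_top"
proof -
  define x where "x = (\<lambda>t. (v + of_real t * d) / of_real t)"
  define y where "y = (\<lambda>t. 1 + Ln (x t) / of_real (ln t))"
  have ri: "((\<lambda>t. complex_of_real (g t)) \<longlongrightarrow> 0) at_top" if "(g \<longlongrightarrow> 0) at_top" for g :: "real \<Rightarrow> real"
    using tendsto_of_real[OF that, where ?'a = complex] by simp
  have l1: "((\<lambda>t. complex_of_real (1 / t)) \<longlongrightarrow> 0) at_top" by (rule ri) real_asymp
  have l2: "((\<lambda>t. complex_of_real (1 / ln t)) \<longlongrightarrow> 0) at_top" by (rule ri) real_asymp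
  have l3: "((\<lambda>t. complex_of_real (ln t / t)) \<longlongrightarrow> 0) at_top" by (rule ri) real_asymp
  have "((\<lambda>t. v * of_real (1 / t) + d) \<longlongrightarrow> v * 0 + d) at_top" by (intro tendsto_intros l1)
  moreover have "eventually (\<lambda>t. v * of_real (1 / t) + d = x t) at_top"
    using eventually_gt_at_top[of 0] by eventually_elim (simp add: x_def field_simps)
  ultimately have x: "(x \<longlongrightarrow> d) at_top" using Lim_transform_eventually by fastforce
  have "d \<notin> \<real>\<^sub>\<le>\<^sub>0" using d by (auto simp: complex_nonpos_Reals_iff)
  then have "((\<lambda>t. 1 + Ln (x t) * of_real (1 / ln t)) \<longlongrightarrow> 1 + Ln d * 0) at_top"
    by (intro tendsto_intros x l2)
  then have y: "(y \<longlongrightarrow> 1) at_top" by (simp add: y_def divide_inverse)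
  have ev: "eventually (\<lambda>t::real. t > 1) at_top" by (rule eventually_gt_at_top)
  have ev2: "eventually (\<lambda>t. x t \<noteq> 0) at_top"
  proof (rule tendsto_imp_eventually_ne[OF x])
    show "d \<noteq> 0" using d by auto
  qed
  have K: "K_expo A B C L P (v + of_real t * d) =
      A * (x t)\<^sup>2 * y t * of_real (t\<^sup>2 * ln t) + B * (x t)\<^sup>2 * of_real (t\<^sup>2) + C * x t * y t * of_real (t * ln t)
        + L * x t * of_real t + P * y t * of_real (ln t)" if "t > 1" "x t \<noteq> 0" for t
  proof -
    define s where "s = v + of_real t * d"
    have sx: "s = of_real t * x t" using that by (simp add: x_def s_def)
    have "s \<noteq> 0" using that sx by auto
    then have "Ln s = of_real (ln t) + Ln (x t)" using Ln_ray[of t s] that sx by simp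
    also have "\<dots> = of_real (ln t) * y t" using that by (simp add: y_def distrib_left)
    finally have Ls: "Ln s = of_real (ln t) * y t" .
    show ?thesis unfolding K_expo_def s_def[symmetric] Ls unfolding sx
      by (simp add: power_mult_distrib mult_ac)
  qed
  have fin: "eventually (\<lambda>t. Re (K_expo A B C L P (v + of_real t * d)) \<le> - M * t) at_top"
    if lim: "((\<lambda>t. K_expo A B C L P (v + of_real t * d) / of_real (g t)) \<longlongrightarrow> c) at_top" and c: "Re c < 0"
      and g: "filterlim (\<lambda>t. g t / t) at_top at_top" for g :: "real \<Rightarrow> real" and c
  proof -
    have "eventually (\<lambda>t. Re (K_expo A B C L P (v + of_real t * d) / of_real (g t)) < Re c / 2) at_top"
      using tendsto_Re[OF lim] c by (intro order_tendstoD(2)) auto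
    moreover have "eventually (\<lambda>t. g t / t \<ge> max 1 (2 * \<bar>M\<bar> / - Re c)) at_top"
      using g unfolding filterlim_at_top by blast
    ultimately show ?thesis using eventually_gt_at_top[of 0]
    proof eventually_elim
      case (elim t)
      have gt: "g t \<ge> t" "g t \<ge> (2 * \<bar>M\<bar> / - Re c) * t" using elim by (simp_all add: field_simps)
      have g0: "g t > 0" using gt elim by linarith
      have "Re (K_expo A B C L P (v + of_real t * d)) < Re c / 2 * g t"
        using elim(1) g0 by (simp add: Re_divide_of_real divide_less_eq)
      also have "\<dots> \<le> Re c / 2 * ((2 * \<bar>M\<bar> / - Re c) * t)"
        using gt(2) c by (intro mult_left_mono_neg) auto
      also have "\<dots> = - \<bar>M\<bar> * t" using c by (simp add: field_simps)
      also have "\<dots> \<le> - M * t" using elim by (intro mult_right_mono) auto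
      finally show ?case by simp
    qed
  qed
  from decay_direction consider "Re (A * d\<^sup>2) < 0" | "A = 0" "Re (B * d\<^sup>2) < 0" | "A = 0" "B = 0" "Re (C * d) < 0" by blast
  then show ?thesis
  proof cases
    case 1
    show ?thesis
    proof (rule fin[OF _ 1, of "\<lambda>t. t\<^sup>2 * ln t"])
      have "((\<lambda>t. A * (x t)\<^sup>2 * y t + B * (x t)\<^sup>2 * of_real (1 / ln t) + C * x t * y t * of_real (1 / t)
          + L * x t * (of_real (1 / t) * of_real (1 / ln t)) + P * y t * (of_real (1 / t) * of_real (1 / t)))
        \<longlongrightarrow> A * d\<^sup>2 * 1 + B * d\<^sup>2 * 0 + C * d * 1 * 0 + L * d * (0 * 0) + P * 1 * (0 * 0)) at_top"
        by (intro tendsto_intros x y l1 l2)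
      then show "((\<lambda>t. K_expo A B C L P (v + of_real t * d) / of_real (t\<^sup>2 * ln t)) \<longlongrightarrow> A * d\<^sup>2) at_top"
      proof (rule Lim_transform_eventually[THEN tendsto_eq_rhs])
        show "eventually (\<lambda>t. A * (x t)\<^sup>2 * y t + B * (x t)\<^sup>2 * of_real (1 / ln t) + C * x t * y t * of_real (1 / t)
          + L * x t * (of_real (1 / t) * of_real (1 / ln t)) + P * y t * (of_real (1 / t) * of_real (1 / t))
          = K_expo A B C L P (v + of_real t * d) / of_real (t\<^sup>2 * ln t)) at_top"
          using ev ev2 by eventually_elim (subst K, assumption, assumption, simp add: field_simps power2_eq_square)
      qed auto
      show "filterlim (\<lambda>t::real. t\<^sup>2 * ln t / t) at_top at_top" by real_asymp
    qed
  next
    case 2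
    show ?thesis
    proof (rule fin[OF _ 2(2), of "\<lambda>t. t\<^sup>2"])
      have "((\<lambda>t. B * (x t)\<^sup>2 + C * x t * y t * of_real (ln t / t)
          + L * x t * of_real (1 / t) + P * y t * (of_real (ln t / t) * of_real (1 / t)))
        \<longlongrightarrow> B * d\<^sup>2 + C * d * 1 * 0 + L * d * 0 + P * 1 * (0 * 0)) at_top"
        by (intro tendsto_intros x y l1 l3)
      then show "((\<lambda>t. K_expo A B C L P (v + of_real t * d) / of_real (t\<^sup>2)) \<longlongrightarrow> B * d\<^sup>2) at_top"
      proof (rule Lim_transform_eventually[THEN tendsto_eq_rhs])
        show "eventually (\<lambda>t. B * (x t)\<^sup>2 + C * x t * y t * of_real (ln t / t)
          + L * x t * of_real (1 / t) + P * y t * (of_real (ln t / t) * of_real (1 / t))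
          = K_expo A B C L P (v + of_real t * d) / of_real (t\<^sup>2)) at_top"
          using ev ev2 by eventually_elim (subst K, assumption, assumption, simp add: 2(1) field_simps power2_eq_square)
      qed auto
      show "filterlim (\<lambda>t::real. t\<^sup>2 / t) at_top at_top" by real_asymp
    qed
  next
    case 3
    show ?thesis
    proof (rule fin[OF _ 3(3), of "\<lambda>t. t * ln t"])
      have "((\<lambda>t. C * x t * y t + L * x t * of_real (1 / ln t) + P * y t * of_real (1 / t))
        \<longlongrightarrow> C * d * 1 + L * d * 0 + P * 1 * 0) at_top"
        by (intro tendsto_intros x y l1 l2)
      then show "((\<lambda>t. K_expo A B C L P (v + of_real t * d) / of_real (t * ln t)) \<longlongrightarrow> C * d) at_top"
      proof (rule Lim_transform_eventually[THEN tendsto_eq_rhs])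
        show "eventually (\<lambda>t. C * x t * y t + L * x t * of_real (1 / ln t) + P * y t * of_real (1 / t)
          = K_expo A B C L P (v + of_real t * d) / of_real (t * ln t)) at_top"
          using ev ev2 by eventually_elim (subst K, assumption, assumption, simp add: 3(1,2) field_simps)
      qed auto
      show "filterlim (\<lambda>t::real. t * ln t / t) at_top at_top" by real_asymp
    qed
  qed
qed

section \<open>Poles and directions of decay\<close>

lemma Lambda_plus_lat:
  "Lambda_plus p n a \<tau> = {a j + of_real (lat \<tau> kl) | j kl. j \<in> {n+1..p}}"
  unfolding Lambda_plus_def lat_def by (auto simp: algebra_simps)

lemma Lambda_minus_lat:
  "Lambda_minus q m b \<tau> = {b j - of_real (lat \<tau> kl) | j kl. j \<in> {m+1..q} \<and> fst kl \<ge> 1 \<and> snd kl \<ge> 1}"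
  unfolding Lambda_minus_def lat_def by (auto simp: algebra_simps)

lemma finite_Lambda_plus_le:
  assumes "\<tau> > 0"
  shows "finite {s \<in> Lambda_plus p n a \<tau>. Re s \<le> x}"
proof (rule finite_subset)
  show "{s \<in> Lambda_plus p n a \<tau>. Re s \<le> x} \<subseteq> (\<Union>j\<in>{n+1..p}. (\<lambda>kl. a j + of_real (lat \<tau> kl)) ` {kl. lat \<tau> kl \<le> x - Re (a j)})"
    unfolding Lambda_plus_lat by auto
  show "finite (\<Union>j\<in>{n+1..p}. (\<lambda>kl. a j + of_real (lat \<tau> kl)) ` {kl. lat \<tau> kl \<le> x - Re (a j)})"
    using finite_lat_le[OF assms] by auto
qed

lemma finite_Lambda_minus_ge:
  assumes "\<tau> > 0"
  shows "finite {s \<in> Lambda_minus q m b \<tau>. Re s \<ge> x}"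
proof (rule finite_subset)
  show "{s \<in> Lambda_minus q m b \<tau>. Re s \<ge> x} \<subseteq> (\<Union>j\<in>{m+1..q}. (\<lambda>kl. b j - of_real (lat \<tau> kl)) ` {kl. lat \<tau> kl \<le> Re (b j) - x})"
    unfolding Lambda_minus_lat by auto
  show "finite (\<Union>j\<in>{m+1..q}. (\<lambda>kl. b j - of_real (lat \<tau> kl)) ` {kl. lat \<tau> kl \<le> Re (b j) - x})"
    using finite_lat_le[OF assms] by auto
qed

lemma finite_Im_Lambda: "finite (Im ` Lambda_plus p n a \<tau>)" "finite (Im ` Lambda_minus q m b \<tau>)"
proof -
  have "Im ` Lambda_plus p n a \<tau> \<subseteq> (\<lambda>j. Im (a j)) ` {n+1..p}" unfolding Lambda_plus_lat by auto
  then show "finite (Im ` Lambda_plus p n a \<tau>)" by (rule finite_subset) auto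
  have "Im ` Lambda_minus q m b \<tau> \<subseteq> (\<lambda>j. Im (b j)) ` {m+1..q}" unfolding Lambda_minus_lat by auto
  then show "finite (Im ` Lambda_minus q m b \<tau>)" by (rule finite_subset) auto
qed

text \<open>A nonempty family of poles extends to infinity. This supplies the unbounded set along
  which a pole is exchanged for a distant one when two contours are compared.\<close>

lemma unbounded_Lambda_plus:
  assumes "s \<in> Lambda_plus p n a \<tau>"
  shows "\<not> bounded (Lambda_plus p n a \<tau>)"
proof
  assume "bounded (Lambda_plus p n a \<tau>)"
  then obtain B where B: "\<And>s. s \<in> Lambda_plus p n a \<tau> \<Longrightarrow> norm s \<le> B" unfolding bounded_iff by blast
  obtain j where j: "j \<in> {n+1..p}" using assms by (auto simp: Lambda_plus_lat)
  obtain k :: nat where k: "real k > B + norm (a j)" using reals_Archimedean2 by blast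
  have "a j + of_nat k \<in> Lambda_plus p n a \<tau>"
    unfolding Lambda_plus_lat using j by (intro CollectI exI[of _ j] exI[of _ "(0, k)"]; simp add: lat_def)
  then have "norm (a j + of_nat k) \<le> B" by (rule B)
  moreover have "norm (a j + of_nat k) \<ge> real k - norm (a j)"
    using norm_diff_ineq[of "of_nat k" "a j"] by (simp add: add.commute)
  ultimately show False using k by linarith
qed

lemma unbounded_Lambda_minus:
  assumes "s \<in> Lambda_minus q m b \<tau>"
  shows "\<not> bounded (Lambda_minus q m b \<tau>)"
proof
  assume "bounded (Lambda_minus q m b \<tau>)"
  then obtain B where B: "\<And>s. s \<in> Lambda_minus q m b \<tau> \<Longrightarrow> norm s \<le> B" unfolding bounded_iff by blast
  obtain j where j: "j \<in> {m+1..q}" using assms by (auto simp: Lambda_minus_lat)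
  obtain k :: nat where k: "real k > B + norm (b j - of_real \<tau>)" using reals_Archimedean2 by blast
  have "b j - of_real \<tau> - of_nat (Suc k) \<in> Lambda_minus q m b \<tau>"
    unfolding Lambda_minus_lat using j by (intro CollectI exI[of _ j] exI[of _ "(1, Suc k)"]; simp add: lat_def)
  then have "norm (b j - of_real \<tau> - of_nat (Suc k)) \<le> B" by (rule B)
  moreover have "norm (of_nat (Suc k) - (b j - of_real \<tau>)) \<ge> norm (of_nat (Suc k) :: complex) - norm (b j - of_real \<tau>)"
    by (rule norm_triangle_ineq2)
  moreover have "norm (of_nat (Suc k) :: complex) = real k + 1" unfolding norm_of_nat by simp
  ultimately show False using k by (simp add: norm_minus_commute)
qed

lemma closed_locally_finite:
  fixes A :: "complex set"
  assumes "\<And>R. finite (A \<inter> cball 0 R)"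
  shows "closed A"
  unfolding closed_limpt
proof (intro allI impI, rule ccontr)
  fix x assume x: "x islimpt A" "x \<notin> A"
  have "infinite (A \<inter> ball x 1)" using x(1) by (simp add: islimpt_eq_infinite_ball)
  moreover have "A \<inter> ball x 1 \<subseteq> A \<inter> cball 0 (norm x + 1)"
  proof (intro Int_mono order_refl subsetI)
    fix y assume "y \<in> ball x 1"
    then have "norm (y - x) < 1" by (simp add: dist_norm norm_minus_commute)
    then show "y \<in> cball 0 (norm x + 1)" using norm_triangle_sub[of y x] by simp
  qed
  ultimately show False using assms finite_subset by blast
qed

definition K_dom :: "nat \<Rightarrow> nat \<Rightarrow> nat \<Rightarrow> nat \<Rightarrow> (nat \<Rightarrow> complex) \<Rightarrow> (nat \<Rightarrow> complex) \<Rightarrow> real \<Rightarrow> complex set" where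
  "K_dom p q m n a b \<tau> = - (Lambda_plus p n a \<tau> \<union> Lambda_minus q m b \<tau>)"

lemma open_K_dom:
  assumes "\<tau> > 0"
  shows "open (K_dom p q m n a b \<tau>)"
proof -
  have "closed (Lambda_plus p n a \<tau> \<union> Lambda_minus q m b \<tau>)"
  proof (rule closed_locally_finite)
    fix R
    have "(Lambda_plus p n a \<tau> \<union> Lambda_minus q m b \<tau>) \<inter> cball 0 R \<subseteq>
      {s \<in> Lambda_plus p n a \<tau>. Re s \<le> R} \<union> {s \<in> Lambda_minus q m b \<tau>. Re s \<ge> - R}"
    proof
      fix s assume s: "s \<in> (Lambda_plus p n a \<tau> \<union> Lambda_minus q m b \<tau>) \<inter> cball 0 R"
      then have "\<bar>Re s\<bar> \<le> R" using abs_Re_le_cmod[of s] by auto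
      then show "s \<in> {s \<in> Lambda_plus p n a \<tau>. Re s \<le> R} \<union> {s \<in> Lambda_minus q m b \<tau>. Re s \<ge> - R}"
        using s by (auto simp: abs_le_iff)
    qed
    then show "finite ((Lambda_plus p n a \<tau> \<union> Lambda_minus q m b \<tau>) \<inter> cball 0 R)"
      by (rule finite_subset) (use finite_Lambda_plus_le[OF assms] finite_Lambda_minus_ge[OF assms] in auto)
  qed
  then show ?thesis unfolding K_dom_def by (rule open_Compl)
qed

text \<open>The poles lie on finitely many horizontal lines. Beyond the height Y the ends of a
  contour can be turned without meeting any.\<close>

lemma K_dom_Im_bound:
  obtains Y where "Y > 0" "\<And>s. \<bar>Im s\<bar> > Y \<Longrightarrow> s \<in> K_dom p q m n a b \<tau>"
proof -
  have "finite (Im ` (Lambda_plus p n a \<tau> \<union> Lambda_minus q m b \<tau>))"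
    unfolding image_Un using finite_Im_Lambda by auto
  then obtain B where B: "\<And>y. y \<in> Im ` (Lambda_plus p n a \<tau> \<union> Lambda_minus q m b \<tau>) \<Longrightarrow> \<bar>y\<bar> \<le> B"
    by (metis bounded_iff finite_imp_bounded real_norm_def)
  show ?thesis
  proof (rule that[of "\<bar>B\<bar> + 1"])
    fix s :: complex assume s: "\<bar>Im s\<bar> > \<bar>B\<bar> + 1"
    show "s \<in> K_dom p q m n a b \<tau>"
    proof (rule ccontr)
      assume "s \<notin> K_dom p q m n a b \<tau>"
      then have "\<bar>Im s\<bar> \<le> B" by (intro B) (auto simp: K_dom_def)
      then show False using s by linarith
    qed
  qed auto
qed

lemma holomorphic_K_Gquot:
  assumes t: "\<tau> > 0"
  shows "K_Gquot p q m n a b \<tau> holomorphic_on K_dom p q m n a b \<tau>"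
proof -
  have "(\<Prod>j=m+1..q. Barnes_G (of_real \<tau>) (1 + of_real \<tau> - b j + s)) *
      (\<Prod>j=n+1..p. Barnes_G (of_real \<tau>) (a j - s)) \<noteq> 0" if s: "s \<in> K_dom p q m n a b \<tau>" for s
  proof
    assume "(\<Prod>j=m+1..q. Barnes_G (of_real \<tau>) (1 + of_real \<tau> - b j + s)) *
      (\<Prod>j=n+1..p. Barnes_G (of_real \<tau>) (a j - s)) = 0"
    then have "(\<exists>j\<in>{m+1..q}. Barnes_G (of_real \<tau>) (1 + of_real \<tau> - b j + s) = 0) \<or>
       (\<exists>j\<in>{n+1..p}. Barnes_G (of_real \<tau>) (a j - s) = 0)"
      by (simp only: mult_eq_0_iff prod_zero_iff finite_atLeastAtMost)
    then show False
    proof (elim disjE bexE)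
      fix j assume 1: "j \<in> {m+1..q}" "Barnes_G (of_real \<tau>) (1 + of_real \<tau> - b j + s) = 0"
      obtain kl where e: "1 + of_real \<tau> - b j + s = - of_real (lat \<tau> kl)"
        using Barnes_G_eq_0[OF t 1(2)] by blast
      \<comment> \<open>The shift by 1 + \<tau> in the argument raises both lattice indices by one,
        which accounts for l, k >= 1 in \<open>Lambda_minus\<close>.\<close>
      have "s = (1 + of_real \<tau> - b j + s) - 1 - of_real \<tau> + b j" by simp
      also have "\<dots> = b j - of_real (lat \<tau> (Suc (fst kl), Suc (snd kl)))"
        unfolding e by (simp add: lat_def algebra_simps)
      finally have "s \<in> Lambda_minus q m b \<tau>" unfolding Lambda_minus_lat using 1(1)
        by (intro CollectI exI[of _ j] exI[of _ "(Suc (fst kl), Suc (snd kl))"]; simp)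
      then show False using s by (simp add: K_dom_def)
    next
      fix j assume 2: "j \<in> {n+1..p}" "Barnes_G (of_real \<tau>) (a j - s) = 0"
      obtain kl where "a j - s = - of_real (lat \<tau> kl)" using Barnes_G_eq_0[OF t 2(2)] by blast
      then have "s = a j + of_real (lat \<tau> kl)" by (simp add: algebra_simps)
      then have "s \<in> Lambda_plus p n a \<tau>" unfolding Lambda_plus_lat using 2(1) by blast
      then show False using s by (simp add: K_dom_def)
    qed
  qed
  then show ?thesis unfolding K_Gquot_def
    by (intro holomorphic_on_divide holomorphic_on_mult holomorphic_on_prod holomorphic_Barnes_G[OF t] holomorphic_intros)
qed

text \<open>The angle has tangent - Re \<omega> / (|Im \<omega>| + 1), so |Im \<omega>| times this
  tangent stays below - Re \<omega>. The summand 1 covers real \<omega>.\<close>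

lemma small_angle_exists:
  assumes "Re \<omega> < 0"
  obtains \<phi> where "\<phi> \<in> {0<..<pi/2}" "Re (\<omega> * cis \<phi>) < 0" "Re (\<omega> * cis (- \<phi>)) < 0"
proof -
  define r where "r = - Re \<omega> / (\<bar>Im \<omega>\<bar> + 1)"
  define \<phi> where "\<phi> = arctan r"
  have r: "r > 0" using assms by (simp add: r_def divide_neg_pos)
  have \<phi>: "0 < \<phi>" "\<phi> < pi / 2" using r arctan_ubound[of r] by (simp_all add: \<phi>_def)
  have c: "cos \<phi> > 0" using \<phi> by (intro cos_gt_zero) auto
  have "sin \<phi> = r * cos \<phi>" using tan_arctan[of r] c by (simp add: \<phi>_def tan_def field_simps)
  moreover have "\<bar>Im \<omega>\<bar> * r < - Re \<omega>"
    using assms r by (simp add: r_def pos_divide_less_eq field_simps)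
  ultimately have "\<bar>Im \<omega>\<bar> * sin \<phi> < - Re \<omega> * cos \<phi>"
    using c by (metis mult.assoc mult_strict_right_mono)
  moreover have "\<bar>Im \<omega> * sin \<phi>\<bar> = \<bar>Im \<omega>\<bar> * sin \<phi>" using sin_gt_zero[of \<phi>] \<phi> by (simp add: abs_mult)
  ultimately have "Re \<omega> * cos \<phi> - Im \<omega> * sin \<phi> < 0" "Re \<omega> * cos \<phi> + Im \<omega> * sin \<phi> < 0"
    by (simp_all add: abs_if split: if_splits)
  then show ?thesis using that[of \<phi>] \<phi> by simp
qed

text \<open>Taking 2 \<theta> to be the argument of - cnj c modulo 2 \<pi> makes c cis (2 \<theta>)
  equal to - |c|, and \<theta> - \<pi> has the same square. The argument 0, for which \<theta> would
  fall on the real axis, means that c is negative and is ruled out by Re c >= 0.\<close>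

lemma quadratic_angle_exists:
  assumes "c \<noteq> 0" "Re c \<ge> 0"
  obtains \<theta> where "\<theta> \<in> {0<..<pi}" "Re (c * (cis \<theta>)\<^sup>2) < 0" "Re (c * (cis (\<theta> - pi))\<^sup>2) < 0"
proof -
  define z where "z = - cnj c"
  define \<psi> where "\<psi> = Arg z"
  have zn: "z \<noteq> 0" using assms by (simp add: z_def)
  have cz: "z = of_real (norm c) * cis \<psi>" using rcis_cmod_Arg[of z] by (simp add: rcis_def z_def \<psi>_def)
  have \<psi>: "- pi < \<psi>" "\<psi> \<le> pi" "\<psi> \<noteq> 0"
  proof -
    show "- pi < \<psi>" "\<psi> \<le> pi" using Arg_bounded[of z] by (auto simp: \<psi>_def)
    show "\<psi> \<noteq> 0"
    proof
      assume "\<psi> = 0"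
      then have "z = of_real (norm c)" using cz by simp
      then have "Re z = norm c" by simp
      then have "- Re c = norm c" by (simp add: z_def)
      then have "norm c \<le> 0" using assms(2) by linarith
      then show False using assms(1) by simp
    qed
  qed
  define \<theta> where "\<theta> = (if \<psi> > 0 then \<psi> / 2 else \<psi> / 2 + pi)"
  have \<theta>: "\<theta> \<in> {0<..<pi}" using \<psi> by (auto simp: \<theta>_def)
  have sq: "(cis \<theta>)\<^sup>2 = cis \<psi>"
  proof (cases "\<psi> > 0")
    case True
    then show ?thesis by (simp add: \<theta>_def power2_eq_square cis_mult)
  next
    case False
    then have "(cis \<theta>)\<^sup>2 = cis (\<psi> + 2 * pi)" by (simp add: \<theta>_def power2_eq_square cis_mult)
    then show ?thesis by (simp add: complex_eq_iff)
  qed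
  have "of_real (norm c) * (c * cis \<psi>) = c * z" using cz by simp
  also have "\<dots> = - of_real ((norm c)\<^sup>2)" unfolding z_def complex_norm_square by simp
  finally have "of_real (norm c) * (c * cis \<psi>) = of_real (norm c) * - of_real (norm c)" by (simp add: power2_eq_square)
  moreover have "complex_of_real (norm c) \<noteq> 0" using assms by simp
  ultimately have cp: "c * cis \<psi> = - of_real (norm c)" by (meson mult_left_cancel)
  have "cis (\<theta> - pi) = - cis \<theta>" by (simp add: complex_eq_iff)
  then have sq2: "(cis (\<theta> - pi))\<^sup>2 = cis \<psi>" using sq by simp
  show ?thesis
    by (rule that[OF \<theta>]) (use assms(1) in \<open>simp_all add: sq sq2 cp\<close>)
qed

text \<open>The half-plane Re (\<mu> s) > 0 meets the open upper half-plane unless \<mu> is a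
  positive multiple of the imaginary unit.\<close>

lemma linear_angle_exists:
  assumes "\<mu> \<noteq> 0" "\<not> (Re \<mu> = 0 \<and> Im \<mu> > 0)"
  obtains \<theta> where "\<theta> \<in> {0<..<pi}" "Re (\<mu> * cis \<theta>) > 0"
proof (cases "Re \<mu>" "0::real" rule: linorder_cases)
  case less
  obtain \<phi> where \<phi>: "\<phi> \<in> {0<..<pi/2}" "Re (\<mu> * cis (- \<phi>)) < 0" using small_angle_exists[OF less] by metis
  then show ?thesis by (intro that[of "pi - \<phi>"]) (auto simp: sin_diff cos_diff)
next
  case greater
  then have "Re (- \<mu>) < 0" by simp
  then obtain \<phi> where "\<phi> \<in> {0<..<pi/2}" "Re (- \<mu> * cis \<phi>) < 0" using small_angle_exists by metis
  then show ?thesis by (intro that[of \<phi>]) auto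
next
  case equal
  then have "Im \<mu> < 0" using assms by (auto simp: complex_eq_iff)
  then show ?thesis using equal by (intro that[of "pi / 2"]) auto
qed

lemma Re_Arg_quadratic:
  assumes "s \<noteq> 0"
  shows "Re (c * s\<^sup>2) = (norm s)\<^sup>2 * Re (c * (cis (Arg s))\<^sup>2)" "Re (c * s) = norm s * Re (c * cis (Arg s))"
proof -
  have s: "s = of_real (norm s) * cis (Arg s)" using rcis_cmod_Arg[of s] by (simp add: rcis_def)
  have "c * s = of_real (norm s) * (c * cis (Arg s))" by (subst s) simp
  moreover have R: "Re (of_real r * x) = r * Re x" for r x by simp
  ultimately show "Re (c * s) = norm s * Re (c * cis (Arg s))" by (simp only: R)
  have "c * s\<^sup>2 = of_real ((norm s)\<^sup>2) * (c * (cis (Arg s))\<^sup>2)" by (subst s) (simp add: power_mult_distrib)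
  then show "Re (c * s\<^sup>2) = (norm s)\<^sup>2 * Re (c * (cis (Arg s))\<^sup>2)" by (simp only: R)
qed

lemma all_Arg_quadratic_iff:
  assumes "\<theta> \<in> {-pi<..pi}"
  shows "(\<forall>s. s \<noteq> 0 \<and> Arg s = \<theta> \<longrightarrow> Re (c * s\<^sup>2) < 0) \<longleftrightarrow> Re (c * (cis \<theta>)\<^sup>2) < 0"
    "(\<forall>s. s \<noteq> 0 \<and> Arg s = \<theta> \<longrightarrow> Re (c * s) > 0) \<longleftrightarrow> Re (c * cis \<theta>) > 0"
proof -
  have A: "Arg (cis \<theta>) = \<theta>" "cis \<theta> \<noteq> 0" using assms by (auto intro: Arg_cis)
  have "Re (c * s\<^sup>2) < 0" if "Re (c * (cis \<theta>)\<^sup>2) < 0" "s \<noteq> 0" "Arg s = \<theta>" for s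
  proof -
    have "(norm s)\<^sup>2 > 0" using that by simp
    then show ?thesis unfolding Re_Arg_quadratic(1)[OF that(2)] that(3) using that(1) by (rule mult_pos_neg)
  qed
  then show "(\<forall>s. s \<noteq> 0 \<and> Arg s = \<theta> \<longrightarrow> Re (c * s\<^sup>2) < 0) \<longleftrightarrow> Re (c * (cis \<theta>)\<^sup>2) < 0" using A by blast
  have "Re (c * s) > 0" if "Re (c * cis \<theta>) > 0" "s \<noteq> 0" "Arg s = \<theta>" for s
    unfolding Re_Arg_quadratic(2)[OF that(2)] that(3) using that by (intro mult_pos_pos) auto
  then show "(\<forall>s. s \<noteq> 0 \<and> Arg s = \<theta> \<longrightarrow> Re (c * s) > 0) \<longleftrightarrow> Re (c * cis \<theta>) > 0" using A by blast
qed

section \<open>The integrand in exponential form and its decay\<close>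

definition K_weight :: "nat \<Rightarrow> nat \<Rightarrow> nat \<Rightarrow> nat \<Rightarrow> (nat \<Rightarrow> complex) \<Rightarrow> (nat \<Rightarrow> complex) \<Rightarrow>
    real \<Rightarrow> complex \<Rightarrow> complex \<Rightarrow> complex" where
  "K_weight p q m n a b \<tau> \<alpha> s = K_Gquot p q m n a b \<tau> s * exp (of_real pi * \<alpha> / of_real \<tau> * s\<^sup>2)"

lemma holomorphic_K_weight:
  assumes "\<tau> > 0"
  shows "K_weight p q m n a b \<tau> \<alpha> holomorphic_on K_dom p q m n a b \<tau>"
  unfolding K_weight_def by (intro holomorphic_intros holomorphic_K_Gquot[OF assms]) auto

text \<open>With z = exp (2 \<pi> w) the factor z powr (- s) is exp (\<omega> s) for \<omega> = - 2
  \<pi> w. From here on the parameter of the integrals is \<omega>.\<close>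

lemma Meijer_Barnes_K_exp:
  "Meijer_Barnes_K p q m n a b \<tau> \<alpha> (exp (2 * pi * w)) = 1 / (2 * of_real pi * \<i>) *
     line_contour_integral (SOME \<gamma>. K_contour p q m n a b \<tau> \<alpha> (exp (2 * pi * w)) \<gamma>)
       (\<lambda>s. K_weight p q m n a b \<tau> \<alpha> s * exp (of_real (- (2 * pi * w)) * s))"
proof -
  have "of_real (exp (2 * pi * w)) powr (- s) = exp (of_real (- (2 * pi * w)) * s)" for s :: complex
    by (simp add: powr_def Ln_of_real mult.commute)
  then show ?thesis unfolding Meijer_Barnes_K_def K_weight_def by simp
qed

definition decay_direction :: "complex \<Rightarrow> complex \<Rightarrow> complex \<Rightarrow> complex \<Rightarrow> bool" where
  "decay_direction A B C d \<longleftrightarrow> Re (A * d\<^sup>2) < 0 \<or> A = 0 \<and> Re (B * d\<^sup>2) < 0 \<or> A = 0 \<and> B = 0 \<and> Re (C * d) < 0"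

lemma K_weight_asymp:
  assumes t: "\<tau> > 0" and mq: "m \<le> q" and np: "n \<le> p"
  obtains A B C L P where
    "\<And>\<kappa>. \<kappa> > 0 \<Longrightarrow> \<exists>R D. \<forall>s. norm s \<ge> R \<longrightarrow> \<bar>Im s\<bar> \<ge> \<kappa> * norm s \<longrightarrow>
       norm (K_weight p q m n a b \<tau> \<alpha> s) \<le> exp (Re (K_expo A (B (sgn (Im s))) C (L (sgn (Im s))) P s) + D)"
    "A = of_real (of_int (K_N p q m n) / (2 * \<tau>))"
    "\<And>\<sigma>. K_N p q m n = 0 \<Longrightarrow> B \<sigma> = of_real (pi / \<tau>) * (\<alpha> + of_real \<sigma> * ((of_nat p - of_nat q) * \<i> / 4))"
    "K_N p q m n = 0 \<Longrightarrow> C = - K_mu p q m n a b / of_real \<tau>"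
    "\<And>\<sigma>. K_N p q m n = 0 \<Longrightarrow> p = q \<Longrightarrow> K_mu p q m n a b = 0 \<Longrightarrow>
       L \<sigma> = - (\<i> * of_real pi * of_real \<sigma> * K_nu p q a b / (2 * of_real \<tau>))"
    "K_N p q m n = 0 \<Longrightarrow> p = q \<Longrightarrow> K_mu p q m n a b = 0 \<Longrightarrow> K_nu p q a b = 0 \<Longrightarrow>
       P = K_xi p q m n a b / (2 * of_real \<tau>)"
proof -
  obtain b2 L P where G: "\<And>\<kappa>. \<kappa> > 0 \<Longrightarrow> \<exists>R B. \<forall>s. norm s \<ge> R \<longrightarrow> \<bar>Im s\<bar> \<ge> \<kappa> * norm s \<longrightarrow>
       (\<exists>e. norm e \<le> B \<and> K_Gquot p q m n a b \<tau> s =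
         exp (K_expo (of_int (K_N p q m n) / (2 * of_real \<tau>))
           (b2 * of_int (K_N p q m n) - \<i> * of_real pi * of_real (sgn (Im s)) * (of_nat m + of_nat n - of_nat p) / (2 * of_real \<tau>))
           (- Phi_coeff1 \<tau> * of_int (K_N p q m n) - K_mu p q m n a b / of_real \<tau>)
           (L (sgn (Im s))) P s + e))"
    and L: "\<And>\<sigma>. K_N p q m n = 0 \<Longrightarrow> p = q \<Longrightarrow> K_mu p q m n a b = 0 \<Longrightarrow>
       L \<sigma> = - (\<i> * of_real pi * of_real \<sigma> * K_nu p q a b / (2 * of_real \<tau>))"
    and P: "K_N p q m n = 0 \<Longrightarrow> p = q \<Longrightarrow> K_mu p q m n a b = 0 \<Longrightarrow> K_nu p q a b = 0 \<Longrightarrow>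
       P = K_xi p q m n a b / (2 * of_real \<tau>)"
    by (rule K_Gquot_asymp[OF t mq np, of a b]) (rule that)
  define A where "A = (of_int (K_N p q m n) / (2 * of_real \<tau>) :: complex)"
  define B where "B = (\<lambda>\<sigma>. b2 * of_int (K_N p q m n) - \<i> * of_real pi * of_real \<sigma> * (of_nat m + of_nat n - of_nat p) / (2 * of_real \<tau>)
     + of_real pi * \<alpha> / of_real \<tau>)"
  define C where "C = - Phi_coeff1 \<tau> * of_int (K_N p q m n) - K_mu p q m n a b / of_real \<tau>"
  show ?thesis
  proof (rule that[of A B C L P])
    fix \<kappa> :: real assume "\<kappa> > 0"
    then obtain R D where RD: "\<And>s. norm s \<ge> R \<Longrightarrow> \<bar>Im s\<bar> \<ge> \<kappa> * norm s \<Longrightarrow>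
       \<exists>e. norm e \<le> D \<and> K_Gquot p q m n a b \<tau> s = exp (K_expo A (B (sgn (Im s)) - of_real pi * \<alpha> / of_real \<tau>) C (L (sgn (Im s))) P s + e)"
      using G[of \<kappa>] unfolding A_def B_def C_def add_diff_cancel_right' by (elim meta_impE exE) (auto intro: that)
    show "\<exists>R D. \<forall>s. norm s \<ge> R \<longrightarrow> \<bar>Im s\<bar> \<ge> \<kappa> * norm s \<longrightarrow>
       norm (K_weight p q m n a b \<tau> \<alpha> s) \<le> exp (Re (K_expo A (B (sgn (Im s))) C (L (sgn (Im s))) P s) + D)"
    proof (rule exI[of _ R], rule exI[of _ D], intro allI impI)
      fix s :: complex assume s: "norm s \<ge> R" "\<bar>Im s\<bar> \<ge> \<kappa> * norm s"
      obtain e where e: "norm e \<le> D" "K_Gquot p q m n a b \<tau> s = exp (K_expo A (B (sgn (Im s)) - of_real pi * \<alpha> / of_real \<tau>) C (L (sgn (Im s))) P s + e)"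
        using RD[OF s] by blast
      have "K_weight p q m n a b \<tau> \<alpha> s = exp (K_expo A (B (sgn (Im s))) C (L (sgn (Im s))) P s + e)"
        unfolding K_weight_def e(2) exp_add[symmetric] K_expo_def by (simp add: algebra_simps)
      then have "norm (K_weight p q m n a b \<tau> \<alpha> s) = exp (Re (K_expo A (B (sgn (Im s))) C (L (sgn (Im s))) P s) + Re e)" by simp
      also have "\<dots> \<le> exp (Re (K_expo A (B (sgn (Im s))) C (L (sgn (Im s))) P s) + D)"
        using e(1) complex_Re_le_cmod[of e] by simp
      finally show "norm (K_weight p q m n a b \<tau> \<alpha> s) \<le> exp (Re (K_expo A (B (sgn (Im s))) C (L (sgn (Im s))) P s) + D)" .
    qed
  next
    show "A = of_real (of_int (K_N p q m n) / (2 * \<tau>))" by (simp add: A_def)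
  next
    fix \<sigma> assume N: "K_N p q m n = 0"
    \<comment> \<open>Then m + n - p is (q - p) / 2, and the coefficient of s^2 takes the form that
      occurs in the angle rules (ii)-(iv).\<close>
    have mn: "of_nat m + of_nat n = (of_nat p + of_nat q) / (2 :: complex)"
    proof -
      have "2 * (int m + int n) = int p + int q" using N by (simp add: K_N_def)
      then have "of_int (2 * (int m + int n)) = (of_int (int p + int q) :: complex)" by (simp only:)
      then show ?thesis by (simp add: algebra_simps)
    qed
    show "B \<sigma> = of_real (pi / \<tau>) * (\<alpha> + of_real \<sigma> * ((of_nat p - of_nat q) * \<i> / 4))"
      unfolding B_def mn N using t by (simp add: field_simps)
  next
    assume N: "K_N p q m n = 0"
    show "C = - K_mu p q m n a b / of_real \<tau>" unfolding C_def N by simp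
  next
    fix \<sigma> assume "K_N p q m n = 0" "p = q" "K_mu p q m n a b = 0"
    then show "L \<sigma> = - (\<i> * of_real pi * of_real \<sigma> * K_nu p q a b / (2 * of_real \<tau>))" by (rule L)
  next
    assume "K_N p q m n = 0" "p = q" "K_mu p q m n a b = 0" "K_nu p q a b = 0"
    then show "P = K_xi p q m n a b / (2 * of_real \<tau>)" by (rule P)
  qed
qed

text \<open>For large t the imaginary part is at least t |Im d| / 2 and the modulus at most 2 t |d|;
  the quotient of the two is the constant of the sector.\<close>

lemma ray_in_sector:
  assumes d: "Im d \<noteq> 0"
  shows "eventually (\<lambda>t. sgn (Im (v + of_real t * d)) = sgn (Im d) \<and>
     \<bar>Im (v + of_real t * d)\<bar> \<ge> \<bar>Im d\<bar> / (4 * norm d) * norm (v + of_real t * d) \<and> norm (v + of_real t * d) \<ge> R) at_top"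
  using eventually_gt_at_top[of 0] eventually_gt_at_top[of "2 * \<bar>Im v\<bar> / \<bar>Im d\<bar>"]
    eventually_ge_at_top[of "norm v / norm d"] eventually_ge_at_top[of "2 * R / \<bar>Im d\<bar>"]
proof eventually_elim
  case (elim t)
  have dn: "norm d > 0" using d by auto
  let ?s = "v + of_real t * d"
  have I: "Im ?s = Im v + t * Im d" by simp
  have h: "2 * \<bar>Im v\<bar> < t * \<bar>Im d\<bar>" "norm v \<le> t * norm d" "2 * R \<le> t * \<bar>Im d\<bar>"
    using elim d dn by (simp_all add: field_simps)
  have td: "\<bar>t * Im d\<bar> = t * \<bar>Im d\<bar>" using elim by (simp add: abs_mult)
  have g: "\<bar>Im ?s\<bar> \<ge> t * \<bar>Im d\<bar> / 2" unfolding I using h td by linarith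
  have "norm ?s \<le> norm v + t * norm d" using norm_triangle_ineq[of v "of_real t * d"] elim by (simp add: norm_mult)
  then have n: "norm ?s \<le> 2 * (t * norm d)" using h by linarith
  have "\<bar>Im d\<bar> / (4 * norm d) * norm ?s \<le> \<bar>Im d\<bar> / (4 * norm d) * (2 * (t * norm d))"
    using n by (intro mult_left_mono) auto
  also have "\<dots> = t * \<bar>Im d\<bar> / 2" using dn by (simp add: field_simps)
  finally have "\<bar>Im ?s\<bar> \<ge> \<bar>Im d\<bar> / (4 * norm d) * norm ?s" using g by linarith
  moreover have "norm ?s \<ge> R" using g h abs_Im_le_cmod[of ?s] by linarith
  moreover have "sgn (Im ?s) = sgn (Im d)"
  proof (cases "Im d > 0")
    case True
    then have "Im ?s > 0" unfolding I using h by auto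
    then show ?thesis using True by simp
  next
    case False
    then have "Im d < 0" using d by simp
    then have "Im ?s < 0" unfolding I using h by auto
    then show ?thesis using \<open>Im d < 0\<close> by simp
  qed
  ultimately show ?case by blast
qed

lemma ray_integrable_exp_mult:
  assumes f: "f holomorphic_on S" and ray: "\<And>t. t \<ge> 0 \<Longrightarrow> v + of_real t * d \<in> S"
    and bd: "eventually (\<lambda>t. norm (f (v + of_real t * d)) \<le> C * exp (c * t)) at_top" and neg: "Re (\<omega> * d) + c < 0"
  shows "ray_integrable (\<lambda>s. f s * exp (\<omega> * s)) v d"
proof (rule ray_integrable_exp_decay[of _ _ _ "- (Re (\<omega> * d) + c)" "C * exp (Re (\<omega> * v))"])
  have "continuous_on {0..} (\<lambda>t. f (v + of_real t * d))"
    by (rule continuous_on_compose2[OF holomorphic_on_imp_continuous_on[OF f]]) (use ray in \<open>auto intro!: continuous_intros\<close>)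
  then show "continuous_on {0..} (\<lambda>t. f (v + of_real t * d) * exp (\<omega> * (v + of_real t * d)))"
    by (intro continuous_intros)
  show "- (Re (\<omega> * d) + c) > 0" using neg by simp
  show "eventually (\<lambda>t. norm (f (v + of_real t * d) * exp (\<omega> * (v + of_real t * d))) \<le>
      C * exp (Re (\<omega> * v)) * exp (- (- (Re (\<omega> * d) + c)) * t)) at_top"
    using bd
  proof eventually_elim
    case (elim t)
    have r: "Re (\<omega> * (v + of_real t * d)) = Re (\<omega> * v) + Re (\<omega> * d) * t" by (simp add: algebra_simps)
    have "norm (f (v + of_real t * d) * exp (\<omega> * (v + of_real t * d))) \<le> C * exp (c * t) * exp (Re (\<omega> * v) + Re (\<omega> * d) * t)"
      unfolding norm_mult norm_exp_eq_Re r using elim by (intro mult_right_mono) auto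
    also have "\<dots> = C * exp (Re (\<omega> * v)) * exp (- (- (Re (\<omega> * d) + c)) * t)"
      unfolding minus_minus distrib_right exp_add by (simp only: mult_ac)
    finally show ?case .
  qed
qed

lemma contour_sum_exp_holomorphic:
  assumes ct: "contour_tails \<gamma> T dp dm" and S: "open S" "range \<gamma> \<subseteq> S" and f: "f holomorphic_on S"
    and U: "open U" and r1: "\<And>\<omega>. \<omega> \<in> U \<Longrightarrow> ray_integrable (\<lambda>s. f s * exp (\<omega> * s)) (\<gamma> T) d1"
    and r2: "\<And>\<omega>. \<omega> \<in> U \<Longrightarrow> ray_integrable (\<lambda>s. f s * exp (\<omega> * s)) (\<gamma> (- T)) d2"
  shows "(\<lambda>\<omega>. contour_sum \<gamma> T d1 d2 (\<lambda>s. f s * exp (\<omega> * s))) holomorphic_on U"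
proof -
  obtain h where h: "polynomial_function h" "path_image h \<subseteq> S"
    "\<And>f. f holomorphic_on S \<Longrightarrow> contour_integral (mid_path \<gamma> T) f = contour_integral h f"
    using mid_path_polynomial[OF ct S] by metis
  have "contour_integral (mid_path \<gamma> T) (\<lambda>s. f s * exp (\<omega> * s)) = contour_integral h (\<lambda>s. f s * exp (\<omega> * s))" for \<omega>
    by (intro h(3) holomorphic_intros f)
  moreover have "(\<lambda>\<omega>. contour_integral h (\<lambda>s. f s * exp (\<omega> * s))) holomorphic_on U"
    using holomorphic_contour_integral_polynomial[OF h(1,2) holomorphic_on_imp_continuous_on[OF f]]
    by (rule holomorphic_on_subset) auto
  ultimately show ?thesis unfolding contour_sum_def
    by (simp add: holomorphic_on_add holomorphic_on_diff holomorphic_ray_integral[OF U r1] holomorphic_ray_integral[OF U r2])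
qed

lemma K_contour_exists:
  assumes t: "\<tau> > 0" and disj: "Lambda_plus p n a \<tau> \<inter> Lambda_minus q m b \<tau> = {}"
    and ang: "K_angles p q m n a b \<alpha> z \<theta>m \<theta>p"
  shows "\<exists>\<gamma>. K_contour p q m n a b \<tau> \<alpha> z \<gamma>"
proof -
  have "\<theta>p \<in> {0<..<pi}" "\<theta>m \<in> {-pi<..<0}" using ang by (auto simp: K_angles_def)
  then have "\<exists>\<gamma>. separating_contour (Lambda_plus p n a \<tau>) (Lambda_minus q m b \<tau>) \<theta>m \<theta>p \<gamma>"
    using disj finite_Lambda_plus_le[OF t] finite_Lambda_minus_ge[OF t] finite_Im_Lambda
    by (intro separating_contour_exists) auto
  then show ?thesis using ang unfolding K_contour_def by blast
qed

lemma K_angles_exist: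
  assumes "K_case_i p q m n \<or> K_case_ii p q m n \<alpha> \<or> K_case_iii p q m n a b \<alpha> \<or>
      K_case_iv p q m n a b \<alpha> \<or> K_case_v p q m n a b \<alpha> \<or> K_case_vi p q m n a b \<alpha>"
  shows "\<exists>\<theta>m \<theta>p. K_angles p q m n a b \<alpha> z \<theta>m \<theta>p"
proof -
  have quad_p: "\<exists>\<theta>\<in>{0<..<pi}. \<forall>s. s \<noteq> 0 \<and> Arg s = \<theta> \<longrightarrow> Re (c * s\<^sup>2) < 0"
    and quad_m: "\<exists>\<theta>\<in>{-pi<..<0}. \<forall>s. s \<noteq> 0 \<and> Arg s = \<theta> \<longrightarrow> Re (c * s\<^sup>2) < 0"
    if c: "c \<noteq> 0" "Re c \<ge> 0" for c
  proof -
    obtain \<theta> where \<theta>: "\<theta> \<in> {0<..<pi}" "Re (c * (cis \<theta>)\<^sup>2) < 0" "Re (c * (cis (\<theta> - pi))\<^sup>2) < 0"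
      using quadratic_angle_exists[OF c] by metis
    show "\<exists>\<theta>\<in>{0<..<pi}. \<forall>s. s \<noteq> 0 \<and> Arg s = \<theta> \<longrightarrow> Re (c * s\<^sup>2) < 0"
      using \<theta> all_Arg_quadratic_iff(1)[of \<theta> c] by (intro bexI[of _ \<theta>]) auto
    show "\<exists>\<theta>\<in>{-pi<..<0}. \<forall>s. s \<noteq> 0 \<and> Arg s = \<theta> \<longrightarrow> Re (c * s\<^sup>2) < 0"
      using \<theta> all_Arg_quadratic_iff(1)[of "\<theta> - pi" c] by (intro bexI[of _ "\<theta> - pi"]) auto
  qed
  have lin_p: "\<exists>\<theta>\<in>{0<..<pi}. \<forall>s. s \<noteq> 0 \<and> Arg s = \<theta> \<longrightarrow> Re (\<mu> * s) > 0" if \<mu>: "\<mu> \<noteq> 0" "\<not> (Re \<mu> = 0 \<and> Im \<mu> > 0)" for \<mu>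
  proof -
    obtain \<theta> where \<theta>: "\<theta> \<in> {0<..<pi}" "Re (\<mu> * cis \<theta>) > 0" using linear_angle_exists[OF \<mu>] by metis
    then show ?thesis using all_Arg_quadratic_iff(2)[of \<theta> \<mu>] by (intro bexI[of _ \<theta>]) auto
  qed
  \<comment> \<open>Complex conjugation reduces the lower half-plane to the upper one.\<close>
  have lin_m: "\<exists>\<theta>\<in>{-pi<..<0}. \<forall>s. s \<noteq> 0 \<and> Arg s = \<theta> \<longrightarrow> Re (\<mu> * s) > 0" if \<mu>: "\<mu> \<noteq> 0" "\<not> (Re \<mu> = 0 \<and> Im \<mu> < 0)" for \<mu>
  proof -
    obtain \<theta> where \<theta>: "\<theta> \<in> {0<..<pi}" "Re (cnj \<mu> * cis \<theta>) > 0" using linear_angle_exists[of "cnj \<mu>"] \<mu> by auto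
    then have "Re (\<mu> * cis (- \<theta>)) > 0" by simp
    then show ?thesis using all_Arg_quadratic_iff(2)[of "- \<theta>" \<mu>] \<theta> by (intro bexI[of _ "- \<theta>"]) auto
  qed
  have argp: "\<not> (Re \<mu> = 0 \<and> Im \<mu> > 0)" if "Arg \<mu> \<noteq> pi / 2" for \<mu>
  proof
    assume "Re \<mu> = 0 \<and> Im \<mu> > 0"
    then have "\<mu> = of_real (Im \<mu>) * \<i>" "Im \<mu> > 0" by (auto simp: complex_eq_iff)
    then have "Arg \<mu> = pi / 2" using Arg_times_of_real[of "Im \<mu>" \<i>] by (metis Arg_ii)
    then show False using that by simp
  qed
  have argm: "\<not> (Re \<mu> = 0 \<and> Im \<mu> < 0)" if "Arg \<mu> \<noteq> - (pi / 2)" for \<mu>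
  proof
    assume "Re \<mu> = 0 \<and> Im \<mu> < 0"
    then have "\<mu> = of_real (- Im \<mu>) * (- \<i>)" "- Im \<mu> > 0" by (auto simp: complex_eq_iff)
    then have "Arg \<mu> = - (pi / 2)" using Arg_times_of_real[of "- Im \<mu>" "- \<i>"] by (metis Arg_minus_ii minus_divide_left)
    then show False using that by simp
  qed
  consider (i) "K_case_i p q m n" | (ii) "K_case_ii p q m n \<alpha>" | (iii) "K_case_iii p q m n a b \<alpha>"
    | (iv) "K_case_iv p q m n a b \<alpha>" | (v) "K_case_v p q m n a b \<alpha>" | (vi) "K_case_vi p q m n a b \<alpha>"
    using assms by blast
  then show ?thesis
  proof cases
    case i
    then have "K_angles p q m n a b \<alpha> z (- (pi / 2)) (pi / 2)" by (simp add: K_angles_def)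
    then show ?thesis by blast
  next
    case ii
    have "\<alpha> + (of_nat p - of_nat q) * \<i> / 4 \<noteq> 0"
    proof
      assume "\<alpha> + (of_nat p - of_nat q) * \<i> / 4 = 0"
      then have "4 * \<alpha> = - (of_nat p - of_nat q) * \<i>" by algebra
      then show False using ii unfolding K_case_ii_def by blast
    qed
    moreover have "\<alpha> - (of_nat p - of_nat q) * \<i> / 4 \<noteq> 0"
    proof
      assume "\<alpha> - (of_nat p - of_nat q) * \<i> / 4 = 0"
      then have "4 * \<alpha> = (of_nat p - of_nat q) * \<i>" by algebra
      then show False using ii unfolding K_case_ii_def by blast
    qed
    moreover have "Re \<alpha> \<ge> 0" using ii by (simp add: K_case_ii_def)
    ultimately obtain \<theta>p \<theta>m where "\<theta>p \<in> {0<..<pi}" "\<theta>m \<in> {-pi<..<0}"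
      "\<forall>s. s \<noteq> 0 \<and> Arg s = \<theta>p \<longrightarrow> Re ((\<alpha> + (of_nat p - of_nat q) * \<i> / 4) * s\<^sup>2) < 0"
      "\<forall>s. s \<noteq> 0 \<and> Arg s = \<theta>m \<longrightarrow> Re ((\<alpha> - (of_nat p - of_nat q) * \<i> / 4) * s\<^sup>2) < 0"
      using quad_p[of "\<alpha> + (of_nat p - of_nat q) * \<i> / 4"] quad_m[of "\<alpha> - (of_nat p - of_nat q) * \<i> / 4"] by auto
    then show ?thesis using ii unfolding K_angles_def by blast
  next
    case iii
    then have pq: "of_nat p \<noteq> (of_nat q :: complex)" by (auto simp: K_case_iii_def)
    have "\<i> * (of_nat q - of_nat p) \<noteq> 0" "Re (\<i> * (of_nat q - of_nat p)) \<ge> 0" using pq by auto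
    then obtain \<theta>p \<theta>m where "\<theta>p \<in> {0<..<pi}" "\<theta>m \<in> {-pi<..<0}"
      "\<forall>s. s \<noteq> 0 \<and> Arg s = \<theta>p \<longrightarrow> Re (K_mu p q m n a b * s) > 0"
      "\<forall>s. s \<noteq> 0 \<and> Arg s = \<theta>m \<longrightarrow> Re (\<i> * (of_nat q - of_nat p) * s\<^sup>2) < 0"
      using quad_m[of "\<i> * (of_nat q - of_nat p)"] lin_p[of "K_mu p q m n a b"] argp iii unfolding K_case_iii_def by metis
    then show ?thesis using iii unfolding K_angles_def by blast
  next
    case iv
    then have pq: "of_nat p \<noteq> (of_nat q :: complex)" by (auto simp: K_case_iv_def)
    have "\<i> * (of_nat p - of_nat q) \<noteq> 0" "Re (\<i> * (of_nat p - of_nat q)) \<ge> 0" using pq by auto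
    then obtain \<theta>p \<theta>m where "\<theta>p \<in> {0<..<pi}" "\<theta>m \<in> {-pi<..<0}"
      "\<forall>s. s \<noteq> 0 \<and> Arg s = \<theta>p \<longrightarrow> Re (\<i> * (of_nat p - of_nat q) * s\<^sup>2) < 0"
      "\<forall>s. s \<noteq> 0 \<and> Arg s = \<theta>m \<longrightarrow> Re (K_mu p q m n a b * s) > 0"
      using quad_p[of "\<i> * (of_nat p - of_nat q)"] lin_m[of "K_mu p q m n a b"] argm iv unfolding K_case_iv_def by metis
    then show ?thesis using iv unfolding K_angles_def by blast
  next
    case v
    then have "Re (K_mu p q m n a b) \<noteq> 0" unfolding K_case_v_def by blast
    then obtain \<theta>p \<theta>m where "\<theta>p \<in> {0<..<pi}" "\<theta>m \<in> {-pi<..<0}"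
      "\<forall>s. s \<noteq> 0 \<and> Arg s = \<theta>p \<longrightarrow> Re (K_mu p q m n a b * s) > 0"
      "\<forall>s. s \<noteq> 0 \<and> Arg s = \<theta>m \<longrightarrow> Re (K_mu p q m n a b * s) > 0"
      using lin_p[of "K_mu p q m n a b"] lin_m[of "K_mu p q m n a b"] by (metis zero_complex.sel(1))
    then show ?thesis using v unfolding K_angles_def by blast
  next
    case vi
    then have "K_angles p q m n a b \<alpha> z (- (pi / 2)) (pi / 2)" by (simp add: K_angles_def)
    then show ?thesis by blast
  qed
qed

text \<open>In \<open>K_angles\<close> the number z occurs only in the rule for case (vii). In the
  other cases the choice operator therefore returns the same curve for every z, and a single
  integral represents the whole function.\<close>

lemma K_contour_indep:
  assumes "\<not> K_case_vii p q m n a b \<alpha>"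
  shows "K_contour p q m n a b \<tau> \<alpha> z = K_contour p q m n a b \<tau> \<alpha> z'"
  using assms unfolding K_contour_def K_angles_def by (simp add: fun_eq_iff)

text \<open>Up to positive factors the angle rules (i)-(v) are sign conditions on the first
  nonvanishing coefficient in the given direction. In (iii) and (iv) the quadratic coefficient
  vanishes at one end only, so the two ends decay for different reasons.\<close>

lemma K_angles_decay_direction:
  assumes ang: "K_angles p q m n a b \<alpha> z \<theta>m \<theta>p" and t: "\<tau> > 0"
    and nvi: "\<not> K_case_vi p q m n a b \<alpha>" "\<not> K_case_vii p q m n a b \<alpha>"
    and A: "A = of_real (of_int (K_N p q m n) / (2 * \<tau>))"
    and B: "\<And>\<sigma>. K_N p q m n = 0 \<Longrightarrow> B \<sigma> = of_real (pi / \<tau>) * (\<alpha> + of_real \<sigma> * ((of_nat p - of_nat q) * \<i> / 4))"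
    and C: "K_N p q m n = 0 \<Longrightarrow> C = - K_mu p q m n a b / of_real \<tau>"
  shows "decay_direction A (B 1) C (cis \<theta>p)" "decay_direction A (B (- 1)) C (cis \<theta>m)"
proof -
  have \<theta>: "\<theta>p \<in> {0<..<pi}" "\<theta>m \<in> {-pi<..<0}" using ang by (auto simp: K_angles_def)
  then have \<theta>': "\<theta>p \<in> {-pi<..pi}" "\<theta>m \<in> {-pi<..pi}" by auto
  note iff = all_Arg_quadratic_iff[OF \<theta>'(1)] all_Arg_quadratic_iff[OF \<theta>'(2)]
  have scale: "Re (of_real r * c) = r * Re c" for r c by simp
  have Bneg: "Re (B \<sigma> * d) < 0" if N: "K_N p q m n = 0" and "Re ((\<alpha> + of_real \<sigma> * ((of_nat p - of_nat q) * \<i> / 4)) * d) < 0" for \<sigma> d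
    unfolding B[OF N] mult.assoc scale using that(2) t by (intro mult_pos_neg) auto
  have Cneg: "Re (C * d) < 0" if N: "K_N p q m n = 0" and "Re (K_mu p q m n a b * d) > 0" for d
  proof -
    have "C * d = of_real (- 1 / \<tau>) * (K_mu p q m n a b * d)" unfolding C[OF N] by simp
    then have "Re (C * d) = - 1 / \<tau> * Re (K_mu p q m n a b * d)" by (simp only: scale)
    then show ?thesis using that(2) t by (simp add: mult_neg_pos)
  qed
  define c where "c = (of_nat p - of_nat q) * \<i> / 4"
  have c: "(of_nat p - of_nat q) * \<i> = 4 * c" "\<i> * (of_nat p - of_nat q) = 4 * c"
    "\<i> * (of_nat q - of_nat p) = - (4 * c)" "(of_nat q - of_nat p) * \<i> = - (4 * c)"
    unfolding c_def by algebra+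
  \<comment> \<open>Rules (iii) and (iv) are stated with 4 c, up to sign, whereas the coefficient of
    s^2 is a positive multiple of 2 c with the same sign.\<close>
  have half: "Re (x * d) < 0" if "Re (2 * x * d) < 0" for x d
  proof -
    have "2 * x * d = of_real 2 * (x * d)" by simp
    then show ?thesis using that by (simp only: scale)
  qed
  have A0: "A = 0" if "K_N p q m n = 0" using that A by simp
  have "(K_case_i p q m n \<and> \<theta>p \<in> {pi/4<..<3*pi/4} \<and> \<theta>m \<in> {-3*pi/4<..<-pi/4} \<or>
      K_case_ii p q m n \<alpha> \<and> Re ((\<alpha> + (of_nat p - of_nat q) * \<i> / 4) * (cis \<theta>p)\<^sup>2) < 0 \<and> Re ((\<alpha> - (of_nat p - of_nat q) * \<i> / 4) * (cis \<theta>m)\<^sup>2) < 0 \<or>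
      K_case_iii p q m n a b \<alpha> \<and> Re (K_mu p q m n a b * cis \<theta>p) > 0 \<and> Re (\<i> * (of_nat q - of_nat p) * (cis \<theta>m)\<^sup>2) < 0 \<or>
      K_case_iv p q m n a b \<alpha> \<and> Re (\<i> * (of_nat p - of_nat q) * (cis \<theta>p)\<^sup>2) < 0 \<and> Re (K_mu p q m n a b * cis \<theta>m) > 0 \<or>
      K_case_v p q m n a b \<alpha> \<and> Re (K_mu p q m n a b * cis \<theta>p) > 0 \<and> Re (K_mu p q m n a b * cis \<theta>m) > 0)"
    using ang nvi unfolding K_angles_def iff by blast
  then have "decay_direction A (B 1) C (cis \<theta>p) \<and> decay_direction A (B (- 1)) C (cis \<theta>m)"
  proof (elim disjE conjE)
    assume N: "K_case_i p q m n" and ap: "\<theta>p \<in> {pi/4<..<3*pi/4}" and am: "\<theta>m \<in> {-3*pi/4<..<-pi/4}"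
    have Np: "real_of_int (K_N p q m n) / (2 * \<tau>) > 0" using N t by (simp add: K_case_i_def)
    have "cos (2 * \<theta>p - pi) > 0" using ap by (intro cos_gt_zero_pi) auto
    then have "cos (2 * \<theta>p) < 0" by (simp add: cos_diff)
    moreover have "cos (2 * \<theta>m + pi) > 0" using am by (intro cos_gt_zero_pi) auto
    then have "cos (2 * \<theta>m) < 0" by simp
    moreover have "Re (A * (cis \<theta>)\<^sup>2) = of_int (K_N p q m n) / (2 * \<tau>) * cos (2 * \<theta>)" for \<theta>
      unfolding A scale Complex.DeMoivre by simp
    ultimately have "Re (A * (cis \<theta>p)\<^sup>2) < 0" "Re (A * (cis \<theta>m)\<^sup>2) < 0"
      using mult_pos_neg[OF Np] by metis+
    then show ?thesis by (simp add: decay_direction_def)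
  next
    assume h: "K_case_ii p q m n \<alpha>" "Re ((\<alpha> + (of_nat p - of_nat q) * \<i> / 4) * (cis \<theta>p)\<^sup>2) < 0"
      "Re ((\<alpha> - (of_nat p - of_nat q) * \<i> / 4) * (cis \<theta>m)\<^sup>2) < 0"
    then have N: "K_N p q m n = 0" by (simp add: K_case_ii_def)
    have "Re (B 1 * (cis \<theta>p)\<^sup>2) < 0" by (rule Bneg[OF N]) (use h(2) in simp)
    moreover have "Re (B (- 1) * (cis \<theta>m)\<^sup>2) < 0" by (rule Bneg[OF N]) (use h(3) in simp)
    ultimately show ?thesis using A0[OF N] by (simp add: decay_direction_def)
  next
    assume h: "K_case_iii p q m n a b \<alpha>" "Re (K_mu p q m n a b * cis \<theta>p) > 0" "Re (\<i> * (of_nat q - of_nat p) * (cis \<theta>m)\<^sup>2) < 0"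
    then have N: "K_N p q m n = 0" and al: "4 * \<alpha> = (of_nat q - of_nat p) * \<i>" unfolding K_case_iii_def by blast+
    have al2: "\<alpha> = - c" using al unfolding c by simp
    \<comment> \<open>At the upper end \<alpha> cancels the contribution of p - q, so the decay
      there has to come from the term s Ln s with coefficient \<open>C\<close>.\<close>
    have B1: "B 1 = 0" unfolding B[OF N] c_def[symmetric] al2 by simp
    have "Re ((\<alpha> + of_real (- 1) * c) * (cis \<theta>m)\<^sup>2) < 0"
      by (rule half) (use h(3) in \<open>simp add: al2 c\<close>)
    then have "Re (B (- 1) * (cis \<theta>m)\<^sup>2) < 0" unfolding c_def by (rule Bneg[OF N])
    then show ?thesis using A0[OF N] B1 Cneg[OF N h(2)] unfolding decay_direction_def by blast
  next
    assume h: "K_case_iv p q m n a b \<alpha>" "Re (\<i> * (of_nat p - of_nat q) * (cis \<theta>p)\<^sup>2) < 0" "Re (K_mu p q m n a b * cis \<theta>m) > 0"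
    then have N: "K_N p q m n = 0" and al: "4 * \<alpha> = (of_nat p - of_nat q) * \<i>" unfolding K_case_iv_def by blast+
    have al2: "\<alpha> = c" using al unfolding c by simp
    have B1: "B (- 1) = 0" unfolding B[OF N] c_def[symmetric] al2 by simp
    have "Re ((\<alpha> + of_real 1 * c) * (cis \<theta>p)\<^sup>2) < 0"
      by (rule half) (use h(2) in \<open>simp add: al2 c\<close>)
    then have "Re (B 1 * (cis \<theta>p)\<^sup>2) < 0" unfolding c_def by (rule Bneg[OF N])
    then show ?thesis using A0[OF N] B1 Cneg[OF N h(3)] unfolding decay_direction_def by blast
  next
    assume h: "K_case_v p q m n a b \<alpha>" "Re (K_mu p q m n a b * cis \<theta>p) > 0" "Re (K_mu p q m n a b * cis \<theta>m) > 0"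
    then have N: "K_N p q m n = 0" and a0: "\<alpha> = 0" and pq: "p = q" unfolding K_case_v_def by blast+
    have B0: "B 1 = 0" "B (- 1) = 0" unfolding B[OF N] a0 pq by simp_all
    then show ?thesis using A0[OF N] B0 Cneg[OF N h(2)] Cneg[OF N h(3)] unfolding decay_direction_def by blast
  qed
  then show "decay_direction A (B 1) C (cis \<theta>p)" "decay_direction A (B (- 1)) C (cis \<theta>m)" by blast+
qed

section \<open>Cases (i)-(vi)\<close>

lemma separating_contour_K_dom:
  assumes "separating_contour (Lambda_plus p n a \<tau>) (Lambda_minus q m b \<tau>) \<theta>m \<theta>p \<gamma>"
  shows "range \<gamma> \<subseteq> K_dom p q m n a b \<tau>"
proof -
  obtain Dp Dm where D: "components (- range \<gamma>) = {Dp, Dm}" "Lambda_plus p n a \<tau> \<subseteq> Dp" "Lambda_minus q m b \<tau> \<subseteq> Dm"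
    using assms unfolding separating_contour_def by auto
  then have "Dp \<subseteq> - range \<gamma>" "Dm \<subseteq> - range \<gamma>" by (auto intro!: in_components_subset)
  then show ?thesis using D unfolding K_dom_def by blast
qed

text \<open>The term P Ln s grows only logarithmically and fits into the gap between Re (L d) and
  c.\<close>

lemma K_expo_linear_bound:
  assumes c: "c > Re (L * d)" and d: "Im d \<noteq> 0"
  shows "eventually (\<lambda>t. Re (K_expo 0 0 0 L P (v + of_real t * d)) \<le> c * t) at_top"
proof -
  have k: "norm d > 0" "c - Re (L * d) > 0" using c d by auto
  have "eventually (\<lambda>t. Re (L * v) + norm P * (ln (norm v + t * norm d) + pi) \<le> (c - Re (L * d)) * t) at_top"
    using k by real_asymp
  then show ?thesis
    using eventually_ge_at_top[of 0] ray_in_sector[OF d, of v 1]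
  proof eventually_elim
    case (elim t)
    let ?s = "v + of_real t * d"
    have s1: "norm ?s \<ge> 1" using elim by blast
    then have s0: "?s \<noteq> 0" by auto
    have "norm ?s \<le> norm v + t * norm d" using norm_triangle_ineq[of v "of_real t * d"] elim by (simp add: norm_mult)
    then have l: "ln (norm ?s) \<le> ln (norm v + t * norm d)" using s1 by (intro iffD2[OF ln_le_cancel_iff]; linarith)
    have "norm (Ln ?s) \<le> \<bar>Re (Ln ?s)\<bar> + \<bar>Im (Ln ?s)\<bar>" by (rule cmod_le)
    also have "\<dots> \<le> ln (norm v + t * norm d) + pi"
      using l s1 s0 mpi_less_Im_Ln[of ?s] Im_Ln_le_pi[of ?s] by simp
    finally have "norm (P * Ln ?s) \<le> norm P * (ln (norm v + t * norm d) + pi)"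
      unfolding norm_mult by (intro mult_left_mono) auto
    then have "Re (P * Ln ?s) \<le> norm P * (ln (norm v + t * norm d) + pi)"
      using complex_Re_le_cmod order_trans by blast
    moreover have "Re (K_expo 0 0 0 L P ?s) = Re (L * v) + t * Re (L * d) + Re (P * Ln ?s)"
      unfolding K_expo_def by (simp add: algebra_simps)
    ultimately show ?case using elim by (simp add: algebra_simps)
  qed
qed

lemma norm_le_exp_mult_on_ray:
  assumes W: "\<And>\<kappa>. \<kappa> > 0 \<Longrightarrow> \<exists>R D. \<forall>s. norm s \<ge> R \<longrightarrow> \<bar>Im s\<bar> \<ge> \<kappa> * norm s \<longrightarrow> norm (W s) \<le> exp (Re (E (sgn (Im s)) s) + D)"
    and d: "Im d \<noteq> 0" and E: "eventually (\<lambda>t. Re (E (sgn (Im d)) (v + of_real t * d)) \<le> c * t) at_top"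
  shows "\<exists>C. eventually (\<lambda>t. norm (W (v + of_real t * d)) \<le> C * exp (c * t)) at_top"
proof -
  have "\<bar>Im d\<bar> / (4 * norm d) > 0" using d by (auto intro!: divide_pos_pos)
  then obtain R D where RD: "\<And>s. norm s \<ge> R \<Longrightarrow> \<bar>Im s\<bar> \<ge> \<bar>Im d\<bar> / (4 * norm d) * norm s \<Longrightarrow> norm (W s) \<le> exp (Re (E (sgn (Im s)) s) + D)"
    using W by blast
  have "eventually (\<lambda>t. norm (W (v + of_real t * d)) \<le> exp D * exp (c * t)) at_top"
    using E ray_in_sector[OF d, of v R]
  proof eventually_elim
    case (elim t)
    then have "norm (W (v + of_real t * d)) \<le> exp (Re (E (sgn (Im d)) (v + of_real t * d)) + D)"
      using RD[of "v + of_real t * d"] by simp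
    also have "\<dots> \<le> exp (c * t + D)" using elim by simp
    finally show ?case by (simp add: exp_add mult.commute)
  qed
  then show ?thesis by blast
qed

lemma contour_continuation:
  assumes sc: "separating_contour (Lambda_plus p n a \<tau>) (Lambda_minus q m b \<tau>) \<theta>m \<theta>p \<gamma>"
    and t: "\<tau> > 0" and U: "open U" and W: "W holomorphic_on K_dom p q m n a b \<tau>"
    and bd: "\<And>\<omega> v d. \<omega> \<in> U \<Longrightarrow> d = cis \<theta>p \<or> d = cis \<theta>m \<Longrightarrow>
        \<exists>c C. eventually (\<lambda>t. norm (W (v + of_real t * d)) \<le> C * exp (c * t)) at_top \<and> Re (\<omega> * d) + c < 0"
  shows "\<exists>F. F holomorphic_on U \<and> (\<forall>\<omega>\<in>U. F \<omega> = line_contour_integral \<gamma> (\<lambda>s. W s * exp (\<omega> * s)))"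
proof -
  obtain T where ct: "contour_tails \<gamma> T (cis \<theta>p) (cis \<theta>m)" using separating_contour_tails[OF sc] .
  note S = open_K_dom[OF t] separating_contour_K_dom[OF sc]
  have r: "ray_integrable (\<lambda>s. W s * exp (\<omega> * s)) (\<gamma> T) (cis \<theta>p)"
    "ray_integrable (\<lambda>s. W s * exp (\<omega> * s)) (\<gamma> (- T)) (cis \<theta>m)" if om: "\<omega> \<in> U" for \<omega>
  proof -
    obtain c C where "eventually (\<lambda>t. norm (W (\<gamma> T + of_real t * cis \<theta>p)) \<le> C * exp (c * t)) at_top" "Re (\<omega> * cis \<theta>p) + c < 0"
      using bd[OF om, of "cis \<theta>p" "\<gamma> T"] by blast
    then show "ray_integrable (\<lambda>s. W s * exp (\<omega> * s)) (\<gamma> T) (cis \<theta>p)"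
      by (intro ray_integrable_exp_mult[OF W]) (use contour_tails_range(1)[OF ct] S in blast)
    obtain c C where "eventually (\<lambda>t. norm (W (\<gamma> (- T) + of_real t * cis \<theta>m)) \<le> C * exp (c * t)) at_top" "Re (\<omega> * cis \<theta>m) + c < 0"
      using bd[OF om, of "cis \<theta>m" "\<gamma> (- T)"] by blast
    then show "ray_integrable (\<lambda>s. W s * exp (\<omega> * s)) (\<gamma> (- T)) (cis \<theta>m)"
      by (intro ray_integrable_exp_mult[OF W]) (use contour_tails_range(2)[OF ct] S in blast)
  qed
  have "line_contour_integral \<gamma> (\<lambda>s. W s * exp (\<omega> * s)) = contour_sum \<gamma> T (cis \<theta>p) (cis \<theta>m) (\<lambda>s. W s * exp (\<omega> * s))"
    if "\<omega> \<in> U" for \<omega>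
    by (rule line_contour_integral_eq_contour_sum[OF ct S _ r[OF that]]) (intro holomorphic_intros W)
  moreover have "(\<lambda>\<omega>. contour_sum \<gamma> T (cis \<theta>p) (cis \<theta>m) (\<lambda>s. W s * exp (\<omega> * s))) holomorphic_on U"
    by (rule contour_sum_exp_holomorphic[OF ct S W U r])
  ultimately show ?thesis by (intro exI[of _ "\<lambda>\<omega>. contour_sum \<gamma> T (cis \<theta>p) (cis \<theta>m) (\<lambda>s. W s * exp (\<omega> * s))"]) simp
qed

text \<open>\<open>U\<close> is a set of parameters \<omega> for which the exponential rate of the
  weight plus that of exp (\<omega> s) is negative on both ends: the whole plane in cases (i)-(v), a
  strip in case (vi).\<close>

lemma K_continuation:
  assumes t: "\<tau> > 0"
    and disj: "Lambda_plus p n a \<tau> \<inter> Lambda_minus q m b \<tau> = {}"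
    and cases: "K_case_i p q m n \<or> K_case_ii p q m n \<alpha> \<or> K_case_iii p q m n a b \<alpha> \<or>
      K_case_iv p q m n a b \<alpha> \<or> K_case_v p q m n a b \<alpha> \<or> K_case_vi p q m n a b \<alpha>"
    and nvii: "\<not> K_case_vii p q m n a b \<alpha>" and U: "open U" "range of_real \<subseteq> U"
    and bd: "\<And>\<theta>m \<theta>p \<omega> v d. K_angles p q m n a b \<alpha> 1 \<theta>m \<theta>p \<Longrightarrow> \<omega> \<in> U \<Longrightarrow> d = cis \<theta>p \<or> d = cis \<theta>m \<Longrightarrow>
        \<exists>c C. eventually (\<lambda>t. norm (K_weight p q m n a b \<tau> \<alpha> (v + of_real t * d)) \<le> C * exp (c * t)) at_top \<and>
          Re (\<omega> * d) + c < 0"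
  shows "\<exists>F. F holomorphic_on {w. of_real (- (2 * pi)) * w \<in> U} \<and>
     (\<forall>w::real. F (of_real w) = Meijer_Barnes_K p q m n a b \<tau> \<alpha> (exp (2 * pi * w)))"
proof -
  \<comment> \<open>The contour chosen for z = 1; by \<open>K_contour_indep\<close> it is the one
    chosen for every z.\<close>
  define \<gamma> where "\<gamma> = (SOME \<gamma>. K_contour p q m n a b \<tau> \<alpha> 1 \<gamma>)"
  have "K_contour p q m n a b \<tau> \<alpha> 1 \<gamma>"
  proof -
    obtain \<theta>m \<theta>p where "K_angles p q m n a b \<alpha> 1 \<theta>m \<theta>p" using K_angles_exist[OF cases, of 1] by (elim exE)
    then have "\<exists>\<gamma>. K_contour p q m n a b \<tau> \<alpha> 1 \<gamma>" by (rule K_contour_exists[OF t disj])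
    then show ?thesis unfolding \<gamma>_def by (rule someI_ex)
  qed
  then obtain \<theta>m \<theta>p where ang: "K_angles p q m n a b \<alpha> 1 \<theta>m \<theta>p"
    and sc: "separating_contour (Lambda_plus p n a \<tau>) (Lambda_minus q m b \<tau>) \<theta>m \<theta>p \<gamma>"
    unfolding K_contour_def by (elim exE conjE)
  obtain F where F: "F holomorphic_on U"
    "\<And>\<omega>. \<omega> \<in> U \<Longrightarrow> F \<omega> = line_contour_integral \<gamma> (\<lambda>s. K_weight p q m n a b \<tau> \<alpha> s * exp (\<omega> * s))"
  proof -
    have "\<exists>F. F holomorphic_on U \<and>
       (\<forall>\<omega>\<in>U. F \<omega> = line_contour_integral \<gamma> (\<lambda>s. K_weight p q m n a b \<tau> \<alpha> s * exp (\<omega> * s)))"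
      by (rule contour_continuation[OF sc t U(1) holomorphic_K_weight[OF t] bd[OF ang]])
    then show thesis by (elim exE conjE) (rule that, assumption, simp)
  qed
  have "(\<lambda>w. 1 / (2 * of_real pi * \<i>) * F (of_real (- (2 * pi)) * w)) holomorphic_on {w. of_real (- (2 * pi)) * w \<in> U}"
  proof -
    have "(\<lambda>w. F (of_real (- (2 * pi)) * w)) holomorphic_on {w. of_real (- (2 * pi)) * w \<in> U}"
      by (rule holomorphic_on_compose_gen[OF _ F(1), unfolded o_def]) (auto intro!: holomorphic_intros)
    then show ?thesis by (intro holomorphic_on_mult holomorphic_on_const)
  qed
  moreover have "1 / (2 * of_real pi * \<i>) * F (of_real (- (2 * pi)) * of_real w) = Meijer_Barnes_K p q m n a b \<tau> \<alpha> (exp (2 * pi * w))" for w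
  proof -
    have "complex_of_real (- (2 * pi * w)) \<in> U" by (rule subsetD[OF U(2) rangeI])
    moreover have "K_contour p q m n a b \<tau> \<alpha> (exp (2 * pi * w)) = K_contour p q m n a b \<tau> \<alpha> 1"
      by (rule K_contour_indep[OF nvii])
    ultimately show ?thesis unfolding Meijer_Barnes_K_exp \<gamma>_def
      using F(2)[of "of_real (- (2 * pi * w))"] by (simp add: \<gamma>_def)
  qed
  ultimately show ?thesis by (intro exI[of _ "\<lambda>w. 1 / (2 * of_real pi * \<i>) * F (of_real (- (2 * pi)) * w)"]) simp
qed

lemma sgn_Im_cis:
  assumes "\<theta>p \<in> {0<..<pi}" "\<theta>m \<in> {-pi<..<0}"
  shows "sgn (Im (cis \<theta>p)) = 1" "sgn (Im (cis \<theta>m)) = - 1" "Im (cis \<theta>p) > 0" "Im (cis \<theta>m) < 0"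
  using assms sin_gt_zero[of \<theta>p] sin_gt_zero[of "- \<theta>m"] by auto

text \<open>The rules in \<open>K_angles\<close> form a disjunction. In cases (vi) and (vii) the
  angles can be read off once the alternatives (i)-(v) are excluded.\<close>

lemma K_case_exclusive:
  assumes "K_case_vi p q m n a b \<alpha> \<or> K_case_vii p q m n a b \<alpha>"
  shows "\<not> K_case_i p q m n" "\<not> K_case_ii p q m n \<alpha>" "\<not> K_case_iii p q m n a b \<alpha>" "\<not> K_case_iv p q m n a b \<alpha>"
    "\<not> K_case_v p q m n a b \<alpha>"
proof -
  have h: "K_N p q m n = 0" "\<alpha> = 0" "p = q" "K_mu p q m n a b = 0"
    using assms unfolding K_case_vi_def K_case_vii_def by (-) ((elim disjE conjE; assumption)+)
  show "\<not> K_case_i p q m n" unfolding K_case_i_def h(1) by simp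
  show "\<not> K_case_ii p q m n \<alpha>" unfolding K_case_ii_def h(2,3) by simp
  show "\<not> K_case_iii p q m n a b \<alpha>" unfolding K_case_iii_def h(2) by simp
  show "\<not> K_case_iv p q m n a b \<alpha>" unfolding K_case_iv_def h(2) by simp
  show "\<not> K_case_v p q m n a b \<alpha>" unfolding K_case_v_def h(4) by simp
qed

lemma K_entire:
  assumes t: "\<tau> > 0" and mq: "m \<le> q" and np: "n \<le> p"
    and disj: "Lambda_plus p n a \<tau> \<inter> Lambda_minus q m b \<tau> = {}"
    and cases: "K_case_i p q m n \<or> K_case_ii p q m n \<alpha> \<or> K_case_iii p q m n a b \<alpha> \<or>
      K_case_iv p q m n a b \<alpha> \<or> K_case_v p q m n a b \<alpha>"
  shows "\<exists>F. F holomorphic_on UNIV \<and> (\<forall>w::real. F (of_real w) = Meijer_Barnes_K p q m n a b \<tau> \<alpha> (exp (2 * pi * w)))"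
proof -
  have "\<not> (K_case_vi p q m n a b \<alpha> \<or> K_case_vii p q m n a b \<alpha>)"
    using cases K_case_exclusive[of p q m n a b \<alpha>] by blast
  then have excl: "\<not> K_case_vi p q m n a b \<alpha>" "\<not> K_case_vii p q m n a b \<alpha>" by simp_all
  obtain A B C L P where asy: "\<And>\<kappa>. \<kappa> > 0 \<Longrightarrow> \<exists>R D. \<forall>s. norm s \<ge> R \<longrightarrow> \<bar>Im s\<bar> \<ge> \<kappa> * norm s \<longrightarrow>
       norm (K_weight p q m n a b \<tau> \<alpha> s) \<le> exp (Re (K_expo A (B (sgn (Im s))) C (L (sgn (Im s))) P s) + D)"
    and A: "A = of_real (of_int (K_N p q m n) / (2 * \<tau>))"
    and B: "\<And>\<sigma>. K_N p q m n = 0 \<Longrightarrow> B \<sigma> = of_real (pi / \<tau>) * (\<alpha> + of_real \<sigma> * ((of_nat p - of_nat q) * \<i> / 4))"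
    and C: "K_N p q m n = 0 \<Longrightarrow> C = - K_mu p q m n a b / of_real \<tau>"
    by (rule K_weight_asymp[OF t mq np, of a b \<alpha>]) (rule that)
  have "\<exists>F. F holomorphic_on {w. of_real (- (2 * pi)) * w \<in> (UNIV :: complex set)} \<and>
     (\<forall>w::real. F (of_real w) = Meijer_Barnes_K p q m n a b \<tau> \<alpha> (exp (2 * pi * w)))"
  proof (rule K_continuation[OF t disj _ excl(2)])
    show "K_case_i p q m n \<or> K_case_ii p q m n \<alpha> \<or> K_case_iii p q m n a b \<alpha> \<or>
      K_case_iv p q m n a b \<alpha> \<or> K_case_v p q m n a b \<alpha> \<or> K_case_vi p q m n a b \<alpha>" using cases by blast
    fix \<theta>m \<theta>p \<omega> v d assume ang: "K_angles p q m n a b \<alpha> 1 \<theta>m \<theta>p" and d: "d = cis \<theta>p \<or> d = cis \<theta>m"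
    note ld = K_angles_decay_direction[OF ang t excl A B C]
    have \<theta>: "\<theta>p \<in> {0<..<pi}" "\<theta>m \<in> {-pi<..<0}" using ang by (auto simp: K_angles_def)
    have "decay_direction A (B (sgn (Im d))) C d" and d0: "Im d \<noteq> 0"
      using d ld sgn_Im_cis[OF \<theta>] by auto
    \<comment> \<open>The arbitrary rate of \<open>K_expo_ray_decay\<close> is adapted to \<omega>,
      so that the product with exp (\<omega> s) decays like exp (- t).\<close>
    then have "eventually (\<lambda>t. Re (K_expo A (B (sgn (Im d))) C (L (sgn (Im d))) P (v + of_real t * d)) \<le> - (Re (\<omega> * d) + 1) * t) at_top"
      unfolding decay_direction_def by (intro K_expo_ray_decay)
    from norm_le_exp_mult_on_ray[OF asy d0 this]
    obtain c where "eventually (\<lambda>t. norm (K_weight p q m n a b \<tau> \<alpha> (v + of_real t * d)) \<le> c * exp (- (Re (\<omega> * d) + 1) * t)) at_top" by blast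
    then show "\<exists>c C. eventually (\<lambda>t. norm (K_weight p q m n a b \<tau> \<alpha> (v + of_real t * d)) \<le> C * exp (c * t)) at_top \<and> Re (\<omega> * d) + c < 0"
      by (intro exI[of _ "- (Re (\<omega> * d) + 1)"] exI[of _ c] conjI) simp_all
  qed auto
  then show ?thesis by simp
qed

text \<open>On both vertical ends the weight has the same rate \<beta> = \<pi> Re \<nu> / (2
  \<tau>), because the sign in \<open>L\<close> cancels that of the direction. The factor exp
  (\<omega> s) adds - Im \<omega> or Im \<omega>, so the ends converge for |Im \<omega>| < -
  \<beta>; division by 2 \<pi> gives the strip for w.\<close>

lemma K_strip:
  assumes t: "\<tau> > 0" and mq: "m \<le> q" and np: "n \<le> p"
    and disj: "Lambda_plus p n a \<tau> \<inter> Lambda_minus q m b \<tau> = {}" and vi: "K_case_vi p q m n a b \<alpha>"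
  shows "\<exists>F. F holomorphic_on {w. \<bar>Im w\<bar> < - Re (K_nu p q a b) / (4 * \<tau>)} \<and>
     (\<forall>w::real. F (of_real w) = Meijer_Barnes_K p q m n a b \<tau> \<alpha> (exp (2 * pi * w)))"
proof -
  have h: "K_N p q m n = 0" "\<alpha> = 0" "p = q" "K_mu p q m n a b = 0" "Re (K_nu p q a b) < 0"
    using vi unfolding K_case_vi_def by (-) ((elim conjE; assumption)+)
  note excl = K_case_exclusive[OF disjI1[OF vi]]
  have nvii: "\<not> K_case_vii p q m n a b \<alpha>" using h(5) unfolding K_case_vii_def by auto
  obtain A B C L P where asy: "\<And>\<kappa>. \<kappa> > 0 \<Longrightarrow> \<exists>R D. \<forall>s. norm s \<ge> R \<longrightarrow> \<bar>Im s\<bar> \<ge> \<kappa> * norm s \<longrightarrow>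
       norm (K_weight p q m n a b \<tau> \<alpha> s) \<le> exp (Re (K_expo A (B (sgn (Im s))) C (L (sgn (Im s))) P s) + D)"
    and A: "A = of_real (of_int (K_N p q m n) / (2 * \<tau>))"
    and B: "\<And>\<sigma>. K_N p q m n = 0 \<Longrightarrow> B \<sigma> = of_real (pi / \<tau>) * (\<alpha> + of_real \<sigma> * ((of_nat p - of_nat q) * \<i> / 4))"
    and C: "K_N p q m n = 0 \<Longrightarrow> C = - K_mu p q m n a b / of_real \<tau>"
    and L: "\<And>\<sigma>. K_N p q m n = 0 \<Longrightarrow> p = q \<Longrightarrow> K_mu p q m n a b = 0 \<Longrightarrow>
       L \<sigma> = - (\<i> * of_real pi * of_real \<sigma> * K_nu p q a b / (2 * of_real \<tau>))"
    by (rule K_weight_asymp[OF t mq np, of a b \<alpha>]) (rule that)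
  have A0: "A = 0" using A h(1) by simp
  have B0: "B \<sigma> = 0" for \<sigma> unfolding B[OF h(1)] h(2,3) by simp
  have C0: "C = 0" using C[OF h(1)] h(4) by simp
  define \<beta> where "\<beta> = pi * Re (K_nu p q a b) / (2 * \<tau>)"
  define U where "U = {\<omega>. \<bar>Im \<omega>\<bar> < - \<beta>}"
  have "\<exists>F. F holomorphic_on {w. of_real (- (2 * pi)) * w \<in> U} \<and>
     (\<forall>w::real. F (of_real w) = Meijer_Barnes_K p q m n a b \<tau> \<alpha> (exp (2 * pi * w)))"
  proof (rule K_continuation[OF t disj _ nvii])
    show "K_case_i p q m n \<or> K_case_ii p q m n \<alpha> \<or> K_case_iii p q m n a b \<alpha> \<or>
      K_case_iv p q m n a b \<alpha> \<or> K_case_v p q m n a b \<alpha> \<or> K_case_vi p q m n a b \<alpha>" using vi by blast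
    show "open U" unfolding U_def by (intro open_Collect_less continuous_intros)
    have "\<beta> < 0" using h(5) t by (simp add: \<beta>_def divide_neg_pos mult_pos_neg)
    then show "range of_real \<subseteq> U" by (auto simp: U_def)
    fix \<theta>m \<theta>p \<omega> v d assume ang: "K_angles p q m n a b \<alpha> 1 \<theta>m \<theta>p" and \<omega>: "\<omega> \<in> U" and d: "d = cis \<theta>p \<or> d = cis \<theta>m"
    have "\<theta>p = pi / 2 \<and> \<theta>m = - (pi / 2)" using ang excl nvii unfolding K_angles_def by blast
    then have \<theta>: "\<theta>p = pi / 2" "\<theta>m = - (pi / 2)" by simp_all
    have "d = \<i> \<or> d = - \<i>" using d unfolding \<theta> by (auto simp: complex_eq_iff)
    then obtain \<sigma> :: real where \<sigma>: "\<sigma> = 1 \<or> \<sigma> = - 1" "d = of_real \<sigma> * \<i>"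
      by (metis mult_1 mult_minus1 of_real_1 of_real_minus)
    have d0: "Im d \<noteq> 0" and sg: "sgn (Im d) = \<sigma>" using \<sigma> by auto
    have e: "Re (L \<sigma> * d) = \<beta>" unfolding L[OF h(1,3,4)] \<sigma>(2) using \<sigma>(1) by (auto simp: \<beta>_def)
    have x: "Re (\<omega> * d) < - \<beta>" using \<omega> \<sigma> by (auto simp: U_def)
    \<comment> \<open>The midpoint of \<beta> and - Re (\<omega> d) leaves room on both sides: for
      the logarithmic term and for the convergence of the integral.\<close>
    have c: "(\<beta> - Re (\<omega> * d)) / 2 > Re (L \<sigma> * d)" "Re (\<omega> * d) + (\<beta> - Re (\<omega> * d)) / 2 < 0"
      unfolding e using x by argo+
    have "eventually (\<lambda>t. Re (K_expo A (B (sgn (Im d))) C (L (sgn (Im d))) P (v + of_real t * d)) \<le> (\<beta> - Re (\<omega> * d)) / 2 * t) at_top"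
      unfolding A0 B0 C0 sg by (rule K_expo_linear_bound[OF c(1) d0])
    from norm_le_exp_mult_on_ray[OF asy d0 this]
    show "\<exists>c C. eventually (\<lambda>t. norm (K_weight p q m n a b \<tau> \<alpha> (v + of_real t * d)) \<le> C * exp (c * t)) at_top \<and> Re (\<omega> * d) + c < 0"
      using c(2) by blast
  qed
  moreover have "{w. of_real (- (2 * pi)) * w \<in> U} = {w. \<bar>Im w\<bar> < - Re (K_nu p q a b) / (4 * \<tau>)}"
  proof -
    have "\<bar>2 * pi * Im w\<bar> < - \<beta> \<longleftrightarrow> \<bar>Im w\<bar> < - Re (K_nu p q a b) / (4 * \<tau>)" for w
    proof -
      have "- \<beta> = (2 * pi) * (- Re (K_nu p q a b) / (4 * \<tau>))" using t by (simp add: \<beta>_def field_simps)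
      moreover have "\<bar>2 * pi * Im w\<bar> = (2 * pi) * \<bar>Im w\<bar>" by (simp add: abs_mult)
      ultimately show ?thesis by (simp only: mult_less_cancel_left_pos[of "2 * pi"] pi_gt_zero zero_less_mult_iff zero_less_numeral simp_thms)
    qed
    then show ?thesis by (simp add: U_def)
  qed
  ultimately show ?thesis by simp
qed

section \<open>Case (vii)\<close>

definition sector_bounded :: "(complex \<Rightarrow> complex) \<Rightarrow> real \<Rightarrow> bool" where
  "sector_bounded W e \<longleftrightarrow>
     (\<forall>\<kappa>>0. \<exists>R D. \<forall>s. norm s \<ge> R \<longrightarrow> \<bar>Im s\<bar> \<ge> \<kappa> * norm s \<longrightarrow> norm (W s) \<le> D * norm s powr e)"

text \<open>The second alternative admits directions along which exp (\<omega> s) does not decay,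
  provided that the power bound alone is integrable. These are the vertical ends for real
  \<omega>.\<close>

definition decaying :: "real \<Rightarrow> complex \<Rightarrow> complex \<Rightarrow> bool" where
  "decaying e \<omega> d \<longleftrightarrow> Re (\<omega> * d) < 0 \<or> e < -1 \<and> Re (\<omega> * d) \<le> 0"

lemma powr_le_max:
  fixes x :: real
  assumes "0 < l" "l \<le> x" "x \<le> u"
  shows "x powr e \<le> max (l powr e) (u powr e)"
proof (cases "e \<ge> 0")
  case True
  then have "x powr e \<le> u powr e" using assms by (intro powr_mono2) auto
  then show ?thesis by simp
next
  case False
  then have "x powr e \<le> l powr e" using assms by (intro powr_mono2') auto
  then show ?thesis by simp
qed

text \<open>By convexity Re (\<omega> s) is at most M - \<eta> R on the whole chord. The chord stays
  in a fixed sector with |s| comparable to R, so the power of |s| may be replaced by the same power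
  of R, whatever the sign of its exponent.\<close>

lemma sector_bounded_chord:
  assumes W: "sector_bounded W e0" and \<sigma>: "\<bar>\<sigma>\<bar> = 1" and d: "\<sigma> * Im d1 > 0" "\<sigma> * Im d2 > 0"
    and dec: "decaying e0 \<omega> d1" "decaying e0 \<omega> d2"
  obtains e B where "e < -1" "eventually (\<lambda>R. \<forall>s\<in>closed_segment (v1 + of_real R * d1) (v2 + of_real R * d2).
      norm (W s * exp (\<omega> * s)) \<le> B * R powr e) at_top"
proof -
  \<comment> \<open>\<eta> is a common exponential rate. It is taken to be 0 when the exponent is
    below -1 and the power alone suffices.\<close>
  obtain \<eta> where \<eta>: "Re (\<omega> * d1) \<le> - \<eta>" "Re (\<omega> * d2) \<le> - \<eta>" "\<eta> > 0 \<or> \<eta> = 0 \<and> e0 < -1"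
  proof (cases "e0 < -1")
    case True
    then show ?thesis using dec by (intro that[of 0]) (auto simp: decaying_def)
  next
    case False
    then show ?thesis using dec
      by (intro that[of "min (- Re (\<omega> * d1)) (- Re (\<omega> * d2))"]) (auto simp: decaying_def)
  qed
  define \<delta> where "\<delta> = min (\<sigma> * Im d1) (\<sigma> * Im d2)"
  define K where "K = max (norm d1) (norm d2)"
  define V where "V = max (norm v1) (norm v2)"
  define M where "M = norm \<omega> * V"
  have \<delta>0: "\<delta> > 0" using d by (simp add: \<delta>_def)
  have sIm: "\<bar>\<sigma> * Im z\<bar> \<le> norm z" for z using \<sigma> abs_Im_le_cmod[of z] by (simp add: abs_mult)
  have K0: "K > 0" using sIm[of d1] d(1) by (simp add: K_def)
  have V0: "V \<ge> 0" by (simp add: V_def le_max_iff_disj)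
  have "\<delta> / (4 * K) > 0" using \<delta>0 K0 by simp
  then obtain R0 D where W': "\<And>s. norm s \<ge> R0 \<Longrightarrow> \<bar>Im s\<bar> \<ge> \<delta> / (4 * K) * norm s \<Longrightarrow> norm (W s) \<le> D * norm s powr e0"
    using W unfolding sector_bounded_def by blast
  define C where "C = \<bar>D\<bar> * max ((\<delta> / 2) powr e0) ((2 * K) powr e0) * exp M"
  have ev: "eventually (\<lambda>R. \<forall>s\<in>closed_segment (v1 + of_real R * d1) (v2 + of_real R * d2).
      norm (W s * exp (\<omega> * s)) \<le> C * (R powr e0 * exp (- \<eta> * R))) at_top"
    using eventually_gt_at_top[of 0] eventually_ge_at_top[of "2 * V / \<delta>"] eventually_ge_at_top[of "2 * R0 / \<delta>"]
      eventually_ge_at_top[of "V / K"]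
  proof eventually_elim
    case (elim R)
    have h: "R > 0" "2 * V \<le> R * \<delta>" "2 * R0 \<le> R * \<delta>" "V \<le> R * K"
      using elim \<delta>0 K0 by (simp_all add: field_simps)
    show ?case
    proof
      fix s assume s: "s \<in> closed_segment (v1 + of_real R * d1) (v2 + of_real R * d2)"
      have ne: "norm (v1 + of_real R * d1) \<le> 2 * K * R" "norm (v2 + of_real R * d2) \<le> 2 * K * R"
      proof -
        have "norm (v + of_real R * d) \<le> 2 * K * R" if "norm v \<le> V" "norm d \<le> K" for v d :: complex
        proof -
          have "norm (v + of_real R * d) \<le> norm v + R * norm d"
            using norm_triangle_ineq[of v "of_real R * d"] h(1) by (simp add: norm_mult)
          also have "\<dots> \<le> R * K + R * K" using that h by (intro add_mono mult_left_mono) auto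
          finally show ?thesis by simp
        qed
        then show "norm (v1 + of_real R * d1) \<le> 2 * K * R" "norm (v2 + of_real R * d2) \<le> 2 * K * R"
          by (auto simp: V_def K_def)
      qed
      have "closed_segment (v1 + of_real R * d1) (v2 + of_real R * d2) \<subseteq> cball 0 (2 * K * R)"
        by (rule closed_segment_subset) (use ne in auto)
      then have ns: "norm s \<le> 2 * K * R" using s by auto
      have "\<sigma> * Im s \<ge> - V + R * \<delta>"
      proof (rule chord_Im_ge[OF s])
        show "\<sigma> * Im v1 \<ge> - V" using sIm[of v1] by (simp add: V_def)
        show "\<sigma> * Im v2 \<ge> - V" using sIm[of v2] by (simp add: V_def)
        show "\<sigma> * Im d1 \<ge> \<delta>" "\<sigma> * Im d2 \<ge> \<delta>" by (simp_all add: \<delta>_def)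
      qed (use h in simp)
      then have "\<sigma> * Im s \<ge> \<delta> / 2 * R" using h by (simp add: mult.commute)
      then have Is: "\<bar>Im s\<bar> \<ge> \<delta> / 2 * R" using \<sigma> by (auto simp: abs_if split: if_splits)
      then have ns2: "norm s \<ge> \<delta> / 2 * R" using abs_Im_le_cmod[of s] by linarith
      have "\<delta> / (4 * K) * norm s \<le> \<delta> / (4 * K) * (2 * K * R)" using ns \<delta>0 K0 by (intro mult_left_mono) auto
      also have "\<dots> = \<delta> / 2 * R" using K0 by simp
      finally have "\<delta> / (4 * K) * norm s \<le> \<bar>Im s\<bar>" using Is by linarith
      moreover have "norm s \<ge> R0" using ns2 h by (simp add: mult.commute)
      ultimately have "norm (W s) \<le> D * norm s powr e0" using W' by blast
      also have "\<dots> \<le> \<bar>D\<bar> * norm s powr e0" by (intro mult_right_mono) auto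
      also have "norm s powr e0 = (norm s / R) powr e0 * R powr e0" using h(1) by (simp add: powr_divide)
      also have "\<bar>D\<bar> * ((norm s / R) powr e0 * R powr e0) \<le> \<bar>D\<bar> * (max ((\<delta> / 2) powr e0) ((2 * K) powr e0) * R powr e0)"
      proof (intro mult_left_mono mult_right_mono powr_le_max)
        show "\<delta> / 2 \<le> norm s / R" using ns2 h(1) by (simp add: pos_le_divide_eq)
        show "norm s / R \<le> 2 * K" using ns h(1) by (simp add: pos_divide_le_eq)
      qed (use \<delta>0 in auto)
      finally have n1: "norm (W s) \<le> \<bar>D\<bar> * (max ((\<delta> / 2) powr e0) ((2 * K) powr e0) * R powr e0)" .
      have re: "Re (\<omega> * (v + of_real R * d)) \<le> M - \<eta> * R" if "norm v \<le> V" "Re (\<omega> * d) \<le> - \<eta>" for v d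
      proof -
        have "Re (\<omega> * v) \<le> norm \<omega> * norm v" using complex_Re_le_cmod[of "\<omega> * v"] by (simp only: norm_mult)
        also have "\<dots> \<le> M" unfolding M_def using that by (intro mult_left_mono) auto
        finally have "Re (\<omega> * v) \<le> M" .
        moreover have "R * Re (\<omega> * d) \<le> R * - \<eta>" using that h by (intro mult_left_mono) auto
        moreover have "Re (\<omega> * (v + of_real R * d)) = Re (\<omega> * v) + R * Re (\<omega> * d)" by (simp add: algebra_simps)
        ultimately show ?thesis by (simp add: mult.commute)
      qed
      obtain u where u: "0 \<le> u" "u \<le> 1" "s = (1 - u) *\<^sub>R (v1 + of_real R * d1) + u *\<^sub>R (v2 + of_real R * d2)"
        using s unfolding closed_segment_def by blast
      have "Re (\<omega> * s) = (1 - u) * Re (\<omega> * (v1 + of_real R * d1)) + u * Re (\<omega> * (v2 + of_real R * d2))"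
        unfolding u(3) by (simp add: algebra_simps)
      also have "\<dots> \<le> M - \<eta> * R"
        by (rule convex_bound_le) (use re \<eta> u in \<open>auto simp: V_def\<close>)
      finally have "norm (exp (\<omega> * s)) \<le> exp M * exp (- \<eta> * R)" by (simp add: exp_diff exp_minus field_simps flip: exp_add)
      then have "norm (W s * exp (\<omega> * s)) \<le> \<bar>D\<bar> * (max ((\<delta> / 2) powr e0) ((2 * K) powr e0) * R powr e0) * (exp M * exp (- \<eta> * R))"
        unfolding norm_mult using n1 by (intro mult_mono mult_nonneg_nonneg) (auto simp: le_max_iff_disj)
      then show "norm (W s * exp (\<omega> * s)) \<le> C * (R powr e0 * exp (- \<eta> * R))" unfolding C_def by (simp only: mult_ac)
    qed
  qed
  have C0: "C \<ge> 0" by (simp add: C_def le_max_iff_disj)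
  \<comment> \<open>A positive rate absorbs any power, so the exponent -2 can be used then.\<close>
  obtain e where e: "e < -1" "eventually (\<lambda>R. R powr e0 * exp (- \<eta> * R) \<le> R powr e) at_top"
  proof (cases "\<eta> = 0")
    case True
    then show ?thesis using \<eta>(3) by (intro that[of e0]) auto
  next
    case False
    then have "\<eta> > 0" using \<eta>(3) by simp
    then have "eventually (\<lambda>R. R powr e0 * exp (- \<eta> * R) \<le> R powr (- 2)) at_top" by real_asymp
    then show ?thesis by (intro that[of "- 2"]) auto
  qed
  show ?thesis
  proof (rule that[OF e(1)])
    show "eventually (\<lambda>R. \<forall>s\<in>closed_segment (v1 + of_real R * d1) (v2 + of_real R * d2).
      norm (W s * exp (\<omega> * s)) \<le> C * R powr e) at_top"
      using ev e(2)
    proof eventually_elim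
      case (elim R)
      then show ?case using mult_left_mono[OF elim(2) C0] by (meson order_trans)
    qed
  qed
qed

lemma sector_bounded_ray_integrable:
  assumes W: "sector_bounded W e0" and \<sigma>: "\<bar>\<sigma>\<bar> = 1" and d: "\<sigma> * Im d > 0" and dec: "decaying e0 \<omega> d"
    and hol: "W holomorphic_on S" and ray: "\<And>t. t \<ge> 0 \<Longrightarrow> v + of_real t * d \<in> S"
  shows "ray_integrable (\<lambda>s. W s * exp (\<omega> * s)) v d"
proof -
  \<comment> \<open>The degenerate chord between equal endpoints is a single point of the
    ray.\<close>
  obtain e B where eB: "e < -1" "eventually (\<lambda>R. \<forall>s\<in>closed_segment (v + of_real R * d) (v + of_real R * d).
      norm (W s * exp (\<omega> * s)) \<le> B * R powr e) at_top"
    by (rule sector_bounded_chord[OF W \<sigma> d d dec dec])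
  show ?thesis
  proof (rule ray_integrable_powr[OF _ eB(1)])
    have "continuous_on {0..} (\<lambda>t. W (v + of_real t * d))"
      by (rule continuous_on_compose2[OF holomorphic_on_imp_continuous_on[OF hol]]) (use ray in \<open>auto intro!: continuous_intros\<close>)
    then show "continuous_on {0..} (\<lambda>t. W (v + of_real t * d) * exp (\<omega> * (v + of_real t * d)))"
      by (intro continuous_intros)
    show "eventually (\<lambda>t. norm (W (v + of_real t * d) * exp (\<omega> * (v + of_real t * d))) \<le> B * t powr e) at_top"
      using eB(2) by simp
  qed
qed

lemma Im_ray_gt:
  assumes "\<sigma> * Im v > Y" "\<sigma> * Im d > 0" "t \<ge> 0"
  shows "\<sigma> * Im (v + of_real t * d) > Y"
proof -
  have "\<sigma> * Im (v + of_real t * d) = \<sigma> * Im v + t * (\<sigma> * Im d)" by (simp add: algebra_simps)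
  moreover have "t * (\<sigma> * Im d) \<ge> 0" by (rule mult_nonneg_nonneg[OF assms(3) less_imp_le[OF assms(2)]])
  ultimately show ?thesis using assms by linarith
qed

lemma sector_bounded_ray_move:
  assumes W: "sector_bounded W e0" and \<sigma>: "\<bar>\<sigma>\<bar> = 1" and d: "\<sigma> * Im d1 > 0" "\<sigma> * Im d2 > 0"
    and dec: "decaying e0 \<omega> d1" "decaying e0 \<omega> d2"
    and hol: "W holomorphic_on {s. \<sigma> * Im s > Y}" and v: "\<sigma> * Im v1 > Y" "\<sigma> * Im v2 > Y"
  shows "ray_integral (\<lambda>s. W s * exp (\<omega> * s)) v1 d1 =
     contour_integral (linepath v1 v2) (\<lambda>s. W s * exp (\<omega> * s)) + ray_integral (\<lambda>s. W s * exp (\<omega> * s)) v2 d2"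
proof -
  obtain e B where eB: "e < -1" "eventually (\<lambda>R. \<forall>s\<in>closed_segment (v1 + of_real R * d1) (v2 + of_real R * d2).
      norm (W s * exp (\<omega> * s)) \<le> B * R powr e) at_top"
    by (rule sector_bounded_chord[OF W \<sigma> d dec])
  have r: "ray_integrable (\<lambda>s. W s * exp (\<omega> * s)) v1 d1" "ray_integrable (\<lambda>s. W s * exp (\<omega> * s)) v2 d2"
    by (rule sector_bounded_ray_integrable[OF W \<sigma> d(1) dec(1) hol], use Im_ray_gt[OF v(1) d(1)] in simp)
      (rule sector_bounded_ray_integrable[OF W \<sigma> d(2) dec(2) hol], use Im_ray_gt[OF v(2) d(2)] in simp)
  show ?thesis
    by (rule ray_integral_move_halfplane[OF _ v d r eB]) (intro holomorphic_intros hol)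
qed

text \<open>Beyond the height Y there are no poles, so each end can be turned about its starting
  point as long as both directions make the integrand decay.\<close>

lemma contour_sum_rotate:
  assumes W: "sector_bounded W e0" and hol: "W holomorphic_on S" and Y: "\<And>s. \<bar>Im s\<bar> > Y \<Longrightarrow> s \<in> S"
    and v: "Im (\<gamma> T) > Y" "Im (\<gamma> (- T)) < - Y"
    and d: "Im d1 > 0" "Im d2 < 0" "decaying e0 \<omega> d1" "decaying e0 \<omega> d2"
    and d': "Im d1' > 0" "Im d2' < 0" "decaying e0 \<omega> d1'" "decaying e0 \<omega> d2'"
  shows "contour_sum \<gamma> T d1 d2 (\<lambda>s. W s * exp (\<omega> * s)) = contour_sum \<gamma> T d1' d2' (\<lambda>s. W s * exp (\<omega> * s))"
proof -
  have "W holomorphic_on {s. 1 * Im s > Y}" "W holomorphic_on {s. - 1 * Im s > Y}"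
    by (rule holomorphic_on_subset[OF hol]; use Y in force)+
  note m = sector_bounded_ray_move[OF W _ _ _ _ _ this(1)] sector_bounded_ray_move[OF W _ _ _ _ _ this(2)]
  show ?thesis unfolding contour_sum_def
    using m(1)[of d1 d1' \<omega> "\<gamma> T" "\<gamma> T"] m(2)[of d2 d2' \<omega> "\<gamma> (- T)" "\<gamma> (- T)"] v d d' by simp
qed

text \<open>The directions of the rays are chosen for each \<open>\<omega>\<close>; since the value does not depend on
  them, the function is holomorphic although no single choice works on the whole half-plane.\<close>

lemma contour_sum_continuation:
  assumes W: "sector_bounded W e0" and hol: "W holomorphic_on S" and Y: "\<And>s. \<bar>Im s\<bar> > Y \<Longrightarrow> s \<in> S"
    and v: "Im (\<gamma> T) > Y" "Im (\<gamma> (- T)) < - Y"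
    and ct: "contour_tails \<gamma> T dp dm" and S: "open S" "range \<gamma> \<subseteq> S"
  obtains F where
    "F holomorphic_on {\<omega>. \<exists>d1 d2. Im d1 > 0 \<and> Im d2 < 0 \<and> Re (\<omega> * d1) < 0 \<and> Re (\<omega> * d2) < 0}"
    "\<And>\<omega> d1 d2. Im d1 > 0 \<Longrightarrow> Im d2 < 0 \<Longrightarrow> Re (\<omega> * d1) < 0 \<Longrightarrow> Re (\<omega> * d2) < 0 \<Longrightarrow>
       F \<omega> = contour_sum \<gamma> T d1 d2 (\<lambda>s. W s * exp (\<omega> * s))"
proof -
  define good where "good = (\<lambda>\<omega> d. Im (fst d) > 0 \<and> Im (snd d) < 0 \<and> Re (\<omega> * fst d) < 0 \<and> Re (\<omega> * snd d) < 0)"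
  define F where "F = (\<lambda>\<omega>. let d = (SOME d. good \<omega> d) in contour_sum \<gamma> T (fst d) (snd d) (\<lambda>s. W s * exp (\<omega> * s)))"
  have F: "F \<omega> = contour_sum \<gamma> T (fst d) (snd d) (\<lambda>s. W s * exp (\<omega> * s))" if g: "good \<omega> d" for \<omega> d
  proof -
    have g': "good \<omega> (SOME d. good \<omega> d)" using g by (rule someI)
    show ?thesis unfolding F_def Let_def
      by (rule contour_sum_rotate[OF W hol Y v]) (use g g' in \<open>simp_all add: good_def decaying_def\<close>)
  qed
  have hF: "F holomorphic_on {\<omega>. good \<omega> d}" for d
  proof (cases "Im (fst d) > 0 \<and> Im (snd d) < 0")
    case True
    let ?U = "{\<omega>. Re (\<omega> * fst d) < 0 \<and> Re (\<omega> * snd d) < 0}"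
    have U: "{\<omega>. good \<omega> d} = ?U" using True by (auto simp: good_def)
    have op: "open ?U" by (intro open_Collect_conj open_Collect_less continuous_intros)
    have "(\<lambda>\<omega>. contour_sum \<gamma> T (fst d) (snd d) (\<lambda>s. W s * exp (\<omega> * s))) holomorphic_on ?U"
    proof (rule contour_sum_exp_holomorphic[OF ct S hol op])
      fix \<omega> assume \<omega>: "\<omega> \<in> ?U"
      have 1: "\<gamma> T + of_real t * fst d \<in> S" if "t \<ge> 0" for t
        using Im_ray_gt[of Y 1 "\<gamma> T" "fst d" t] that v True by (intro Y) auto
      show "ray_integrable (\<lambda>s. W s * exp (\<omega> * s)) (\<gamma> T) (fst d)"
        by (rule sector_bounded_ray_integrable[OF W _ _ _ hol 1, of 1]) (use True \<omega> in \<open>auto simp: decaying_def\<close>)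
      have 2: "\<gamma> (- T) + of_real t * snd d \<in> S" if "t \<ge> 0" for t
        using Im_ray_gt[of Y "-1" "\<gamma> (- T)" "snd d" t] that v True by (intro Y) auto
      show "ray_integrable (\<lambda>s. W s * exp (\<omega> * s)) (\<gamma> (- T)) (snd d)"
        by (rule sector_bounded_ray_integrable[OF W _ _ _ hol 2, of "-1"]) (use True \<omega> in \<open>auto simp: decaying_def\<close>)
    qed
    then show ?thesis unfolding U[symmetric] by (rule holomorphic_transform) (simp add: F[of _ d])
  next
    case False
    then have "{\<omega>. good \<omega> d} = {}" by (auto simp: good_def)
    then show ?thesis by (simp only: holomorphic_on_empty)
  qed
  have op: "open {\<omega>. good \<omega> d}" for d
    unfolding good_def by (intro open_Collect_conj open_Collect_const open_Collect_less continuous_intros)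
  have "F holomorphic_on (\<Union>d. {\<omega>. good \<omega> d})"
    by (rule holomorphic_on_UN_open) (use hF op in auto)
  moreover have "(\<Union>d. {\<omega>. good \<omega> d}) = {\<omega>. \<exists>d1 d2. Im d1 > 0 \<and> Im d2 < 0 \<and> Re (\<omega> * d1) < 0 \<and> Re (\<omega> * d2) < 0}"
    by (auto simp: good_def) blast
  ultimately show ?thesis using F by (intro that[of F]) (auto simp: good_def)
qed

text \<open>For real w and a vertical direction the factor exp (w t d) has modulus 1, so |W| along
  the ray dominates all these integrands. The factor exp (w v) is taken out first because v need not
  be imaginary.\<close>

lemma continuous_vertical_ray_integral:
  assumes int: "ray_integrable W v d" and d: "Re d = 0"
  shows "continuous_on UNIV (\<lambda>w. ray_integral (\<lambda>s. W s * exp (of_real w * s)) v d)"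
proof -
  define g where "g = (\<lambda>w. LINT t:{0..}|lborel. W (v + of_real t * d) * d * exp (of_real w * (of_real t * d)))"
  have eq: "ray_integral (\<lambda>s. W s * exp (of_real w * s)) v d = exp (of_real w * v) * g w" for w
  proof -
    have "ray_integral (\<lambda>s. W s * exp (of_real w * s)) v d =
       (LINT t:{0..}|lborel. exp (of_real w * v) * (W (v + of_real t * d) * d * exp (of_real w * (of_real t * d))))"
      unfolding ray_integral_def by (simp add: exp_add distrib_left mult_ac)
    then show ?thesis unfolding g_def by (simp only: set_integral_mult_right)
  qed
  have "isCont g w" for w
    unfolding isCont_def tendsto_at_iff_sequentially o_def
  proof (intro allI impI)
    fix X :: "nat \<Rightarrow> real" assume X: "X \<longlonglongrightarrow> w"
    have mW: "(\<lambda>t. indicator {0..} t *\<^sub>R (W (v + of_real t * d) * d)) \<in> borel_measurable lborel"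
      and iW: "integrable lborel (\<lambda>t. norm (indicator {0..} t *\<^sub>R (W (v + of_real t * d) * d)))"
      using int unfolding ray_integrable_def set_integrable_def
      by (rule borel_measurable_integrable, rule integrable_norm)
    have meas: "(\<lambda>t. indicator {0..} t *\<^sub>R (W (v + of_real t * d) * d * exp (of_real x * (of_real t * d)))) \<in> borel_measurable lborel" for x
    proof -
      have "(\<lambda>t. exp (of_real x * (of_real t * d))) \<in> borel_measurable borel"
        by (intro borel_measurable_continuous_onI continuous_intros)
      then have "(\<lambda>t. exp (of_real x * (of_real t * d))) \<in> borel_measurable lborel" by simp
      from borel_measurable_times[OF mW this] show ?thesis by (simp add: mult.assoc)
    qed
    show "(\<lambda>n. g (X n)) \<longlonglongrightarrow> g w"
      unfolding g_def set_lebesgue_integral_def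
    proof (rule integral_dominated_convergence[OF meas meas iW])
      show "AE t in lborel. (\<lambda>n. indicator {0..} t *\<^sub>R (W (v + of_real t * d) * d * exp (of_real (X n) * (of_real t * d))))
         \<longlonglongrightarrow> indicator {0..} t *\<^sub>R (W (v + of_real t * d) * d * exp (of_real w * (of_real t * d)))"
        by (intro AE_I2 tendsto_intros X)
      show "AE t in lborel. norm (indicator {0..} t *\<^sub>R (W (v + of_real t * d) * d * exp (of_real (X n) * (of_real t * d))))
         \<le> norm (indicator {0..} t *\<^sub>R (W (v + of_real t * d) * d))" for n
        using d by (intro AE_I2) (simp add: norm_mult norm_exp_eq_Re)
    qed
  qed
  then show ?thesis unfolding eq by (intro continuous_intros continuous_at_imp_continuous_on ballI)
qed

lemma K_weight_sector_bounded:
  assumes t: "\<tau> > 0" and mq: "m \<le> q" and np: "n \<le> p" and vii: "K_case_vii p q m n a b \<alpha>"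
  shows "sector_bounded (K_weight p q m n a b \<tau> \<alpha>) (Re (K_xi p q m n a b) / (2 * \<tau>))"
proof -
  have h: "K_N p q m n = 0" "\<alpha> = 0" "p = q" "K_mu p q m n a b = 0" "K_nu p q a b = 0"
    using vii unfolding K_case_vii_def by (-) ((elim conjE; assumption)+)
  obtain A B C L P where asy: "\<And>\<kappa>. \<kappa> > 0 \<Longrightarrow> \<exists>R D. \<forall>s. norm s \<ge> R \<longrightarrow> \<bar>Im s\<bar> \<ge> \<kappa> * norm s \<longrightarrow>
       norm (K_weight p q m n a b \<tau> \<alpha> s) \<le> exp (Re (K_expo A (B (sgn (Im s))) C (L (sgn (Im s))) P s) + D)"
    and A: "A = of_real (of_int (K_N p q m n) / (2 * \<tau>))"
    and B: "\<And>\<sigma>. K_N p q m n = 0 \<Longrightarrow> B \<sigma> = of_real (pi / \<tau>) * (\<alpha> + of_real \<sigma> * ((of_nat p - of_nat q) * \<i> / 4))"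
    and C: "K_N p q m n = 0 \<Longrightarrow> C = - K_mu p q m n a b / of_real \<tau>"
    and L: "\<And>\<sigma>. K_N p q m n = 0 \<Longrightarrow> p = q \<Longrightarrow> K_mu p q m n a b = 0 \<Longrightarrow>
       L \<sigma> = - (\<i> * of_real pi * of_real \<sigma> * K_nu p q a b / (2 * of_real \<tau>))"
    and P: "K_N p q m n = 0 \<Longrightarrow> p = q \<Longrightarrow> K_mu p q m n a b = 0 \<Longrightarrow> K_nu p q a b = 0 \<Longrightarrow>
       P = K_xi p q m n a b / (2 * of_real \<tau>)"
    by (rule K_weight_asymp[OF t mq np, of a b \<alpha>]) (rule that)
  have A0: "A = 0" using A h(1) by simp
  have B0: "B \<sigma> = 0" for \<sigma> unfolding B[OF h(1)] h(2,3) by simp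
  have C0: "C = 0" using C[OF h(1)] h(4) by simp
  have L0: "L \<sigma> = 0" for \<sigma> unfolding L[OF h(1,3,4)] h(5) by simp
  have ReP: "Re P = Re (K_xi p q m n a b) / (2 * \<tau>)" unfolding P[OF h(1,3,4,5)]
    by (metis Re_divide_of_real of_real_mult of_real_numeral)
  show ?thesis unfolding sector_bounded_def ReP[symmetric]
  proof (intro allI impI)
    fix \<kappa> :: real assume "\<kappa> > 0"
    then obtain R D where RD: "\<And>s. norm s \<ge> R \<Longrightarrow> \<bar>Im s\<bar> \<ge> \<kappa> * norm s \<Longrightarrow>
       norm (K_weight p q m n a b \<tau> \<alpha> s) \<le> exp (Re (P * Ln s) + D)"
      using asy[of \<kappa>] unfolding A0 B0 C0 L0 K_expo_def by auto
    show "\<exists>R D. \<forall>s. norm s \<ge> R \<longrightarrow> \<bar>Im s\<bar> \<ge> \<kappa> * norm s \<longrightarrow> norm (K_weight p q m n a b \<tau> \<alpha> s) \<le> D * norm s powr Re P"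
    proof (rule exI[of _ "max R 1"], rule exI[of _ "exp (\<bar>Im P\<bar> * pi + D)"], intro allI impI)
      fix s :: complex assume s: "norm s \<ge> max R 1" "\<bar>Im s\<bar> \<ge> \<kappa> * norm s"
      then have s0: "s \<noteq> 0" by auto
      \<comment> \<open>The argument of s is bounded, so the imaginary part of \<open>P\<close>
        costs only a constant factor.\<close>
      have "\<bar>Im P * Im (Ln s)\<bar> \<le> \<bar>Im P\<bar> * pi"
        unfolding abs_mult using mpi_less_Im_Ln[OF s0] Im_Ln_le_pi[OF s0] by (intro mult_left_mono) auto
      then have "Re (P * Ln s) + D \<le> Re P * ln (norm s) + (\<bar>Im P\<bar> * pi + D)" using s0 by simp
      then have "exp (Re (P * Ln s) + D) \<le> exp (\<bar>Im P\<bar> * pi + D) * norm s powr Re P"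
        using s0 by (simp add: powr_def mult.commute flip: exp_add)
      then show "norm (K_weight p q m n a b \<tau> \<alpha> s) \<le> exp (\<bar>Im P\<bar> * pi + D) * norm s powr Re P"
        using RD[of s] s by simp
    qed
  qed
qed

section \<open>Contours on the two sides of z = 1\<close>

lemma separating_contour_high_tails:
  assumes sc: "separating_contour Lp Lm \<theta>m \<theta>p \<gamma>" and \<theta>: "\<theta>p \<in> {0<..<pi}" "\<theta>m \<in> {-pi<..<0}"
  obtains T where "contour_tails \<gamma> T (cis \<theta>p) (cis \<theta>m)" "Im (\<gamma> T) > Y" "Im (\<gamma> (- T)) < - Y"
proof -
  obtain T where ct: "contour_tails \<gamma> T (cis \<theta>p) (cis \<theta>m)" using separating_contour_tails[OF sc] .
  have sp: "sin \<theta>p > 0" and sm: "sin \<theta>m < 0" using \<theta> sin_gt_zero[of \<theta>p] sin_gt_zero[of "- \<theta>m"] by auto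
  define t where "t = max 0 (max ((Y - Im (\<gamma> T)) / sin \<theta>p) ((Y + Im (\<gamma> (- T))) / (- sin \<theta>m))) + 1"
  have t: "t \<ge> 0" "t > (Y - Im (\<gamma> T)) / sin \<theta>p" "t > (Y + Im (\<gamma> (- T))) / (- sin \<theta>m)"
    unfolding t_def by linarith+
  have i: "Y - Im (\<gamma> T) < t * sin \<theta>p" "Y + Im (\<gamma> (- T)) < t * (- sin \<theta>m)"
    using t(2) sp t(3) sm by (simp_all only: pos_divide_less_eq neg_0_less_iff_less)
  have g: "\<gamma> (T + t) = \<gamma> T + of_real t * cis \<theta>p" "\<gamma> (- T - t) = \<gamma> (- T) + of_real t * cis \<theta>m"
    using ct t(1) unfolding contour_tails_def by blast+
  show ?thesis
  proof (rule that[of "T + t"])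
    show "contour_tails \<gamma> (T + t) (cis \<theta>p) (cis \<theta>m)" using t(1) by (intro contour_tails_mono[OF ct]) simp
    show "Im (\<gamma> (T + t)) > Y" using i(1) unfolding g by simp
    have "- (T + t) = - T - t" by simp
    then show "Im (\<gamma> (- (T + t))) < - Y" using i(2) g(2) by simp
  qed
qed

text \<open>Directions close to the positive real axis work for Re \<omega> < 0, those close to the
  negative real axis for Re \<omega> > 0. How close they must be depends on \<omega>.\<close>

lemma directions_exist:
  assumes "Re \<omega> \<noteq> 0"
  shows "\<exists>d1 d2. Im d1 > 0 \<and> Im d2 < 0 \<and> Re (\<omega> * d1) < 0 \<and> Re (\<omega> * d2) < 0"
proof (cases "Re \<omega> < 0")
  case True
  obtain \<phi> where \<phi>: "\<phi> \<in> {0<..<pi/2}" "Re (\<omega> * cis \<phi>) < 0" "Re (\<omega> * cis (- \<phi>)) < 0"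
    using small_angle_exists[OF True] by metis
  have "sin \<phi> > 0" using \<phi>(1) by (intro sin_gt_zero) auto
  then show ?thesis using \<phi> by (intro exI[of _ "cis \<phi>"] exI[of _ "cis (- \<phi>)"]) simp
next
  case False
  then have "Re (- \<omega>) < 0" using assms by simp
  then obtain \<phi> where \<phi>: "\<phi> \<in> {0<..<pi/2}" "Re (- \<omega> * cis \<phi>) < 0" "Re (- \<omega> * cis (- \<phi>)) < 0"
    using small_angle_exists by metis
  have "sin \<phi> > 0" using \<phi>(1) by (intro sin_gt_zero) auto
  then show ?thesis using \<phi> by (intro exI[of _ "- cis (- \<phi>)"] exI[of _ "- cis \<phi>"]) simp
qed

lemma K_contour_vii_exists:
  assumes t: "\<tau> > 0" and disj: "Lambda_plus p n a \<tau> \<inter> Lambda_minus q m b \<tau> = {}"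
    and vii: "K_case_vii p q m n a b \<alpha>" and z: "z \<noteq> 1"
  shows "\<exists>\<gamma>. K_contour p q m n a b \<tau> \<alpha> z \<gamma>"
proof -
  have pe: "pi / 4 \<in> {0<..<pi/2}" by simp
  have "\<exists>\<theta>m \<theta>p. K_angles p q m n a b \<alpha> z \<theta>m \<theta>p"
  proof (cases "z > 1")
    case True
    have "\<exists>\<epsilon>\<in>{0<..<pi/2}. z > 1 \<and> pi / 4 = \<epsilon> \<and> - (pi / 4) = - \<epsilon> \<or> z < 1 \<and> pi / 4 = pi - \<epsilon> \<and> - (pi / 4) = - (pi - \<epsilon>)"
      using True pe by (intro bexI[of _ "pi / 4"]) auto
    then have "K_angles p q m n a b \<alpha> z (- (pi / 4)) (pi / 4)"
      unfolding K_angles_def using vii by (intro conjI disjI2) auto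
    then show ?thesis by blast
  next
    case False
    then have "z < 1" using z by simp
    then have "\<exists>\<epsilon>\<in>{0<..<pi/2}. z > 1 \<and> pi - pi / 4 = \<epsilon> \<and> - (pi - pi / 4) = - \<epsilon> \<or> z < 1 \<and> pi - pi / 4 = pi - \<epsilon> \<and> - (pi - pi / 4) = - (pi - \<epsilon>)"
      using pe by (intro bexI[of _ "pi / 4"]) auto
    then have "K_angles p q m n a b \<alpha> z (- (pi - pi / 4)) (pi - pi / 4)"
      unfolding K_angles_def using vii by (intro conjI disjI2) auto
    then show ?thesis by blast
  qed
  then show ?thesis using K_contour_exists[OF t disj] by blast
qed

text \<open>Here \<rho> is the sign of w. The rule for case (vii) depends on z only through the side
  of 1 on which it lies, so the contour chosen for z = exp \<rho> is the one chosen for all w of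
  this sign.\<close>

lemma K_vii_contour:
  assumes t: "\<tau> > 0" and mq: "m \<le> q" and np: "n \<le> p"
    and disj: "Lambda_plus p n a \<tau> \<inter> Lambda_minus q m b \<tau> = {}"
    and vii: "K_case_vii p q m n a b \<alpha>" and \<rho>: "\<rho> = 1 \<or> \<rho> = (- 1 :: real)"
  obtains \<gamma> T \<theta>m \<theta>p where
    "separating_contour (Lambda_plus p n a \<tau>) (Lambda_minus q m b \<tau>) \<theta>m \<theta>p \<gamma>"
    "contour_tails \<gamma> T (cis \<theta>p) (cis \<theta>m)" "Im (\<gamma> T) > Y" "Im (\<gamma> (- T)) < - Y"
    "Im (cis \<theta>p) > 0" "Im (cis \<theta>m) < 0" "\<And>w. \<rho> * w > 0 \<Longrightarrow> Re (of_real (- (2 * pi * w)) * cis \<theta>p) < 0"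
    "\<And>w. \<rho> * w > 0 \<Longrightarrow> Re (of_real (- (2 * pi * w)) * cis \<theta>m) < 0"
    "\<And>w. \<rho> * w > 0 \<Longrightarrow> Meijer_Barnes_K p q m n a b \<tau> \<alpha> (exp (2 * pi * w)) = 1 / (2 * of_real pi * \<i>) *
       contour_sum \<gamma> T (cis \<theta>p) (cis \<theta>m) (\<lambda>s. K_weight p q m n a b \<tau> \<alpha> s * exp (of_real (- (2 * pi * w)) * s))"
proof -
  define z where "z = exp \<rho>"
  have z1: "z \<noteq> 1" using \<rho> by (auto simp: z_def)
  define \<gamma> where "\<gamma> = (SOME \<gamma>. K_contour p q m n a b \<tau> \<alpha> z \<gamma>)"
  have "K_contour p q m n a b \<tau> \<alpha> z \<gamma>" unfolding \<gamma>_def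
    by (rule someI_ex[OF K_contour_vii_exists[OF t disj vii z1]])
  then obtain \<theta>m \<theta>p where ang: "K_angles p q m n a b \<alpha> z \<theta>m \<theta>p"
    and sc: "separating_contour (Lambda_plus p n a \<tau>) (Lambda_minus q m b \<tau>) \<theta>m \<theta>p \<gamma>"
    unfolding K_contour_def by (elim exE conjE)
  note excl = K_case_exclusive[OF disjI2[OF vii]]
  have nvi: "\<not> K_case_vi p q m n a b \<alpha>" using vii unfolding K_case_vi_def K_case_vii_def by auto
  have \<theta>: "\<theta>p \<in> {0<..<pi}" "\<theta>m \<in> {-pi<..<0}" using ang by (auto simp: K_angles_def)
  obtain \<epsilon> where \<epsilon>: "\<epsilon> \<in> {0<..<pi/2}" "z > 1 \<and> \<theta>p = \<epsilon> \<and> \<theta>m = - \<epsilon> \<or> z < 1 \<and> \<theta>p = pi - \<epsilon> \<and> \<theta>m = - (pi - \<epsilon>)"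
    using ang excl nvi unfolding K_angles_def by blast
  have ce: "cos \<epsilon> > 0" using \<epsilon>(1) by (intro cos_gt_zero) auto
  \<comment> \<open>Both ends bend to the right for \<rho> = 1 and to the left for \<rho> = -1, the
    side on which exp (\<omega> s) decays when \<rho> w > 0.\<close>
  have c: "cos \<theta>p = \<rho> * cos \<epsilon>" "cos \<theta>m = \<rho> * cos \<epsilon>"
    using \<epsilon>(2) \<rho> by (auto simp: z_def)
  have sg: "Im (cis \<theta>p) > 0" "Im (cis \<theta>m) < 0" using sgn_Im_cis[OF \<theta>] by auto
  obtain T where ct: "contour_tails \<gamma> T (cis \<theta>p) (cis \<theta>m)" "Im (\<gamma> T) > Y" "Im (\<gamma> (- T)) < - Y"
    by (rule separating_contour_high_tails[OF sc \<theta>])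
  have neg: "Re (of_real (- (2 * pi * w)) * cis \<theta>p) < 0" "Re (of_real (- (2 * pi * w)) * cis \<theta>m) < 0" if "\<rho> * w > 0" for w
  proof -
    have g: "2 * pi * cos \<epsilon> * (\<rho> * w) > 0" by (intro mult_pos_pos that ce) auto
    have "Re (of_real (- (2 * pi * w)) * cis \<theta>p) = - (2 * pi * cos \<epsilon> * (\<rho> * w))" by (simp add: c mult_ac)
    then show "Re (of_real (- (2 * pi * w)) * cis \<theta>p) < 0" using g by linarith
    have "Re (of_real (- (2 * pi * w)) * cis \<theta>m) = - (2 * pi * cos \<epsilon> * (\<rho> * w))" by (simp add: c mult_ac)
    then show "Re (of_real (- (2 * pi * w)) * cis \<theta>m) < 0" using g by linarith
  qed
  have K: "Meijer_Barnes_K p q m n a b \<tau> \<alpha> (exp (2 * pi * w)) = 1 / (2 * of_real pi * \<i>) *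
       contour_sum \<gamma> T (cis \<theta>p) (cis \<theta>m) (\<lambda>s. K_weight p q m n a b \<tau> \<alpha> s * exp (of_real (- (2 * pi * w)) * s))"
    if w: "\<rho> * w > 0" for w
  proof -
    have "(exp (2 * pi * w) > 1 \<longleftrightarrow> z > 1) \<and> (exp (2 * pi * w) < 1 \<longleftrightarrow> z < 1)"
      using w \<rho> by (auto simp: z_def zero_less_mult_iff mult_less_0_iff)
    then have "K_contour p q m n a b \<tau> \<alpha> (exp (2 * pi * w)) = K_contour p q m n a b \<tau> \<alpha> z"
      unfolding K_contour_def K_angles_def by (simp add: fun_eq_iff)
    then have g: "(SOME \<gamma>. K_contour p q m n a b \<tau> \<alpha> (exp (2 * pi * w)) \<gamma>) = \<gamma>" by (simp add: \<gamma>_def)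
    note W = K_weight_sector_bounded[OF t mq np vii] and hol = holomorphic_K_weight[OF t]
      and S = open_K_dom[OF t] separating_contour_K_dom[OF sc]
    show ?thesis unfolding Meijer_Barnes_K_exp g
    proof (rule arg_cong[where f = "(*) _"], rule line_contour_integral_eq_contour_sum[OF ct(1) S])
      show "(\<lambda>s. K_weight p q m n a b \<tau> \<alpha> s * exp (of_real (- (2 * pi * w)) * s)) holomorphic_on K_dom p q m n a b \<tau>"
        by (intro holomorphic_intros hol)
      show "ray_integrable (\<lambda>s. K_weight p q m n a b \<tau> \<alpha> s * exp (of_real (- (2 * pi * w)) * s)) (\<gamma> T) (cis \<theta>p)"
        by (rule sector_bounded_ray_integrable[OF W _ _ _ hol, of 1])
          (use sg neg[OF w] contour_tails_range(1)[OF ct(1)] S in \<open>auto simp: decaying_def\<close>)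
      show "ray_integrable (\<lambda>s. K_weight p q m n a b \<tau> \<alpha> s * exp (of_real (- (2 * pi * w)) * s)) (\<gamma> (- T)) (cis \<theta>m)"
        by (rule sector_bounded_ray_integrable[OF W _ _ _ hol, of "- 1"])
          (use sg neg[OF w] contour_tails_range(2)[OF ct(1)] S in \<open>auto simp: decaying_def\<close>)
    qed
  qed
  show ?thesis by (rule that[OF sc ct sg neg K])
qed

lemma K_half_plane:
  assumes t: "\<tau> > 0" and mq: "m \<le> q" and np: "n \<le> p"
    and disj: "Lambda_plus p n a \<tau> \<inter> Lambda_minus q m b \<tau> = {}"
    and vii: "K_case_vii p q m n a b \<alpha>" and \<rho>: "\<rho> = 1 \<or> \<rho> = (- 1 :: real)"
  shows "\<exists>F. F holomorphic_on {w. \<rho> * Re w > 0} \<and>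
     (\<forall>w::real. \<rho> * w > 0 \<longrightarrow> F (of_real w) = Meijer_Barnes_K p q m n a b \<tau> \<alpha> (exp (2 * pi * w)))"
proof -
  obtain Y where Y: "Y > 0" "\<And>s. \<bar>Im s\<bar> > Y \<Longrightarrow> s \<in> K_dom p q m n a b \<tau>" using K_dom_Im_bound by blast
  obtain \<gamma> T \<theta>m \<theta>p where sc: "separating_contour (Lambda_plus p n a \<tau>) (Lambda_minus q m b \<tau>) \<theta>m \<theta>p \<gamma>"
    and ct: "contour_tails \<gamma> T (cis \<theta>p) (cis \<theta>m)" and v: "Im (\<gamma> T) > Y" "Im (\<gamma> (- T)) < - Y"
    and sg: "Im (cis \<theta>p) > 0" "Im (cis \<theta>m) < 0"
    and neg: "\<And>w. \<rho> * w > 0 \<Longrightarrow> Re (of_real (- (2 * pi * w)) * cis \<theta>p) < 0"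
      "\<And>w. \<rho> * w > 0 \<Longrightarrow> Re (of_real (- (2 * pi * w)) * cis \<theta>m) < 0"
    and K: "\<And>w. \<rho> * w > 0 \<Longrightarrow> Meijer_Barnes_K p q m n a b \<tau> \<alpha> (exp (2 * pi * w)) = 1 / (2 * of_real pi * \<i>) *
       contour_sum \<gamma> T (cis \<theta>p) (cis \<theta>m) (\<lambda>s. K_weight p q m n a b \<tau> \<alpha> s * exp (of_real (- (2 * pi * w)) * s))"
    by (rule K_vii_contour[OF t mq np disj vii \<rho>, of Y]) (rule that)
  obtain F where
    F: "F holomorphic_on {\<omega>. \<exists>d1 d2. Im d1 > 0 \<and> Im d2 < 0 \<and> Re (\<omega> * d1) < 0 \<and> Re (\<omega> * d2) < 0}"
    "\<And>\<omega> d1 d2. Im d1 > 0 \<Longrightarrow> Im d2 < 0 \<Longrightarrow> Re (\<omega> * d1) < 0 \<Longrightarrow> Re (\<omega> * d2) < 0 \<Longrightarrow>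
       F \<omega> = contour_sum \<gamma> T d1 d2 (\<lambda>s. K_weight p q m n a b \<tau> \<alpha> s * exp (\<omega> * s))"
    by (rule contour_sum_continuation[OF K_weight_sector_bounded[OF t mq np vii] holomorphic_K_weight[OF t] Y(2) v ct
        open_K_dom[OF t] separating_contour_K_dom[OF sc]], assumption) (rule that)
  have "(\<lambda>w. 1 / (2 * of_real pi * \<i>) * F (of_real (- (2 * pi)) * w)) holomorphic_on {w. \<rho> * Re w > 0}"
  proof -
    have "(\<lambda>w. F (of_real (- (2 * pi)) * w)) holomorphic_on {w. \<rho> * Re w > 0}"
    proof (rule holomorphic_on_compose_gen[OF _ F(1), unfolded o_def])
      show "(*) (of_real (- (2 * pi))) ` {w. \<rho> * Re w > 0} \<subseteq>
        {\<omega>. \<exists>d1 d2. Im d1 > 0 \<and> Im d2 < 0 \<and> Re (\<omega> * d1) < 0 \<and> Re (\<omega> * d2) < 0}"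
      proof (intro image_subsetI CollectI directions_exist)
        fix w assume "w \<in> {w. \<rho> * Re w > 0}"
        then show "Re (of_real (- (2 * pi)) * w) \<noteq> 0" by auto
      qed
    qed (intro holomorphic_intros)
    then show ?thesis by (intro holomorphic_on_mult holomorphic_on_const)
  qed
  moreover have "1 / (2 * of_real pi * \<i>) * F (of_real (- (2 * pi)) * of_real w) = Meijer_Barnes_K p q m n a b \<tau> \<alpha> (exp (2 * pi * w))"
    if "\<rho> * w > 0" for w
    using F(2)[OF sg neg[OF that]] unfolding K[OF that] by simp
  ultimately show ?thesis by (intro exI[of _ "\<lambda>w. 1 / (2 * of_real pi * \<i>) * F (of_real (- (2 * pi)) * w)"]) simp
qed

text \<open>The set \<open>A\<close> is the whole family of poles that contains \<zeta>: it is
  unbounded, and every separating contour keeps it within one component.\<close>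

lemma K_dom_cover:
  assumes sc1: "separating_contour (Lambda_plus p n a \<tau>) (Lambda_minus q m b \<tau>) \<theta>m1 \<theta>p1 \<gamma>1"
    and sc2: "separating_contour (Lambda_plus p n a \<tau>) (Lambda_minus q m b \<tau>) \<theta>m2 \<theta>p2 \<gamma>2"
    and \<zeta>: "\<zeta> \<notin> K_dom p q m n a b \<tau>"
  shows "\<exists>A D1 D2. \<zeta> \<in> A \<and> A \<inter> K_dom p q m n a b \<tau> = {} \<and> \<not> bounded A \<and> A \<subseteq> D1 \<and> A \<subseteq> D2 \<and>
       D1 \<in> components (- range \<gamma>1) \<and> D2 \<in> components (- range \<gamma>2)"
proof -
  obtain Dp1 Dm1 where D1: "Dp1 \<in> components (- range \<gamma>1)" "Dm1 \<in> components (- range \<gamma>1)"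
    "Lambda_plus p n a \<tau> \<subseteq> Dp1" "Lambda_minus q m b \<tau> \<subseteq> Dm1" using sc1 unfolding separating_contour_def by auto
  obtain Dp2 Dm2 where D2: "Dp2 \<in> components (- range \<gamma>2)" "Dm2 \<in> components (- range \<gamma>2)"
    "Lambda_plus p n a \<tau> \<subseteq> Dp2" "Lambda_minus q m b \<tau> \<subseteq> Dm2" using sc2 unfolding separating_contour_def by auto
  consider "\<zeta> \<in> Lambda_plus p n a \<tau>" | "\<zeta> \<in> Lambda_minus q m b \<tau>" using \<zeta> by (auto simp: K_dom_def)
  then show ?thesis
  proof cases
    case 1
    then show ?thesis using D1(1,3) D2(1,3) unbounded_Lambda_plus[OF 1]
      by (intro exI[of _ "Lambda_plus p n a \<tau>"] exI[of _ Dp1] exI[of _ Dp2] conjI) (simp_all add: K_dom_def disjoint_iff)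
  next
    case 2
    then show ?thesis using D1(2,4) D2(2,4) unbounded_Lambda_minus[OF 2]
      by (intro exI[of _ "Lambda_minus q m b \<tau>"] exI[of _ Dm1] exI[of _ Dm2] conjI) (simp_all add: K_dom_def disjoint_iff)
  qed
qed

lemma continuous_vertical_contour_sum:
  assumes W: "sector_bounded W e" and e: "e < -1" and hol: "W holomorphic_on S" and Y: "\<And>s. \<bar>Im s\<bar> > Y \<Longrightarrow> s \<in> S"
    and v: "Im (\<gamma> T) > Y" "Im (\<gamma> (- T)) < - Y"
    and ct: "contour_tails \<gamma> T dp dm" and S: "open S" "range \<gamma> \<subseteq> S"
  shows "continuous_on UNIV (\<lambda>x. contour_sum \<gamma> T \<i> (- \<i>) (\<lambda>s. W s * exp (of_real x * s)))"
proof -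
  obtain h where h: "polynomial_function h" "path_image h \<subseteq> S"
    "\<And>f. f holomorphic_on S \<Longrightarrow> contour_integral (mid_path \<gamma> T) f = contour_integral h f"
    using mid_path_polynomial[OF ct S] by metis
  have "contour_integral (mid_path \<gamma> T) (\<lambda>s. W s * exp (of_real x * s)) = contour_integral h (\<lambda>s. W s * exp (of_real x * s))" for x
    by (intro h(3) holomorphic_intros hol)
  moreover have "continuous_on UNIV (\<lambda>\<omega>. contour_integral h (\<lambda>s. W s * exp (\<omega> * s)))"
    by (rule holomorphic_on_imp_continuous_on[OF holomorphic_contour_integral_polynomial[OF h(1,2) holomorphic_on_imp_continuous_on[OF hol]]])
  then have "continuous_on UNIV (\<lambda>x. contour_integral h (\<lambda>s. W s * exp (of_real x * s)))"
    by (rule continuous_on_compose2) (auto intro: continuous_intros)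
  \<comment> \<open>At parameter 0 the power bound alone gives integrability, since e < -1; on
    vertical rays this case dominates all real parameters.\<close>
  moreover have "ray_integrable (\<lambda>s. W s * exp (0 * s)) (\<gamma> T) \<i>"
  proof (rule sector_bounded_ray_integrable[OF W _ _ _ hol, of 1])
    show "\<gamma> T + of_real t * \<i> \<in> S" if "t \<ge> 0" for t
      using Im_ray_gt[of Y 1 "\<gamma> T" \<i> t] that v by (intro Y) auto
  qed (use e in \<open>auto simp: decaying_def\<close>)
  then have "continuous_on UNIV (\<lambda>x. ray_integral (\<lambda>s. W s * exp (of_real x * s)) (\<gamma> T) \<i>)"
    by (intro continuous_vertical_ray_integral) auto
  moreover have "ray_integrable (\<lambda>s. W s * exp (0 * s)) (\<gamma> (- T)) (- \<i>)"
  proof (rule sector_bounded_ray_integrable[OF W _ _ _ hol, of "- 1"])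
    show "\<gamma> (- T) + of_real t * (- \<i>) \<in> S" if "t \<ge> 0" for t
      using Im_ray_gt[of Y "- 1" "\<gamma> (- T)" "- \<i>" t] that v by (intro Y) auto
  qed (use e in \<open>auto simp: decaying_def\<close>)
  then have "continuous_on UNIV (\<lambda>x. ray_integral (\<lambda>s. W s * exp (of_real x * s)) (\<gamma> (- T)) (- \<i>))"
    by (intro continuous_vertical_ray_integral) auto
  ultimately show ?thesis unfolding contour_sum_def by (simp only:) (intro continuous_intros)
qed

lemma K_continuous:
  assumes t: "\<tau> > 0" and mq: "m \<le> q" and np: "n \<le> p"
    and disj: "Lambda_plus p n a \<tau> \<inter> Lambda_minus q m b \<tau> = {}"
    and vii: "K_case_vii p q m n a b \<alpha>" and \<xi>: "Re (K_xi p q m n a b) < - 2 * \<tau>"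
  shows "\<exists>F :: real \<Rightarrow> complex. continuous_on UNIV F \<and>
     (\<forall>w. w \<noteq> 0 \<longrightarrow> F w = Meijer_Barnes_K p q m n a b \<tau> \<alpha> (exp (2 * pi * w)))"
proof -
  let ?S = "K_dom p q m n a b \<tau>"
  let ?f = "\<lambda>w s. K_weight p q m n a b \<tau> \<alpha> s * exp (of_real (- (2 * pi * w)) * s)"
  \<comment> \<open>In terms of this exponent the condition Re \<xi> < - 2 \<tau> reads e <
    -1.\<close>
  define e where "e = Re (K_xi p q m n a b) / (2 * \<tau>)"
  have e: "e < -1" using \<xi> t by (simp add: e_def pos_divide_less_eq)
  have W: "sector_bounded (K_weight p q m n a b \<tau> \<alpha>) e" unfolding e_def by (rule K_weight_sector_bounded[OF t mq np vii])
  note hol = holomorphic_K_weight[OF t, of p q m n a b \<alpha>]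
  note op = open_K_dom[OF t, of p q m n a b]
  obtain Y where Y: "Y > 0" "\<And>s. \<bar>Im s\<bar> > Y \<Longrightarrow> s \<in> ?S" using K_dom_Im_bound by blast
  have dv: "decaying e (of_real x) \<i>" "decaying e (of_real x) (- \<i>)" for x using e by (simp_all add: decaying_def)
  obtain \<gamma>1 T1 \<theta>m1 \<theta>p1 where sc1: "separating_contour (Lambda_plus p n a \<tau>) (Lambda_minus q m b \<tau>) \<theta>m1 \<theta>p1 \<gamma>1"
    and ct1: "contour_tails \<gamma>1 T1 (cis \<theta>p1) (cis \<theta>m1)" and v1: "Im (\<gamma>1 T1) > Y" "Im (\<gamma>1 (- T1)) < - Y"
    and sg1: "Im (cis \<theta>p1) > 0" "Im (cis \<theta>m1) < 0"
    and neg1: "\<And>w. 1 * w > 0 \<Longrightarrow> Re (of_real (- (2 * pi * w)) * cis \<theta>p1) < 0"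
      "\<And>w. 1 * w > 0 \<Longrightarrow> Re (of_real (- (2 * pi * w)) * cis \<theta>m1) < 0"
    and K1: "\<And>w. 1 * w > 0 \<Longrightarrow> Meijer_Barnes_K p q m n a b \<tau> \<alpha> (exp (2 * pi * w)) = 1 / (2 * of_real pi * \<i>) *
       contour_sum \<gamma>1 T1 (cis \<theta>p1) (cis \<theta>m1) (?f w)"
    by (rule K_vii_contour[OF t mq np disj vii, of 1 Y]) (simp, rule that)
  obtain \<gamma>2 T2 \<theta>m2 \<theta>p2 where sc2: "separating_contour (Lambda_plus p n a \<tau>) (Lambda_minus q m b \<tau>) \<theta>m2 \<theta>p2 \<gamma>2"
    and ct2: "contour_tails \<gamma>2 T2 (cis \<theta>p2) (cis \<theta>m2)" and v2: "Im (\<gamma>2 T2) > Y" "Im (\<gamma>2 (- T2)) < - Y"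
    and sg2: "Im (cis \<theta>p2) > 0" "Im (cis \<theta>m2) < 0"
    and neg2: "\<And>w. - 1 * w > 0 \<Longrightarrow> Re (of_real (- (2 * pi * w)) * cis \<theta>p2) < 0"
      "\<And>w. - 1 * w > 0 \<Longrightarrow> Re (of_real (- (2 * pi * w)) * cis \<theta>m2) < 0"
    and K2: "\<And>w. - 1 * w > 0 \<Longrightarrow> Meijer_Barnes_K p q m n a b \<tau> \<alpha> (exp (2 * pi * w)) = 1 / (2 * of_real pi * \<i>) *
       contour_sum \<gamma>2 T2 (cis \<theta>p2) (cis \<theta>m2) (?f w)"
    by (rule K_vii_contour[OF t mq np disj vii, of "- 1" Y]) (simp, rule that)
  note r1 = separating_contour_K_dom[OF sc1] and r2 = separating_contour_K_dom[OF sc2]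
  have Kpos: "Meijer_Barnes_K p q m n a b \<tau> \<alpha> (exp (2 * pi * w)) = 1 / (2 * of_real pi * \<i>) * contour_sum \<gamma>1 T1 \<i> (- \<i>) (?f w)"
    if w: "w > 0" for w
  proof -
    have w1: "1 * w > 0" using w by simp
    have "contour_sum \<gamma>1 T1 (cis \<theta>p1) (cis \<theta>m1) (?f w) = contour_sum \<gamma>1 T1 \<i> (- \<i>) (?f w)"
      by (rule contour_sum_rotate[OF W hol Y(2) v1 sg1 _ _ _ _ dv]) (use neg1[OF w1] in \<open>simp_all only: decaying_def\<close>, simp_all)
    then show ?thesis unfolding K1[OF w1] by simp
  qed
  have Kneg: "Meijer_Barnes_K p q m n a b \<tau> \<alpha> (exp (2 * pi * w)) = 1 / (2 * of_real pi * \<i>) * contour_sum \<gamma>1 T1 \<i> (- \<i>) (?f w)"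
    if w: "w < 0" for w
  proof -
    have w1: "- 1 * w > 0" using w by simp
    have "contour_sum \<gamma>2 T2 (cis \<theta>p2) (cis \<theta>m2) (?f w) = contour_sum \<gamma>2 T2 \<i> (- \<i>) (?f w)"
      by (rule contour_sum_rotate[OF W hol Y(2) v2 sg2 _ _ _ _ dv]) (use neg2[OF w1] in \<open>simp_all only: decaying_def\<close>, simp_all)
    \<comment> \<open>The contour chosen for z < 1 is exchanged for the one chosen for z > 1; both
      have been given vertical ends, where the integrals converge for every real w.\<close>
    also have "\<dots> = contour_sum \<gamma>1 T1 \<i> (- \<i>) (?f w)"
    proof (rule sym, rule contour_sum_vertical_eq[OF ct1 ct2 op r1 r2 _ less_imp_le[OF Y(1)] Y(2) v1(1) v2(1) sg1(1) sg2(1)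
        v1(2) v2(2) sg1(2) sg2(2) _ _ K_dom_cover[OF sc1 sc2]])
      show "?f w holomorphic_on ?S" by (intro holomorphic_intros hol)
      show "ray_integral (?f w) (\<gamma>1 T1) \<i> = contour_integral (linepath (\<gamma>1 T1) (\<gamma>2 T2)) (?f w) + ray_integral (?f w) (\<gamma>2 T2) \<i>"
      proof (rule sector_bounded_ray_move[OF W _ _ _ dv(1) dv(1), of 1 Y])
        show "K_weight p q m n a b \<tau> \<alpha> holomorphic_on {s. 1 * Im s > Y}"
          by (rule holomorphic_on_subset[OF hol]) (use Y(2) in force)
      qed (use v1 v2 in auto)
      show "ray_integral (?f w) (\<gamma>1 (- T1)) (- \<i>) = contour_integral (linepath (\<gamma>1 (- T1)) (\<gamma>2 (- T2))) (?f w) + ray_integral (?f w) (\<gamma>2 (- T2)) (- \<i>)"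
      proof (rule sector_bounded_ray_move[OF W _ _ _ dv(2) dv(2), of "- 1" Y])
        show "K_weight p q m n a b \<tau> \<alpha> holomorphic_on {s. - 1 * Im s > Y}"
          by (rule holomorphic_on_subset[OF hol]) (use Y(2) in force)
      qed (use v1 v2 in auto)
    qed
    finally show ?thesis unfolding K2[OF w1] by simp
  qed
  have "continuous_on UNIV (\<lambda>w. contour_sum \<gamma>1 T1 \<i> (- \<i>) (?f w))"
    by (rule continuous_on_compose2[OF continuous_vertical_contour_sum[OF W e hol Y(2) v1 ct1 op r1]])
      (auto intro!: continuous_intros)
  then have "continuous_on UNIV (\<lambda>w. 1 / (2 * of_real pi * \<i>) * contour_sum \<gamma>1 T1 \<i> (- \<i>) (?f w))"
    by (rule continuous_on_mult_left)
  moreover have "1 / (2 * of_real pi * \<i>) * contour_sum \<gamma>1 T1 \<i> (- \<i>) (?f w) = Meijer_Barnes_K p q m n a b \<tau> \<alpha> (exp (2 * pi * w))"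
    if "w \<noteq> 0" for w
  proof (cases "w > 0")
    case True
    then show ?thesis by (rule Kpos[symmetric])
  next
    case False
    then show ?thesis using that by (intro Kneg[symmetric]) simp
  qed
  ultimately show ?thesis by blast
qed

theorem theorem1:
  fixes \<tau> :: real and \<alpha> :: complex and p q m n :: nat and a b :: "nat \<Rightarrow> complex"
  assumes "\<tau> > 0" and "m \<le> q" and "n \<le> p"
    and "K_admissible p q m n a b \<tau> \<alpha>"
  shows
    "(K_case_i p q m n \<or> K_case_ii p q m n \<alpha> \<or> K_case_iii p q m n a b \<alpha> \<or>
      K_case_iv p q m n a b \<alpha> \<or> K_case_v p q m n a b \<alpha> \<longrightarrow>
        (\<exists>F. F holomorphic_on UNIV \<and>
          (\<forall>w::real. F (of_real w) = Meijer_Barnes_K p q m n a b \<tau> \<alpha> (exp (2 * pi * w))))) \<and>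
     (K_case_vi p q m n a b \<alpha> \<longrightarrow>
        (\<exists>F. F holomorphic_on {w. \<bar>Im w\<bar> < - Re (K_nu p q a b) / (4 * \<tau>)} \<and>
          (\<forall>w::real. F (of_real w) = Meijer_Barnes_K p q m n a b \<tau> \<alpha> (exp (2 * pi * w))))) \<and>
     (K_case_vii p q m n a b \<alpha> \<longrightarrow>
        (\<exists>F. F holomorphic_on {w. Re w < 0} \<and>
          (\<forall>w::real. w < 0 \<longrightarrow>
             F (of_real w) = Meijer_Barnes_K p q m n a b \<tau> \<alpha> (exp (2 * pi * w)))) \<and>
        (\<exists>F. F holomorphic_on {w. Re w > 0} \<and>
          (\<forall>w::real. w > 0 \<longrightarrow>
             F (of_real w) = Meijer_Barnes_K p q m n a b \<tau> \<alpha> (exp (2 * pi * w)))) \<and>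
        (Re (K_xi p q m n a b) < - 2 * \<tau> \<longrightarrow>
          (\<exists>F :: real \<Rightarrow> complex. continuous_on UNIV F \<and>
            (\<forall>w. w \<noteq> 0 \<longrightarrow>
               F w = Meijer_Barnes_K p q m n a b \<tau> \<alpha> (exp (2 * pi * w))))))"
proof (intro conjI impI)
  have disj: "Lambda_plus p n a \<tau> \<inter> Lambda_minus q m b \<tau> = {}" using assms(4) unfolding K_admissible_def by blast
  note K = assms(1-3) disj
  show "\<exists>F. F holomorphic_on UNIV \<and> (\<forall>w::real. F (of_real w) = Meijer_Barnes_K p q m n a b \<tau> \<alpha> (exp (2 * pi * w)))"
    if "K_case_i p q m n \<or> K_case_ii p q m n \<alpha> \<or> K_case_iii p q m n a b \<alpha> \<or>
      K_case_iv p q m n a b \<alpha> \<or> K_case_v p q m n a b \<alpha>"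
    using that by (rule K_entire[OF K])
  show "\<exists>F. F holomorphic_on {w. \<bar>Im w\<bar> < - Re (K_nu p q a b) / (4 * \<tau>)} \<and>
      (\<forall>w::real. F (of_real w) = Meijer_Barnes_K p q m n a b \<tau> \<alpha> (exp (2 * pi * w)))" if "K_case_vi p q m n a b \<alpha>"
    using that by (rule K_strip[OF K])
  assume vii: "K_case_vii p q m n a b \<alpha>"
  show "\<exists>F. F holomorphic_on {w. Re w < 0} \<and>
      (\<forall>w::real. w < 0 \<longrightarrow> F (of_real w) = Meijer_Barnes_K p q m n a b \<tau> \<alpha> (exp (2 * pi * w)))"
    using K_half_plane[OF K vii, of "- 1"] by simp
  show "\<exists>F. F holomorphic_on {w. Re w > 0} \<and>
      (\<forall>w::real. w > 0 \<longrightarrow> F (of_real w) = Meijer_Barnes_K p q m n a b \<tau> \<alpha> (exp (2 * pi * w)))"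
    using K_half_plane[OF K vii, of 1] by simp
  show "\<exists>F :: real \<Rightarrow> complex. continuous_on UNIV F \<and>
      (\<forall>w. w \<noteq> 0 \<longrightarrow> F w = Meijer_Barnes_K p q m n a b \<tau> \<alpha> (exp (2 * pi * w)))" if "Re (K_xi p q m n a b) < - 2 * \<tau>"
    using that by (rule K_continuous[OF K vii])
qed

end
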